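(* Let $k\ge4$ be an integer and $f_0\in H^k(\mathbb{R}^2)$. Let $\bar T>0$ and $\bar M>0$, and suppose that for every $\alpha\in[0,\frac12)$ the function $f_\alpha\in C^1([0,\bar T];H^k(\mathbb{R}^2))$ solves \[ \frac{\partial f_\alpha(x,t)}{\partial t} = \mathrm{PV}\int_{\mathbb{R}^2} \frac{\left(\nabla f_\alpha(x,t)-\nabla f_\alpha(x-y,t)\right)\cdot y}{\left[|y|^2+(f_\alpha(x,t)-f_\alpha(x-y,t))^2\right]^{\frac{3+\alpha}{2}}}\,dy,\qquad f_\alpha(x,0)=f_0(x), \] and that $f\in C^1([0,\bar T];H^k(\mathbb{R}^2))$ solves the same equation with $\alpha=0$ (exponent $\frac32$) and $f(x,0)=f_0(x)$, with the uniform bound $\sup_{0\le\alpha<1/2}\sup_{0\le t\le\bar T}\|f_\alpha\|_{H^4}(t)\le\bar M$. Then for all $t\in[0,\bar T]$, \[ \lim_{\alpha\to0^+}\|f_\alpha-f\|_{L^2}(t)=0. \]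
   Context: $\mathrm{PV}$ denotes the principal value; $x\in\mathbb{R}^2$. (The paper shows, via its local existence argument, that such $\bar T$, $\bar M$ and solutions exist.) *)

theory Defs
  imports "HOL-Analysis.Analysis"
begin

type_synonym pt = "real \<times> real"

definition pdir :: "bool \<Rightarrow> (pt \<Rightarrow> real) \<Rightarrow> pt \<Rightarrow> real" where
  "pdir d g = (if d then (\<lambda>x. deriv (\<lambda>s. g (s, snd x)) (fst x))
                    else (\<lambda>x. deriv (\<lambda>s. g (fst x, s)) (snd x)))"

primrec iterpd :: "bool list \<Rightarrow> (pt \<Rightarrow> real) \<Rightarrow> pt \<Rightarrow> real" where
  "iterpd [] g = g"
| "iterpd (d # ds) g = pdir d (iterpd ds g)"

definition mi :: "nat \<Rightarrow> nat \<Rightarrow> bool list" where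
  "mi a b = replicate a True @ replicate b False"

definition test_fun :: "(pt \<Rightarrow> real) \<Rightarrow> bool" where
  "test_fun \<phi> \<longleftrightarrow> compact (closure {x. \<phi> x \<noteq> 0}) \<and>
     (\<forall>ds. continuous_on UNIV (iterpd ds \<phi>) \<and>
        (\<forall>x. (\<lambda>s. iterpd ds \<phi> (s, snd x)) differentiable (at (fst x)) \<and>
             (\<lambda>s. iterpd ds \<phi> (fst x, s)) differentiable (at (snd x))))"

definition L2 :: "(pt \<Rightarrow> real) \<Rightarrow> bool" where
  "L2 g \<longleftrightarrow> g \<in> borel_measurable lborel \<and> integrable lborel (\<lambda>x. (g x)\<^sup>2)"

definition weak_deriv :: "nat \<Rightarrow> nat \<Rightarrow> (pt \<Rightarrow> real) \<Rightarrow> (pt \<Rightarrow> real) \<Rightarrow> bool" where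
  "weak_deriv a b f g \<longleftrightarrow>
     (\<forall>\<phi>. test_fun \<phi> \<longrightarrow>
        integrable lborel (\<lambda>x. f x * iterpd (mi a b) \<phi> x) \<and>
        integrable lborel (\<lambda>x. g x * \<phi> x) \<and>
        (\<integral>x. f x * iterpd (mi a b) \<phi> x \<partial>lborel) = (-1) ^ (a + b) * (\<integral>x. g x * \<phi> x \<partial>lborel))"

definition sobolev :: "nat \<Rightarrow> (pt \<Rightarrow> real) \<Rightarrow> bool" where
  "sobolev k f \<longleftrightarrow> L2 f \<and> (\<forall>a b. a + b \<le> k \<longrightarrow> (\<exists>g. weak_deriv a b f g \<and> L2 g))"

definition wd :: "nat \<Rightarrow> nat \<Rightarrow> (pt \<Rightarrow> real) \<Rightarrow> pt \<Rightarrow> real" where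
  "wd a b f = (SOME g. weak_deriv a b f g \<and> L2 g)"

definition l2norm :: "(pt \<Rightarrow> real) \<Rightarrow> real" where
  "l2norm g = sqrt (\<integral>x. (g x)\<^sup>2 \<partial>lborel)"

definition hk_norm :: "nat \<Rightarrow> (pt \<Rightarrow> real) \<Rightarrow> real" where
  "hk_norm k f = sqrt (\<Sum>(a, b) \<in> {(a, b). a + b \<le> k}. (l2norm (wd a b f))\<^sup>2)"

definition C1_Hk :: "nat \<Rightarrow> real \<Rightarrow> (real \<Rightarrow> pt \<Rightarrow> real) \<Rightarrow> (real \<Rightarrow> pt \<Rightarrow> real) \<Rightarrow> bool" where
  "C1_Hk k T u u' \<longleftrightarrow>
     (\<forall>t\<in>{0..T}. sobolev k (u t) \<and> sobolev k (u' t)) \<and>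
     (\<forall>t\<in>{0..T}. ((\<lambda>h. hk_norm k (\<lambda>x. (u (t + h) x - u t x) / h - u' t x)) \<longlongrightarrow> 0)
                   (at 0 within {h. t + h \<in> {0..T}})) \<and>
     (\<forall>t\<in>{0..T}. ((\<lambda>s. hk_norm k (\<lambda>x. u' s x - u' t x)) \<longlongrightarrow> 0) (at t within {0..T}))"

definition pv_integral :: "(pt \<Rightarrow> real) \<Rightarrow> real \<Rightarrow> bool" where
  "pv_integral K v \<longleftrightarrow>
     (\<forall>\<^sub>F \<epsilon> in at_right 0. set_integrable lborel {y. \<epsilon> < norm y \<and> norm y < 1 / \<epsilon>} K) \<and>
     ((\<lambda>\<epsilon>. LINT y:{y. \<epsilon> < norm y \<and> norm y < 1 / \<epsilon>}|lborel. K y) \<longlongrightarrow> v) (at_right 0)"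

definition grad :: "(pt \<Rightarrow> real) \<Rightarrow> pt \<Rightarrow> pt" where
  "grad g x = (wd 1 0 g x, wd 0 1 g x)"

definition kernel :: "real \<Rightarrow> (pt \<Rightarrow> real) \<Rightarrow> pt \<Rightarrow> pt \<Rightarrow> real" where
  "kernel \<alpha> g x y = ((grad g x - grad g (x - y)) \<bullet> y) /
       ((norm y)\<^sup>2 + (g x - g (x - y))\<^sup>2) powr ((3 + \<alpha>) / 2)"

definition solves :: "nat \<Rightarrow> real \<Rightarrow> real \<Rightarrow> (pt \<Rightarrow> real) \<Rightarrow> (real \<Rightarrow> pt \<Rightarrow> real) \<Rightarrow> bool" where
  "solves k T \<alpha> f0 u \<longleftrightarrow>
     (\<exists>u'. C1_Hk k T u u' \<and>
        (\<forall>t\<in>{0..T}. AE x in lborel. pv_integral (kernel \<alpha> (u t) x) (u' t x))) \<and>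
     (AE x in lborel. u 0 x = f0 x)"

end

theory Submission
  imports Defs "HOL-Analysis.Analysis"
begin

text \<open>
  The functions are replaced by continuous representatives, obtained by averaging weak derivatives over the
  unit square (an elementary Sobolev embedding), with bounded Lipschitz gradient. Along each line
  \<open>x + \<real> w\<close> an integration by parts turns the principal value into an absolutely convergent integral
  of \<open>s powr (- 1 - a) * (Psi q\<^sub>+ - Psi q\<^sub>-)\<close> in the difference quotients \<open>q\<^sub>\<plusminus>\<close>. In this form the equation obeys a
  maximum principle up to a zeroth-order term, and evaluating it at a space-time maximum of the difference
  of the solutions shows that \<open>f\<^sub>\<alpha> \<rightarrow> f\<close> uniformly.

  The maximum principle says nothing about \<open>L\<^sup>2\<close>. There, the energy identity
  \<open>d/dt \<parallel>f\<^sub>\<alpha>\<parallel>\<^sup>2 = - 4 D\<^sub>\<alpha>(f\<^sub>\<alpha>)\<close> has a nonnegative dissipation density, so Fatou's lemma and the uniform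
  convergence give \<open>limsup \<parallel>f\<^sub>\<alpha>\<parallel> \<le> \<parallel>f\<parallel>\<close>. Fatou's lemma applied to \<open>(f\<^sub>\<alpha> + f)\<^sup>2\<close> and the parallelogram
  identity then yield strong convergence.\<close>

section \<open>Square-integrable functions\<close>

text \<open>The kernel contains the gradient at the moving point \<open>x - y\<close>, and at a
  maximum of a difference of two solutions nothing is known about gradients away from the maximum
  point. This is the main reason for the integration by parts: the line form contains only values of
  the function and its slope at x, and at the maximum the two slopes agree while the increments of
  the difference have a sign. At q = p the function \<open>Psi a p\<close> has slope
  \<open>- (1 + a) * phi a p\<close>, so it decreases for q within 1/4 of p; a Lipschitz constant B
  of the gradient puts all quotients with \<open>s \<le> 1 / (4 * B)\<close> in that range, and only
  larger s feed the zeroth-order term. For a between 0 and 1/2 one integrable majorant, s^(-1/2)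
  near 0 and s^(-2) at infinity, serves every exponent. In the energy identity the integrand splits
  into a derivative along the line direction in x, which integrates to zero, an exact derivative in
  s with vanishing end values, and \<open>- 2 * s powr (- a) * dd a q\<close>. The energy of the
  limit is balanced as well, so Fatou's inequality for the dissipation becomes an upper bound for
  the norms.\<close>

lemma lborel_integral_shift:
  fixes f :: "'a::euclidean_space \<Rightarrow> real"
  shows "(\<integral>x. f (x + c) \<partial>lborel) = (\<integral>x. f x \<partial>lborel)"
proof -
  have "(\<integral>x. f x \<partial>lborel) = (\<integral>x. f x \<partial>distr lborel lborel ((+) c))"
    using lborel_distr_plus[of c] by (simp cong: distr_cong)
  also have "\<dots> = (\<integral>x. f (c + x) \<partial>lborel)"
  proof (cases "f \<in> borel_measurable borel")
    case True
    then show ?thesis by (subst integral_distr) auto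
  next
    case False
    \<comment> \<open>Without measurability neither side is integrable, so both integrals have the
      default value 0; this keeps the lemma free of a measurability hypothesis.\<close>
    have "\<not> integrable lborel f" using False borel_measurable_integrable by fastforce
    moreover have "\<not> integrable lborel (\<lambda>x. f (c + x))"
    proof
      assume "integrable lborel (\<lambda>x. f (c + x))"
      then have "(\<lambda>x. f (c + x)) \<in> borel_measurable borel" using borel_measurable_integrable by fastforce
      then have "(\<lambda>x. f (c + (x - c))) \<in> borel_measurable borel"
        by (intro measurable_compose[of "\<lambda>x. x - c" _ borel "\<lambda>x. f (c + x)"]) auto
      then show False using False by simp
    qed
    ultimately show ?thesis using lborel_distr_plus[of c]
      by (simp add: not_integrable_integral_eq cong: distr_cong)
  qed
  finally show ?thesis by (simp add: add.commute)
qed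

lemma lborel_integrable_shift:
  fixes f :: "'a::euclidean_space \<Rightarrow> real"
  assumes "integrable lborel f"
  shows "integrable lborel (\<lambda>x. f (x + c))"
proof -
  have "integrable (distr lborel lborel ((+) c)) f"
    using lborel_distr_plus[of c] assms by (simp cong: distr_cong)
  then have "integrable lborel (\<lambda>x. f (c + x))"
    by (subst (asm) integrable_distr_eq) (use assms in auto)
  then show ?thesis by (simp add: add.commute)
qed

lemma lborel_reflect: "lborel = distr lborel lborel (\<lambda>x. c - x :: 'a::euclidean_space)"
  using lborel_affine[of "-1" c] by (simp add: density_1 cong: distr_cong)

lemma AE_lborel_reflect:
  fixes c :: "'a::euclidean_space"
  assumes "AE x in lborel. P x"
  shows "AE x in lborel. P (c - x)"
proof -
  obtain N where N: "N \<in> null_sets lborel" "{x. \<not> P x} \<subseteq> N"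
    using assms by (auto simp: eventually_ae_filter)
  have "AE x in lborel. x \<notin> N" using N(1) by (rule AE_not_in)
  then have "AE x in distr lborel lborel (\<lambda>x. c - x). x \<notin> N"
    by (simp only: lborel_reflect[of c, symmetric])
  then have "AE x in lborel. c - x \<notin> N"
    using N(1) by (subst (asm) AE_distr_iff) auto
  then show ?thesis using N(2) by (auto elim!: eventually_mono)
qed

lemma L2_measurable [measurable_dest]: "L2 g \<Longrightarrow> g \<in> borel_measurable borel"
  by (simp add: L2_def)

lemma L2_square: "L2 g \<Longrightarrow> integrable lborel (\<lambda>x. (g x)\<^sup>2)"
  by (simp add: L2_def)

lemma L2_mult:
  assumes "L2 f" "L2 g" shows "integrable lborel (\<lambda>x. f x * g x)"
proof (rule Bochner_Integration.integrable_bound)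
  note [measurable] = L2_measurable[OF assms(1)] L2_measurable[OF assms(2)]
  show "integrable lborel (\<lambda>x. (f x)\<^sup>2 + (g x)\<^sup>2)" using assms by (simp add: L2_def)
  show "(\<lambda>x. f x * g x) \<in> borel_measurable lborel" by measurable
  show "AE x in lborel. norm (f x * g x) \<le> norm ((f x)\<^sup>2 + (g x)\<^sup>2)"
  proof (intro AE_I2)
    fix x show "norm (f x * g x) \<le> norm ((f x)\<^sup>2 + (g x)\<^sup>2)"
      using sum_squares_bound[of "\<bar>f x\<bar>" "\<bar>g x\<bar>"] mult_nonneg_nonneg[OF abs_ge_zero[of "f x"] abs_ge_zero[of "g x"]]
      unfolding real_norm_def abs_mult power2_abs mult.assoc by linarith
  qed
qed

lemma L2_add: assumes "L2 f" "L2 g" shows "L2 (\<lambda>x. f x + g x)"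
proof -
  note [measurable] = L2_measurable[OF assms(1)] L2_measurable[OF assms(2)]
  have "(\<lambda>x. (f x + g x)\<^sup>2) = (\<lambda>x. (f x)\<^sup>2 + (g x)\<^sup>2 + 2 * (f x * g x))"
    by (auto simp: power2_eq_square algebra_simps)
  then have "integrable lborel (\<lambda>x. (f x + g x)\<^sup>2)" using assms L2_mult[OF assms] by (simp add: L2_def)
  then show ?thesis by (simp add: L2_def)
qed

lemma L2_cmult: assumes "L2 f" shows "L2 (\<lambda>x. c * f x)"
  using assms by (auto simp: L2_def power_mult_distrib)

lemma L2_uminus: "L2 f \<Longrightarrow> L2 (\<lambda>x. - f x)"
  by (auto simp: L2_def)

lemma L2_diff: assumes "L2 f" "L2 g" shows "L2 (\<lambda>x. f x - g x)"
  using L2_add[OF assms(1) L2_uminus[OF assms(2)]] by simp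

lemma L2_AE_cong:
  assumes "L2 f" "g \<in> borel_measurable borel" "AE x in lborel. f x = g x"
  shows "L2 g"
proof -
  have [measurable]: "f \<in> borel_measurable borel" "g \<in> borel_measurable borel"
    using assms by (auto simp: L2_def)
  have "integrable lborel (\<lambda>x. (f x)\<^sup>2) = integrable lborel (\<lambda>x. (g x)\<^sup>2)"
    using assms(3) by (intro integrable_cong_AE) auto
  then show ?thesis using assms by (simp add: L2_def)
qed

lemma L2_shift: assumes "L2 f" shows "L2 (\<lambda>x. f (x + c))"
proof -
  have [measurable]: "f \<in> borel_measurable borel" using assms by (simp add: L2_def)
  show ?thesis using assms lborel_integrable_shift[of "\<lambda>x. (f x)\<^sup>2" c] by (simp add: L2_def)
qed

lemma l2norm_nonneg: "l2norm f \<ge> 0"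
  by (simp add: l2norm_def)

lemma l2norm_power2: "(l2norm f)\<^sup>2 = (\<integral>x. (f x)\<^sup>2 \<partial>lborel)"
  by (simp add: l2norm_def)

lemma l2norm_AE_cong:
  assumes "f \<in> borel_measurable borel" "g \<in> borel_measurable borel" "AE x in lborel. f x = g x"
  shows "l2norm f = l2norm g"
  unfolding l2norm_def using assms by (auto intro!: arg_cong[where f=sqrt] integral_cong_AE)

lemma l2norm_shift: "l2norm (\<lambda>x. f (x + c)) = l2norm f"
  unfolding l2norm_def using lborel_integral_shift[of "\<lambda>x. (f x)\<^sup>2" c] by simp

lemma l2norm_cmult: "l2norm (\<lambda>x. c * f x) = \<bar>c\<bar> * l2norm f"
  by (simp add: l2norm_def power_mult_distrib real_sqrt_mult)

lemma L2_Cauchy_Schwarz_abs: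
  assumes "L2 f" "L2 g"
  shows "(\<integral>x. \<bar>f x * g x\<bar> \<partial>lborel) \<le> l2norm f * l2norm g"
proof -
  note [measurable] = L2_measurable[OF assms(1)] L2_measurable[OF assms(2)]
  have "ennreal ((\<integral>x. \<bar>f x * g x\<bar> \<partial>lborel)\<^sup>2) = (\<integral>\<^sup>+x. ennreal \<bar>f x\<bar> * ennreal \<bar>g x\<bar> \<partial>lborel)\<^sup>2"
    using L2_mult[OF assms]
    by (simp add: nn_integral_eq_integral ennreal_mult[symmetric] abs_mult[symmetric] ennreal_power)
  also have "\<dots> \<le> (\<integral>\<^sup>+x. (ennreal \<bar>f x\<bar>)\<^sup>2 \<partial>lborel) * (\<integral>\<^sup>+x. (ennreal \<bar>g x\<bar>)\<^sup>2 \<partial>lborel)"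
    by (intro Cauchy_Schwarz_nn_integral) auto
  also have "\<dots> = ennreal ((l2norm f)\<^sup>2 * (l2norm g)\<^sup>2)"
    using L2_square[OF assms(1)] L2_square[OF assms(2)]
    by (simp add: ennreal_power nn_integral_eq_integral l2norm_power2 ennreal_mult)
  finally have "(\<integral>x. \<bar>f x * g x\<bar> \<partial>lborel)\<^sup>2 \<le> (l2norm f * l2norm g)\<^sup>2"
    by (simp add: power_mult_distrib)
  then show ?thesis
    using l2norm_nonneg by (meson mult_nonneg_nonneg power2_le_imp_le)
qed

lemma L2_Cauchy_Schwarz:
  assumes "L2 f" "L2 g"
  shows "\<bar>\<integral>x. f x * g x \<partial>lborel\<bar> \<le> l2norm f * l2norm g"
  using L2_Cauchy_Schwarz_abs[OF assms] integral_abs_bound[of lborel "\<lambda>x. f x * g x"] by linarith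

lemma l2norm_triangle:
  assumes "L2 f" "L2 g"
  shows "l2norm (\<lambda>x. f x + g x) \<le> l2norm f + l2norm g"
proof -
  have "(l2norm (\<lambda>x. f x + g x))\<^sup>2 = (\<integral>x. (f x)\<^sup>2 + (g x)\<^sup>2 + 2 * (f x * g x) \<partial>lborel)"
    unfolding l2norm_power2 by (intro Bochner_Integration.integral_cong) (auto simp: power2_eq_square algebra_simps)
  also have "\<dots> = (l2norm f)\<^sup>2 + (l2norm g)\<^sup>2 + 2 * (\<integral>x. f x * g x \<partial>lborel)"
    using L2_mult[OF assms] L2_square[OF assms(1)] L2_square[OF assms(2)] by (simp add: l2norm_power2)
  also have "\<dots> \<le> (l2norm f + l2norm g)\<^sup>2"
    using L2_Cauchy_Schwarz[OF assms] by (simp add: power2_eq_square algebra_simps)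
  finally show ?thesis
    using l2norm_nonneg by (meson add_nonneg_nonneg power2_le_imp_le)
qed

lemma l2norm_triangle_diff:
  assumes "L2 f" "L2 g"
  shows "l2norm (\<lambda>x. f x - g x) \<le> l2norm f + l2norm g"
  using l2norm_triangle[OF assms(1) L2_uminus[OF assms(2)]] by (simp add: l2norm_def)

section \<open>Smooth test functions of product form\<close>

definition smooth :: "(real \<Rightarrow> real) \<Rightarrow> bool" where
  "smooth \<phi> \<longleftrightarrow> (\<forall>n x. ((deriv ^^ n) \<phi> has_real_derivative (deriv ^^ Suc n) \<phi> x) (at x))"

text \<open>A set of functions closed under differentiation consists of smooth functions, because
  every iterated \<open>deriv\<close> stays in the set. Formulas for n-th derivatives are thereby
  avoided.\<close>

lemma smooth_coinduct:
  assumes "\<phi> \<in> S" "\<And>\<phi>. \<phi> \<in> S \<Longrightarrow> \<exists>\<phi>'\<in>S. \<forall>x. (\<phi> has_real_derivative \<phi>' x) (at x)"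
  shows "smooth \<phi>"
proof -
  have step: "deriv \<phi> \<in> S \<and> (\<forall>x. (\<phi> has_real_derivative deriv \<phi> x) (at x))" if m: "\<phi> \<in> S" for \<phi>
  proof -
    obtain \<phi>' where \<phi>': "\<phi>' \<in> S" "\<forall>x. (\<phi> has_real_derivative \<phi>' x) (at x)"
      using assms(2)[OF m] by blast
    then have "deriv \<phi> = \<phi>'" by (auto intro!: ext DERIV_imp_deriv)
    with \<phi>' show ?thesis by auto
  qed
  have "(deriv ^^ n) \<phi> \<in> S" for n
    by (induction n) (use assms(1) step in auto)
  then show ?thesis using step by (auto simp: smooth_def)
qed

lemma smooth_DERIV: "smooth \<phi> \<Longrightarrow> (\<phi> has_real_derivative deriv \<phi> x) (at x)"
  unfolding smooth_def by (drule spec[of _ 0], drule spec[of _ x]) simp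

lemma smooth_deriv: "smooth \<phi> \<Longrightarrow> smooth (deriv \<phi>)"
  unfolding smooth_def by (metis funpow_Suc_right o_apply)

lemma smooth_funpow_deriv: "smooth \<phi> \<Longrightarrow> smooth ((deriv ^^ n) \<phi>)"
  by (induction n) (auto intro: smooth_deriv)

lemma smooth_continuous: "smooth \<phi> \<Longrightarrow> continuous_on A \<phi>"
  by (meson DERIV_isCont continuous_at_imp_continuous_on smooth_DERIV)

text \<open>The flat function exp(-1/x) times x^(-n). The powers are carried along because
  differentiation then maps the family into its own linear combinations.\<close>

definition expinv :: "nat \<Rightarrow> real \<Rightarrow> real" where
  "expinv n x = (if x > 0 then (1 / x) ^ n * exp (- (1 / x)) else 0)"

lemma expinv_tendsto_0: "((\<lambda>x::real. (1 / x) ^ n * exp (- (1 / x))) \<longlongrightarrow> 0) (at_right 0)"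
proof -
  have "((\<lambda>x::real. (inverse x) ^ n / exp (inverse x)) \<longlongrightarrow> 0) (at_right 0)"
    by (rule filterlim_compose[OF tendsto_power_div_exp_0 filterlim_inverse_at_top_right])
  then show ?thesis by (simp add: divide_inverse exp_minus)
qed

lemma expinv_DERIV:
  "(expinv n has_real_derivative (expinv (n + 2) x - real n * expinv (n + 1) x)) (at x)"
proof -
  consider "x < 0" | "x > 0" | "x = 0" by linarith
  then show ?thesis
  proof cases
    case 1
    have "((\<lambda>x. 0) has_real_derivative 0) (at x)" by simp
    then have "(expinv n has_real_derivative 0) (at x)"
      by (rule DERIV_cong_ev[THEN iffD1, rotated 3])
        (use 1 in \<open>auto simp: expinv_def intro!: eventually_mono[OF eventually_nhds_in_open[of "{..<0}" x]]\<close>)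
    then show ?thesis using 1 by (simp add: expinv_def)
  next
    case 2
    have "((\<lambda>x. (1 / x) ^ n * exp (- (1 / x))) has_real_derivative
         (expinv (n + 2) x - real n * expinv (n + 1) x)) (at x)"
    proof -
      have d: "((\<lambda>x. 1 / x) has_real_derivative - ((1 / x)\<^sup>2)) (at x)"
        using DERIV_inverse[of x UNIV] 2 by (simp add: inverse_eq_divide power2_eq_square)
      have e: "((\<lambda>x. exp (- (1 / x))) has_real_derivative exp (- (1 / x)) * (1 / x)\<^sup>2) (at x)"
        using DERIV_fun_exp[OF DERIV_minus[OF d]] by simp
      have p: "((\<lambda>x. (1 / x) ^ n) has_real_derivative - real n * (1 / x) ^ (n + 1)) (at x)"
        using DERIV_power[OF d, of n] 2 by (cases n) (simp_all add: power2_eq_square mult_ac minus_add_distrib[symmetric] del: minus_add_distrib)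
      show ?thesis using DERIV_mult'[OF p e] 2
        by (simp add: expinv_def power_add power2_eq_square algebra_simps)
    qed
    then show ?thesis
      by (rule DERIV_cong_ev[THEN iffD1, rotated 3])
        (use 2 in \<open>auto simp: expinv_def intro!: eventually_mono[OF eventually_nhds_in_open[of "{0<..}" x]]\<close>)
  next
    case 3
    \<comment> \<open>To the right of 0 the difference quotient at 0 is
      \<open>expinv (Suc n)\<close>, which is flat there as well.\<close>
    have "((\<lambda>h. expinv n h / h) \<longlongrightarrow> 0) (at_right 0)"
      by (rule Lim_transform_eventually[OF expinv_tendsto_0[of "Suc n"]])
        (auto simp: expinv_def eventually_at_filter)
    moreover have "((\<lambda>h. expinv n h / h) \<longlongrightarrow> 0) (at_left 0)"
      by (rule Lim_transform_eventually[OF tendsto_const]) (auto simp: expinv_def eventually_at_filter)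
    ultimately have "((\<lambda>h. expinv n h / h) \<longlongrightarrow> 0) (at 0)"
      by (simp add: filterlim_split_at)
    then show ?thesis using 3 by (simp add: DERIV_def expinv_def)
  qed
qed

text \<open>The closure that \<open>smooth_coinduct\<close> asks for: affine substitutions,
  constants, sums and products suffice to write the derivative of every member as a member
  again.\<close>

inductive_set expinv_algebra :: "(real \<Rightarrow> real) set" where
  base: "(\<lambda>x. expinv n (a * x + b)) \<in> expinv_algebra"
| const: "(\<lambda>x. c) \<in> expinv_algebra"
| add: "f \<in> expinv_algebra \<Longrightarrow> g \<in> expinv_algebra \<Longrightarrow> (\<lambda>x. f x + g x) \<in> expinv_algebra"
| mult: "f \<in> expinv_algebra \<Longrightarrow> g \<in> expinv_algebra \<Longrightarrow> (\<lambda>x. f x * g x) \<in> expinv_algebra"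

lemma expinv_algebra_smooth:
  assumes "f \<in> expinv_algebra" shows "smooth f"
  using assms
proof (rule smooth_coinduct)
  fix f assume "f \<in> expinv_algebra"
  then show "\<exists>f'\<in>expinv_algebra. \<forall>x. (f has_real_derivative f' x) (at x)"
  proof induction
    case (base n a b)
    show ?case
    proof (intro bexI allI)
      fix x
      show "((\<lambda>x. expinv n (a * x + b)) has_real_derivative
         (expinv (n + 2) (a * x + b) + (- real n) * expinv (n + 1) (a * x + b)) * a) (at x)"
        using DERIV_chain2[where f="expinv n" and g="\<lambda>x. a * x + b" and x=x and s=UNIV, OF expinv_DERIV, of a]
          DERIV_add[OF DERIV_cmult[OF DERIV_ident, of a] DERIV_const[of b], of x UNIV]
        by simp
    qed (intro expinv_algebra.intros)
  next
    case (const c)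
    then show ?case by (intro bexI[of _ "\<lambda>x. 0"]) (auto intro: expinv_algebra.intros)
  next
    case (add f g)
    then obtain f' g' where "f' \<in> expinv_algebra" "g' \<in> expinv_algebra"
      "\<And>x. (f has_real_derivative f' x) (at x)" "\<And>x. (g has_real_derivative g' x) (at x)" by blast
    then show ?case
      by (intro bexI[of _ "\<lambda>x. f' x + g' x"]) (auto intro!: derivative_intros expinv_algebra.intros)
  next
    case (mult f g)
    then obtain f' g' where "f' \<in> expinv_algebra" "g' \<in> expinv_algebra"
      "\<And>x. (f has_real_derivative f' x) (at x)" "\<And>x. (g has_real_derivative g' x) (at x)" by blast
    with mult.hyps show ?case
      by (intro bexI[of _ "\<lambda>x. f x * g' x + f' x * g x"])
        (auto intro!: derivative_intros expinv_algebra.intros DERIV_mult')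
  qed
qed

section \<open>Compactly supported smooth functions of one variable and their products\<close>

definition bump :: "(real \<Rightarrow> real) \<Rightarrow> bool" where
  "bump \<phi> \<longleftrightarrow> smooth \<phi> \<and> (\<exists>R. \<forall>x. \<bar>x\<bar> > R \<longrightarrow> \<phi> x = 0)"

lemma bump_smooth: "bump \<phi> \<Longrightarrow> smooth \<phi>" by (simp add: bump_def)

lemma bump_continuous: "bump \<phi> \<Longrightarrow> continuous_on A \<phi>"
  by (simp add: bump_def smooth_continuous)

lemma bump_measurable: "bump \<phi> \<Longrightarrow> \<phi> \<in> borel_measurable borel"
  by (intro borel_measurable_continuous_onI bump_continuous)

lemma bump_deriv: assumes "bump \<phi>" shows "bump (deriv \<phi>)"
proof -
  obtain R where R: "\<And>x. \<bar>x\<bar> > R \<Longrightarrow> \<phi> x = 0" using assms by (auto simp: bump_def)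
  have "deriv \<phi> x = 0" if "\<bar>x\<bar> > R" for x
  proof -
    have "((\<lambda>x. 0) has_real_derivative 0) (at x)" by simp
    moreover have "eventually (\<lambda>y. \<phi> y = 0) (nhds x)"
    proof -
      have "open {y::real. \<bar>y\<bar> > R}" by (intro open_Collect_less continuous_intros)
      from eventually_nhds_in_open[OF this, of x] that have "eventually (\<lambda>y. \<bar>y\<bar> > R) (nhds x)" by simp
      then show ?thesis by eventually_elim (rule R)
    qed
    ultimately have "(\<phi> has_real_derivative 0) (at x)"
      by (subst DERIV_cong_ev[OF refl _ refl, of _ "\<lambda>x. 0"]) auto
    then show ?thesis by (rule DERIV_imp_deriv)
  qed
  then show ?thesis using assms by (auto simp: bump_def smooth_deriv)
qed

lemma bump_funpow_deriv: "bump \<phi> \<Longrightarrow> bump ((deriv ^^ n) \<phi>)"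
  by (induction n) (auto intro: bump_deriv)

lemma bump_bounded: assumes "bump \<phi>" obtains C where "\<And>x. \<bar>\<phi> x\<bar> \<le> C"
proof -
  obtain R where R: "\<And>x. \<bar>x\<bar> > R \<Longrightarrow> \<phi> x = 0" using assms by (auto simp: bump_def)
  have "compact (\<phi> ` {-R..R})"
    by (intro compact_continuous_image bump_continuous assms compact_Icc)
  then obtain C where "\<forall>y\<in>\<phi> ` {-R..R}. norm y \<le> C"
    using compact_imp_bounded bounded_iff by metis
  then have "\<bar>\<phi> x\<bar> \<le> max C 0" for x
    by (cases "\<bar>x\<bar> > R") (force simp: R le_max_iff_disj)+
  then show ?thesis using that by blast
qed

lemma iterpd_tensor:
  assumes "smooth \<phi>" "smooth \<psi>"
  shows "iterpd ds (\<lambda>x. \<phi> (fst x) * \<psi> (snd x)) =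
     (\<lambda>x. (deriv ^^ count_list ds True) \<phi> (fst x) * (deriv ^^ count_list ds False) \<psi> (snd x))"
proof (induction ds)
  case (Cons d ds)
  show ?case
  proof (cases d)
    case True
    have "deriv (\<lambda>s. (deriv ^^ m) \<phi> s * c) y = (deriv ^^ Suc m) \<phi> y * c" for m c y
      using assms(1) by (intro DERIV_imp_deriv DERIV_cmult_right) (auto simp: smooth_def)
    then show ?thesis using True Cons by (auto simp: pdir_def)
  next
    case False
    have "deriv (\<lambda>s. c * (deriv ^^ m) \<psi> s) y = c * (deriv ^^ Suc m) \<psi> y" for m c y
      using assms(2) by (intro DERIV_imp_deriv DERIV_cmult) (auto simp: smooth_def)
    then show ?thesis using False Cons by (auto simp: pdir_def)
  qed
qed auto

lemma test_fun_tensor: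
  assumes "bump \<phi>" "bump \<psi>"
  shows "test_fun (\<lambda>x. \<phi> (fst x) * \<psi> (snd x))"
  unfolding test_fun_def
proof (intro conjI allI)
  note sm = assms[THEN bump_smooth]
  obtain R where R: "\<And>x. \<bar>x\<bar> > R \<Longrightarrow> \<phi> x = 0" using assms by (auto simp: bump_def)
  obtain S where S: "\<And>x. \<bar>x\<bar> > S \<Longrightarrow> \<psi> x = 0" using assms by (auto simp: bump_def)
  have "{x. \<phi> (fst x) * \<psi> (snd x) \<noteq> 0} \<subseteq> {-R..R} \<times> {-S..S}"
    using R S by (force simp: abs_le_iff[symmetric] not_less[symmetric])
  moreover have "bounded ({-R..R} \<times> {-S..S})" by (intro bounded_Times) auto
  ultimately show "compact (closure {x. \<phi> (fst x) * \<psi> (snd x) \<noteq> 0})"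
    using bounded_subset by (auto simp: compact_closure)
  show "continuous_on UNIV (iterpd ds (\<lambda>x. \<phi> (fst x) * \<psi> (snd x)))" for ds
    unfolding iterpd_tensor[OF sm]
    by (intro continuous_on_mult
        continuous_on_compose2[OF smooth_continuous[OF smooth_funpow_deriv[OF sm(1)], of UNIV] continuous_on_fst[OF continuous_on_id]]
        continuous_on_compose2[OF smooth_continuous[OF smooth_funpow_deriv[OF sm(2)], of UNIV] continuous_on_snd[OF continuous_on_id]]
        subset_UNIV)
  fix ds and x :: pt
  have d: "(deriv ^^ n) \<phi> differentiable at y" "(deriv ^^ n) \<psi> differentiable at y" for n y
    using smooth_DERIV[OF smooth_funpow_deriv[OF sm(1), of n], of y]
      smooth_DERIV[OF smooth_funpow_deriv[OF sm(2), of n], of y]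
    unfolding real_differentiable_def by blast+
  show "(\<lambda>s. iterpd ds (\<lambda>x. \<phi> (fst x) * \<psi> (snd x)) (s, snd x)) differentiable at (fst x)"
     "(\<lambda>s. iterpd ds (\<lambda>x. \<phi> (fst x) * \<psi> (snd x)) (fst x, s)) differentiable at (snd x)"
    unfolding iterpd_tensor[OF sm] fst_conv snd_conv
    by (rule differentiable_mult[OF d(1) differentiable_const] differentiable_mult[OF differentiable_const d(2)])+
qed

lemma tensor_measurable:
  fixes \<phi> \<psi> :: "real \<Rightarrow> real"
  assumes "\<phi> \<in> borel_measurable borel" "\<psi> \<in> borel_measurable borel"
  shows "(\<lambda>x::pt. \<phi> (fst x) * \<psi> (snd x)) \<in> borel_measurable borel"
proof -
  have f: "fst \<in> borel_measurable (borel :: pt measure)" "snd \<in> borel_measurable (borel :: pt measure)"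
    by (intro borel_measurable_continuous_onI continuous_intros)+
  have "(\<lambda>x::pt. \<phi> (fst x)) \<in> borel_measurable borel" "(\<lambda>x::pt. \<psi> (snd x)) \<in> borel_measurable borel"
    using measurable_compose[OF f(1) assms(1)] measurable_compose[OF f(2) assms(2)] .
  then show ?thesis by (rule borel_measurable_times)
qed

lemma tensor_L2:
  assumes "bump \<phi>" "bump \<psi>"
  shows "L2 (\<lambda>x. \<phi> (fst x) * \<psi> (snd x))"
proof -
  note [measurable] = tensor_measurable[OF assms[THEN bump_measurable]]
  obtain R where R: "\<And>x. \<bar>x\<bar> > R \<Longrightarrow> \<phi> x = 0" using assms by (auto simp: bump_def)
  obtain S where S: "\<And>x. \<bar>x\<bar> > S \<Longrightarrow> \<psi> x = 0" using assms by (auto simp: bump_def)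
  obtain C where C: "\<And>x. \<bar>\<phi> x\<bar> \<le> C" using bump_bounded[OF assms(1)] by blast
  obtain D where D: "\<And>x. \<bar>\<psi> x\<bar> \<le> D" using bump_bounded[OF assms(2)] by blast
  have C0: "0 \<le> C" using C[of 0] by linarith
  have "integrable lborel (\<lambda>x::pt. (C * D)\<^sup>2 * indicator (cbox (-R, -S) (R, S)) x)"
    by (intro integrable_mult_right integrable_real_indicator) (use emeasure_lborel_cbox_finite in auto)
  then have "integrable lborel (\<lambda>x. (\<phi> (fst x) * \<psi> (snd x))\<^sup>2)"
  proof (rule Bochner_Integration.integrable_bound)
    show "AE x in lborel. norm ((\<phi> (fst x) * \<psi> (snd x))\<^sup>2) \<le> norm ((C * D)\<^sup>2 * indicator (cbox (-R, -S) (R, S)) x)"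
    proof (intro AE_I2)
      fix x :: pt
      have "\<bar>\<phi> (fst x) * \<psi> (snd x)\<bar> \<le> C * D"
        unfolding abs_mult by (intro mult_mono C D C0 abs_ge_zero)
      then have "(\<phi> (fst x) * \<psi> (snd x))\<^sup>2 \<le> (C * D)\<^sup>2" by (metis power2_abs power_mono abs_ge_zero)
      moreover have "\<phi> (fst x) * \<psi> (snd x) = 0" if "x \<notin> cbox (-R, -S) (R, S)"
      proof -
        have "\<bar>fst x\<bar> > R \<or> \<bar>snd x\<bar> > S" using that by (cases x) (auto simp: cbox_Pair_eq)
        then show ?thesis using R S by auto
      qed
      ultimately show "norm ((\<phi> (fst x) * \<psi> (snd x))\<^sup>2) \<le> norm ((C * D)\<^sup>2 * indicator (cbox (-R, -S) (R, S)) x)"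
        by (auto simp: indicator_def)
    qed
  qed measurable
  then show ?thesis by (simp add: L2_def)
qed

text \<open>Local integrability is tested on boxes only. The class contains both the
  square-integrable and the bounded measurable functions, which have to be compared with each other
  in \<open>srep_AE\<close>.\<close>

definition locint :: "(pt \<Rightarrow> real) \<Rightarrow> bool" where
  "locint f \<longleftrightarrow> f \<in> borel_measurable borel \<and> (\<forall>a b. integrable lborel (\<lambda>x. indicator (box a b) x * f x))"

lemma L2_locint: assumes "L2 f" shows "locint f"
proof -
  have "L2 (\<lambda>x. indicator (box a b) x)" for a b :: pt
  proof -
    have "(\<lambda>x. (indicator (box a b) x :: real)\<^sup>2) = indicator (box a b)" by (auto simp: indicator_def)
    then show ?thesis
      using integrable_real_indicator[of "box a b" lborel] emeasure_lborel_box_finite[of a b] by (simp add: L2_def)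
  qed
  then show ?thesis using assms L2_mult[of "\<lambda>x. indicator _ x"] by (auto simp: locint_def L2_measurable)
qed

lemma bounded_locint:
  assumes [measurable]: "f \<in> borel_measurable borel" and "\<And>x. \<bar>f x\<bar> \<le> C"
  shows "locint f"
  unfolding locint_def
proof (intro conjI allI)
  fix a b :: pt
  show "integrable lborel (\<lambda>x. indicator (box a b) x * f x)"
  proof (rule Bochner_Integration.integrable_bound)
    show "integrable lborel (\<lambda>x::pt. C * indicator (box a b) x)"
      by (intro integrable_mult_right integrable_real_indicator) (use emeasure_lborel_box_finite in auto)
    have "0 \<le> C" using assms(2)[of 0] by linarith
    then show "AE x in lborel. norm (indicator (box a b) x * f x) \<le> norm (C * indicator (box a b) x)"
      using assms(2) by (auto simp: indicator_def)
  qed measurable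
qed (rule assms)

lemma locint_diff: "locint f \<Longrightarrow> locint g \<Longrightarrow> locint (\<lambda>x. f x - g x)"
  by (auto simp: locint_def right_diff_distrib)

text \<open>The indicator of a box is a pointwise limit of products of bumps with values in [0, 1]
  supported in that box, so dominated convergence passes from test functions to boxes.\<close>

lemma locint_tensor_zero_box:
  assumes f: "locint f"
    and z: "\<And>\<phi> \<psi>. bump \<phi> \<Longrightarrow> bump \<psi> \<Longrightarrow> (\<integral>x. f x * (\<phi> (fst x) * \<psi> (snd x)) \<partial>lborel) = 0"
  shows "(\<integral>x. indicator (box a b) x * f x \<partial>lborel) = 0"
proof -
  obtain a1 a2 b1 b2 where ab: "a = (a1, a2)" "b = (b1, b2)" by fastforce
  have [measurable]: "f \<in> borel_measurable borel" using f by (simp add: locint_def)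
  \<comment> \<open>On the interval from a to b this is exp(-1/(N(x-a))) * exp(-1/(N(b-x))) with N =
    n + 1, and 0 elsewhere. Increasing N keeps the support and drives the values in the open
    interval to 1.\<close>
  define p where "p a b n x = expinv 0 (real (Suc n) * x + (- real (Suc n) * a)) * expinv 0 (- real (Suc n) * x + real (Suc n) * b)"
    for a b x :: real and n
  have p_eq: "p a b n x = (if a < x \<and> x < b then exp (- (1 / (real (Suc n) * (x - a)))) * exp (- (1 / (real (Suc n) * (b - x)))) else 0)" for a b n x
  proof -
    have 1: "real (Suc n) * x + (- real (Suc n) * a) = real (Suc n) * (x - a)"
      "- real (Suc n) * x + real (Suc n) * b = real (Suc n) * (b - x)" by (auto simp: algebra_simps)
    have "0 < real (Suc n) * (x - a) \<longleftrightarrow> a < x" "0 < real (Suc n) * (b - x) \<longleftrightarrow> x < b"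
      by (auto simp: zero_less_mult_iff)
    then show ?thesis unfolding p_def 1 expinv_def by auto
  qed
  have bp: "bump (p a b n)" for a b n
  proof -
    have "smooth (p a b n)" unfolding p_def by (intro expinv_algebra_smooth expinv_algebra.intros)
    moreover have "p a b n x = 0" if "\<bar>x\<bar> > max \<bar>a\<bar> \<bar>b\<bar>" for x using that by (auto simp: p_eq)
    ultimately show ?thesis unfolding bump_def by blast
  qed
  have p01: "0 \<le> p a b n x" "p a b n x \<le> 1" for a b n x
    by (auto simp: p_eq intro!: mult_le_one)
  have p_lim: "(\<lambda>n. p a b n x) \<longlonglongrightarrow> indicator {a<..<b} x" for a b x
  proof (cases "a < x \<and> x < b")
    case True
    have "(\<lambda>n. 1 / (real (Suc n) * c)) \<longlonglongrightarrow> 0" if "c > 0" for c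
      using tendsto_mult_right_zero[OF LIMSEQ_inverse_real_of_nat, of "1/c"] by (simp add: field_simps)
    from this[of "x - a"] this[of "b - x"] True
    have "(\<lambda>n. exp (- (1 / (real (Suc n) * (x - a)))) * exp (- (1 / (real (Suc n) * (b - x))))) \<longlonglongrightarrow> exp (- 0) * exp (- 0)"
      by (intro tendsto_intros) auto
    then show ?thesis using True by (simp add: p_eq)
  qed (auto simp: p_eq)
  have meas [measurable]: "(\<lambda>x. p a b n (fst x) * p c d n (snd x)) \<in> borel_measurable borel" for a b c d n
    using bp bump_measurable by (intro tensor_measurable) blast+
  have bx: "x \<in> box a b \<longleftrightarrow> fst x \<in> {a1<..<b1} \<and> snd x \<in> {a2<..<b2}" for x
    by (cases x) (auto simp: ab mem_box Basis_prod_def)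
  have "(\<lambda>n. \<integral>x. f x * (p a1 b1 n (fst x) * p a2 b2 n (snd x)) \<partial>lborel) \<longlonglongrightarrow> (\<integral>x. indicator (box a b) x * f x \<partial>lborel)"
  proof (rule integral_dominated_convergence[where w="\<lambda>x. \<bar>indicator (box a b) x * f x\<bar>"])
    show "integrable lborel (\<lambda>x. \<bar>indicator (box a b) x * f x\<bar>)" using f unfolding locint_def by (intro integrable_abs) blast
    show "AE x in lborel. (\<lambda>n. f x * (p a1 b1 n (fst x) * p a2 b2 n (snd x))) \<longlonglongrightarrow> indicator (box a b) x * f x"
    proof (intro AE_I2)
      fix x
      have "(\<lambda>n. f x * (p a1 b1 n (fst x) * p a2 b2 n (snd x))) \<longlonglongrightarrow> f x * (indicator {a1<..<b1} (fst x) * indicator {a2<..<b2} (snd x))"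
        by (intro tendsto_intros p_lim)
      then show "(\<lambda>n. f x * (p a1 b1 n (fst x) * p a2 b2 n (snd x))) \<longlonglongrightarrow> indicator (box a b) x * f x"
        using bx[of x] by (auto simp: indicator_def mult.commute split: if_splits)
    qed
    fix n
    show "AE x in lborel. norm (f x * (p a1 b1 n (fst x) * p a2 b2 n (snd x))) \<le> \<bar>indicator (box a b) x * f x\<bar>"
    proof (intro AE_I2)
      fix x
      have "\<bar>p a1 b1 n (fst x) * p a2 b2 n (snd x)\<bar> \<le> indicator (box a b) x"
      proof (cases "x \<in> box a b")
        case True
        then show ?thesis using p01 by (auto simp: abs_mult intro!: mult_le_one)
      next
        case False
        then show ?thesis unfolding bx by (auto simp: p_eq)
      qed
      then show "norm (f x * (p a1 b1 n (fst x) * p a2 b2 n (snd x))) \<le> \<bar>indicator (box a b) x * f x\<bar>"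
        unfolding abs_mult real_norm_def
        by (subst mult.commute) (auto intro!: mult_right_mono simp: abs_mult)
    qed
  qed auto
  then show ?thesis using z[OF bp bp] by (simp add: LIMSEQ_const_iff)
qed

lemma box_Int_box_ex: "\<exists>e f. box a b \<inter> box c d = box e (f :: 'a::euclidean_space)"
  by (intro exI) (rule box_Int_box)

text \<open>Boxes are an intersection-stable generator of the Borel sets, so the vanishing of all
  box integrals extends by Dynkin induction to all Borel sets; a function with this property is zero
  almost everywhere. The argument runs inside a fixed box \<open>box (-c) c\<close>, where
  \<open>f\<close> is integrable, and countably many such boxes exhaust the plane.\<close>

lemma locint_tensor_zero_AE:
  assumes f: "locint f"
    and z: "\<And>\<phi> \<psi>. bump \<phi> \<Longrightarrow> bump \<psi> \<Longrightarrow> (\<integral>x. f x * (\<phi> (fst x) * \<psi> (snd x)) \<partial>lborel) = 0"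
  shows "AE x in lborel. f x = 0"
proof -
  have [measurable]: "f \<in> borel_measurable borel" using f by (simp add: locint_def)
  have zb: "(\<integral>x. indicator (box a b) x * f x \<partial>lborel) = 0" for a b
    by (rule locint_tensor_zero_box[OF f]) (rule z)
  have ae: "AE x in lborel. indicator (box (-c) c) x * f x = 0" for c :: pt
  proof (rule sigma_finite_measure.density_zero[OF sigma_finite_lborel])
    let ?h = "\<lambda>x. indicator (box (-c) c) x * f x"
    show int: "integrable lborel ?h" using f unfolding locint_def by blast
    have intA: "integrable lborel (\<lambda>x. indicator A x * ?h x)" if "A \<in> sets borel" for A
      using integrable_mult_indicator[OF _ int, of A] that by simp
    fix A :: "pt set" assume "A \<in> sets lborel"
    then have sA: "A \<in> sigma_sets UNIV (range (\<lambda>(a, b). box a b))"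
      by (simp add: borel_eq_box sets_measure_of)
    have stable: "Int_stable (range (\<lambda>(a, b). box a b :: pt set))"
      unfolding Int_stable_def
    proof (intro ballI)
      fix A B :: "pt set"
      assume "A \<in> range (\<lambda>(a, b). box a b)" "B \<in> range (\<lambda>(a, b). box a b)"
      then obtain a b c d where "A = box a b" "B = box c d" by auto
      then show "A \<inter> B \<in> range (\<lambda>(a, b). box a b)"
        using box_Int_box_ex[of a b c d] by auto
    qed
    have sub: "range (\<lambda>(a, b). box a b :: pt set) \<subseteq> Pow UNIV" by simp
    have "(\<integral>x. indicator A x * ?h x \<partial>lborel) = 0"
      using stable sub sA
    proof (induction rule: sigma_sets_induct_disjoint)
      case (basic A)
      then obtain a b :: pt where A: "A = box a b" by auto
      obtain a' b' :: pt where "box a b \<inter> box (-c) c = box a' b'" using box_Int_box_ex[of a b "- c" c] by blast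
      then have "indicator A x * ?h x = indicator (box a' b') x * f x" for x
        by (simp add: A indicator_inter_arith[symmetric] mult.assoc[symmetric])
      then show ?case
        by (simp only: zb)
    next
      case empty
      then show ?case by simp
    next
      case (compl A)
      then have "A \<in> sets borel" by (simp add: borel_eq_box sets_measure_of)
      moreover have "(\<integral>x. indicator (UNIV - A) x * ?h x \<partial>lborel) = (\<integral>x. ?h x - indicator A x * ?h x \<partial>lborel)"
        by (intro Bochner_Integration.integral_cong) (auto simp: indicator_def)
      ultimately show ?case
        using compl(2) int intA zb[of "- c" c] by simp
    next
      case (union A)
      then have m: "A i \<in> sets borel" for i by (auto simp: borel_eq_box sets_measure_of)
      have "set_lebesgue_integral lborel (\<Union>i. A i) ?h = (\<Sum>i. set_lebesgue_integral lborel (A i) ?h)"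
        using intA[of "\<Union>i. A i"] m union(1)
        by (intro lebesgue_integral_countable_add)
          (auto simp: set_integrable_def disjoint_family_on_def)
      then show ?case
        using union(3) by (simp add: set_lebesgue_integral_def)
    qed
    then show "set_lebesgue_integral lborel A ?h = 0" by (simp add: set_lebesgue_integral_def)
  qed
  have "AE x in lborel. \<forall>n::nat. indicator (box (- (real n, real n)) (real n, real n)) x * f x = 0"
    by (intro iffD2[OF AE_all_countable] allI ae)
  then show ?thesis
  proof eventually_elim
    case (elim x)
    obtain n :: nat where n: "real n > \<bar>fst x\<bar>" "real n > \<bar>snd x\<bar>"
      using reals_Archimedean2[of "max \<bar>fst x\<bar> \<bar>snd x\<bar>"] by auto
    then have "x \<in> box (- (real n, real n)) (real n, real n)"
      by (cases x) (auto simp: mem_box Basis_prod_def)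
    then show ?case using elim[rule_format, of n] by simp
  qed
qed

text \<open>A nonempty open set is not null. This is the device that turns almost-everywhere
  identities between continuous representatives into pointwise ones.\<close>

lemma continuous_AE_zero:
  fixes w :: "'a::euclidean_space \<Rightarrow> real"
  assumes "continuous_on UNIV w" "AE x in lborel. w x = 0"
  shows "w x = 0"
proof (rule ccontr)
  assume "w x \<noteq> 0"
  have "open {y. w y \<noteq> 0}"
    using assms(1) by (intro open_Collect_neq) (auto intro: continuous_intros)
  with \<open>w x \<noteq> 0\<close> obtain e where e: "e > 0" "ball x e \<subseteq> {y. w y \<noteq> 0}"
    using open_contains_ball by blast
  have "AE y in lborel. y \<notin> ball x e"
    using assms(2) by eventually_elim (use e in auto)
  then have "ball x e \<in> null_sets lborel" using AE_iff_null_sets[of "ball x e" lborel] by auto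
  then have "negligible (ball x e)" by (simp add: negligible_iff_null_sets null_sets_completionI)
  then show False using e(1) open_not_negligible[of "ball x e"] by simp
qed

section \<open>Weak derivatives\<close>

text \<open>The defining identity of a weak derivative, restricted to products of bumps and without
  the integrability clauses of \<open>weak_deriv\<close>. Products already determine the derivative
  almost everywhere.\<close>

definition pweak :: "nat \<Rightarrow> nat \<Rightarrow> (pt \<Rightarrow> real) \<Rightarrow> (pt \<Rightarrow> real) \<Rightarrow> bool" where
  "pweak a b f g \<longleftrightarrow> (\<forall>\<phi> \<psi>. bump \<phi> \<longrightarrow> bump \<psi> \<longrightarrow>
     (\<integral>x. f x * ((deriv ^^ a) \<phi> (fst x) * (deriv ^^ b) \<psi> (snd x)) \<partial>lborel) =
     (-1) ^ (a + b) * (\<integral>x. g x * (\<phi> (fst x) * \<psi> (snd x)) \<partial>lborel))"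

lemma pweakD:
  "pweak a b f g \<Longrightarrow> bump \<phi> \<Longrightarrow> bump \<psi> \<Longrightarrow>
     (\<integral>x. f x * ((deriv ^^ a) \<phi> (fst x) * (deriv ^^ b) \<psi> (snd x)) \<partial>lborel) =
     (-1) ^ (a + b) * (\<integral>x. g x * (\<phi> (fst x) * \<psi> (snd x)) \<partial>lborel)"
  unfolding pweak_def by blast

lemma weak_deriv_pweak: assumes "weak_deriv a b f g" shows "pweak a b f g"
  unfolding pweak_def
proof (intro allI impI)
  fix \<phi> \<psi> :: "real \<Rightarrow> real" assume b: "bump \<phi>" "bump \<psi>"
  have c: "count_list (mi a b) True = a" "count_list (mi a b) False = b"
    unfolding mi_def by (induction a; induction b; simp)+
  show "(\<integral>x. f x * ((deriv ^^ a) \<phi> (fst x) * (deriv ^^ b) \<psi> (snd x)) \<partial>lborel) =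
     (-1) ^ (a + b) * (\<integral>x. g x * (\<phi> (fst x) * \<psi> (snd x)) \<partial>lborel)"
    using assms test_fun_tensor[OF b] unfolding weak_deriv_def
    by (auto simp: iterpd_tensor[OF b[THEN bump_smooth]] c)
qed

lemma pweak_unique:
  assumes "pweak a b f g" "pweak a b f g'" "L2 g" "L2 g'"
  shows "AE x in lborel. g x = g' x"
proof -
  have "AE x in lborel. g x - g' x = 0"
  proof (rule locint_tensor_zero_AE)
    show "locint (\<lambda>x. g x - g' x)" using assms by (intro locint_diff L2_locint)
    fix \<phi> \<psi> :: "real \<Rightarrow> real" assume b: "bump \<phi>" "bump \<psi>"
    have "(-1) ^ (a + b) * (\<integral>x. g x * (\<phi> (fst x) * \<psi> (snd x)) \<partial>lborel) =
      (-1) ^ (a + b) * (\<integral>x. g' x * (\<phi> (fst x) * \<psi> (snd x)) \<partial>lborel)"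
      using pweakD[OF assms(1) b] pweakD[OF assms(2) b] by simp
    then have "(\<integral>x. g x * (\<phi> (fst x) * \<psi> (snd x)) \<partial>lborel) = (\<integral>x. g' x * (\<phi> (fst x) * \<psi> (snd x)) \<partial>lborel)"
      by simp
    then show "(\<integral>x. (g x - g' x) * (\<phi> (fst x) * \<psi> (snd x)) \<partial>lborel) = 0"
      using L2_mult[OF assms(3) tensor_L2[OF b]] L2_mult[OF assms(4) tensor_L2[OF b]]
      by (simp add: left_diff_distrib)
  qed
  then show ?thesis by simp
qed

lemma sobolev_wd:
  assumes "sobolev k f" "a + b \<le> k"
  shows "weak_deriv a b f (wd a b f)" "L2 (wd a b f)"
proof -
  have "\<exists>g. weak_deriv a b f g \<and> L2 g" using assms by (auto simp: sobolev_def)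
  from someI_ex[OF this] show "weak_deriv a b f (wd a b f)" "L2 (wd a b f)" by (auto simp: wd_def)
qed

text \<open>\<open>wd\<close> is a Hilbert choice, hence known only up to null sets; any concrete
  candidate must be identified with it in this almost-everywhere form.\<close>

lemma wd_unique:
  assumes "weak_deriv a b f g" "L2 g"
  shows "AE x in lborel. wd a b f x = g x"
proof -
  have "\<exists>g. weak_deriv a b f g \<and> L2 g" using assms by blast
  from someI_ex[OF this] have "weak_deriv a b f (wd a b f)" "L2 (wd a b f)" by (auto simp: wd_def)
  then show ?thesis using assms by (intro pweak_unique weak_deriv_pweak)
qed

text \<open>Derivatives of bumps are bumps, so they may be inserted as test functions into the
  identity for \<open>wd a b f\<close>; comparing with the identity for the total order removes the
  common sign.\<close>

lemma pweak_wd_succ: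
  assumes "sobolev k f" "a + b + c + d \<le> k"
  shows "pweak c d (wd a b f) (wd (a + c) (b + d) f)"
  unfolding pweak_def
proof (intro allI impI)
  fix \<phi> \<psi> :: "real \<Rightarrow> real" assume b: "bump \<phi>" "bump \<psi>"
  have 1: "pweak a b f (wd a b f)" "pweak (a + c) (b + d) f (wd (a + c) (b + d) f)"
    using assms by (intro weak_deriv_pweak sobolev_wd[of k]; simp)+
  have "(-1) ^ (a + b) * (\<integral>x. wd a b f x * ((deriv ^^ c) \<phi> (fst x) * (deriv ^^ d) \<psi> (snd x)) \<partial>lborel)
    = (\<integral>x. f x * ((deriv ^^ a) ((deriv ^^ c) \<phi>) (fst x) * (deriv ^^ b) ((deriv ^^ d) \<psi>) (snd x)) \<partial>lborel)"
    by (rule pweakD[OF 1(1), symmetric]) (intro bump_funpow_deriv b)+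
  also have "\<dots> = (-1) ^ (a + c + (b + d)) * (\<integral>x. wd (a + c) (b + d) f x * (\<phi> (fst x) * \<psi> (snd x)) \<partial>lborel)"
    using pweakD[OF 1(2) b] by (simp add: funpow_add)
  also have "(-1) ^ (a + c + (b + d)) = (-1) ^ (a + b) * ((-1) ^ (c + d) :: real)"
    by (simp add: power_add[symmetric] algebra_simps)
  finally show "(\<integral>x. wd a b f x * ((deriv ^^ c) \<phi> (fst x) * (deriv ^^ d) \<psi> (snd x)) \<partial>lborel) =
     (-1) ^ (c + d) * (\<integral>x. wd (a + c) (b + d) f x * (\<phi> (fst x) * \<psi> (snd x)) \<partial>lborel)"
    by simp
qed

lemma weak_deriv_lin:
  assumes "weak_deriv a b f f'" "weak_deriv a b g g'"
  shows "weak_deriv a b (\<lambda>x. c * f x + d * g x) (\<lambda>x. c * f' x + d * g' x)"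
  unfolding weak_deriv_def
proof (intro allI impI)
  fix \<phi> assume \<phi>: "test_fun \<phi>"
  note A = assms(1)[unfolded weak_deriv_def, rule_format, OF \<phi>] and B = assms(2)[unfolded weak_deriv_def, rule_format, OF \<phi>]
  have e: "(\<lambda>x. (c * f x + d * g x) * h x) = (\<lambda>x. c * (f x * h x) + d * (g x * h x))" for f g h :: "pt \<Rightarrow> real"
    by (auto simp: algebra_simps)
  show "integrable lborel (\<lambda>x. (c * f x + d * g x) * iterpd (mi a b) \<phi> x) \<and>
       integrable lborel (\<lambda>x. (c * f' x + d * g' x) * \<phi> x) \<and>
       (\<integral>x. (c * f x + d * g x) * iterpd (mi a b) \<phi> x \<partial>lborel) =
       (- 1) ^ (a + b) * (\<integral>x. (c * f' x + d * g' x) * \<phi> x \<partial>lborel)"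
    unfolding e using A B by (simp add: algebra_simps)
qed

lemma sobolev_lin:
  assumes "sobolev k f" "sobolev k g"
  shows "sobolev k (\<lambda>x. c * f x + d * g x)"
  unfolding sobolev_def
proof (intro conjI allI impI)
  show "L2 (\<lambda>x. c * f x + d * g x)" using assms by (auto simp: sobolev_def intro!: L2_add L2_cmult)
  fix a b :: nat assume ab: "a + b \<le> k"
  note A = sobolev_wd[OF assms(1) ab] and B = sobolev_wd[OF assms(2) ab]
  then show "\<exists>h. weak_deriv a b (\<lambda>x. c * f x + d * g x) h \<and> L2 h"
    by (intro exI[of _ "\<lambda>x. c * wd a b f x + d * wd a b g x"] conjI weak_deriv_lin L2_add L2_cmult)
qed

lemma wd_lin:
  assumes "sobolev k f" "sobolev k g" "a + b \<le> k"
  shows "AE x in lborel. wd a b (\<lambda>x. c * f x + d * g x) x = c * wd a b f x + d * wd a b g x"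
  using sobolev_wd[OF assms(1,3)] sobolev_wd[OF assms(2,3)]
  by (intro wd_unique weak_deriv_lin L2_add L2_cmult)

lemma wd_0: assumes "sobolev k f" shows "AE x in lborel. wd 0 0 f x = f x"
proof -
  have "pweak 0 0 f f" by (simp add: pweak_def)
  moreover have "L2 f" using assms by (simp add: sobolev_def)
  ultimately show ?thesis using sobolev_wd[OF assms, of 0 0]
    by (intro pweak_unique[of 0 0 f "wd 0 0 f" f]) (auto dest: weak_deriv_pweak)
qed

section \<open>The Sobolev norm\<close>

lemma hk_index_finite: "finite {(a, b). a + b \<le> (k::nat)}"
  by (rule finite_subset[of _ "{..k} \<times> {..k}"]) auto

lemma hk_norm_L2_set: "hk_norm k f = L2_set (\<lambda>(a, b). l2norm (wd a b f)) {(a, b). a + b \<le> k}"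
  by (simp add: hk_norm_def L2_set_def case_prod_unfold)

lemma l2norm_wd_le_hk: assumes "a + b \<le> k" shows "l2norm (wd a b f) \<le> hk_norm k f"
  using member_le_L2_set[OF hk_index_finite[of k], of "(a, b)" "\<lambda>(a, b). l2norm (wd a b f)"] assms
  by (simp add: hk_norm_L2_set)

lemma hk_norm_nonneg: "hk_norm k f \<ge> 0"
  unfolding hk_norm_def by (intro real_sqrt_ge_zero sum_nonneg) auto

lemma hk_norm_mono: assumes "k \<le> l" shows "hk_norm k f \<le> hk_norm l f"
  unfolding hk_norm_def using assms hk_index_finite[of l]
  by (intro real_sqrt_le_mono sum_mono2) auto

lemma hk_norm_triangle:
  assumes "sobolev k f" "sobolev k g"
  shows "hk_norm k (\<lambda>x. c * f x + d * g x) \<le> \<bar>c\<bar> * hk_norm k f + \<bar>d\<bar> * hk_norm k g"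
proof -
  let ?I = "{(a, b). a + b \<le> k}"
  have "l2norm (wd a b (\<lambda>x. c * f x + d * g x)) \<le> \<bar>c\<bar> * l2norm (wd a b f) + \<bar>d\<bar> * l2norm (wd a b g)"
    if "a + b \<le> k" for a b
  proof -
    note L = sobolev_wd(2)[OF assms(1) that] sobolev_wd(2)[OF assms(2) that]
    have "l2norm (wd a b (\<lambda>x. c * f x + d * g x)) = l2norm (\<lambda>x. c * wd a b f x + d * wd a b g x)"
      using L sobolev_wd(2)[OF sobolev_lin[OF assms] that]
      by (intro l2norm_AE_cong wd_lin[OF assms that]) (auto intro!: L2_measurable L2_add L2_cmult)
    also have "\<dots> \<le> l2norm (\<lambda>x. c * wd a b f x) + l2norm (\<lambda>x. d * wd a b g x)"
      using L by (intro l2norm_triangle L2_cmult)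
    finally show ?thesis by (simp add: l2norm_cmult)
  qed
  then have "hk_norm k (\<lambda>x. c * f x + d * g x) \<le>
     L2_set (\<lambda>i. (case i of (a, b) \<Rightarrow> \<bar>c\<bar> * l2norm (wd a b f)) + (case i of (a, b) \<Rightarrow> \<bar>d\<bar> * l2norm (wd a b g))) ?I"
    unfolding hk_norm_L2_set by (intro L2_set_mono) (auto simp: l2norm_nonneg)
  also have "\<dots> \<le> L2_set (\<lambda>i. case i of (a, b) \<Rightarrow> \<bar>c\<bar> * l2norm (wd a b f)) ?I + L2_set (\<lambda>i. case i of (a, b) \<Rightarrow> \<bar>d\<bar> * l2norm (wd a b g)) ?I"
    by (rule L2_set_triangle_ineq)
  also have "\<dots> = \<bar>c\<bar> * hk_norm k f + \<bar>d\<bar> * hk_norm k g"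
    unfolding hk_norm_L2_set by (simp add: L2_set_right_distrib case_prod_unfold)
  finally show ?thesis .
qed

section \<open>Averages of test functions over an interval\<close>

definition avg :: "(real \<Rightarrow> real) \<Rightarrow> real \<Rightarrow> real \<Rightarrow> (real \<Rightarrow> real) \<Rightarrow> real \<Rightarrow> real" where
  "avg k h e \<phi> y = integral {0..h} (\<lambda>z. k z * \<phi> (y + e * z))"

lemma avg_DERIV:
  assumes "smooth \<phi>" "continuous_on UNIV k"
  shows "(avg k h e \<phi> has_real_derivative avg k h e (deriv \<phi>) y) (at y)"
proof -
  have c: "continuous_on UNIV \<phi>" "continuous_on UNIV (deriv \<phi>)"
    using assms smooth_continuous smooth_deriv by blast+
  have "((\<lambda>y. integral (cbox 0 h) (\<lambda>z. k z * \<phi> (y + e * z))) has_real_derivative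
     integral (cbox 0 h) (\<lambda>z. k z * deriv \<phi> (y + e * z))) (at y within UNIV)"
  proof (rule leibniz_rule_field_derivative)
    fix y z :: real
    have "((\<lambda>y. \<phi> (y + e * z)) has_real_derivative deriv \<phi> (y + e * z)) (at y)"
      using DERIV_shift[THEN iffD1, OF smooth_DERIV[OF assms(1), of "y + e * z"]] .
    then show "((\<lambda>y. k z * \<phi> (y + e * z)) has_real_derivative k z * deriv \<phi> (y + e * z)) (at y within UNIV)"
      by (intro DERIV_cmult)
  next
    fix y :: real
    show "(\<lambda>z. k z * \<phi> (y + e * z)) integrable_on cbox 0 h"
      by (intro integrable_continuous continuous_intros continuous_on_subset[OF assms(2)]
          continuous_on_compose2[OF c(1)]) auto
  next
    show "continuous_on (UNIV \<times> cbox 0 h) (\<lambda>(y, z). k z * deriv \<phi> (y + e * z))"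
      unfolding case_prod_unfold
      by (intro continuous_intros continuous_on_compose2[OF assms(2)] continuous_on_compose2[OF c(2)]) auto
  qed auto
  then show ?thesis by (simp add: avg_def[abs_def])
qed

lemma avg_bump:
  assumes "bump \<phi>" "continuous_on UNIV k"
  shows "bump (avg k h e \<phi>)" "deriv (avg k h e \<phi>) = avg k h e (deriv \<phi>)"
proof -
  have "smooth (avg k h e \<phi>)"
  proof (rule smooth_coinduct[where S="avg k h e ` {\<phi>. smooth \<phi>}"])
    show "avg k h e \<phi> \<in> avg k h e ` {\<phi>. smooth \<phi>}" using assms by (auto simp: bump_def)
    fix f assume "f \<in> avg k h e ` {\<phi>. smooth \<phi>}"
    then show "\<exists>f'\<in>avg k h e ` {\<phi>. smooth \<phi>}. \<forall>x. (f has_real_derivative f' x) (at x)"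
      using avg_DERIV[OF _ assms(2)] smooth_deriv by blast
  qed
  moreover obtain R where R: "\<And>x. \<bar>x\<bar> > R \<Longrightarrow> \<phi> x = 0" using assms by (auto simp: bump_def)
  have "avg k h e \<phi> y = 0" if "\<bar>y\<bar> > R + \<bar>e\<bar> * \<bar>h\<bar>" for y
  proof -
    have "k z * \<phi> (y + e * z) = 0" if "z \<in> {0..h}" for z
    proof -
      have "\<bar>e * z\<bar> \<le> \<bar>e\<bar> * \<bar>h\<bar>" unfolding abs_mult using that by (intro mult_left_mono) auto
      then have "\<bar>y + e * z\<bar> > R" using \<open>\<bar>y\<bar> > R + \<bar>e\<bar> * \<bar>h\<bar>\<close> by linarith
      then show ?thesis using R by simp
    qed
    then show ?thesis unfolding avg_def using integral_cong[of "{0..h}" "\<lambda>z. k z * \<phi> (y + e * z)" "\<lambda>z. 0"] by (simp only: integral_0)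
  qed
  ultimately show "bump (avg k h e \<phi>)" unfolding bump_def by blast
  show "deriv (avg k h e \<phi>) = avg k h e (deriv \<phi>)"
    using assms by (intro ext DERIV_imp_deriv avg_DERIV) (auto simp: bump_def)
qed

text \<open>Integration by parts of (1 - z) * phi'(y + z) over [0, 1] gives the integral of phi
  minus phi(y). It is the adjoint, on the test-function side, of the representation of a function by
  averages of itself and its derivative.\<close>

lemma avg_reproducing:
  assumes "bump \<phi>"
  shows "avg (\<lambda>_. 1) 1 1 \<phi> y - deriv (avg (\<lambda>z. 1 - z) 1 1 \<phi>) y = \<phi> y"
proof -
  have sm: "smooth \<phi>" using assms by (simp add: bump_def)
  have c: "continuous_on UNIV \<phi>" "continuous_on UNIV (deriv \<phi>)"
    using sm smooth_continuous smooth_deriv by blast+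
  have "((\<lambda>z. (1 - z) * deriv \<phi> (y + z) - \<phi> (y + z)) has_integral ((1 - 1) * \<phi> (y + 1) - (1 - 0) * \<phi> (y + 0))) {0..1}"
  proof (rule fundamental_theorem_of_calculus)
    fix z :: real
    have "((\<lambda>z. \<phi> (y + z)) has_real_derivative deriv \<phi> (y + z)) (at z)"
      using DERIV_shift[THEN iffD1, of \<phi> "deriv \<phi> (z + y)" z y] smooth_DERIV[OF sm, of "z + y"] by (simp add: add.commute)
    then have "((\<lambda>z. (1 - z) * \<phi> (y + z)) has_real_derivative ((1 - z) * deriv \<phi> (y + z) - \<phi> (y + z))) (at z)"
      by (auto intro!: derivative_eq_intros)
    then show "((\<lambda>z. (1 - z) * \<phi> (y + z)) has_vector_derivative ((1 - z) * deriv \<phi> (y + z) - \<phi> (y + z))) (at z within {0..1})"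
      by (simp add: has_real_derivative_iff_has_vector_derivative[symmetric] has_field_derivative_at_within)
  qed auto
  then have "integral {0..1} (\<lambda>z. (1 - z) * deriv \<phi> (y + z) - \<phi> (y + z)) = - \<phi> y" by (simp add: integral_unique)
  moreover have "integral {0..1} (\<lambda>z. (1 - z) * deriv \<phi> (y + z) - \<phi> (y + z)) =
     integral {0..1} (\<lambda>z. (1 - z) * deriv \<phi> (y + z)) - integral {0..1} (\<lambda>z. \<phi> (y + z))"
    by (intro Henstock_Kurzweil_Integration.integral_diff integrable_continuous_real continuous_intros continuous_on_compose2[OF c(1)] continuous_on_compose2[OF c(2)]) auto
  ultimately show ?thesis using avg_bump(2)[OF assms, of "\<lambda>z. 1 - z" 1 1]
    by (simp add: avg_def continuous_intros)
qed

lemma avg_deriv_backward: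
  assumes "bump \<phi>" "0 \<le> h"
  shows "deriv (avg (\<lambda>_. 1) h (-1) \<phi>) y = \<phi> y - \<phi> (y - h)"
proof -
  have sm: "smooth \<phi>" using assms by (simp add: bump_def)
  have "((\<lambda>z. - deriv \<phi> (y - z)) has_integral (\<phi> (y - h) - \<phi> (y - 0))) {0..h}"
  proof (rule fundamental_theorem_of_calculus)
    fix z :: real
    have "((\<lambda>z. \<phi> (y - z)) has_real_derivative - deriv \<phi> (y - z)) (at z)"
      using DERIV_chain2[where f=\<phi> and g="\<lambda>z. y - z" and x=z and s=UNIV, OF smooth_DERIV[OF sm], of "- 1"]
        DERIV_diff[OF DERIV_const[of y] DERIV_ident, of z UNIV] by simp
    then show "((\<lambda>z. \<phi> (y - z)) has_vector_derivative - deriv \<phi> (y - z)) (at z within {0..h})"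
      by (simp add: has_real_derivative_iff_has_vector_derivative[symmetric] has_field_derivative_at_within)
  qed (use assms in auto)
  then have "integral {0..h} (\<lambda>z. deriv \<phi> (y - z)) = \<phi> y - \<phi> (y - h)"
    using has_integral_neg by (fastforce dest: integral_unique)
  then show ?thesis using avg_bump(2)[OF assms(1), of "\<lambda>_. 1" h "-1"] by (simp add: avg_def continuous_intros)
qed

text \<open>For fixed z the x-integral is at most
  \<open>\<bar>K z\<bar> * (l2norm g * l2norm h)\<close> by Cauchy-Schwarz and translation
  invariance, which is the hypothesis for Fubini. The shift \<open>\<sigma>\<close> is arbitrary
  since it is used both with z in the plane (averages over a square) and with multiples of a vector
  (averages over a segment).\<close>

lemma conv_integrable:
  fixes K :: "'b::euclidean_space \<Rightarrow> real" and \<sigma> :: "'b \<Rightarrow> pt"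
  assumes K: "integrable lborel K" and [measurable]: "\<sigma> \<in> borel_measurable borel"
    and L: "L2 g" "L2 h"
  shows "integrable (lborel \<Otimes>\<^sub>M lborel) (\<lambda>(z, x). K z * (g (x - \<sigma> z) * h x))"
    and "integrable (lborel \<Otimes>\<^sub>M lborel) (\<lambda>(z, x). K z * (g x * h (x + \<sigma> z)))"
proof -
  note [measurable] = borel_measurable_integrable[OF K] L2_measurable[OF L(1)] L2_measurable[OF L(2)]
  have gs: "L2 (\<lambda>x. g (x - c))" "l2norm (\<lambda>x. g (x - c)) = l2norm g" for c
    using L2_shift[OF L(1), of "- c"] l2norm_shift[of g "- c"] by auto
  have hs: "L2 (\<lambda>x. h (x + c))" "l2norm (\<lambda>x. h (x + c)) = l2norm h" for c
    using L2_shift[OF L(2), of "c"] l2norm_shift[of h "c"] by auto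
  have dom: "integrable lborel (\<lambda>z. K z * (l2norm g * l2norm h))" using K by simp
  show "integrable (lborel \<Otimes>\<^sub>M lborel) (\<lambda>(z, x). K z * (g (x - \<sigma> z) * h x))"
  proof (rule lborel_pair.Fubini_integrable)
    show "AE z in lborel. integrable lborel (\<lambda>x. case (z, x) of (z, x) \<Rightarrow> K z * (g (x - \<sigma> z) * h x))"
      using L2_mult[OF gs(1) L(2)] by simp
    show "integrable lborel (\<lambda>z. \<integral>x. norm (case (z, x) of (z, x) \<Rightarrow> K z * (g (x - \<sigma> z) * h x)) \<partial>lborel)"
    proof (rule Bochner_Integration.integrable_bound[OF dom])
      show "AE z in lborel. norm (\<integral>x. norm (case (z, x) of (z, x) \<Rightarrow> K z * (g (x - \<sigma> z) * h x)) \<partial>lborel) \<le> norm (K z * (l2norm g * l2norm h))"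
      proof (intro AE_I2)
        fix z
        show "norm (\<integral>x. norm (case (z, x) of (z, x) \<Rightarrow> K z * (g (x - \<sigma> z) * h x)) \<partial>lborel) \<le> norm (K z * (l2norm g * l2norm h))"
          using mult_left_mono[OF L2_Cauchy_Schwarz_abs[OF gs(1)[of "\<sigma> z"] L(2)], of "\<bar>K z\<bar>"]
          by (simp add: abs_mult l2norm_nonneg gs(2))
      qed
    qed measurable
  qed measurable
  show "integrable (lborel \<Otimes>\<^sub>M lborel) (\<lambda>(z, x). K z * (g x * h (x + \<sigma> z)))"
  proof (rule lborel_pair.Fubini_integrable)
    show "AE z in lborel. integrable lborel (\<lambda>x. case (z, x) of (z, x) \<Rightarrow> K z * (g x * h (x + \<sigma> z)))"
      using L2_mult[OF L(1) hs(1)] by simp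
    show "integrable lborel (\<lambda>z. \<integral>x. norm (case (z, x) of (z, x) \<Rightarrow> K z * (g x * h (x + \<sigma> z))) \<partial>lborel)"
    proof (rule Bochner_Integration.integrable_bound[OF dom])
      show "AE z in lborel. norm (\<integral>x. norm (case (z, x) of (z, x) \<Rightarrow> K z * (g x * h (x + \<sigma> z))) \<partial>lborel) \<le> norm (K z * (l2norm g * l2norm h))"
      proof (intro AE_I2)
        fix z
        show "norm (\<integral>x. norm (case (z, x) of (z, x) \<Rightarrow> K z * (g x * h (x + \<sigma> z))) \<partial>lborel) \<le> norm (K z * (l2norm g * l2norm h))"
          using mult_left_mono[OF L2_Cauchy_Schwarz_abs[OF L(1) hs(1)[of "\<sigma> z"]], of "\<bar>K z\<bar>"]
          by (simp add: abs_mult l2norm_nonneg hs(2))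
      qed
    qed measurable
  qed measurable
qed

lemma conv_dual:
  fixes K :: "'b::euclidean_space \<Rightarrow> real" and \<sigma> :: "'b \<Rightarrow> pt"
  assumes K: "integrable lborel K" and s: "\<sigma> \<in> borel_measurable borel"
    and L: "L2 g" "L2 h"
  shows "(\<integral>x. (\<integral>z. K z * g (x - \<sigma> z) \<partial>lborel) * h x \<partial>lborel) = (\<integral>x. g x * (\<integral>z. K z * h (x + \<sigma> z) \<partial>lborel) \<partial>lborel)"
proof -
  have "(\<integral>x. (\<integral>z. K z * g (x - \<sigma> z) \<partial>lborel) * h x \<partial>lborel) = (\<integral>x. (\<integral>z. K z * (g (x - \<sigma> z) * h x) \<partial>lborel) \<partial>lborel)"
    unfolding mult.assoc[symmetric] by simp
  also have "\<dots> = (\<integral>z. (\<integral>x. K z * (g (x - \<sigma> z) * h x) \<partial>lborel) \<partial>lborel)"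
    by (rule lborel_pair.Fubini_integral[OF conv_integrable(1)[OF assms]])
  also have "\<dots> = (\<integral>z. (\<integral>x. K z * (g x * h (x + \<sigma> z)) \<partial>lborel) \<partial>lborel)"
  proof (rule Bochner_Integration.integral_cong[OF refl])
    fix z
    show "(\<integral>x. K z * (g (x - \<sigma> z) * h x) \<partial>lborel) = (\<integral>x. K z * (g x * h (x + \<sigma> z)) \<partial>lborel)"
      using lborel_integral_shift[of "\<lambda>x. K z * (g (x - \<sigma> z) * h x)" "\<sigma> z"]
      unfolding add_diff_cancel_right' by (rule sym)
  qed
  also have "\<dots> = (\<integral>x. (\<integral>z. K z * (g x * h (x + \<sigma> z)) \<partial>lborel) \<partial>lborel)"
    by (rule lborel_pair.Fubini_integral[OF conv_integrable(2)[OF assms], symmetric])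
  also have "\<dots> = (\<integral>x. g x * (\<integral>z. K z * h (x + \<sigma> z) \<partial>lborel) \<partial>lborel)"
    by (subst integral_mult_right_zero[symmetric]) (simp add: mult_ac)
  finally show ?thesis .
qed

lemma tensor_integral:
  fixes a b :: "real \<Rightarrow> real"
  assumes a: "integrable lborel a" and b: "integrable lborel b"
  shows "integrable lborel (\<lambda>z::pt. a (fst z) * b (snd z))"
    and "(\<integral>z. a (fst z) * b (snd z) \<partial>(lborel :: pt measure)) = (\<integral>x. a x \<partial>lborel) * (\<integral>x. b x \<partial>lborel)"
proof -
  note [measurable] = borel_measurable_integrable[OF a] borel_measurable_integrable[OF b]
  have i: "integrable (lborel \<Otimes>\<^sub>M lborel) (\<lambda>z. a (fst z) * b (snd z))"
    by (rule lborel_pair.Fubini_integrable) (use a b in \<open>auto simp: abs_mult\<close>)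
  then show "integrable lborel (\<lambda>z::pt. a (fst z) * b (snd z))" by (simp add: lborel_prod)
  have "(\<integral>z. a (fst z) * b (snd z) \<partial>(lborel \<Otimes>\<^sub>M lborel)) = (\<integral>x. (\<integral>y. a x * b y \<partial>lborel) \<partial>lborel)"
    using lborel_pair.integral_fst'[OF i] by simp
  then show "(\<integral>z. a (fst z) * b (snd z) \<partial>(lborel :: pt measure)) = (\<integral>x. a x \<partial>lborel) * (\<integral>x. b x \<partial>lborel)"
    by (simp add: lborel_prod)
qed

section \<open>Continuous representatives\<close>

text \<open>With \<open>d\<close> the factor \<open>1 - z\<close> vanishes at the far end of the unit interval, so that
  \<open>g x = \<integral>\<^sub>0\<^sup>1 (1 - z) g' (x - z) + g (x - z) dz\<close>; \<open>srep\<close> is the product of these formulas in both coordinates.\<close>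

definition cut :: "bool \<Rightarrow> real \<Rightarrow> real" where
  "cut d z = indicator {0..1} z * (if d then 1 - z else 1)"

definition sqconv :: "bool \<Rightarrow> bool \<Rightarrow> (pt \<Rightarrow> real) \<Rightarrow> pt \<Rightarrow> real" where
  "sqconv d e g x = (\<integral>z. (cut d (fst z) * cut e (snd z)) * g (x - z) \<partial>lborel)"

lemma cut_measurable [measurable]: "cut d \<in> borel_measurable borel"
  unfolding cut_def[abs_def] by (cases d) auto

lemma cut_bounds: "0 \<le> cut d z" "cut d z \<le> indicator {0..1} z" "cut d z \<le> 1"
  by (auto simp: cut_def indicator_def)

lemma cut_integral:
  assumes "continuous_on UNIV \<phi>"
  shows "integrable lborel (\<lambda>z. cut d z * \<phi> (y + z))"
    and "(\<integral>z. cut d z * \<phi> (y + z) \<partial>lborel) = avg (if d then (\<lambda>z. 1 - z) else (\<lambda>_. 1)) 1 1 \<phi> y"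
proof -
  have "set_integrable lborel {0..1} (\<lambda>z. (if d then 1 - z else 1) * \<phi> (y + z))"
    by (cases d) (auto intro!: borel_integrable_atLeastAtMost' continuous_intros continuous_on_compose2[OF assms])
  moreover have "indicator {0..1} z *\<^sub>R ((if d then 1 - z else 1) * \<phi> (y + z)) = cut d z * \<phi> (y + z)" for z
    by (simp add: cut_def)
  ultimately show "integrable lborel (\<lambda>z. cut d z * \<phi> (y + z))"
    "(\<integral>z. cut d z * \<phi> (y + z) \<partial>lborel) = avg (if d then (\<lambda>z. 1 - z) else (\<lambda>_. 1)) 1 1 \<phi> y"
    using set_borel_integral_eq_integral(2)[of "{0..1}" "\<lambda>z. (if d then 1 - z else 1) * \<phi> (y + z)"]
    unfolding set_integrable_def set_lebesgue_integral_def avg_def by (auto simp: if_distrib cong: if_cong)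
qed

lemma cut_tensor_integrable: "integrable lborel (\<lambda>z::pt. cut d (fst z) * cut e (snd z))"
  using cut_integral(1)[of "\<lambda>_. 1"] by (intro tensor_integral(1)) auto

lemma cut_tensor_L2: "L2 (\<lambda>z::pt. cut d (fst z) * cut e (snd z))"
    and cut_tensor_l2norm: "l2norm (\<lambda>z::pt. cut d (fst z) * cut e (snd z)) \<le> 1"
proof -
  let ?K = "\<lambda>z::pt. cut d (fst z) * cut e (snd z)"
  have [measurable]: "?K \<in> borel_measurable borel" by (intro tensor_measurable) measurable
  have le: "(?K z)\<^sup>2 \<le> cut False (fst z) * cut False (snd z)" for z
  proof -
    have c: "(cut d z)\<^sup>2 \<le> cut False z" for d z
      by (auto simp: cut_def indicator_def power2_eq_square intro!: mult_le_one)
    show ?thesis unfolding power_mult_distrib by (intro mult_mono c) (auto simp: cut_bounds)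
  qed
  have i: "integrable lborel (\<lambda>z. (?K z)\<^sup>2)"
    by (rule Bochner_Integration.integrable_bound[OF cut_tensor_integrable[of False False]])
      (auto simp: le abs_mult cut_bounds)
  then show "L2 ?K" by (simp add: L2_def)
  have "(\<integral>z. (?K z)\<^sup>2 \<partial>lborel) \<le> (\<integral>z. cut False (fst z) * cut False (snd z) \<partial>(lborel::pt measure))"
    by (intro integral_mono i cut_tensor_integrable le)
  also have "\<dots> = (\<integral>x. cut False x \<partial>lborel) * (\<integral>x. cut False x \<partial>lborel)"
    using cut_integral(1)[of "\<lambda>_. 1" False] by (intro tensor_integral(2)) auto
  also have "(\<integral>x. cut False x \<partial>lborel) = 1"
    using cut_integral(2)[of "\<lambda>_. 1" False] by (simp add: avg_def)
  finally show "l2norm ?K \<le> 1" by (simp add: l2norm_def)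
qed

lemma L2_reflect:
  assumes "L2 g" shows "L2 (\<lambda>z. g (x - z))" "l2norm (\<lambda>z. g (x - z)) = l2norm g"
proof -
  note [measurable] = L2_measurable[OF assms]
  have "integrable (distr lborel lborel (\<lambda>z. x - z)) (\<lambda>z. (g z)\<^sup>2)"
    using L2_square[OF assms] by (simp add: lborel_reflect[of x, symmetric])
  then have "integrable lborel (\<lambda>z. (g (x - z))\<^sup>2)" by (subst (asm) integrable_distr_eq) auto
  then show "L2 (\<lambda>z. g (x - z))" by (simp add: L2_def)
  have "(\<integral>z. (g z)\<^sup>2 \<partial>lborel) = (\<integral>z. (g z)\<^sup>2 \<partial>distr lborel lborel (\<lambda>z. x - z))"
    by (simp add: lborel_reflect[of x, symmetric])
  also have "\<dots> = (\<integral>z. (g (x - z))\<^sup>2 \<partial>lborel)" by (subst integral_distr) auto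
  finally show "l2norm (\<lambda>z. g (x - z)) = l2norm g" by (simp add: l2norm_def)
qed

text \<open>The averaging kernel has L2 norm at most 1 whatever the flags, so averaging over the
  unit square gains boundedness from square integrability. This is the whole Sobolev
  embedding.\<close>

lemma sqconv_bound:
  assumes "L2 g" shows "\<bar>sqconv d e g x\<bar> \<le> l2norm g"
proof -
  have "\<bar>sqconv d e g x\<bar> \<le> l2norm (\<lambda>z::pt. cut d (fst z) * cut e (snd z)) * l2norm (\<lambda>z. g (x - z))"
    unfolding sqconv_def by (intro L2_Cauchy_Schwarz cut_tensor_L2 L2_reflect assms)
  also have "\<dots> \<le> 1 * l2norm g"
    unfolding L2_reflect(2)[OF assms] by (intro mult_right_mono cut_tensor_l2norm l2norm_nonneg)
  finally show ?thesis by simp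
qed

lemma sqconv_alt:
  assumes "L2 g"
  shows "sqconv d e g x = (\<integral>y. (cut d (fst x - fst y) * cut e (snd x - snd y)) * g y \<partial>lborel)"
proof -
  note [measurable] = L2_measurable[OF assms]
  have [measurable]: "(\<lambda>z::pt. cut d (fst z) * cut e (snd z)) \<in> borel_measurable borel" by (intro tensor_measurable) measurable
  have "sqconv d e g x = (\<integral>z. (cut d (fst z) * cut e (snd z)) * g (x - z) \<partial>distr lborel lborel (\<lambda>z. x - z))"
    by (simp add: sqconv_def lborel_reflect[of x, symmetric])
  also have "\<dots> = (\<integral>z. (cut d (fst (x - z)) * cut e (snd (x - z))) * g (x - (x - z)) \<partial>lborel)"
    by (subst integral_distr) auto
  finally show ?thesis by simp
qed

lemma AE_hyperplane:
  fixes b :: "'a::euclidean_space"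
  assumes "b \<noteq> 0" shows "AE x in lborel. b \<bullet> x \<noteq> c"
proof -
  have "negligible {x. b \<bullet> x = c}" using assms by (intro negligible_hyperplane) auto
  moreover have "{x. b \<bullet> x = c} \<in> sets borel" by (intro borel_closed closed_hyperplane)
  ultimately have "{x. b \<bullet> x = c} \<in> null_sets lborel"
    by (simp add: negligible_iff_null_sets null_sets_completion_iff)
  then show ?thesis by (drule_tac AE_not_in) simp
qed

lemma cut_isCont: assumes "z \<noteq> 0" "z \<noteq> 1" shows "isCont (cut d) z"
proof -
  consider "z < 0" | "z > 1" | "0 < z \<and> z < 1" using assms by linarith
  then show ?thesis
  proof cases
    case 1
    then have "eventually (\<lambda>w. cut d w = 0) (nhds z)"
      by (intro eventually_mono[OF eventually_nhds_in_open[of "{..<0}" z]]) (auto simp: cut_def)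
    then show ?thesis by (subst isCont_cong) auto
  next
    case 2
    then have "eventually (\<lambda>w. cut d w = 0) (nhds z)"
      by (intro eventually_mono[OF eventually_nhds_in_open[of "{1<..}" z]]) (auto simp: cut_def)
    then show ?thesis by (subst isCont_cong) auto
  next
    case 3
    then have "eventually (\<lambda>w. cut d w = (if d then 1 - w else 1)) (nhds z)"
      by (intro eventually_mono[OF eventually_nhds_in_open[of "{0<..<1}" z]]) (auto simp: cut_def)
    then show ?thesis by (cases d) (auto simp: isCont_cong intro!: continuous_intros)
  qed
qed

text \<open>In the form \<open>sqconv_alt\<close> the point x occurs only in the kernel, and
  \<open>cut\<close> jumps at 0 and 1 at most. For fixed x the affected y lie on four lines, a null
  set, so dominated convergence needs no continuity of \<open>g\<close>.\<close>

lemma sqconv_continuous: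
  assumes "L2 g" shows "continuous_on UNIV (sqconv d e g)"
  unfolding continuous_on_sequentially comp_def
proof (intro allI ballI impI, elim conjE)
  note [measurable] = L2_measurable[OF assms]
  have [measurable]: "(\<lambda>z::pt. cut d (a - fst z) * cut e (b - snd z)) \<in> borel_measurable borel" for a b
    by (rule tensor_measurable[of "\<lambda>z. cut d (a - z)" "\<lambda>z. cut e (b - z)"]) measurable
  fix X :: "nat \<Rightarrow> pt" and x assume X: "X \<longlonglongrightarrow> x"
  then have Xf: "(\<lambda>n. fst (X n)) \<longlonglongrightarrow> fst x" "(\<lambda>n. snd (X n)) \<longlonglongrightarrow> snd x" by (auto intro: tendsto_intros)
  obtain R where R: "\<And>n. norm (X n) \<le> R" using convergent_imp_Bseq[OF convergentI[OF X]] unfolding Bseq_def by blast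
  have R1: "\<bar>fst (X n)\<bar> \<le> R" "\<bar>snd (X n)\<bar> \<le> R" for n
    using R[of n] norm_fst_le[of "fst (X n)" "snd (X n)"] norm_snd_le[of "snd (X n)" "fst (X n)"] by auto
  \<comment> \<open>The margin 1 is the side length of the averaging square: all kernels along the
    bounded sequence vanish outside this one box.\<close>
  let ?Q = "cbox (- (R + 1), - (R + 1)) (R + 1, R + 1) :: pt set"
  have LQ: "L2 (indicator ?Q)"
  proof -
    have "(\<lambda>x. (indicator ?Q x :: real)\<^sup>2) = indicator ?Q" by (auto simp: indicator_def)
    then show ?thesis using integrable_real_indicator[of ?Q lborel] emeasure_lborel_cbox_finite[of "(- (R + 1), - (R + 1))" "(R + 1, R + 1)"]
      by (simp add: L2_def)
  qed
  show "(\<lambda>n. sqconv d e g (X n)) \<longlonglongrightarrow> sqconv d e g x"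
    unfolding sqconv_alt[OF assms]
  proof (rule integral_dominated_convergence[where w="\<lambda>y. \<bar>indicator ?Q y * g y\<bar>"])
    show "integrable lborel (\<lambda>y. \<bar>indicator ?Q y * g y\<bar>)"
      by (intro integrable_abs L2_mult LQ assms)
    have "AE y in lborel. (1::real, 0::real) \<bullet> y \<noteq> fst x - c" "AE y in lborel. (0::real, 1::real) \<bullet> y \<noteq> snd x - c" for c
      by (auto intro!: AE_hyperplane simp: zero_prod_def)
    from this(1)[of 0] this(1)[of 1] this(2)[of 0] this(2)[of 1]
    show "AE y in lborel. (\<lambda>n. (cut d (fst (X n) - fst y) * cut e (snd (X n) - snd y)) * g y)
       \<longlonglongrightarrow> (cut d (fst x - fst y) * cut e (snd x - snd y)) * g y"
    proof eventually_elim
      case (elim y)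
      show ?case
        by (intro tendsto_mult tendsto_const isCont_tendsto_compose[OF cut_isCont] tendsto_diff Xf)
          (use elim in \<open>auto simp: inner_prod_def\<close>)
    qed
    fix n
    show "AE y in lborel. norm ((cut d (fst (X n) - fst y) * cut e (snd (X n) - snd y)) * g y) \<le> \<bar>indicator ?Q y * g y\<bar>"
    proof (intro AE_I2)
      fix y :: pt
      have "cut d (fst (X n) - fst y) * cut e (snd (X n) - snd y) \<le> indicator ?Q y"
      proof (cases "y \<in> ?Q")
        case True then show ?thesis by (auto intro!: mult_le_one simp: cut_bounds)
      next
        case False
        then have "\<bar>fst y\<bar> > R + 1 \<or> \<bar>snd y\<bar> > R + 1" by (cases y) (auto simp: cbox_Pair_eq)
        then have "cut d (fst (X n) - fst y) = 0 \<or> cut e (snd (X n) - snd y) = 0"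
          using R1[of n] by (auto simp: cut_def indicator_def)
        then show ?thesis by auto
      qed
      then show "norm ((cut d (fst (X n) - fst y) * cut e (snd (X n) - snd y)) * g y) \<le> \<bar>indicator ?Q y * g y\<bar>"
        by (auto simp: abs_mult cut_bounds intro!: mult_right_mono)
    qed
  qed measurable
qed

text \<open>Far from the origin the average sees only the tail of \<open>g\<close>, whose L2 norm
  tends to 0.\<close>

lemma sqconv_vanish:
  assumes "L2 g" shows "(sqconv d e g \<longlongrightarrow> 0) at_infinity"
proof -
  note [measurable] = L2_measurable[OF assms]
  let ?t = "\<lambda>n y. indicator {y. norm y \<ge> real n} y * g y"
  have Lt: "L2 (?t n)" for n
    using Bochner_Integration.integrable_bound[OF L2_square[OF assms], of "\<lambda>y. (?t n y)\<^sup>2"]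
    by (auto simp: L2_def indicator_def)
  have "(\<lambda>n. \<integral>y. (?t n y)\<^sup>2 \<partial>lborel) \<longlonglongrightarrow> (\<integral>y. 0 \<partial>(lborel :: pt measure))"
  proof (rule integral_dominated_convergence[where w="\<lambda>y. (g y)\<^sup>2"])
    show "AE y in lborel. (\<lambda>n. (?t n y)\<^sup>2) \<longlonglongrightarrow> 0"
    proof (intro AE_I2 tendsto_eventually)
      fix y :: pt
      obtain N :: nat where "norm y < real N" using reals_Archimedean2 by blast
      then show "eventually (\<lambda>n. (?t n y)\<^sup>2 = 0) sequentially"
        unfolding eventually_sequentially by (intro exI[of _ N]) (auto simp: indicator_def)
    qed
  qed (use L2_square[OF assms] in \<open>auto simp: indicator_def\<close>)
  then have lim: "(\<lambda>n. l2norm (?t n)) \<longlonglongrightarrow> 0"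
    unfolding l2norm_def using tendsto_real_sqrt by fastforce
  show ?thesis
    unfolding tendsto_iff eventually_at_infinity
  proof (intro allI impI)
    fix r :: real assume "r > 0"
    then obtain n where n: "l2norm (?t n) < r"
      using lim l2norm_nonneg unfolding tendsto_iff eventually_sequentially by (fastforce simp: dist_real_def)
    show "\<exists>b. \<forall>x. norm x \<ge> b \<longrightarrow> dist (sqconv d e g x) 0 < r"
    \<comment> \<open>The 2 is a crude bound for the norm of a point of the unit square.\<close>
    proof (intro exI[of _ "real n + 2"] allI impI)
      fix x :: pt assume x: "norm x \<ge> real n + 2"
      have "sqconv d e g x = sqconv d e (?t n) x"
        unfolding sqconv_def
      proof (intro Bochner_Integration.integral_cong refl)
        fix z :: pt
        show "cut d (fst z) * cut e (snd z) * g (x - z) = cut d (fst z) * cut e (snd z) * ?t n (x - z)"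
        proof (cases "fst z \<in> {0..1} \<and> snd z \<in> {0..1}")
          case True
          then have "norm z \<le> 2" using norm_Pair_le[of "fst z" "snd z"] by auto
          then have "norm (x - z) \<ge> real n" using x norm_triangle_ineq2[of x z] by linarith
          then show ?thesis by simp
        qed (auto simp: cut_def)
      qed
      then show "dist (sqconv d e g x) 0 < r" using sqconv_bound[OF Lt, of d e n x] n by simp
    qed
  qed
qed

definition srep :: "(pt \<Rightarrow> real) \<Rightarrow> (pt \<Rightarrow> real) \<Rightarrow> (pt \<Rightarrow> real) \<Rightarrow> (pt \<Rightarrow> real) \<Rightarrow> pt \<Rightarrow> real" where
  "srep g00 g10 g01 g11 x = sqconv True True g11 x + sqconv True False g10 x + sqconv False True g01 x + sqconv False False g00 x"

lemma sqconv_dual: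
  assumes "L2 g" "bump \<phi>" "bump \<psi>"
  shows "(\<integral>x. sqconv d e g x * (\<phi> (fst x) * \<psi> (snd x)) \<partial>lborel) =
   (\<integral>x. g x * (avg (if d then (\<lambda>z. 1 - z) else (\<lambda>_. 1)) 1 1 \<phi> (fst x) * avg (if e then (\<lambda>z. 1 - z) else (\<lambda>_. 1)) 1 1 \<psi> (snd x)) \<partial>lborel)"
proof -
  have "(\<integral>z. (cut d (fst z) * cut e (snd z)) * (\<phi> (fst (x + z)) * \<psi> (snd (x + z))) \<partial>lborel) =
     avg (if d then (\<lambda>z. 1 - z) else (\<lambda>_. 1)) 1 1 \<phi> (fst x) * avg (if e then (\<lambda>z. 1 - z) else (\<lambda>_. 1)) 1 1 \<psi> (snd x)" for x :: pt
  proof -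
    have "(\<integral>z. (cut d (fst z) * cut e (snd z)) * (\<phi> (fst (x + z)) * \<psi> (snd (x + z))) \<partial>lborel) =
      (\<integral>z. (cut d (fst z) * \<phi> (fst x + fst z)) * (cut e (snd z) * \<psi> (snd x + snd z)) \<partial>lborel)"
      by (simp add: mult_ac)
    also have "\<dots> = (\<integral>z. cut d z * \<phi> (fst x + z) \<partial>lborel) * (\<integral>z. cut e z * \<psi> (snd x + z) \<partial>lborel)"
      by (rule tensor_integral(2)[OF cut_integral(1) cut_integral(1)]) (intro bump_continuous assms)+
    finally show ?thesis using assms by (simp add: cut_integral(2) bump_continuous)
  qed
  then show ?thesis
    using conv_dual[OF cut_tensor_integrable[of d e] _ assms(1) tensor_L2[OF assms(2,3)], of "\<lambda>z. z"]
    unfolding sqconv_def by simp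
qed

lemma bump_integrable:
  assumes "bump \<phi>" shows "integrable lborel \<phi>"
proof -
  obtain R where R: "\<And>x. \<bar>x\<bar> > R \<Longrightarrow> \<phi> x = 0" using assms by (auto simp: bump_def)
  have "set_integrable lborel {-R..R} \<phi>"
    by (intro borel_integrable_atLeastAtMost' bump_continuous assms)
  moreover have "indicator {-R..R} x *\<^sub>R \<phi> x = \<phi> x" for x
    using R[of x] by (cases "\<bar>x\<bar> > R") (auto simp: indicator_def abs_le_iff)
  ultimately have "(\<lambda>x. indicator {-R..R} x *\<^sub>R \<phi> x) = \<phi>" by auto
  with \<open>set_integrable lborel {-R..R} \<phi>\<close> show ?thesis by (simp only: set_integrable_def)
qed

text \<open>Tested against phi(x1) psi(x2), each average moves onto the test functions and each weak
  derivative onto the averaged ones. The four terms factor into (B phi - (A phi)') * (B psi - (A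
  psi)'), where A and B average with weights 1 - z and 1, and by \<open>avg_reproducing\<close> this
  is the original product.\<close>

lemma srep_AE:
  assumes L: "L2 g00" "L2 g10" "L2 g01" "L2 g11"
    and w: "pweak 1 0 g00 g10" "pweak 0 1 g00 g01" "pweak 1 1 g00 g11"
  shows "AE x in lborel. g00 x = srep g00 g10 g01 g11 x"
proof -
  have m [measurable]: "sqconv d e g \<in> borel_measurable borel" if "L2 g" for d e g
    by (intro borel_measurable_continuous_onI sqconv_continuous that)
  have li: "locint (sqconv d e g)" if "L2 g" for d e g
    by (rule bounded_locint[OF m[OF that] sqconv_bound[OF that]])
  have "locint (\<lambda>x. g00 x - srep g00 g10 g01 g11 x)"
  proof -
    have "locint (srep g00 g10 g01 g11)"
    proof (rule bounded_locint)
      show "srep g00 g10 g01 g11 \<in> borel_measurable borel"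
        unfolding srep_def[abs_def] using L by measurable
      show "\<bar>srep g00 g10 g01 g11 x\<bar> \<le> l2norm g11 + l2norm g10 + l2norm g01 + l2norm g00" for x
        unfolding srep_def
        using sqconv_bound[OF L(4), of True True x] sqconv_bound[OF L(2), of True False x]
          sqconv_bound[OF L(3), of False True x] sqconv_bound[OF L(1), of False False x] by linarith
    qed
    then show ?thesis by (intro locint_diff[OF L2_locint[OF L(1)]])
  qed
  moreover have "(\<integral>x. (g00 x - srep g00 g10 g01 g11 x) * (\<phi> (fst x) * \<psi> (snd x)) \<partial>lborel) = 0"
    if b: "bump \<phi>" "bump \<psi>" for \<phi> \<psi>
  proof -
    let ?h = "\<lambda>x. \<phi> (fst x) * \<psi> (snd x)"
    have hint: "integrable lborel (\<lambda>x. sqconv d e g x * ?h x)" if "L2 g" for d e g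
    proof (rule Bochner_Integration.integrable_bound)
      show "integrable lborel (\<lambda>x. l2norm g * ?h x)" by (intro integrable_mult_right tensor_integral(1) bump_integrable b)
      show "(\<lambda>x. sqconv d e g x * ?h x) \<in> borel_measurable lborel"
        using m[OF that] L2_measurable[OF tensor_L2[OF b]] by simp
      show "AE x in lborel. norm (sqconv d e g x * ?h x) \<le> norm (l2norm g * ?h x)"
        using sqconv_bound[OF that] by (auto simp: abs_mult l2norm_nonneg intro!: mult_right_mono)
    qed
    define A where "A = avg (\<lambda>z. 1 - z) 1 1"
    define B where "B = avg (\<lambda>_. 1) 1 1"
    have bA: "bump (A \<phi>)" "bump (B \<phi>)" "bump (A \<psi>)" "bump (B \<psi>)"
      unfolding A_def B_def by (intro avg_bump b continuous_intros)+
    note dual = sqconv_dual[OF L(4) b, of True True] sqconv_dual[OF L(2) b, of True False]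
       sqconv_dual[OF L(3) b, of False True] sqconv_dual[OF L(1) b, of False False]
    have "(\<integral>x. srep g00 g10 g01 g11 x * ?h x \<partial>lborel) =
       (\<integral>x. sqconv True True g11 x * ?h x \<partial>lborel) + (\<integral>x. sqconv True False g10 x * ?h x \<partial>lborel)
       + (\<integral>x. sqconv False True g01 x * ?h x \<partial>lborel) + (\<integral>x. sqconv False False g00 x * ?h x \<partial>lborel)"
      unfolding srep_def using hint L by (simp add: distrib_right)
    also have "\<dots> = (\<integral>x. g11 x * (A \<phi> (fst x) * A \<psi> (snd x)) \<partial>lborel) + (\<integral>x. g10 x * (A \<phi> (fst x) * B \<psi> (snd x)) \<partial>lborel)
      + (\<integral>x. g01 x * (B \<phi> (fst x) * A \<psi> (snd x)) \<partial>lborel) + (\<integral>x. g00 x * (B \<phi> (fst x) * B \<psi> (snd x)) \<partial>lborel)"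
      using dual by (simp add: A_def B_def)
    also have "\<dots> = (\<integral>x. g00 x * (deriv (A \<phi>) (fst x) * deriv (A \<psi>) (snd x)) \<partial>lborel) - (\<integral>x. g00 x * (deriv (A \<phi>) (fst x) * B \<psi> (snd x)) \<partial>lborel)
      - (\<integral>x. g00 x * (B \<phi> (fst x) * deriv (A \<psi>) (snd x)) \<partial>lborel) + (\<integral>x. g00 x * (B \<phi> (fst x) * B \<psi> (snd x)) \<partial>lborel)"
      using pweakD[OF w(3) bA(1) bA(3)] pweakD[OF w(1) bA(1) bA(4)] pweakD[OF w(2) bA(2) bA(3)] by simp
    also have "\<dots> = (\<integral>x. g00 x * (deriv (A \<phi>) (fst x) * deriv (A \<psi>) (snd x)) - g00 x * (deriv (A \<phi>) (fst x) * B \<psi> (snd x))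
      - g00 x * (B \<phi> (fst x) * deriv (A \<psi>) (snd x)) + g00 x * (B \<phi> (fst x) * B \<psi> (snd x)) \<partial>lborel)"
      using L2_mult[OF L(1) tensor_L2[OF bump_deriv[OF bA(1)] bump_deriv[OF bA(3)]]]
        L2_mult[OF L(1) tensor_L2[OF bump_deriv[OF bA(1)] bA(4)]]
        L2_mult[OF L(1) tensor_L2[OF bA(2) bump_deriv[OF bA(3)]]]
        L2_mult[OF L(1) tensor_L2[OF bA(2) bA(4)]] by simp
    also have "\<dots> = (\<integral>x. g00 x * ((B \<phi> (fst x) - deriv (A \<phi>) (fst x)) * (B \<psi> (snd x) - deriv (A \<psi>) (snd x))) \<partial>lborel)"
      by (intro Bochner_Integration.integral_cong) (auto simp: algebra_simps)
    also have "\<dots> = (\<integral>x. g00 x * ?h x \<partial>lborel)"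
      using avg_reproducing[OF b(1)] avg_reproducing[OF b(2)] by (simp add: A_def B_def)
    finally have eq: "(\<integral>x. srep g00 g10 g01 g11 x * ?h x \<partial>lborel) = (\<integral>x. g00 x * ?h x \<partial>lborel)" .
    have "integrable lborel (\<lambda>x. srep g00 g10 g01 g11 x * ?h x)"
      unfolding srep_def distrib_right using hint L by simp
    then show ?thesis using eq L2_mult[OF L(1) tensor_L2[OF b]] by (simp add: left_diff_distrib)
  qed
  ultimately have "AE x in lborel. g00 x - srep g00 g10 g01 g11 x = 0"
    by (intro locint_tensor_zero_AE)
  then show ?thesis by simp
qed

lemma srep_continuous:
  assumes "L2 g00" "L2 g10" "L2 g01" "L2 g11"
  shows "continuous_on A (srep g00 g10 g01 g11)"
proof -
  have "continuous_on UNIV (srep g00 g10 g01 g11)"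
    unfolding srep_def[abs_def] using assms by (intro continuous_intros sqconv_continuous)
  then show ?thesis by (rule continuous_on_subset) simp
qed

lemma srep_bound:
  assumes "L2 g00" "L2 g10" "L2 g01" "L2 g11"
  shows "\<bar>srep g00 g10 g01 g11 x\<bar> \<le> l2norm g11 + l2norm g10 + l2norm g01 + l2norm g00"
  unfolding srep_def
  using sqconv_bound[OF assms(4), of True True x] sqconv_bound[OF assms(2), of True False x]
    sqconv_bound[OF assms(3), of False True x] sqconv_bound[OF assms(1), of False False x] by linarith

lemma srep_vanish:
  assumes "L2 g00" "L2 g10" "L2 g01" "L2 g11"
  shows "(srep g00 g10 g01 g11 \<longlongrightarrow> 0) at_infinity"
proof -
  have "((\<lambda>x. sqconv True True g11 x + sqconv True False g10 x + sqconv False True g01 x + sqconv False False g00 x)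
     \<longlongrightarrow> 0 + 0 + 0 + 0) at_infinity"
    by (intro tendsto_add sqconv_vanish assms)
  then show ?thesis by (simp add: srep_def[abs_def])
qed

text \<open>The averaged test function \<open>\<integral>\<^sub>0\<^sup>h \<phi> (\<cdot> - s e)\<close> has derivative \<open>\<phi> - \<phi> (\<cdot> - h e)\<close> in direction \<open>e\<close>,
  so pairing with it turns the weak derivative into the increment.\<close>

lemma weak_increment:
  fixes f g :: "pt \<Rightarrow> real" and e :: pt
  assumes L: "L2 f" "L2 g" and c: "continuous_on UNIV f" "continuous_on UNIV g"
    and B: "\<And>x. \<bar>f x\<bar> \<le> B" "\<And>x. \<bar>g x\<bar> \<le> B" and h: "0 \<le> h"
    and w: "\<And>\<phi> \<psi>. bump \<phi> \<Longrightarrow> bump \<psi> \<Longrightarrow>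
      (\<integral>x. f x * (\<phi> (fst (x - h *\<^sub>R e)) * \<psi> (snd (x - h *\<^sub>R e)) - \<phi> (fst x) * \<psi> (snd x)) \<partial>lborel) =
      (\<integral>x. g x * integral {0..h} (\<lambda>s. \<phi> (fst (x - s *\<^sub>R e)) * \<psi> (snd (x - s *\<^sub>R e))) \<partial>lborel)"
  shows "f (x + h *\<^sub>R e) - f x = integral {0..h} (\<lambda>s. g (x + s *\<^sub>R e))"
proof -
  note [measurable] = L2_measurable[OF L(1)] L2_measurable[OF L(2)]
  define I where "I x = integral {0..h} (\<lambda>s. g (x + s *\<^sub>R e))" for x
  have line: "(\<integral>s. indicator {0..h} s * u (x + s *\<^sub>R d) \<partial>lborel) = integral {0..h} (\<lambda>s. u (x + s *\<^sub>R d))"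
    if "continuous_on UNIV u" for x d :: pt and u :: "pt \<Rightarrow> real"
  proof -
    from that have "continuous_on {0..h} (\<lambda>s. u (x + s *\<^sub>R d))"
      by (rule continuous_on_compose2) (auto intro!: continuous_intros)
    from set_borel_integral_eq_integral(2)[OF borel_integrable_atLeastAtMost'[OF this]]
    show ?thesis by (simp add: set_lebesgue_integral_def)
  qed
  have Ic: "continuous_on UNIV I"
    unfolding I_def[abs_def] interval_cbox
    by (intro integral_continuous_on_param) (auto simp: case_prod_unfold intro!: continuous_intros continuous_on_compose2[OF c(2)])
  have IB: "\<bar>I x\<bar> \<le> B * h" for x
  proof -
    have "norm (integral {0..h} (\<lambda>s. g (x + s *\<^sub>R e))) \<le> B * (h - 0)"
      by (rule integral_bound[OF h])
        (use B(2) in \<open>auto intro!: continuous_intros continuous_on_compose2[OF c(2)]\<close>)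
    then show ?thesis by (simp add: I_def)
  qed
  define W where "W x = f (x + h *\<^sub>R e) - f x - I x" for x
  have Wc: "continuous_on UNIV W"
    unfolding W_def by (intro continuous_intros Ic c(1) continuous_on_compose2[OF c(1)]) auto
  have "AE x in lborel. W x = 0"
  proof (rule locint_tensor_zero_AE)
    show "locint W"
    proof (rule bounded_locint)
      show "\<bar>W x\<bar> \<le> 2 * B + B * h" for x unfolding W_def using B(1)[of "x + h *\<^sub>R e"] B(1)[of x] IB[of x] by linarith
    qed (intro borel_measurable_continuous_onI Wc)
    fix \<phi> \<psi> :: "real \<Rightarrow> real" assume b: "bump \<phi>" "bump \<psi>"
    let ?h = "\<lambda>x. \<phi> (fst x) * \<psi> (snd x)"
    note Lh = tensor_L2[OF b]
    have hc: "continuous_on UNIV ?h"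
      by (intro continuous_intros continuous_on_compose2[OF bump_continuous[OF b(1)]] continuous_on_compose2[OF bump_continuous[OF b(2)]]) auto
    have Lf: "L2 (\<lambda>x. f (x + h *\<^sub>R e))" "L2 (\<lambda>x. ?h (x - h *\<^sub>R e))"
      using L2_shift[OF L(1)] L2_shift[OF Lh, of "- (h *\<^sub>R e)"] by auto
    have K: "integrable lborel (\<lambda>s. indicator {0..h} s :: real)"
      using h by (intro integrable_real_indicator) simp_all
    have dual: "(\<integral>x. I x * ?h x \<partial>lborel) = (\<integral>x. g x * integral {0..h} (\<lambda>s. ?h (x - s *\<^sub>R e)) \<partial>lborel)"
      using conv_dual[OF K _ L(2) Lh, of "\<lambda>s. - (s *\<^sub>R e)"] line[OF c(2), of _ e] line[OF hc, of _ "- e"]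
      by (simp add: I_def)
    have "(\<integral>x. f (x + h *\<^sub>R e) * ?h x \<partial>lborel) = (\<integral>x. f x * ?h (x - h *\<^sub>R e) \<partial>lborel)"
      using lborel_integral_shift[of "\<lambda>x. f x * ?h (x - h *\<^sub>R e)" "h *\<^sub>R e"] by simp
    then have e1: "(\<integral>x. (f (x + h *\<^sub>R e) - f x) * ?h x \<partial>lborel) = (\<integral>x. f x * (?h (x - h *\<^sub>R e) - ?h x) \<partial>lborel)"
      using L2_mult[OF Lf(1) Lh] L2_mult[OF L(1) Lh] L2_mult[OF L(1) Lf(2)]
      by (simp add: left_diff_distrib right_diff_distrib)
    have Ih: "integrable lborel (\<lambda>x. I x * ?h x)"
    proof (rule Bochner_Integration.integrable_bound)
      show "integrable lborel (\<lambda>x. (B * h) * ?h x)"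
        by (intro integrable_mult_right tensor_integral(1) bump_integrable b)
      show "(\<lambda>x. I x * ?h x) \<in> borel_measurable lborel"
        using borel_measurable_continuous_onI[OF Ic] L2_measurable[OF Lh] by simp
      have "0 \<le> B * h" using B(1)[of 0] h by simp
      then show "AE x in lborel. norm (I x * ?h x) \<le> norm (B * h * ?h x)"
        using IB unfolding real_norm_def abs_mult[of "B * h"] abs_mult[of "I _"]
        by (intro AE_I2 mult_right_mono) auto
    qed
    have "(\<integral>x. W x * ?h x \<partial>lborel) = (\<integral>x. (f (x + h *\<^sub>R e) - f x) * ?h x - I x * ?h x \<partial>lborel)"
      unfolding W_def by (simp add: left_diff_distrib)
    also have "\<dots> = (\<integral>x. (f (x + h *\<^sub>R e) - f x) * ?h x \<partial>lborel) - (\<integral>x. I x * ?h x \<partial>lborel)"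
      by (intro Bochner_Integration.integral_diff Ih L2_mult[OF _ Lh] L2_diff Lf L)
    also have "\<dots> = 0" using w[OF b] by (simp add: e1 dual)
    finally show "(\<integral>x. W x * ?h x \<partial>lborel) = 0" .
  qed
  from continuous_AE_zero[OF Wc this, of x] show ?thesis by (simp add: W_def I_def)
qed

lemma weak_increment_fst:
  assumes "L2 f" "L2 g" "continuous_on UNIV f" "continuous_on UNIV g"
    "\<And>x. \<bar>f x\<bar> \<le> B" "\<And>x. \<bar>g x\<bar> \<le> B" "0 \<le> h" and w: "pweak 1 0 f g"
  shows "f (x + (h, 0)) - f x = integral {0..h} (\<lambda>s. g (x + (s, 0)))"
proof -
  have "f (x + h *\<^sub>R (1, 0)) - f x = integral {0..h} (\<lambda>s. g (x + s *\<^sub>R (1, 0)))"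
  proof (rule weak_increment[OF assms(1-7)])
    fix \<phi> \<psi> :: "real \<Rightarrow> real" assume b: "bump \<phi>" "bump \<psi>"
    have b': "bump (avg (\<lambda>_. 1) h (-1) \<phi>)" by (intro avg_bump b continuous_intros)
    show "(\<integral>x. f x * (\<phi> (fst (x - h *\<^sub>R (1, 0))) * \<psi> (snd (x - h *\<^sub>R (1, 0))) - \<phi> (fst x) * \<psi> (snd x)) \<partial>lborel) =
      (\<integral>x. g x * integral {0..h} (\<lambda>s. \<phi> (fst (x - s *\<^sub>R (1, 0))) * \<psi> (snd (x - s *\<^sub>R (1, 0)))) \<partial>lborel)"
    proof -
      have "(\<integral>x. f x * (\<phi> (fst (x - h *\<^sub>R (1, 0))) * \<psi> (snd (x - h *\<^sub>R (1, 0))) - \<phi> (fst x) * \<psi> (snd x)) \<partial>lborel)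
        = (\<integral>x. - (f x * (deriv (avg (\<lambda>_. 1) h (-1) \<phi>) (fst x) * \<psi> (snd x))) \<partial>lborel)"
        by (simp add: avg_deriv_backward[OF b(1) assms(7)] algebra_simps)
      then show ?thesis using pweakD[OF w b' b(2)] by (simp add: avg_def)
    qed
  qed
  then show ?thesis by simp
qed

lemma weak_increment_snd:
  assumes "L2 f" "L2 g" "continuous_on UNIV f" "continuous_on UNIV g"
    "\<And>x. \<bar>f x\<bar> \<le> B" "\<And>x. \<bar>g x\<bar> \<le> B" "0 \<le> h" and w: "pweak 0 1 f g"
  shows "f (x + (0, h)) - f x = integral {0..h} (\<lambda>s. g (x + (0, s)))"
proof -
  have "f (x + h *\<^sub>R (0, 1)) - f x = integral {0..h} (\<lambda>s. g (x + s *\<^sub>R (0, 1)))"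
  proof (rule weak_increment[OF assms(1-7)])
    fix \<phi> \<psi> :: "real \<Rightarrow> real" assume b: "bump \<phi>" "bump \<psi>"
    have b': "bump (avg (\<lambda>_. 1) h (-1) \<psi>)" by (intro avg_bump b continuous_intros)
    show "(\<integral>x. f x * (\<phi> (fst (x - h *\<^sub>R (0, 1))) * \<psi> (snd (x - h *\<^sub>R (0, 1))) - \<phi> (fst x) * \<psi> (snd x)) \<partial>lborel) =
      (\<integral>x. g x * integral {0..h} (\<lambda>s. \<phi> (fst (x - s *\<^sub>R (0, 1))) * \<psi> (snd (x - s *\<^sub>R (0, 1)))) \<partial>lborel)"
    proof -
      have "(\<integral>x. f x * (\<phi> (fst (x - h *\<^sub>R (0, 1))) * \<psi> (snd (x - h *\<^sub>R (0, 1))) - \<phi> (fst x) * \<psi> (snd x)) \<partial>lborel)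
        = (\<integral>x. - (f x * (\<phi> (fst x) * deriv (avg (\<lambda>_. 1) h (-1) \<psi>) (snd x))) \<partial>lborel)"
        by (simp add: avg_deriv_backward[OF b(2) assms(7)] algebra_simps)
      then show ?thesis using pweakD[OF w b(1) b'] by (simp add: avg_def)
    qed
  qed
  then show ?thesis by simp
qed

lemma increment_DERIV:
  fixes u v :: "real \<Rightarrow> real"
  assumes "continuous_on UNIV v" "\<And>x h. 0 \<le> h \<Longrightarrow> u (x + h) - u x = integral {0..h} (\<lambda>s. v (x + s))"
  shows "(u has_real_derivative v x) (at x)"
proof -
  \<comment> \<open>Increments are known only for h >= 0. Starting the integral at x - 1 makes 1,
    the parameter of x, an interior point, so a two-sided derivative results.\<close>
  have "((\<lambda>y. integral {0..y} (\<lambda>s. v (x - 1 + s))) has_real_derivative v (x - 1 + 1)) (at 1 within {0..2})"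
    by (intro integral_has_real_derivative continuous_intros continuous_on_compose2[OF assms(1)]) auto
  then have "((\<lambda>y. integral {0..y} (\<lambda>s. v (x - 1 + s))) has_real_derivative v x) (at 1)"
    by (simp add: at_within_interior[of 1 "{0..2}"])
  moreover have "eventually (\<lambda>y. integral {0..y} (\<lambda>s. v (x - 1 + s)) = u (x - 1 + y) - u (x - 1)) (nhds 1)"
    by (intro eventually_mono[OF eventually_nhds_in_open[of "{0<..}" 1]]) (auto simp: assms(2))
  ultimately have "((\<lambda>y. u (x - 1 + y) - u (x - 1)) has_real_derivative v x) (at 1)"
    by (subst (asm) DERIV_cong_ev[OF refl _ refl])
  then have "((\<lambda>y. (u (x - 1 + y) - u (x - 1)) + u (x - 1)) has_real_derivative v x + 0) (at 1)"
    by (intro DERIV_add DERIV_const)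
  then have "((\<lambda>y. u (y + (x - 1))) has_real_derivative v x) (at 1)" by (simp add: add.commute)
  then show ?thesis using DERIV_shift[of u "v x" 1 "x - 1"] by simp
qed

lemma weak_gradient_has_derivative:
  assumes L: "L2 f" "L2 g1" "L2 g2" and c: "continuous_on UNIV f" "continuous_on UNIV g1" "continuous_on UNIV g2"
    and B: "\<And>x. \<bar>f x\<bar> \<le> B" "\<And>x. \<bar>g1 x\<bar> \<le> B" "\<And>x. \<bar>g2 x\<bar> \<le> B" and w: "pweak 1 0 f g1" "pweak 0 1 f g2"
  shows "(f has_derivative (\<lambda>h. (g1 x, g2 x) \<bullet> h)) (at x)"
proof -
  obtain a b where x: "x = (a, b)" by fastforce
  have d1: "((\<lambda>s. f (s, t)) has_real_derivative g1 (s, t)) (at s)" for s t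
  proof (rule increment_DERIV[where v="\<lambda>s. g1 (s, t)"])
    show "continuous_on UNIV (\<lambda>s. g1 (s, t))" by (intro continuous_on_compose2[OF c(2)] continuous_intros) auto
    show "0 \<le> h \<Longrightarrow> f (y + h, t) - f (y, t) = integral {0..h} (\<lambda>s. g1 (y + s, t))" for y h
      using weak_increment_fst[OF L(1,2) c(1,2) B(1,2) _ w(1), of h "(y, t)"] by simp
  qed
  have d2: "((\<lambda>t. f (s, t)) has_real_derivative g2 (s, t)) (at t)" for s t
  proof (rule increment_DERIV[where v="\<lambda>t. g2 (s, t)"])
    show "continuous_on UNIV (\<lambda>t. g2 (s, t))" by (intro continuous_on_compose2[OF c(3)] continuous_intros) auto
    show "0 \<le> h \<Longrightarrow> f (s, y + h) - f (s, y) = integral {0..h} (\<lambda>r. g2 (s, y + r))" for y h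
      using weak_increment_snd[OF L(1,3) c(1,3) B(1,3) _ w(2), of h "(s, y)"] by simp
  qed
  have "((\<lambda>(s, t). f (s, t)) has_derivative (\<lambda>(ts, tt). g1 (a, b) * ts + blinfun_mult_right (g2 (a, b)) tt)) (at (a, b) within UNIV \<times> UNIV)"
  \<comment> \<open>Total differentiability follows from both partial derivatives together with
    continuity of the second one in the plane.\<close>
  proof (rule has_derivative_partialsI[where fy="\<lambda>s t. blinfun_mult_right (g2 (s, t))"])
    show "((\<lambda>s. f (s, b)) has_derivative (*) (g1 (a, b))) (at a within UNIV)"
      using d1[of b a] by (simp add: has_field_derivative_def)
    show "((\<lambda>t. f (s, t)) has_derivative blinfun_apply (blinfun_mult_right (g2 (s, t)))) (at t within UNIV)" for s t
      using d2[of s t] by (simp add: has_field_derivative_def)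
    have "continuous_on UNIV (\<lambda>x. blinfun_mult_right (g2 x))"
      by (intro bounded_linear.continuous_on[OF bounded_linear_blinfun_mult_right] c)
    then have "isCont (\<lambda>x. blinfun_mult_right (g2 x)) (a, b)"
      unfolding continuous_on_eq_continuous_at[OF open_UNIV] by blast
    moreover have "(\<lambda>(s, t). blinfun_mult_right (g2 (s, t))) = (\<lambda>x. blinfun_mult_right (g2 x))" by auto
    ultimately show "continuous (at (a, b) within UNIV \<times> UNIV) (\<lambda>(s, t). blinfun_mult_right (g2 (s, t)))"
      by simp
  qed auto
  then show ?thesis by (simp add: x inner_prod_def case_prod_unfold)
qed

text \<open>\<open>srep\<close> spends one further derivative in each coordinate. With four weak
  derivatives in L2 it is therefore available up to order two, which is what a bounded Lipschitz
  gradient requires.\<close>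

definition crep :: "nat \<Rightarrow> nat \<Rightarrow> (pt \<Rightarrow> real) \<Rightarrow> pt \<Rightarrow> real" where
  "crep a b f = srep (wd a b f) (wd (a + 1) b f) (wd a (b + 1) f) (wd (a + 1) (b + 1) f)"

context
  fixes f :: "pt \<Rightarrow> real" and a b :: nat
  assumes f: "sobolev 4 f" and ab: "a + b \<le> 2"
begin

lemma crep_L2_wd:
  "L2 (wd a b f)" "L2 (wd (a + 1) b f)" "L2 (wd a (b + 1) f)" "L2 (wd (a + 1) (b + 1) f)"
  using ab by (intro sobolev_wd[OF f]; simp)+

lemma crep_AE: "AE x in lborel. wd a b f x = crep a b f x"
  unfolding crep_def
proof (rule srep_AE[OF crep_L2_wd])
  show "pweak 1 0 (wd a b f) (wd (a + 1) b f)" using pweak_wd_succ[OF f, of a b 1 0] ab by simp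
  show "pweak 0 1 (wd a b f) (wd a (b + 1) f)" using pweak_wd_succ[OF f, of a b 0 1] ab by simp
  show "pweak 1 1 (wd a b f) (wd (a + 1) (b + 1) f)" using pweak_wd_succ[OF f, of a b 1 1] ab by simp
qed

lemma crep_continuous: "continuous_on A (crep a b f)"
  unfolding crep_def by (rule srep_continuous[OF crep_L2_wd])

lemma crep_measurable: "crep a b f \<in> borel_measurable borel"
  by (intro borel_measurable_continuous_onI crep_continuous)

lemma crep_bound: "\<bar>crep a b f x\<bar> \<le> 4 * hk_norm 4 f"
  using srep_bound[OF crep_L2_wd, of x] l2norm_wd_le_hk[of a b 4 f] l2norm_wd_le_hk[of "a + 1" b 4 f]
    l2norm_wd_le_hk[of a "b + 1" 4 f] l2norm_wd_le_hk[of "a + 1" "b + 1" 4 f] ab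
  by (simp add: crep_def)

lemma crep_vanish: "(crep a b f \<longlongrightarrow> 0) at_infinity"
  unfolding crep_def by (rule srep_vanish[OF crep_L2_wd])

lemma crep_L2: "L2 (crep a b f)"
  by (rule L2_AE_cong[OF crep_L2_wd(1) crep_measurable crep_AE])

end

lemma crep_AE_self:
  assumes "sobolev 4 f" shows "AE x in lborel. f x = crep 0 0 f x"
  using wd_0[OF assms] crep_AE[OF assms, of 0 0] by auto

lemma crep_l2norm_le:
  assumes "sobolev 4 f" shows "l2norm (crep 0 0 f) \<le> hk_norm 4 f"
proof -
  have "l2norm (crep 0 0 f) = l2norm (wd 0 0 f)"
    using crep_AE[OF assms, of 0 0]
    by (intro l2norm_AE_cong crep_measurable assms L2_measurable crep_L2_wd) auto
  then show ?thesis using l2norm_wd_le_hk[of 0 0 4 f] by simp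
qed

text \<open>Transfers the weak-derivative relation from the chosen functions \<open>wd\<close> to
  their continuous representatives, to which the increment formula applies.\<close>

lemma pweak_AE_cong:
  assumes "pweak a b f g" "AE x in lborel. f x = f' x" "AE x in lborel. g x = g' x"
    and L: "L2 f" "L2 f'" "L2 g" "L2 g'"
  shows "pweak a b f' g'"
  unfolding pweak_def
proof (intro allI impI)
  fix \<phi> \<psi> :: "real \<Rightarrow> real" assume b: "bump \<phi>" "bump \<psi>"
  have m: "(\<lambda>x::pt. \<phi> (fst x) * \<psi> (snd x)) \<in> borel_measurable borel" if "bump \<phi>" "bump \<psi>" for \<phi> \<psi>
    using L2_measurable[OF tensor_L2[OF that]] .
  note [measurable] = L[THEN L2_measurable] m[OF b] m[OF bump_funpow_deriv[OF b(1)] bump_funpow_deriv[OF b(2)]]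
  have "(\<integral>x. f' x * ((deriv ^^ a) \<phi> (fst x) * (deriv ^^ b) \<psi> (snd x)) \<partial>lborel) = (\<integral>x. f x * ((deriv ^^ a) \<phi> (fst x) * (deriv ^^ b) \<psi> (snd x)) \<partial>lborel)"
    using assms(2) by (intro integral_cong_AE) auto
  moreover have "(\<integral>x. g' x * (\<phi> (fst x) * \<psi> (snd x)) \<partial>lborel) = (\<integral>x. g x * (\<phi> (fst x) * \<psi> (snd x)) \<partial>lborel)"
    using assms(3) by (intro integral_cong_AE) auto
  ultimately show "(\<integral>x. f' x * ((deriv ^^ a) \<phi> (fst x) * (deriv ^^ b) \<psi> (snd x)) \<partial>lborel) =
     (-1) ^ (a + b) * (\<integral>x. g' x * (\<phi> (fst x) * \<psi> (snd x)) \<partial>lborel)"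
    using pweakD[OF assms(1) b] by simp
qed

lemma crep_has_derivative:
  assumes f: "sobolev 4 f" and ab: "a + b \<le> 1"
  shows "(crep a b f has_derivative (\<lambda>h. (crep (a + 1) b f x, crep a (b + 1) f x) \<bullet> h)) (at x)"
proof (rule weak_gradient_has_derivative[where B="4 * hk_norm 4 f"])
  have i: "a + b \<le> 2" "a + 1 + b \<le> 2" "a + (b + 1) \<le> 2" using ab by auto
  show "pweak 1 0 (crep a b f) (crep (a + 1) b f)"
    using pweak_wd_succ[OF f, of a b 1 0] ab
    by (intro pweak_AE_cong[OF _ crep_AE[OF f i(1)] crep_AE[OF f i(2)]] crep_L2 crep_L2_wd f) auto
  show "pweak 0 1 (crep a b f) (crep a (b + 1) f)"
    using pweak_wd_succ[OF f, of a b 0 1] ab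
    by (intro pweak_AE_cong[OF _ crep_AE[OF f i(1)] crep_AE[OF f i(3)]] crep_L2 crep_L2_wd f) auto
qed (use ab in \<open>auto intro!: crep_L2 crep_continuous crep_bound f\<close>)

lemma crep_lin:
  assumes f: "sobolev 4 f" and g: "sobolev 4 g" and ab: "a + b \<le> 2"
  shows "crep a b (\<lambda>x. c * f x + d * g x) x = c * crep a b f x + d * crep a b g x"
proof -
  note fg = sobolev_lin[OF f g, of c d]
  have "AE x in lborel. crep a b (\<lambda>x. c * f x + d * g x) x - (c * crep a b f x + d * crep a b g x) = 0"
    using crep_AE[OF f ab] crep_AE[OF g ab] crep_AE[OF fg ab] wd_lin[OF f g, of a b c d] ab by auto
  then have "crep a b (\<lambda>x. c * f x + d * g x) x - (c * crep a b f x + d * crep a b g x) = 0"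
    by (rule continuous_AE_zero[rotated]) (intro continuous_intros crep_continuous f g fg ab)
  then show ?thesis by simp
qed

text \<open>A single constant controls the function, its gradient and the Lipschitz constant of the
  gradient; \<open>1 \<le> B\<close> lets higher powers of B absorb lower ones. All later constants
  depend on the solution through B alone.\<close>

definition C11 :: "real \<Rightarrow> (pt \<Rightarrow> real) \<Rightarrow> (pt \<Rightarrow> pt) \<Rightarrow> bool" where
  "C11 B u Du \<longleftrightarrow> 1 \<le> B \<and> (\<forall>x. (u has_derivative (\<lambda>h. Du x \<bullet> h)) (at x)) \<and> (\<forall>x. \<bar>u x\<bar> \<le> B) \<and>
     (\<forall>x. norm (Du x) \<le> B) \<and> (\<forall>x y. norm (Du x - Du y) \<le> B * norm (x - y))"

definition cgrad :: "(pt \<Rightarrow> real) \<Rightarrow> pt \<Rightarrow> pt" where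
  "cgrad f x = (crep 1 0 f x, crep 0 1 f x)"

lemma gradient_Lipschitz:
  assumes "\<And>x. (v has_derivative (\<lambda>h. (g x) \<bullet> h)) (at x)" "\<And>x. norm (g x) \<le> C"
  shows "\<bar>v x - v y\<bar> \<le> C * norm (x - y :: 'a::euclidean_space)"
proof -
  have "norm (v x - v y) \<le> C * norm (x - y)"
  proof (rule differentiable_bound[of UNIV])
    fix z
    show "(v has_derivative (\<lambda>h. (g z) \<bullet> h)) (at z within UNIV)" using assms(1) by simp
    show "onorm (\<lambda>h. g z \<bullet> h) \<le> C"
    proof (rule onorm_le)
      fix h show "norm (g z \<bullet> h) \<le> C * norm h"
        using Cauchy_Schwarz_ineq2[of "g z" h] mult_right_mono[OF assms(2)[of z] norm_ge_zero[of h]] by simp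
    qed
  qed auto
  then show ?thesis by simp
qed

text \<open>Each second derivative is at most 4 times the H^4 norm, one for each average in
  \<open>srep\<close>. Two of them bound the gradient of a first derivative by 8 norms, and the two
  components of \<open>cgrad\<close> add up to 16.\<close>

lemma crep_C11:
  assumes f: "sobolev 4 f" and B: "1 \<le> B" "16 * hk_norm 4 f \<le> B"
  shows "C11 B (crep 0 0 f) (cgrad f)"
  unfolding C11_def
proof (intro conjI allI)
  have n0: "0 \<le> hk_norm 4 f" by (rule hk_norm_nonneg)
  show "(crep 0 0 f has_derivative (\<lambda>h. cgrad f x \<bullet> h)) (at x)" for x
    using crep_has_derivative[OF f, of 0 0 x] by (simp add: cgrad_def)
  show "\<bar>crep 0 0 f x\<bar> \<le> B" for x using crep_bound[OF f, of 0 0 x] B n0 by simp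
  show "norm (cgrad f x) \<le> B" for x
    unfolding cgrad_def using norm_Pair_le[of "crep 1 0 f x" "crep 0 1 f x"]
      crep_bound[OF f, of 1 0 x] crep_bound[OF f, of 0 1 x] B n0 by simp
  fix x y
  have 1: "\<bar>crep a b f x - crep a b f y\<bar> \<le> (8 * hk_norm 4 f) * norm (x - y)" if "a + b = 1" for a b
  proof (rule gradient_Lipschitz[where g="\<lambda>x. (crep (a + 1) b f x, crep a (b + 1) f x)"])
    show "(crep a b f has_derivative (\<lambda>h. (crep (a + 1) b f x, crep a (b + 1) f x) \<bullet> h)) (at x)" for x
      using that by (intro crep_has_derivative f) simp
    show "norm (crep (a + 1) b f x, crep a (b + 1) f x) \<le> 8 * hk_norm 4 f" for x
      using norm_Pair_le[of "crep (a + 1) b f x" "crep a (b + 1) f x"]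
        crep_bound[OF f, of "a + 1" b x] crep_bound[OF f, of a "b + 1" x] that by simp
  qed
  have "norm (cgrad f x - cgrad f y) \<le> \<bar>crep 1 0 f x - crep 1 0 f y\<bar> + \<bar>crep 0 1 f x - crep 0 1 f y\<bar>"
    unfolding cgrad_def using norm_Pair_le[of "crep 1 0 f x - crep 1 0 f y" "crep 0 1 f x - crep 0 1 f y"] by simp
  also have "\<dots> \<le> (16 * hk_norm 4 f) * norm (x - y)" using 1[of 1 0] 1[of 0 1] by simp
  also have "\<dots> \<le> B * norm (x - y)" by (intro mult_right_mono B norm_ge_zero)
  finally show "norm (cgrad f x - cgrad f y) \<le> B * norm (x - y)" .
qed (use B in auto)

section \<open>Finite differences in L2\<close>

lemma conv_pairing_bound:
  fixes K :: "'b::euclidean_space \<Rightarrow> real" and \<sigma> :: "'b \<Rightarrow> pt"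
  assumes K: "integrable lborel K" and s: "\<sigma> \<in> borel_measurable borel"
    and L: "L2 g" "L2 h"
  shows "\<bar>\<integral>x. (\<integral>z. K z * g (x - \<sigma> z) \<partial>lborel) * h x \<partial>lborel\<bar> \<le> (\<integral>z. \<bar>K z\<bar> \<partial>lborel) * (l2norm g * l2norm h)"
proof -
  note i = conv_integrable(1)[OF assms]
  have gs: "L2 (\<lambda>x. g (x - c))" "l2norm (\<lambda>x. g (x - c)) = l2norm g" for c
    using L2_shift[OF L(1), of "- c"] l2norm_shift[of g "- c"] by auto
  have "(\<integral>x. (\<integral>z. K z * g (x - \<sigma> z) \<partial>lborel) * h x \<partial>lborel) = (\<integral>x. (\<integral>z. K z * (g (x - \<sigma> z) * h x) \<partial>lborel) \<partial>lborel)"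
    unfolding mult.assoc[symmetric] by simp
  also have "\<dots> = (\<integral>z. (\<integral>x. K z * (g (x - \<sigma> z) * h x) \<partial>lborel) \<partial>lborel)"
    by (rule lborel_pair.Fubini_integral[OF i])
  also have "\<bar>\<dots>\<bar> \<le> (\<integral>z. \<bar>\<integral>x. K z * (g (x - \<sigma> z) * h x) \<partial>lborel\<bar> \<partial>lborel)"
    by (rule integral_abs_bound)
  also have "\<dots> \<le> (\<integral>z. \<bar>K z\<bar> * (l2norm g * l2norm h) \<partial>lborel)"
  proof (rule integral_mono)
    show "integrable lborel (\<lambda>z. \<bar>\<integral>x. K z * (g (x - \<sigma> z) * h x) \<partial>lborel\<bar>)"
      using lborel_pair.integrable_fst'[OF i] by simp
    show "integrable lborel (\<lambda>z. \<bar>K z\<bar> * (l2norm g * l2norm h))" using K by simp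
    show "\<bar>\<integral>x. K z * (g (x - \<sigma> z) * h x) \<partial>lborel\<bar> \<le> \<bar>K z\<bar> * (l2norm g * l2norm h)" for z
      using mult_left_mono[OF L2_Cauchy_Schwarz[OF gs(1)[of "\<sigma> z"] L(2)], of "\<bar>K z\<bar>"] by (simp add: abs_mult gs(2))
  qed
  also have "\<dots> = (\<integral>z. \<bar>K z\<bar> \<partial>lborel) * (l2norm g * l2norm h)" by simp
  finally show ?thesis .
qed

lemma line_DERIV:
  fixes v :: "pt \<Rightarrow> real"
  assumes "\<And>x. (v has_derivative (\<lambda>h. g x \<bullet> h)) (at x)"
  shows "((\<lambda>s. v (x + s *\<^sub>R h)) has_real_derivative g (x + s *\<^sub>R h) \<bullet> h) (at s)"
proof -
  have "((\<lambda>s. x + s *\<^sub>R h) has_derivative (\<lambda>t. t *\<^sub>R h)) (at s)" by (auto intro!: derivative_eq_intros)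
  from diff_chain_at[OF this assms[of "x + s *\<^sub>R h"]]
  have "((\<lambda>s. v (x + s *\<^sub>R h)) has_derivative (\<lambda>t. g (x + s *\<^sub>R h) \<bullet> (t *\<^sub>R h))) (at s)" unfolding o_def .
  then show ?thesis by (simp add: has_field_derivative_def mult_commute_abs)
qed

text \<open>Minkowski's integral inequality in dual form: the increment is the average of the
  directional derivative over a segment, and pairing the increment with itself gives a bound for its
  squared norm that is linear in the norm, which is then cancelled.\<close>

lemma L2_increment:
  assumes d: "\<And>x. (v has_derivative (\<lambda>h. (g1 x, g2 x) \<bullet> h)) (at x)"
    and L: "L2 v" "L2 g1" "L2 g2" and c: "continuous_on UNIV g1" "continuous_on UNIV g2"
  shows "l2norm (\<lambda>x. v (x + h) - v x) \<le> norm h * (l2norm g1 + l2norm g2)"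
proof -
  define g where "g x = fst h * g1 x + snd h * g2 x" for x
  have Lg: "L2 g" unfolding g_def by (intro L2_add L2_cmult L)
  have gc: "continuous_on UNIV g" unfolding g_def by (intro continuous_intros c)
  have "l2norm g \<le> \<bar>fst h\<bar> * l2norm g1 + \<bar>snd h\<bar> * l2norm g2"
    unfolding g_def using l2norm_triangle[OF L2_cmult[OF L(2)] L2_cmult[OF L(3)], of "fst h" "snd h"] by (simp add: l2norm_cmult)
  also have "\<dots> \<le> norm h * l2norm g1 + norm h * l2norm g2"
    using norm_fst_le[of "fst h" "snd h"] norm_snd_le[of "snd h" "fst h"]
    by (intro add_mono mult_right_mono l2norm_nonneg) auto
  finally have gn: "l2norm g \<le> norm h * (l2norm g1 + l2norm g2)" by (simp add: distrib_left)
  let ?w = "\<lambda>x. v (x + h) - v x"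
  have Lw: "L2 ?w" by (intro L2_diff L2_shift L)
  have w: "?w x = (\<integral>s. indicator {0..1} s * g (x - (- (s *\<^sub>R h))) \<partial>lborel)" for x
  proof -
    have gx: "continuous_on {0..1} (\<lambda>s. g (x + s *\<^sub>R h))"
      by (intro continuous_on_compose2[OF gc] continuous_intros) auto
    have "((\<lambda>s. g (x + s *\<^sub>R h)) has_integral (v (x + 1 *\<^sub>R h) - v (x + 0 *\<^sub>R h))) {0..1}"
      using line_DERIV[OF d, of x h]
      by (intro fundamental_theorem_of_calculus)
        (auto simp: g_def inner_prod_def mult.commute has_real_derivative_iff_has_vector_derivative[symmetric] intro: has_field_derivative_at_within)
    then have "?w x = integral {0..1} (\<lambda>s. g (x + s *\<^sub>R h))" by (simp add: integral_unique)
    with set_borel_integral_eq_integral(2)[OF borel_integrable_atLeastAtMost'[OF gx]]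
    show ?thesis by (simp add: set_lebesgue_integral_def)
  qed
  have K: "integrable lborel (\<lambda>s::real. indicator {0..1} s :: real)" by (intro integrable_real_indicator) simp_all
  have "(l2norm ?w)\<^sup>2 = \<bar>\<integral>x. (\<integral>s. indicator {0..1} s * g (x - (- (s *\<^sub>R h))) \<partial>lborel) * ?w x \<partial>lborel\<bar>"
    unfolding w[symmetric] l2norm_power2 by (simp add: power2_eq_square)
  also have "\<dots> \<le> (\<integral>s. \<bar>indicator {0..1} (s::real)\<bar> \<partial>lborel) * (l2norm g * l2norm ?w)"
    by (rule conv_pairing_bound[where \<sigma>="\<lambda>s. - (s *\<^sub>R h)", OF K _ Lg Lw]) simp
  finally have "l2norm ?w * l2norm ?w \<le> l2norm g * l2norm ?w" by (simp add: power2_eq_square)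
  then have "l2norm ?w \<le> l2norm g"
    using l2norm_nonneg[of ?w] l2norm_nonneg[of g] by (cases "l2norm ?w = 0") (auto simp: mult_le_cancel_right)
  then show ?thesis using gn by simp
qed

text \<open>The constant K is qualitative: it justifies Fubini and the disappearance of end terms in
  the energy identity and does not occur in the identity itself, so it may vary with time and
  exponent.\<close>

definition diff_L2_bounds :: "real \<Rightarrow> (pt \<Rightarrow> real) \<Rightarrow> bool" where
  "diff_L2_bounds K u \<longleftrightarrow> 0 \<le> K \<and> (\<forall>h. l2norm (\<lambda>x. u x - u (x - h)) \<le> K * norm h) \<and>
     (\<forall>h. l2norm (\<lambda>x. 2 * u x - u (x - h) - u (x + h)) \<le> K * (norm h)\<^sup>2)"

lemma crep_diff_L2_bounds:
  assumes f: "sobolev 4 f" shows "\<exists>K. diff_L2_bounds K (crep 0 0 f)"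
proof -
  let ?u = "crep 0 0 f" and ?n = "\<lambda>a b. l2norm (crep a b f)"
  define K where "K = (?n 1 0 + ?n 0 1) + ((?n 2 0 + ?n 1 1) + (?n 1 1 + ?n 0 2))"
  note nn = l2norm_nonneg[of "crep _ _ f"]
  have Lu: "L2 (crep a b f)" if "a + b \<le> 2" for a b using crep_L2[OF f that] .
  have cu: "continuous_on UNIV (crep a b f)" if "a + b \<le> 2" for a b using crep_continuous[OF f that] .
  have i0: "l2norm (\<lambda>x. ?u (x + h) - ?u x) \<le> norm h * (?n 1 0 + ?n 0 1)" for h
    using crep_has_derivative[OF f, of 0 0] by (intro L2_increment Lu cu) auto
  have i1: "l2norm (\<lambda>x. crep a b f (x + h) - crep a b f x) \<le> norm h * (?n (a + 1) b + ?n a (b + 1))" if "a + b = 1" for h a b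
    using crep_has_derivative[OF f, of a b] that by (intro L2_increment Lu cu) auto
  have 1: "l2norm (\<lambda>x. ?u x - ?u (x - h)) \<le> K * norm h" for h
  proof -
    have "l2norm (\<lambda>x. ?u x - ?u (x - h)) = l2norm (\<lambda>x. ?u (x + h) - ?u x)"
      using l2norm_shift[of "\<lambda>x. ?u x - ?u (x - h)" h] by simp
    also have "\<dots> \<le> norm h * (?n 1 0 + ?n 0 1)" by (rule i0)
    also have "\<dots> \<le> norm h * K" unfolding K_def by (intro mult_left_mono) (auto intro!: add_nonneg_nonneg nn)
    finally show ?thesis by (simp add: mult.commute)
  qed
  have 2: "l2norm (\<lambda>x. 2 * ?u x - ?u (x - h) - ?u (x + h)) \<le> K * (norm h)\<^sup>2" for h
  proof -
    let ?g = "\<lambda>a b x. crep a b f (x + h) - crep a b f x"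
    have dsh: "(crep 0 0 f \<circ> (\<lambda>x. x + h) has_derivative (\<lambda>k. (crep 1 0 f (x + h), crep 0 1 f (x + h)) \<bullet> k)) (at x)" for x
    proof -
      have "((\<lambda>x. x + h) has_derivative (\<lambda>k. k)) (at x)" by (auto intro!: derivative_eq_intros)
      from diff_chain_at[OF this crep_has_derivative[OF f, of 0 0 "x + h"]] show ?thesis by (simp add: o_def)
    qed
    have dw: "(?g 0 0 has_derivative (\<lambda>k. (?g 1 0 x, ?g 0 1 x) \<bullet> k)) (at x)" for x
      using has_derivative_diff[OF dsh[of x] crep_has_derivative[OF f, of 0 0 x]]
      by (simp add: o_def inner_prod_def algebra_simps)
    \<comment> \<open>The second difference is, up to sign, the increment of an increment:
      \<open>L2_increment\<close> is applied once to the increment and once to each component of its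
      gradient.\<close>
    have "l2norm (\<lambda>x. 2 * ?u x - ?u (x - h) - ?u (x + h)) = l2norm (\<lambda>x. ?g 0 0 (x + (- h)) - ?g 0 0 x)"
      by (simp add: algebra_simps)
    also have "\<dots> \<le> norm (- h) * (l2norm (?g 1 0) + l2norm (?g 0 1))"
    proof (rule L2_increment[OF dw])
      show "continuous_on UNIV (?g 1 0)" "continuous_on UNIV (?g 0 1)"
        by (intro continuous_intros continuous_on_compose2[OF cu] cu; simp)+
    qed (intro L2_diff L2_shift Lu; simp)+
    also have "\<dots> \<le> norm h * (norm h * (?n 2 0 + ?n 1 1) + norm h * (?n 1 1 + ?n 0 2))"
      unfolding norm_minus_cancel using i1[of 1 0 h] i1[of 0 1 h]
      by (intro mult_left_mono add_mono) (auto simp: numeral_2_eq_2)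
    also have "\<dots> = (norm h)\<^sup>2 * ((?n 2 0 + ?n 1 1) + (?n 1 1 + ?n 0 2))" by (simp add: power2_eq_square algebra_simps)
    also have "\<dots> \<le> (norm h)\<^sup>2 * K" unfolding K_def by (intro mult_left_mono) (auto intro!: add_nonneg_nonneg nn)
    finally show ?thesis by (simp add: mult.commute)
  qed
  show ?thesis unfolding diff_L2_bounds_def using 1 2
    by (intro exI[of _ K]) (auto simp: K_def intro!: add_nonneg_nonneg nn)
qed

section \<open>Polar coordinates\<close>

definition dir :: "real \<Rightarrow> pt" where
  "dir \<tau> = (1 / sqrt (1 + \<tau>\<^sup>2), \<tau> / sqrt (1 + \<tau>\<^sup>2))"

lemma dir_denom_pos: "1 + \<tau>\<^sup>2 > (0::real)" "sqrt (1 + \<tau>\<^sup>2) > 0"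
  by (auto simp: add_pos_nonneg)

lemma norm_dir [simp]: "norm (dir \<tau>) = 1"
proof -
  have "(norm (dir \<tau>))\<^sup>2 = 1"
    using dir_denom_pos[of \<tau>] by (simp add: dir_def norm_Pair power_divide add_divide_distrib[symmetric])
  then show ?thesis by (simp add: power2_eq_1_iff) (metis norm_ge_zero not_one_le_zero neg_0_le_iff_le)
qed

lemma dir_continuous: "continuous_on A dir"
  unfolding dir_def using dir_denom_pos by (intro continuous_intros) (auto simp: less_imp_neq[symmetric])

lemma dir_measurable [measurable]: "dir \<in> borel_measurable borel"
  by (intro borel_measurable_continuous_onI dir_continuous)

text \<open>Polar coordinates \<open>y = s * dir \<tau>\<close> with signed radius \<open>s\<close>, parametrised by the slope \<open>\<tau>\<close>
  of the line through the origin; they follow from two linear substitutions.\<close>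

lemma nn_integral_polar:
  assumes [measurable]: "k \<in> borel_measurable (borel :: pt measure)"
  shows "(\<integral>\<^sup>+y. k y \<partial>lborel) = (\<integral>\<^sup>+\<tau>. (\<integral>\<^sup>+s. ennreal (\<bar>s\<bar> / (1 + \<tau>\<^sup>2)) * k (s *\<^sub>R dir \<tau>) \<partial>lborel) \<partial>lborel)"
proof -
  have [measurable]: "(\<lambda>(a, b). k (a, b)) \<in> borel_measurable (borel \<Otimes>\<^sub>M borel)"
    by (simp add: borel_prod)
  have km [measurable]: "(\<lambda>x. k (f x, g x)) \<in> borel_measurable M"
    if [measurable]: "f \<in> borel_measurable M" "g \<in> borel_measurable M" for f g :: "'c \<Rightarrow> real" and M :: "'c measure"
    using measurable_compose[of "\<lambda>x. (f x, g x)" M borel k borel] by (simp add: borel_prod[symmetric])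
  have "(\<integral>\<^sup>+y. k y \<partial>lborel) = (\<integral>\<^sup>+a. (\<integral>\<^sup>+b. k (a, b) \<partial>lborel) \<partial>lborel)"
    by (subst lborel.nn_integral_fst) (simp_all add: lborel_prod)
  also have "\<dots> = (\<integral>\<^sup>+a. (\<integral>\<^sup>+\<tau>. ennreal \<bar>a\<bar> * k (a, a * \<tau>) \<partial>lborel) \<partial>lborel)"
  proof (intro nn_integral_cong_AE)
    have "AE a in lborel. a \<noteq> (0::real)" by (rule AE_lborel_singleton)
    then show "AE a in lborel. (\<integral>\<^sup>+b. k (a, b) \<partial>lborel) = (\<integral>\<^sup>+\<tau>. ennreal \<bar>a\<bar> * k (a, a * \<tau>) \<partial>lborel)"
    proof eventually_elim
      case (elim a)
      then show ?case using nn_integral_real_affine[of "\<lambda>b. k (a, b)" a 0] by (simp add: nn_integral_cmult)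
    qed
  qed
  also have "\<dots> = (\<integral>\<^sup>+\<tau>. (\<integral>\<^sup>+a. ennreal \<bar>a\<bar> * k (a, a * \<tau>) \<partial>lborel) \<partial>lborel)"
    by (rule lborel_pair.Fubini') simp
  also have "\<dots> = (\<integral>\<^sup>+\<tau>. (\<integral>\<^sup>+s. ennreal (\<bar>s\<bar> / (1 + \<tau>\<^sup>2)) * k (s *\<^sub>R dir \<tau>) \<partial>lborel) \<partial>lborel)"
  proof (rule nn_integral_cong)
    fix \<tau> :: real
    let ?l = "sqrt (1 + \<tau>\<^sup>2)"
    have l: "?l > 0" "?l * ?l = 1 + \<tau>\<^sup>2" using dir_denom_pos[of \<tau>] by auto
    have "(\<integral>\<^sup>+a. ennreal \<bar>a\<bar> * k (a, a * \<tau>) \<partial>lborel) = ennreal \<bar>1 / ?l\<bar> * (\<integral>\<^sup>+s. ennreal \<bar>0 + 1 / ?l * s\<bar> * k (0 + 1 / ?l * s, (0 + 1 / ?l * s) * \<tau>) \<partial>lborel)"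
      using l by (intro nn_integral_real_affine) auto
    also have "\<dots> = (\<integral>\<^sup>+s. ennreal \<bar>1 / ?l\<bar> * (ennreal \<bar>0 + 1 / ?l * s\<bar> * k (0 + 1 / ?l * s, (0 + 1 / ?l * s) * \<tau>)) \<partial>lborel)"
      by (rule nn_integral_cmult[symmetric]) measurable
    also have "\<dots> = (\<integral>\<^sup>+s. ennreal (\<bar>s\<bar> / (1 + \<tau>\<^sup>2)) * k (s *\<^sub>R dir \<tau>) \<partial>lborel)"
    proof (rule nn_integral_cong)
      fix s :: real
      have "ennreal \<bar>1 / ?l\<bar> * ennreal \<bar>0 + 1 / ?l * s\<bar> = ennreal (\<bar>s\<bar> / (1 + \<tau>\<^sup>2))"
        using l by (simp add: ennreal_mult[symmetric] abs_mult)
      then show "ennreal \<bar>1 / ?l\<bar> * (ennreal \<bar>0 + 1 / ?l * s\<bar> * k (0 + 1 / ?l * s, (0 + 1 / ?l * s) * \<tau>)) = ennreal (\<bar>s\<bar> / (1 + \<tau>\<^sup>2)) * k (s *\<^sub>R dir \<tau>)"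
        by (simp add: dir_def mult.assoc[symmetric] mult.commute)
    qed
    finally show "(\<integral>\<^sup>+a. ennreal \<bar>a\<bar> * k (a, a * \<tau>) \<partial>lborel) = (\<integral>\<^sup>+s. ennreal (\<bar>s\<bar> / (1 + \<tau>\<^sup>2)) * k (s *\<^sub>R dir \<tau>) \<partial>lborel)" .
  qed
  finally show ?thesis .
qed

lemma lborel_polar:
  "(lborel :: pt measure) = distr (density (lborel \<Otimes>\<^sub>M lborel) (\<lambda>(\<tau>, s). ennreal (\<bar>s\<bar> / (1 + \<tau>\<^sup>2)))) borel (\<lambda>(\<tau>, s). s *\<^sub>R dir \<tau>)"
proof (rule measure_eqI)
  fix A :: "pt set" assume "A \<in> sets lborel"
  then have [measurable]: "A \<in> sets borel" by simp
  have "emeasure lborel A = (\<integral>\<^sup>+\<tau>. (\<integral>\<^sup>+s. ennreal (\<bar>s\<bar> / (1 + \<tau>\<^sup>2)) * indicator A (s *\<^sub>R dir \<tau>) \<partial>lborel) \<partial>lborel)"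
    using nn_integral_polar[of "indicator A"] by simp
  also have "\<dots> = (\<integral>\<^sup>+z. (case z of (\<tau>, s) \<Rightarrow> ennreal (\<bar>s\<bar> / (1 + \<tau>\<^sup>2)) * indicator A (s *\<^sub>R dir \<tau>)) \<partial>(lborel \<Otimes>\<^sub>M lborel))"
    by (subst lborel.nn_integral_fst[symmetric]) auto
  also have "\<dots> = (\<integral>\<^sup>+z. (case z of (\<tau>, s) \<Rightarrow> ennreal (\<bar>s\<bar> / (1 + \<tau>\<^sup>2))) * indicator A (case z of (\<tau>, s) \<Rightarrow> s *\<^sub>R dir \<tau>) \<partial>(lborel \<Otimes>\<^sub>M lborel))"
    by (simp add: case_prod_unfold)
  also have "\<dots> = (\<integral>\<^sup>+z. indicator A (case z of (\<tau>, s) \<Rightarrow> s *\<^sub>R dir \<tau>) \<partial>density (lborel \<Otimes>\<^sub>M lborel) (\<lambda>(\<tau>, s). ennreal (\<bar>s\<bar> / (1 + \<tau>\<^sup>2))))"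
    by (subst nn_integral_density) auto
  also have "\<dots> = (\<integral>\<^sup>+y. indicator A y \<partial>distr (density (lborel \<Otimes>\<^sub>M lborel) (\<lambda>(\<tau>, s). ennreal (\<bar>s\<bar> / (1 + \<tau>\<^sup>2)))) borel (\<lambda>(\<tau>, s). s *\<^sub>R dir \<tau>))"
    by (subst nn_integral_distr) auto
  finally show "emeasure lborel A = emeasure (distr (density (lborel \<Otimes>\<^sub>M lborel) (\<lambda>(\<tau>, s). ennreal (\<bar>s\<bar> / (1 + \<tau>\<^sup>2)))) borel (\<lambda>(\<tau>, s). s *\<^sub>R dir \<tau>)) A"
    by simp
qed simp

lemma integral_polar:
  fixes k :: "pt \<Rightarrow> real"
  assumes k: "integrable lborel k"
  shows "integrable (lborel \<Otimes>\<^sub>M lborel) (\<lambda>(\<tau>, s). \<bar>s\<bar> / (1 + \<tau>\<^sup>2) * k (s *\<^sub>R dir \<tau>))"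
    and "(\<integral>y. k y \<partial>lborel) = (\<integral>\<tau>. (\<integral>s. \<bar>s\<bar> / (1 + \<tau>\<^sup>2) * k (s *\<^sub>R dir \<tau>) \<partial>lborel) \<partial>lborel)"
proof -
  have [measurable]: "k \<in> borel_measurable borel" using borel_measurable_integrable[OF k] by simp
  let ?D = "\<lambda>z::real \<times> real. \<bar>snd z\<bar> / (1 + (fst z)\<^sup>2)"
  let ?P = "\<lambda>z. snd z *\<^sub>R dir (fst z)"
  have L: "(lborel :: pt measure) = distr (density (lborel \<Otimes>\<^sub>M lborel) (\<lambda>z. ennreal (?D z))) borel ?P"
    using lborel_polar by (simp add: case_prod_unfold)
  have D0: "0 \<le> ?D z" for z by (simp add: add_nonneg_nonneg)
  have "integrable (distr (density (lborel \<Otimes>\<^sub>M lborel) (\<lambda>z. ennreal (?D z))) borel ?P) k"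
    using k L by simp
  then have "integrable (density (lborel \<Otimes>\<^sub>M lborel) (\<lambda>z. ennreal (?D z))) (\<lambda>z. k (?P z))"
    by (subst (asm) integrable_distr_eq) auto
  then have i: "integrable (lborel \<Otimes>\<^sub>M lborel) (\<lambda>z. ?D z * k (?P z))"
    by (subst (asm) integrable_density) (use D0 in auto)
  then show "integrable (lborel \<Otimes>\<^sub>M lborel) (\<lambda>(\<tau>, s). \<bar>s\<bar> / (1 + \<tau>\<^sup>2) * k (s *\<^sub>R dir \<tau>))"
    by (simp add: case_prod_unfold)
  have "(\<integral>y. k y \<partial>lborel) = (\<integral>y. k y \<partial>distr (density (lborel \<Otimes>\<^sub>M lborel) (\<lambda>z. ennreal (?D z))) borel ?P)"
    using L by simp
  also have "\<dots> = (\<integral>z. k (?P z) \<partial>density (lborel \<Otimes>\<^sub>M lborel) (\<lambda>z. ennreal (?D z)))"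
    by (subst integral_distr) auto
  also have "\<dots> = (\<integral>z. ?D z * k (?P z) \<partial>(lborel \<Otimes>\<^sub>M lborel))"
    by (subst integral_density) (use D0 in auto)
  also have "\<dots> = (\<integral>\<tau>. (\<integral>s. \<bar>s\<bar> / (1 + \<tau>\<^sup>2) * k (s *\<^sub>R dir \<tau>) \<partial>lborel) \<partial>lborel)"
    using lborel_pair.integral_fst'[OF i] by simp
  finally show "(\<integral>y. k y \<partial>lborel) = (\<integral>\<tau>. (\<integral>s. \<bar>s\<bar> / (1 + \<tau>\<^sup>2) * k (s *\<^sub>R dir \<tau>) \<partial>lborel) \<partial>lborel)" .
qed

text \<open>Joins the opposite points s and -s of a line through the origin; this pairing carries
  the cancellation of the principal value.\<close>

lemma integral_fold_half_line:
  fixes f :: "real \<Rightarrow> real"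
  assumes f: "integrable lborel f"
  shows "(\<integral>s. f s \<partial>lborel) = (\<integral>s. indicator {0<..} s * (f s + f (- s)) \<partial>lborel)"
proof -
  have i1: "integrable lborel (\<lambda>s. indicator {0<..} s * f s)" "integrable lborel (\<lambda>s. indicator {..<0} s * f s)"
    using integrable_mult_indicator[OF _ f, of "{0<..}"] integrable_mult_indicator[OF _ f, of "{..<0}"] by auto
  have i2: "integrable lborel (\<lambda>s. indicator {0<..} s * f (- s))"
    using lborel_integrable_real_affine[OF i1(2), of "-1" 0] by (simp add: indicator_def)
  have "(\<integral>s. f s \<partial>lborel) = (\<integral>s. indicator {0<..} s * f s + indicator {..<0} s * f s \<partial>lborel)"
  proof (rule integral_cong_AE)
    show "AE s in lborel. f s = indicator {0<..} s * f s + indicator {..<0} s * f s"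
      using AE_lborel_singleton[of 0] by eventually_elim (auto simp: indicator_def)
  qed (use borel_measurable_integrable[OF f] in auto)
  also have "\<dots> = (\<integral>s. indicator {0<..} s * f s \<partial>lborel) + (\<integral>s. indicator {..<0} s * f s \<partial>lborel)"
    using i1 by simp
  also have "(\<integral>s. indicator {..<0} s * f s \<partial>lborel) = (\<integral>s. indicator {0<..} s * f (- s) \<partial>lborel)"
    using lborel_integral_real_affine[of "-1" "\<lambda>s. indicator {..<0} s * f s" 0] by (simp add: indicator_def)
  finally show ?thesis using i1 i2 by (simp add: distrib_left)
qed

lemma antiderivative_exists:
  fixes f :: "real \<Rightarrow> real"
  assumes "continuous_on UNIV f"
  shows "\<exists>F. F 0 = 0 \<and> (\<forall>x. (F has_real_derivative f x) (at x))"
proof -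
  have "isCont f x" for x using assms by (simp add: continuous_on_eq_continuous_at)
  then obtain F where F: "\<And>x. (F has_vector_derivative f x) (at x)"
    using einterval_antiderivative[of "-\<infinity>" \<infinity> f] by auto
  then have "((\<lambda>x. F x - F 0) has_real_derivative f x) (at x)" for x
    using DERIV_diff[of F "f x" x UNIV "\<lambda>_. F 0" 0] by (simp add: has_real_derivative_iff_has_vector_derivative)
  then show ?thesis by (intro exI[of _ "\<lambda>x. F x - F 0"]) auto
qed

definition antideriv :: "(real \<Rightarrow> real) \<Rightarrow> real \<Rightarrow> real" where
  "antideriv f = (SOME F. F 0 = 0 \<and> (\<forall>x. (F has_real_derivative f x) (at x)))"

lemma antideriv:
  assumes "continuous_on UNIV f"
  shows "antideriv f 0 = 0" "(antideriv f has_real_derivative f x) (at x)"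
  using someI_ex[OF antiderivative_exists[OF assms]] by (auto simp: antideriv_def)

section \<open>The nonlinearities of the line integrals\<close>

text \<open>\<open>Psi a p\<close> comes from integrating the kernel by parts along a line, with \<open>p\<close> the slope at the base
  point; \<open>dd a\<close> is the density of the dissipated energy.\<close>

definition phi :: "real \<Rightarrow> real \<Rightarrow> real" where "phi a q = (1 + q\<^sup>2) powr (- (3 + a) / 2)"
definition Phi :: "real \<Rightarrow> real \<Rightarrow> real" where "Phi a = antideriv (phi a)"
definition GG :: "real \<Rightarrow> real \<Rightarrow> real" where "GG a = antideriv (Phi a)"
definition Psi :: "real \<Rightarrow> real \<Rightarrow> real \<Rightarrow> real" where "Psi a p q = (p - q) * phi a q - a * Phi a q"
definition dd :: "real \<Rightarrow> real \<Rightarrow> real" where "dd a q = q * Phi a q - (1 - a) * GG a q"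

lemma one_plus_sq_pos: "1 + (q::real)\<^sup>2 > 0" by (simp add: add_pos_nonneg)

lemma phi_DERIV: "(phi a has_real_derivative - (3 + a) * q / (1 + q\<^sup>2) * phi a q) (at q)"
proof -
  have "((\<lambda>q. (1 + q\<^sup>2) powr (- (3 + a) / 2)) has_real_derivative
      (1 + q\<^sup>2) powr (- (3 + a) / 2) * (0 * ln (1 + q\<^sup>2) + (2 * q) * (- (3 + a) / 2) / (1 + q\<^sup>2))) (at q)"
    by (rule DERIV_powr) (auto intro!: derivative_eq_intros simp: one_plus_sq_pos)
  moreover have "(2 * q) * (- (3 + a) / 2) = - (3 + a) * q" by (simp add: field_simps)
  ultimately show ?thesis unfolding phi_def[abs_def] by (simp add: mult.commute)
qed

lemma phi_continuous: "continuous_on A (phi a)"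
  using DERIV_continuous_on[of A "phi a" "\<lambda>q. - (3 + a) * q / (1 + q\<^sup>2) * phi a q"] phi_DERIV
  by (auto intro: has_field_derivative_at_within)

lemma Phi_DERIV: "(Phi a has_real_derivative phi a q) (at q)" and Phi_0 [simp]: "Phi a 0 = 0"
  unfolding Phi_def using antideriv[OF phi_continuous] by auto

lemma Phi_continuous: "continuous_on A (Phi a)"
  using DERIV_continuous_on[of A "Phi a" "phi a"] Phi_DERIV by (auto intro: has_field_derivative_at_within)

lemma GG_DERIV: "(GG a has_real_derivative Phi a q) (at q)" and GG_0 [simp]: "GG a 0 = 0"
  unfolding GG_def using antideriv[OF Phi_continuous] by auto

lemma GG_continuous: "continuous_on A (GG a)"
  using DERIV_continuous_on[of A "GG a" "Phi a"] GG_DERIV by (auto intro: has_field_derivative_at_within)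

lemma phi_Phi_GG_measurable [measurable]:
  "phi a \<in> borel_measurable borel" "Phi a \<in> borel_measurable borel" "GG a \<in> borel_measurable borel"
  by (intro borel_measurable_continuous_onI phi_continuous Phi_continuous GG_continuous)+

lemma phi_pos: "phi a q > 0"
  using one_plus_sq_pos[of q] by (simp add: phi_def powr_def)

lemma phi_le_1: assumes "0 \<le> a" shows "phi a q \<le> 1"
  using powr_mono[of "- (3 + a) / 2" 0 "1 + q\<^sup>2"] one_plus_sq_pos[of q] assms by (simp add: phi_def)

text \<open>The quotient of the two functions is exp(-(a/2) ln(1 + q^2)), which differs from 1 by at
  most (a/2) ln(1 + q^2), hence by at most (a/2) q^2.\<close>

lemma phi_diff: assumes "0 \<le> a" shows "\<bar>phi a q - phi 0 q\<bar> \<le> a / 2 * q\<^sup>2"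
proof -
  let ?c = "(1 + q\<^sup>2) powr (- a / 2)"
  have e: "phi a q = phi 0 q * ?c" by (simp add: phi_def powr_add[symmetric] field_simps)
  have "?c \<le> 1" using powr_mono[of "- a / 2" 0 "1 + q\<^sup>2"] one_plus_sq_pos[of q] assms by simp
  moreover have "1 - ?c \<le> a / 2 * q\<^sup>2"
  proof -
    have "?c = exp (- (a / 2 * ln (1 + q\<^sup>2)))" using one_plus_sq_pos[of q] by (auto simp: powr_def)
    also have "\<dots> \<ge> 1 - a / 2 * ln (1 + q\<^sup>2)" using exp_ge_add_one_self[of "- (a / 2 * ln (1 + q\<^sup>2))"] by simp
    finally have "1 - ?c \<le> a / 2 * ln (1 + q\<^sup>2)" by simp
    also have "\<dots> \<le> a / 2 * q\<^sup>2" using ln_add_one_self_le_self[of "q\<^sup>2"] assms by (intro mult_left_mono) auto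
    finally show ?thesis .
  qed
  ultimately have "\<bar>?c - 1\<bar> \<le> a / 2 * q\<^sup>2" by linarith
  moreover have "\<bar>phi a q - phi 0 q\<bar> = phi 0 q * \<bar>?c - 1\<bar>"
  proof -
    have "phi a q - phi 0 q = phi 0 q * (?c - 1)" unfolding e by (simp add: right_diff_distrib)
    then show ?thesis using phi_pos[of 0 q] by (simp add: abs_mult)
  qed
  moreover have "phi 0 q * \<bar>?c - 1\<bar> \<le> 1 * \<bar>?c - 1\<bar>"
    by (intro mult_right_mono phi_le_1) auto
  ultimately show ?thesis by (metis mult_1 order_trans)
qed

lemma real_gradient_bound:
  fixes f :: "real \<Rightarrow> real"
  assumes "\<And>t. (f has_real_derivative f' t) (at t)" "\<And>t. \<bar>t\<bar> \<le> R \<Longrightarrow> \<bar>f' t\<bar> \<le> C" "\<bar>x\<bar> \<le> R" "\<bar>y\<bar> \<le> R"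
  shows "\<bar>f x - f y\<bar> \<le> C * \<bar>x - y\<bar>"
proof -
  have "norm (f x - f y) \<le> C * norm (x - y)"
  proof (rule field_differentiable_bound[of "{-R..R}"])
    show "(f has_field_derivative f' z) (at z within {- R..R})" for z
      using assms(1) by (rule has_field_derivative_at_within)
  qed (use assms in \<open>auto simp: abs_le_iff\<close>)
  then show ?thesis by simp
qed

lemma Phi_Lipschitz: assumes "0 \<le> a" shows "\<bar>Phi a x - Phi a y\<bar> \<le> \<bar>x - y\<bar>"
proof -
  have "\<bar>Phi a x - Phi a y\<bar> \<le> 1 * \<bar>x - y\<bar>"
  proof (rule real_gradient_bound[OF Phi_DERIV, where R="max \<bar>x\<bar> \<bar>y\<bar>"])
    show "\<bar>phi a t\<bar> \<le> 1" for t using phi_le_1[OF assms, of t] phi_pos[of a t] by simp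
  qed auto
  then show ?thesis by simp
qed

lemma Phi_bound: assumes "0 \<le> a" shows "\<bar>Phi a x\<bar> \<le> \<bar>x\<bar>"
  using Phi_Lipschitz[OF assms, of x 0] by simp

lemma Phi_diff: assumes "0 \<le> a" shows "\<bar>Phi a q - Phi 0 q\<bar> \<le> a / 2 * \<bar>q\<bar> ^ 3"
proof -
  have "\<bar>(Phi a q - Phi 0 q) - (Phi a 0 - Phi 0 0)\<bar> \<le> (a / 2 * q\<^sup>2) * \<bar>q - 0\<bar>"
  proof (rule real_gradient_bound[where R="\<bar>q\<bar>"])
    show "((\<lambda>q. Phi a q - Phi 0 q) has_real_derivative (phi a t - phi 0 t)) (at t)" for t
      by (intro DERIV_diff Phi_DERIV)
    show "\<bar>t\<bar> \<le> \<bar>q\<bar> \<Longrightarrow> \<bar>phi a t - phi 0 t\<bar> \<le> a / 2 * q\<^sup>2" for t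
      using phi_diff[OF assms, of t] assms
      by (elim order_trans) (intro mult_left_mono, auto simp: abs_le_square_iff)
  qed auto
  moreover have "q\<^sup>2 * \<bar>q\<bar> = \<bar>q\<bar> ^ 3" by (metis power2_abs power_Suc2 eval_nat_numeral(3))
  ultimately show ?thesis by (simp add: mult.assoc)
qed

lemma GG_diff: assumes "0 \<le> a" shows "\<bar>GG a q - GG 0 q\<bar> \<le> a / 2 * \<bar>q\<bar> ^ 3 * \<bar>q\<bar>"
proof -
  have "\<bar>(GG a q - GG 0 q) - (GG a 0 - GG 0 0)\<bar> \<le> (a / 2 * \<bar>q\<bar> ^ 3) * \<bar>q - 0\<bar>"
  proof (rule real_gradient_bound[where R="\<bar>q\<bar>"])
    show "((\<lambda>q. GG a q - GG 0 q) has_real_derivative (Phi a t - Phi 0 t)) (at t)" for t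
      by (intro DERIV_diff GG_DERIV)
    show "\<bar>t\<bar> \<le> \<bar>q\<bar> \<Longrightarrow> \<bar>Phi a t - Phi 0 t\<bar> \<le> a / 2 * \<bar>q\<bar> ^ 3" for t
      using Phi_diff[OF assms, of t] assms
      by (elim order_trans) (intro mult_left_mono power_mono, auto)
  qed auto
  then show ?thesis by simp
qed

lemma GG_bound: assumes "0 \<le> a" shows "\<bar>GG a q\<bar> \<le> q\<^sup>2"
proof -
  have "\<bar>GG a q - GG a 0\<bar> \<le> \<bar>q\<bar> * \<bar>q - 0\<bar>"
  proof (rule real_gradient_bound[OF GG_DERIV, where R="\<bar>q\<bar>"])
    show "\<bar>t\<bar> \<le> \<bar>q\<bar> \<Longrightarrow> \<bar>Phi a t\<bar> \<le> \<bar>q\<bar>" for t using Phi_bound[OF assms, of t] by linarith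
  qed auto
  then show ?thesis by (simp add: power2_eq_square)
qed

section \<open>Signs and limits of the primitives\<close>

lemma nonneg_of_derivative_sign:
  fixes f :: "real \<Rightarrow> real"
  assumes "f 0 = 0" "\<And>t. (f has_real_derivative f' t) (at t)" "\<And>t. 0 \<le> t * f' t"
  shows "0 \<le> f x"
proof -

  consider "x > 0" | "x < 0" | "x = 0" by linarith
  then show ?thesis
  proof cases
    case 1
    from MVT2[OF 1, of f f'] assms(2) obtain z where "z > 0" "f x - f 0 = (x - 0) * f' z" by auto
    moreover have "0 \<le> f' z" using assms(3)[of z] \<open>z > 0\<close> by (simp add: zero_le_mult_iff)
    ultimately show ?thesis using 1 assms(1) by simp
  next
    case 2
    from MVT2[OF 2, of f f'] assms(2) obtain z where "z < 0" "f 0 - f x = (0 - x) * f' z" by auto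
    moreover have "f' z \<le> 0" using assms(3)[of z] \<open>z < 0\<close> by (simp add: zero_le_mult_iff)
    ultimately show ?thesis using 2 assms(1) by (simp add: mult_nonneg_nonpos mult_nonpos_nonpos zero_le_mult_iff)
  qed (use assms in simp)
qed

lemma Phi_sign: "0 \<le> q * Phi a q"
proof -
  consider "q > 0" | "q < 0" | "q = 0" by linarith
  then show ?thesis
  proof cases
    case 1
    from MVT2[OF 1, of "Phi a" "phi a"] Phi_DERIV obtain z where "Phi a q - Phi a 0 = (q - 0) * phi a z" by auto
    then show ?thesis using phi_pos[of a z] 1 by (simp add: zero_le_mult_iff)
  next
    case 2
    from MVT2[OF 2, of "Phi a" "phi a"] Phi_DERIV obtain z where "Phi a 0 - Phi a q = (0 - q) * phi a z" by auto
    then have "Phi a q = q * phi a z" by simp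
    then show ?thesis using phi_pos[of a z] 2 by (simp add: zero_le_mult_iff mult_le_0_iff)
  qed simp
qed

lemma GG_nonneg: "0 \<le> GG a q"
  by (rule nonneg_of_derivative_sign[OF GG_0 GG_DERIV Phi_sign])

text \<open>The derivative \<open>t * phi a t + a * Phi a t\<close> has the sign of t, and
  \<open>dd a\<close> vanishes at 0. Without this sign Fatou's lemma could not be applied to the
  dissipation.\<close>

lemma dd_nonneg: assumes "0 \<le> a" shows "0 \<le> dd a q"
proof (rule nonneg_of_derivative_sign[where f="dd a" and x=q and f'="\<lambda>t. t * phi a t + a * Phi a t"])
  show "(dd a has_real_derivative (t * phi a t + a * Phi a t)) (at t)" for t
  proof -
    have "((\<lambda>q. q * Phi a q - (1 - a) * GG a q) has_real_derivative (t * phi a t + 1 * Phi a t) - (1 - a) * Phi a t) (at t)"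
      by (intro DERIV_diff DERIV_mult' DERIV_cmult DERIV_ident Phi_DERIV GG_DERIV)
    then show ?thesis unfolding dd_def[abs_def] by (rule DERIV_cong) (simp add: algebra_simps)
  qed
  show "0 \<le> t * (t * phi a t + a * Phi a t)" for t
  proof -
    have "t * (t * phi a t + a * Phi a t) = t\<^sup>2 * phi a t + a * (t * Phi a t)"
      by (simp add: power2_eq_square algebra_simps)
    then show ?thesis using phi_pos[of a t] Phi_sign[of t a] assms by simp
  qed
qed (simp add: dd_def)

lemma dd_bound: assumes "0 \<le> a" "a \<le> 1" shows "dd a q \<le> q\<^sup>2"
proof -
  have "q * Phi a q \<le> \<bar>q\<bar> * \<bar>Phi a q\<bar>" by (simp add: abs_mult[symmetric])
  also have "\<dots> \<le> \<bar>q\<bar> * \<bar>q\<bar>" by (intro mult_left_mono Phi_bound assms) auto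
  finally have "q * Phi a q \<le> q\<^sup>2" by (simp add: power2_eq_square)
  moreover have "0 \<le> (1 - a) * GG a q" using GG_nonneg assms by simp
  ultimately show ?thesis by (simp add: dd_def)
qed

text \<open>Exponent and argument move together: the change of exponent costs a multiple of a times
  a power of the bounded arguments, and what remains is continuity at exponent 0.\<close>

lemma dd_tendsto:
  assumes "a \<longlonglongrightarrow> 0" "\<And>n. 0 \<le> a n" "q \<longlonglongrightarrow> q0"
  shows "(\<lambda>n. dd (a n) (q n)) \<longlonglongrightarrow> dd 0 q0"
proof -
  have c: "isCont (Phi 0) q0" "isCont (GG 0) q0"
    using Phi_continuous[of UNIV 0] GG_continuous[of UNIV 0] by (auto simp: continuous_on_eq_continuous_at)
  have P: "(\<lambda>n. Phi (a n) (q n)) \<longlonglongrightarrow> Phi 0 q0"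
  proof -
    have "(\<lambda>n. Phi (a n) (q n) - Phi 0 (q n)) \<longlonglongrightarrow> 0"
    proof (rule Lim_null_comparison)
      show "\<forall>\<^sub>F n in sequentially. norm (Phi (a n) (q n) - Phi 0 (q n)) \<le> a n / 2 * \<bar>q n\<bar> ^ 3"
        using Phi_diff[OF assms(2)] by simp
      have "(\<lambda>n. a n / 2 * \<bar>q n\<bar> ^ 3) \<longlonglongrightarrow> 0 / 2 * \<bar>q0\<bar> ^ 3" by (intro tendsto_intros assms) auto
      then show "(\<lambda>n. a n / 2 * \<bar>q n\<bar> ^ 3) \<longlonglongrightarrow> 0" by simp
    qed
    from tendsto_add[OF this isCont_tendsto_compose[OF c(1) assms(3)]] show ?thesis by simp
  qed
  have G: "(\<lambda>n. GG (a n) (q n)) \<longlonglongrightarrow> GG 0 q0"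
  proof -
    have "(\<lambda>n. GG (a n) (q n) - GG 0 (q n)) \<longlonglongrightarrow> 0"
    proof (rule Lim_null_comparison)
      show "\<forall>\<^sub>F n in sequentially. norm (GG (a n) (q n) - GG 0 (q n)) \<le> a n / 2 * \<bar>q n\<bar> ^ 3 * \<bar>q n\<bar>"
        using GG_diff[OF assms(2)] by simp
      have "(\<lambda>n. a n / 2 * \<bar>q n\<bar> ^ 3 * \<bar>q n\<bar>) \<longlonglongrightarrow> 0 / 2 * \<bar>q0\<bar> ^ 3 * \<bar>q0\<bar>" by (intro tendsto_intros assms) auto
      then show "(\<lambda>n. a n / 2 * \<bar>q n\<bar> ^ 3 * \<bar>q n\<bar>) \<longlonglongrightarrow> 0" by simp
    qed
    from tendsto_add[OF this isCont_tendsto_compose[OF c(2) assms(3)]] show ?thesis by simp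
  qed
  have "(\<lambda>n. q n * Phi (a n) (q n) - (1 - a n) * GG (a n) (q n)) \<longlonglongrightarrow> q0 * Phi 0 q0 - (1 - 0) * GG 0 q0"
    by (intro tendsto_intros P G assms)
  then show ?thesis by (simp add: dd_def)
qed

section \<open>Lipschitz and monotonicity properties of \<open>Psi\<close>\<close>

lemma Psi_DERIV: "(Psi a p has_real_derivative phi a q * (- (1 + a) - (3 + a) * ((p - q) * q / (1 + q\<^sup>2)))) (at q)"
proof -
  have "((\<lambda>q. (p - q) * phi a q - a * Phi a q) has_real_derivative
     (p - q) * (- (3 + a) * q / (1 + q\<^sup>2) * phi a q) + (0 - 1) * phi a q - a * phi a q) (at q)"
    by (intro DERIV_diff DERIV_mult' phi_DERIV Phi_DERIV DERIV_const DERIV_ident DERIV_cmult)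
  then show ?thesis unfolding Psi_def[abs_def]
    by (rule DERIV_cong) (simp add: algebra_simps add_divide_distrib diff_divide_distrib)
qed

lemma abs_quotient_half: "\<bar>q / (1 + q\<^sup>2)\<bar> \<le> (1::real) / 2"
proof -
  have "2 * \<bar>q\<bar> \<le> 1 + q\<^sup>2" using zero_le_power2[of "\<bar>q\<bar> - 1"] by (simp add: power2_diff)
  then show ?thesis using one_plus_sq_pos[of q] by (simp add: abs_divide field_simps)
qed

lemma Psi_slope_bound: "\<bar>(p - q) * q / (1 + q\<^sup>2)\<bar> \<le> \<bar>p - q\<bar> / (2::real)"
proof -
  have "\<bar>(p - q) * q / (1 + q\<^sup>2)\<bar> = \<bar>p - q\<bar> * \<bar>q / (1 + q\<^sup>2)\<bar>"
    by (metis abs_mult times_divide_eq_right)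
  also have "\<dots> \<le> \<bar>p - q\<bar> * (1 / 2)" by (intro mult_left_mono abs_quotient_half) auto
  finally show ?thesis by simp
qed

lemma Psi_Lipschitz:
  assumes a: "0 \<le> a" "a \<le> 1/2" and B: "1 \<le> B" "\<bar>p\<bar> \<le> B" "\<bar>x\<bar> \<le> B" "\<bar>y\<bar> \<le> B"
  shows "\<bar>Psi a p x - Psi a p y\<bar> \<le> 5 * B * \<bar>x - y\<bar>"
proof (rule real_gradient_bound[OF Psi_DERIV _ B(3,4)])
  fix t assume t: "\<bar>t\<bar> \<le> B"
  have "(3 + a) * \<bar>(p - t) * t / (1 + t\<^sup>2)\<bar> \<le> (7 / 2) * (\<bar>p - t\<bar> / 2)"
    using a by (intro mult_mono Psi_slope_bound) auto
  also have "\<dots> \<le> 7 / 2 * B" using t B(2) by simp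
  finally have "\<bar>(3 + a) * ((p - t) * t / (1 + t\<^sup>2))\<bar> \<le> 7 / 2 * B" using a by (simp add: abs_mult)
  \<comment> \<open>The first summand is at most 3/2 in absolute value, and 3/2 + 7/2 * B is at most
    5 * B because B is at least 1.\<close>
  then have "\<bar>- (1 + a) - (3 + a) * ((p - t) * t / (1 + t\<^sup>2))\<bar> \<le> 5 * B" using a B(1) by linarith
  then have "phi a t * \<bar>- (1 + a) - (3 + a) * ((p - t) * t / (1 + t\<^sup>2))\<bar> \<le> 1 * (5 * B)"
    using phi_le_1[OF a(1)] phi_pos[of a t] by (intro mult_mono) auto
  then show "\<bar>phi a t * (- (1 + a) - (3 + a) * ((p - t) * t / (1 + t\<^sup>2)))\<bar> \<le> 5 * B"
    using phi_pos[of a t] by (simp add: abs_mult)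
qed

text \<open>At q = p the bracket in the derivative is - (1 + a). Its other term has absolute value
  at most (7/2) * (1/8) = 7/16 when q is within 1/4 of p, so the derivative stays nonpositive on the
  whole interval between x and y.\<close>

lemma Psi_antimono_near:
  assumes a: "0 \<le> a" "a \<le> 1/2" and xy: "x \<le> y" "\<bar>p - x\<bar> \<le> 1/4" "\<bar>p - y\<bar> \<le> 1/4"
  shows "Psi a p y \<le> Psi a p x"
proof (rule DERIV_nonpos_imp_nonincreasing[OF xy(1)])
  fix t assume t: "x \<le> t" "t \<le> y"
  then have "\<bar>p - t\<bar> \<le> 1/4" using xy by linarith
  have "(3 + a) * \<bar>(p - t) * t / (1 + t\<^sup>2)\<bar> \<le> (7 / 2) * (\<bar>p - t\<bar> / 2)"
    using a by (intro mult_mono Psi_slope_bound) auto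
  also have "\<dots> \<le> 1" using \<open>\<bar>p - t\<bar> \<le> 1/4\<close> by simp
  finally have "\<bar>(3 + a) * ((p - t) * t / (1 + t\<^sup>2))\<bar> \<le> 1" using a by (simp add: abs_mult)
  then have "- (1 + a) - (3 + a) * ((p - t) * t / (1 + t\<^sup>2)) \<le> 0" using a by linarith
  then have "phi a t * (- (1 + a) - (3 + a) * ((p - t) * t / (1 + t\<^sup>2))) \<le> 0"
    using phi_pos[of a t] by (simp add: mult_nonneg_nonpos order_less_imp_le)
  then show "\<exists>d. (Psi a p has_real_derivative d) (at t) \<and> d \<le> 0" using Psi_DERIV by blast
qed

text \<open>The constant is 1 + 1: the change of \<open>phi\<close> contributes at most (2 B) *
  (a/2) * B^2, and the summand \<open>a * Phi a q\<close> at most a * B, which is at most a *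
  B^3.\<close>

lemma Psi_diff:
  assumes a: "0 \<le> a" and B: "1 \<le> B" "\<bar>p\<bar> \<le> B" "\<bar>q\<bar> \<le> B"
  shows "\<bar>Psi a p q - Psi 0 p q\<bar> \<le> 2 * B ^ 3 * a"
proof -
  have q2: "q\<^sup>2 \<le> B\<^sup>2" using B by (simp add: abs_le_square_iff[symmetric])
  have "\<bar>p - q\<bar> * \<bar>phi a q - phi 0 q\<bar> \<le> (2 * B) * (a / 2 * B\<^sup>2)"
  proof (intro mult_mono)
    show "\<bar>phi a q - phi 0 q\<bar> \<le> a / 2 * B\<^sup>2"
      using phi_diff[OF a, of q] mult_left_mono[OF q2, of "a / 2"] a by linarith
  qed (use B in auto)
  moreover have "a * \<bar>Phi a q\<bar> \<le> a * B" using Phi_bound[OF a, of q] B a by (intro mult_left_mono) auto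
  moreover have "a * B \<le> a * B ^ 3" using a B(1) by (intro mult_left_mono) (auto intro: self_le_power)
  moreover have "Psi a p q - Psi 0 p q = (p - q) * (phi a q - phi 0 q) - a * Phi a q"
    by (simp add: Psi_def algebra_simps)
  then have "\<bar>Psi a p q - Psi 0 p q\<bar> \<le> \<bar>p - q\<bar> * \<bar>phi a q - phi 0 q\<bar> + a * \<bar>Phi a q\<bar>"
    using a abs_triangle_ineq4[of "(p - q) * (phi a q - phi 0 q)" "a * Phi a q"] by (simp add: abs_mult)
  ultimately show ?thesis by (simp add: power3_eq_cube power2_eq_square algebra_simps)
qed

lemma Psi_continuous: "continuous_on UNIV (\<lambda>x. Psi a (fst x) (snd x))"
  unfolding Psi_def
  by (intro continuous_intros continuous_on_compose2[OF phi_continuous] continuous_on_compose2[OF Phi_continuous]) auto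

lemma Psi_measurable [measurable (raw)]:
  "f \<in> borel_measurable M \<Longrightarrow> g \<in> borel_measurable M \<Longrightarrow> (\<lambda>x. Psi a (f x) (g x)) \<in> borel_measurable M"
proof -
  assume fg [measurable]: "f \<in> borel_measurable M" "g \<in> borel_measurable M"
  have [measurable]: "(\<lambda>x. phi a (g x)) \<in> borel_measurable M" "(\<lambda>x. Phi a (g x)) \<in> borel_measurable M"
    using measurable_compose[OF fg(2) phi_Phi_GG_measurable(1)] measurable_compose[OF fg(2) phi_Phi_GG_measurable(2)] .
  show "(\<lambda>x. Psi a (f x) (g x)) \<in> borel_measurable M"
    unfolding Psi_def by (intro borel_measurable_diff borel_measurable_times borel_measurable_const) fact+
qed

lemma dd_measurable [measurable]: "dd a \<in> borel_measurable borel"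
  unfolding dd_def[abs_def] by measurable

section \<open>Backward and forward difference quotients along a line\<close>

definition qp :: "(pt \<Rightarrow> real) \<Rightarrow> pt \<Rightarrow> pt \<Rightarrow> real \<Rightarrow> real" where
  "qp u x w s = (u x - u (x - s *\<^sub>R w)) / s"

definition qm :: "(pt \<Rightarrow> real) \<Rightarrow> pt \<Rightarrow> pt \<Rightarrow> real \<Rightarrow> real" where
  "qm u x w s = (u (x + s *\<^sub>R w) - u x) / s"

lemma qm_qp: "qm u x w s = - qp u x (- w) s"
  by (simp add: qm_def qp_def minus_divide_left)

lemma C11_derivative: "C11 B u Du \<Longrightarrow> (u has_derivative (\<lambda>h. Du x \<bullet> h)) (at x)"
  and C11_ge_1: "C11 B u Du \<Longrightarrow> 1 \<le> B"
  and C11_bound: "C11 B u Du \<Longrightarrow> \<bar>u x\<bar> \<le> B"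
  and C11_grad_bound: "C11 B u Du \<Longrightarrow> norm (Du x) \<le> B"
  and C11_grad_Lipschitz: "C11 B u Du \<Longrightarrow> norm (Du x - Du y) \<le> B * norm (x - y)"
  unfolding C11_def by blast+

lemma C11_continuous: assumes "C11 B u Du" shows "continuous_on A u" "continuous_on A Du"
proof -
  show "continuous_on A u"
    using has_derivative_continuous[OF C11_derivative[OF assms]]
    by (intro continuous_at_imp_continuous_on) auto
  have "B-lipschitz_on A Du"
    using C11_ge_1[OF assms] C11_grad_Lipschitz[OF assms] by (intro lipschitz_onI) (auto simp: dist_norm)
  then show "continuous_on A Du" by (rule lipschitz_on_continuous_on)
qed

context
  fixes B u Du assumes C: "C11 B u Du"
begin

lemma inner_unit_bound: "norm w = 1 \<Longrightarrow> \<bar>v \<bullet> w\<bar> \<le> norm (v::pt)"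
  using Cauchy_Schwarz_ineq2[of v w] by simp

lemma qp_mvt:
  assumes "s > 0" shows "\<exists>r. 0 < r \<and> r < s \<and> qp u x w s = Du (x - r *\<^sub>R w) \<bullet> w"
proof -
  have "((\<lambda>r. u (x - r *\<^sub>R w)) has_real_derivative - (Du (x - r *\<^sub>R w) \<bullet> w)) (at r)" for r
    using line_DERIV[OF C11_derivative[OF C], of x "- w" r] by simp
  from MVT2[OF assms, of "\<lambda>r. u (x - r *\<^sub>R w)" "\<lambda>r. - (Du (x - r *\<^sub>R w) \<bullet> w)", OF this]
  obtain r where "0 < r" "r < s" "u (x - s *\<^sub>R w) - u x = s * - (Du (x - r *\<^sub>R w) \<bullet> w)" by auto
  then show ?thesis using assms by (intro exI[of _ r]) (simp add: qp_def field_simps)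
qed

lemma qp_bounds:
  assumes "s > 0" "norm w = 1"
  shows "\<bar>qp u x w s\<bar> \<le> B" "\<bar>Du x \<bullet> w - qp u x w s\<bar> \<le> B * s" "\<bar>qp u x w s\<bar> \<le> 2 * B / s"
proof -
  obtain r where r: "0 < r" "r < s" "qp u x w s = Du (x - r *\<^sub>R w) \<bullet> w" using qp_mvt[OF assms(1)] by blast
  show "\<bar>qp u x w s\<bar> \<le> B"
    unfolding r(3) using inner_unit_bound[OF assms(2)] C11_grad_bound[OF C] by (rule order_trans)
  have "\<bar>Du x \<bullet> w - qp u x w s\<bar> \<le> norm (Du x - Du (x - r *\<^sub>R w))"
    unfolding r(3) inner_diff_left[symmetric] by (rule inner_unit_bound[OF assms(2)])
  also have "\<dots> \<le> B * norm (r *\<^sub>R w)" using C11_grad_Lipschitz[OF C, of x "x - r *\<^sub>R w"] by simp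
  also have "\<dots> \<le> B * s" using r assms(2) C11_ge_1[OF C] by simp
  finally show "\<bar>Du x \<bullet> w - qp u x w s\<bar> \<le> B * s" .
  have "\<bar>u x - u (x - s *\<^sub>R w)\<bar> \<le> 2 * B" using C11_bound[OF C, of x] C11_bound[OF C, of "x - s *\<^sub>R w"] by linarith
  then show "\<bar>qp u x w s\<bar> \<le> 2 * B / s" using assms by (simp add: qp_def abs_divide divide_right_mono)
qed

lemma qm_bounds:
  assumes "s > 0" "norm w = 1"
  shows "\<bar>qm u x w s\<bar> \<le> B" "\<bar>Du x \<bullet> w - qm u x w s\<bar> \<le> B * s" "\<bar>qm u x w s\<bar> \<le> 2 * B / s"
  using qp_bounds[of s "- w" x] assms unfolding qm_qp by (auto simp: abs_minus_commute)

text \<open>For small s both quotients lie within B * s of the common slope at x; for large s each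
  is at most 2 * B / s. A power of s is gained at either end, which makes the weight
  \<open>s powr (- 1 - a)\<close> integrable.\<close>

lemma qp_qm_diff:
  assumes "s > 0" "norm w = 1"
  shows "\<bar>qp u x w s - qm u x w s\<bar> \<le> 4 * B * min s (1 / s)"
proof -
  have "\<bar>qp u x w s - qm u x w s\<bar> \<le> 2 * (B * s)" "\<bar>qp u x w s - qm u x w s\<bar> \<le> 2 * (2 * B / s)"
    using qp_bounds[OF assms, of x] qm_bounds[OF assms, of x] by linarith+
  moreover have "2 * (B * s) \<le> 4 * B * s" using C11_ge_1[OF C] assms by simp
  ultimately show ?thesis by (auto simp: min_def)
qed

lemma grad_dir_bound: "norm w = 1 \<Longrightarrow> \<bar>Du x \<bullet> w\<bar> \<le> B"
  using inner_unit_bound[of w "Du x"] C11_grad_bound[OF C, of x] by linarith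

lemma Psi_qp_qm_bound:
  assumes "s > 0" "norm w = 1" "0 \<le> a" "a \<le> 1/2"
  shows "\<bar>Psi a (Du x \<bullet> w) (qp u x w s) - Psi a (Du x \<bullet> w) (qm u x w s)\<bar> \<le> 20 * B\<^sup>2 * min s (1 / s)"
proof -
  have "\<bar>Psi a (Du x \<bullet> w) (qp u x w s) - Psi a (Du x \<bullet> w) (qm u x w s)\<bar> \<le> 5 * B * \<bar>qp u x w s - qm u x w s\<bar>"
    by (intro Psi_Lipschitz assms C11_ge_1[OF C] grad_dir_bound qp_bounds qm_bounds)
  also have "\<dots> \<le> 5 * B * (4 * B * min s (1 / s))"
    using C11_ge_1[OF C] by (intro mult_left_mono qp_qm_diff assms) auto
  finally show ?thesis by (simp add: power2_eq_square)
qed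

end

section \<open>The principal value as an absolutely convergent integral\<close>

text \<open>A majorant of s^(-1-a) * min(s, 1/s) that is independent of a: the product is s^(-a), at
  most s^(-1/2), on the unit interval, and s^(-2-a), at most s^(-2), beyond it.\<close>

definition mu :: "real \<Rightarrow> real" where
  "mu s = indicator {0..1} s * s powr (- 1/2) + indicator {1..} s * (1 / s\<^sup>2)"

lemma mu_nonneg: "0 \<le> mu s" by (simp add: mu_def)

lemma mu_measurable [measurable]: "mu \<in> borel_measurable borel"
  unfolding mu_def[abs_def] by measurable

lemma inv_square_integrable:
  "integrable lborel (\<lambda>s::real. indicator {1..} s * (1 / s\<^sup>2))"
proof (rule integrableI_bounded)
  have "(\<integral>\<^sup>+s. ennreal (1 / s\<^sup>2) * indicator {1..} (s::real) \<partial>lborel) = ennreal (0 - (- 1 / 1))"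
  proof (rule nn_integral_FTC_atLeast[where F="\<lambda>s. - 1 / s" and T=0])
    fix x :: real assume "1 \<le> x"
    then show "((\<lambda>s. - 1 / s) has_real_derivative 1 / x\<^sup>2) (at x)"
      by (auto intro!: derivative_eq_intros simp: power2_eq_square)
    show "0 \<le> 1 / x\<^sup>2" by simp
  next
    have "((\<lambda>s::real. - 1 * inverse s) \<longlongrightarrow> - 1 * 0) at_top"
      by (intro tendsto_mult tendsto_const tendsto_inverse_0_at_top filterlim_ident)
    then show "((\<lambda>s::real. - 1 / s) \<longlongrightarrow> 0) at_top" by (simp add: divide_inverse)
  qed measurable
  then show "(\<integral>\<^sup>+s. ennreal (norm (indicator {1..} (s::real) * (1 / s\<^sup>2))) \<partial>lborel) < \<infinity>"
  proof -
    assume *: "(\<integral>\<^sup>+s. ennreal (1 / s\<^sup>2) * indicator {1..} (s::real) \<partial>lborel) = ennreal (0 - (- 1 / 1))"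
    have "(\<integral>\<^sup>+s. ennreal (norm (indicator {1..} (s::real) * (1 / s\<^sup>2))) \<partial>lborel) = (\<integral>\<^sup>+s. ennreal (1 / s\<^sup>2) * indicator {1..} (s::real) \<partial>lborel)"
      by (intro nn_integral_cong) (auto simp: indicator_def)
    then show ?thesis unfolding * by simp
  qed
qed measurable

lemma mu_integrable: "integrable lborel mu"
  unfolding mu_def
proof (rule Bochner_Integration.integrable_add[OF _ inv_square_integrable])
  show "integrable lborel (\<lambda>s::real. indicator {0..1} s * s powr (- 1/2))"
  proof (rule integrableI_bounded)
    have "((\<lambda>x::real. x powr (- 1/2)) has_integral (1 powr (- 1/2 + 1) / (- 1/2 + 1))) {0..1}"
      by (rule has_integral_powr_from_0) auto
    then have "integral\<^sup>N lborel (\<lambda>x. ennreal (indicator {0..1} x * x powr (- 1/2))) = ennreal (1 powr (- 1/2 + 1) / (- 1/2 + 1))"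
      by (rule nn_integral_has_integral_lebesgue[rotated]) auto
    then show "(\<integral>\<^sup>+s. ennreal (norm (indicator {0..1} (s::real) * s powr (- 1/2))) \<partial>lborel) < \<infinity>" by simp
  qed measurable
qed

lemma cauchy_density_integrable: "integrable lborel (\<lambda>t::real. 1 / (1 + t\<^sup>2))"
proof (rule Bochner_Integration.integrable_bound)
  have i: "integrable lborel (\<lambda>s::real. indicator {1..} (- s) * (1 / (- s)\<^sup>2))"
    using lborel_integrable_real_affine[OF inv_square_integrable, of "-1" 0] by simp
  show "integrable lborel (\<lambda>t::real. indicator {-1..1} t + indicator {1..} t * (1 / t\<^sup>2) + indicator {1..} (- t) * (1 / (- t)\<^sup>2))"
    by (intro Bochner_Integration.integrable_add i inv_square_integrable integrable_real_indicator) auto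
  have "1 / (1 + t\<^sup>2) \<le> indicator {-1..1} t + indicator {1..} t * (1 / t\<^sup>2) + indicator {1..} (- t) * (1 / (- t)\<^sup>2)" for t :: real
  proof (cases "t \<in> {-1..1}")
    case True
    then have "1 / (1 + t\<^sup>2) \<le> indicator {-1..1} t" using one_plus_sq_pos[of t] by simp
    then show ?thesis by (simp add: add_increasing2)
  next
    case False
    then have "t\<^sup>2 > 0" by auto
    then have "1 / (1 + t\<^sup>2) \<le> 1 / t\<^sup>2" using one_plus_sq_pos[of t] by (intro divide_left_mono) auto
    moreover have "t > 1 \<or> t < -1" using False by auto
    ultimately show ?thesis by auto
  qed
  then show "AE t in lborel. norm (1 / (1 + t\<^sup>2)) \<le> norm (indicator {-1..1} t + indicator {1..} t * (1 / t\<^sup>2) + indicator {1..} (- t) * (1 / (- t)\<^sup>2) :: real)"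
    by (intro AE_I2) (simp add: add_nonneg_nonneg)
qed measurable

text \<open>The factor 1 / (1 + t^2) is the angular density that belongs to the slope coordinate;
  its product with \<open>mu\<close> dominates, up to constants, the integrands over slope and
  radius.\<close>

definition wgt :: "real \<times> real \<Rightarrow> real" where
  "wgt z = 1 / (1 + (fst z)\<^sup>2) * mu (snd z)"

lemma wgt_nonneg: "0 \<le> wgt z"
  using mu_nonneg by (simp add: wgt_def add_nonneg_nonneg)

lemma wgt_integrable: "integrable (lborel \<Otimes>\<^sub>M lborel) wgt"
  using tensor_integral(1)[OF cauchy_density_integrable mu_integrable] by (simp add: wgt_def[abs_def] lborel_prod)

lemma powr_min_le_mu:
  assumes "0 \<le> a" "a \<le> 1/2" "s > 0"
  shows "s powr (- 1 - a) * min s (1 / s) \<le> mu s"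
proof (cases "s \<le> 1")
  case True
  have "1 \<le> 1 / s" using True assms by simp
  then have "s \<le> 1 / s" using True by linarith
  then have "min s (1 / s) = s powr 1" using assms by simp
  moreover have "s powr (- 1 - a) * s powr 1 = s powr ((- 1 - a) + 1)" by (rule powr_add[symmetric])
  ultimately have "s powr (- 1 - a) * min s (1 / s) = s powr (- a)" by simp
  also have "\<dots> \<le> s powr (- 1/2)" using True assms by (intro powr_mono') auto
  also have "\<dots> \<le> mu s" using True assms by (simp add: mu_def)
  finally show ?thesis .
next
  case False
  then have "1 / s \<le> 1" by simp
  then have "1 / s \<le> s" using False by linarith
  then have "min s (1 / s) = s powr (- 1)" using assms by (simp add: min_def powr_minus_divide)
  moreover have "s powr (- 1 - a) * s powr (- 1) = s powr ((- 1 - a) + (- 1))" by (rule powr_add[symmetric])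
  moreover have "(- 1 - a) + (- 1) = - 2 - a" by simp
  ultimately have "s powr (- 1 - a) * min s (1 / s) = s powr (- 2 - a)" by simp
  also have "\<dots> \<le> s powr (- 2)" using False assms by (intro powr_mono) auto
  also have "\<dots> = 1 / s\<^sup>2" using assms by (simp add: powr_minus_divide)
  also have "\<dots> = mu s" using False by (simp add: mu_def)
  finally show ?thesis .
qed

text \<open>Away from 0 the factor 1/s alone suffices. The cube comes from s^(-2-a) <= s0^(-3) for s
  between s0 and 1; it reappears with s0 = 1 / (4 B) as the factor (4 B)^3 in the maximum
  principle.\<close>

lemma powr_far_le_mu:
  assumes "0 \<le> a" "a \<le> 1/2" "0 < s0" "s0 \<le> 1" "s0 \<le> s"
  shows "s powr (- 1 - a) * (1 / s) \<le> (1 / s0) ^ 3 * mu s"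
proof -
  have s: "s > 0" using assms by linarith
  have e: "s powr (- 1 - a) * (1 / s) = s powr (- 2 - a)"
  proof -
    have "1 / s = s powr (- 1)" using s by (simp add: powr_minus_divide)
    moreover have "s powr (- 1 - a) * s powr (- 1) = s powr ((- 1 - a) + (- 1))" by (rule powr_add[symmetric])
    moreover have "(- 1 - a) + (- 1) = - 2 - a" by simp
    ultimately show ?thesis by simp
  qed
  have g1: "1 \<le> (1 / s0) ^ 3" using assms by (intro one_le_power) simp
  show ?thesis
  proof (cases "s \<le> 1")
    case True
    have "s powr (- 2 - a) \<le> s0 powr (- 2 - a)" using assms s by (intro powr_mono2') auto
    also have "\<dots> \<le> s0 powr (- 3)" using assms by (intro powr_mono') auto
    also have "\<dots> = (1 / s0) ^ 3" using assms by (simp add: powr_minus_divide power_one_over)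
    also have "\<dots> \<le> (1 / s0) ^ 3 * mu s"
    proof -
      have "1 \<le> s powr (- 1/2)" using powr_mono'[of "- 1/2" 0 s] True s by simp
      then have "1 \<le> mu s" using True s by (simp add: mu_def add_increasing2)
      then have "(1 / s0) ^ 3 * 1 \<le> (1 / s0) ^ 3 * mu s" using g1 assms by (intro mult_left_mono) auto
      then show ?thesis by simp
    qed
    finally show ?thesis unfolding e .
  next
    case False
    have "s powr (- 2 - a) \<le> s powr (- 2)" using False assms by (intro powr_mono) auto
    also have "\<dots> = mu s" using False s by (simp add: mu_def powr_minus_divide)
    also have "\<dots> \<le> (1 / s0) ^ 3 * mu s" using mult_right_mono[OF g1 mu_nonneg[of s]] by simp
    finally show ?thesis unfolding e .
  qed
qed

definition jj :: "real \<Rightarrow> (pt \<Rightarrow> real) \<Rightarrow> (pt \<Rightarrow> pt) \<Rightarrow> pt \<Rightarrow> pt \<Rightarrow> real \<Rightarrow> real" where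
  "jj a u Du x w s = s powr (- 1 - a) * (Psi a (Du x \<bullet> w) (qp u x w s) - Psi a (Du x \<bullet> w) (qm u x w s))"

definition jz :: "real \<Rightarrow> (pt \<Rightarrow> real) \<Rightarrow> (pt \<Rightarrow> pt) \<Rightarrow> pt \<Rightarrow> real \<times> real \<Rightarrow> real" where
  "jz a u Du x z = indicator {0<..} (snd z) * (1 / (1 + (fst z)\<^sup>2) * jj a u Du x (dir (fst z)) (snd z))"

text \<open>The regularised form of the principal value: the difference of the two values of \<open>Psi\<close> cancels the
  singularity at \<open>s = 0\<close> and the slow decay at infinity.\<close>

definition JJ :: "real \<Rightarrow> (pt \<Rightarrow> real) \<Rightarrow> (pt \<Rightarrow> pt) \<Rightarrow> pt \<Rightarrow> real" where
  "JJ a u Du x = (\<integral>z. jz a u Du x z \<partial>(lborel \<Otimes>\<^sub>M lborel))"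

text \<open>The kernel with an explicit gradient field in place of \<open>grad\<close>, which is
  built from a choice and determined only almost everywhere.\<close>

definition krep :: "real \<Rightarrow> (pt \<Rightarrow> real) \<Rightarrow> (pt \<Rightarrow> pt) \<Rightarrow> pt \<Rightarrow> pt \<Rightarrow> real" where
  "krep a u Du x y = ((Du x - Du (x - y)) \<bullet> y) / ((norm y)\<^sup>2 + (u x - u (x - y))\<^sup>2) powr ((3 + a) / 2)"

text \<open>The boundary term of the integration by parts. Its s-derivative, written out in
  \<open>bdry'\<close>, carries exactly the gradients at \<open>x - s *\<^sub>R w\<close> and
  \<open>x + s *\<^sub>R w\<close> that occur in the kernel, and its values tend to 0 at both ends
  of the half line.\<close>

definition bdry :: "real \<Rightarrow> (pt \<Rightarrow> real) \<Rightarrow> pt \<Rightarrow> pt \<Rightarrow> real \<Rightarrow> real" where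
  "bdry a u x w s = s powr (- a) * (Phi a (qp u x w s) - Phi a (qm u x w s))"

definition bdry' :: "real \<Rightarrow> (pt \<Rightarrow> real) \<Rightarrow> (pt \<Rightarrow> pt) \<Rightarrow> pt \<Rightarrow> pt \<Rightarrow> real \<Rightarrow> real" where
  "bdry' a u Du x w s = s powr (- 1 - a) * (phi a (qp u x w s) * (Du (x - s *\<^sub>R w) \<bullet> w - qp u x w s)
     - phi a (qm u x w s) * (Du (x + s *\<^sub>R w) \<bullet> w - qm u x w s) - a * (Phi a (qp u x w s) - Phi a (qm u x w s)))"

lemma krep_ray:
  assumes s: "s > 0" and w: "norm w = 1"
  shows "s * krep a u Du x (s *\<^sub>R w) = s powr (- 1 - a) * ((Du x \<bullet> w - Du (x - s *\<^sub>R w) \<bullet> w) * phi a (qp u x w s))"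
proof -
  let ?q = "qp u x w s"
  have du: "u x - u (x - s *\<^sub>R w) = s * ?q" using s by (simp add: qp_def)
  have "(norm (s *\<^sub>R w))\<^sup>2 + (u x - u (x - s *\<^sub>R w))\<^sup>2 = s\<^sup>2 * (1 + ?q\<^sup>2)"
    using w s by (simp add: du power_mult_distrib algebra_simps)
  then have "((norm (s *\<^sub>R w))\<^sup>2 + (u x - u (x - s *\<^sub>R w))\<^sup>2) powr ((3 + a) / 2)
     = (s powr 2) powr ((3 + a) / 2) * (1 + ?q\<^sup>2) powr ((3 + a) / 2)"
    using s one_plus_sq_pos[of ?q] by (simp add: powr_mult)
  also have "(s powr 2) powr ((3 + a) / 2) = s powr (3 + a)"
    unfolding powr_powr by (rule arg_cong[where f="\<lambda>r. s powr r"]) simp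
  finally have den: "((norm (s *\<^sub>R w))\<^sup>2 + (u x - u (x - s *\<^sub>R w))\<^sup>2) powr ((3 + a) / 2) = s powr (3 + a) * (1 + ?q\<^sup>2) powr ((3 + a) / 2)" .
  have ph: "phi a ?q = 1 / (1 + ?q\<^sup>2) powr ((3 + a) / 2)"
  proof -
    have "- (3 + a) / 2 = - ((3 + a) / 2)" by (rule minus_divide_left[symmetric])
    then show ?thesis unfolding phi_def by (simp only: powr_minus_divide)
  qed
  have "s * (s / s powr (3 + a)) = s powr 2 / s powr (3 + a)" using s by (simp add: power2_eq_square)
  also have "\<dots> = s powr (2 - (3 + a))" by (rule powr_diff[symmetric])
  also have "2 - (3 + a) = - 1 - a" by simp
  finally have pw: "s * (s / s powr (3 + a)) = s powr (- 1 - a)" .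
  have "s * krep a u Du x (s *\<^sub>R w) = (s * (s / s powr (3 + a))) * ((Du x \<bullet> w - Du (x - s *\<^sub>R w) \<bullet> w) * phi a ?q)"
  proof -
    have n: "(Du x - Du (x - s *\<^sub>R w)) \<bullet> (s *\<^sub>R w) = s * (Du x \<bullet> w - Du (x - s *\<^sub>R w) \<bullet> w)"
      by (simp add: inner_diff_left)
    show ?thesis unfolding krep_def den ph n by simp
  qed
  then show ?thesis unfolding pw .
qed

text \<open>The gradients at the two moving points cancel against those in \<open>bdry'\<close>,
  leaving \<open>Psi\<close> with the slope frozen at x. The summand \<open>- a * Phi a q\<close> of
  \<open>Psi\<close> compensates the derivative of the factor \<open>s powr (- a)\<close>.\<close>

lemma krep_line:
  assumes s: "s > 0" and w: "norm w = 1"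
  shows "s * (krep a u Du x (s *\<^sub>R w) + krep a u Du x (- (s *\<^sub>R w))) = jj a u Du x w s - bdry' a u Du x w s"
proof -
  have "phi a (qp u x (- w) s) = phi a (qm u x w s)" by (simp add: qm_qp phi_def)
  then have 2: "s * krep a u Du x (- (s *\<^sub>R w)) = s powr (- 1 - a) * (- (Du x \<bullet> w - Du (x + s *\<^sub>R w) \<bullet> w) * phi a (qm u x w s))"
    using krep_ray[of s "- w" a u Du x] s w by simp
  show ?thesis
    unfolding distrib_left krep_ray[OF assms] 2 jj_def bdry'_def Psi_def by (simp add: algebra_simps)
qed

lemma qp_qm_measurable [measurable (raw)]:
  assumes [measurable]: "u \<in> borel_measurable borel" "f \<in> borel_measurable M" "g \<in> borel_measurable M" "h \<in> borel_measurable M"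
  shows "(\<lambda>z. qp u (f z) (g z) (h z)) \<in> borel_measurable M" "(\<lambda>z. qm u (f z) (g z) (h z)) \<in> borel_measurable M"
  unfolding qp_def qm_def by measurable

context
  fixes B u Du assumes C: "C11 B u Du"
begin

lemma qp_DERIV:
  assumes "s \<noteq> 0"
  shows "((\<lambda>s. qp u x w s) has_real_derivative (Du (x - s *\<^sub>R w) \<bullet> w - qp u x w s) / s) (at s)"
proof -
  have "((\<lambda>s. u (x - s *\<^sub>R w)) has_real_derivative - (Du (x - s *\<^sub>R w) \<bullet> w)) (at s)"
    using line_DERIV[OF C11_derivative[OF C], of x "- w" s] by simp
  then have "((\<lambda>s. (u x - u (x - s *\<^sub>R w)) / s) has_real_derivative
     ((0 - (- (Du (x - s *\<^sub>R w) \<bullet> w))) * s - (u x - u (x - s *\<^sub>R w)) * 1) / (s * s)) (at s)"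
    by (intro DERIV_divide DERIV_diff DERIV_const DERIV_ident assms)
  then show ?thesis unfolding qp_def by (rule DERIV_cong) (use assms in \<open>simp add: field_simps\<close>)
qed

lemma qm_DERIV:
  assumes "s \<noteq> 0"
  shows "((\<lambda>s. qm u x w s) has_real_derivative (Du (x + s *\<^sub>R w) \<bullet> w - qm u x w s) / s) (at s)"
  using DERIV_minus[OF qp_DERIV[OF assms, of x "- w"]] unfolding qm_qp
  by (rule DERIV_cong) (simp add: minus_divide_left)

lemma bdry_DERIV:
  assumes "s > 0"
  shows "(bdry a u x w has_real_derivative bdry' a u Du x w s) (at s)"
proof -
  have p: "((\<lambda>s. s powr (- a)) has_real_derivative - a * s powr (- a - 1)) (at s)"
    using has_real_derivative_powr[OF assms, of "- a"] .
  have s: "s \<noteq> 0" using assms by simp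
  have "((\<lambda>s. Phi a (qp u x w s) - Phi a (qm u x w s)) has_real_derivative
     phi a (qp u x w s) * ((Du (x - s *\<^sub>R w) \<bullet> w - qp u x w s) / s) - phi a (qm u x w s) * ((Du (x + s *\<^sub>R w) \<bullet> w - qm u x w s) / s)) (at s)"
    by (intro DERIV_diff DERIV_chain2[OF Phi_DERIV] qp_DERIV qm_DERIV s)
  from DERIV_mult'[OF p this] have D: "(bdry a u x w has_real_derivative
     s powr (- a) * (phi a (qp u x w s) * ((Du (x - s *\<^sub>R w) \<bullet> w - qp u x w s) / s) - phi a (qm u x w s) * ((Du (x + s *\<^sub>R w) \<bullet> w - qm u x w s) / s))
     + - a * s powr (- a - 1) * (Phi a (qp u x w s) - Phi a (qm u x w s))) (at s)"
    unfolding bdry_def[abs_def] .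
  have e: "s powr (- a) = s powr (- 1 - a) * s" using assms by (simp add: powr_diff powr_minus_divide[symmetric])
  have e2: "- a - 1 = - 1 - a" by simp
  show ?thesis using D unfolding e e2 bdry'_def
    by (rule DERIV_cong) (use s in \<open>simp add: field_simps\<close>)
qed

lemma qp_qm_continuous:
  assumes "0 < c"
  shows "continuous_on {c..d} (\<lambda>s. qp u x w s)" "continuous_on {c..d} (\<lambda>s. qm u x w s)"
  by (intro continuous_at_imp_continuous_on ballI DERIV_isCont[OF qp_DERIV] DERIV_isCont[OF qm_DERIV]; use assms in simp)+

lemma jj_bdry'_continuous:
  assumes "0 < c"
  shows "continuous_on {c..d} (jj a u Du x w)" "continuous_on {c..d} (bdry' a u Du x w)"
proof -
  note q = qp_qm_continuous[OF assms, of d x w]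
  note co = continuous_on_compose2[OF phi_continuous[of UNIV]] continuous_on_compose2[OF Phi_continuous[of UNIV]]
    continuous_on_compose2[OF C11_continuous(2)[OF C, of UNIV]]
  show "continuous_on {c..d} (jj a u Du x w)"
    unfolding jj_def[abs_def] Psi_def using assms by (intro continuous_intros q co) auto
  show "continuous_on {c..d} (bdry' a u Du x w)"
    unfolding bdry'_def[abs_def] using assms by (intro continuous_intros q co) auto
qed

lemma krep_line_integral:
  assumes "0 < c" "c \<le> d" "norm w = 1"
  shows "(\<integral>s. indicator {c<..<d} s * (s * (krep a u Du x (s *\<^sub>R w) + krep a u Du x (- (s *\<^sub>R w)))) \<partial>lborel)
     = (\<integral>s. indicator {c<..<d} s * jj a u Du x w s \<partial>lborel) - (bdry a u x w d - bdry a u x w c)"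
proof -
  have op: "set_integrable lborel {c<..<d} f \<and> (\<integral>s. indicator {c<..<d} s * f s \<partial>lborel) = integral {c..d} f"
    if "continuous_on {c..d} f" for f :: "real \<Rightarrow> real"
  proof -
    have si: "set_integrable lborel {c<..<d} f"
      by (rule set_integrable_subset[OF borel_integrable_atLeastAtMost'[OF that]]) auto
    show ?thesis using si set_borel_integral_eq_integral(2)[OF si]
      by (simp add: set_lebesgue_integral_def integral_open_interval_real)
  qed
  note cj = jj_bdry'_continuous[OF assms(1), of d a x w]
  have "(bdry' a u Du x w has_integral (bdry a u x w d - bdry a u x w c)) {c..d}"
  proof (rule fundamental_theorem_of_calculus[OF assms(2)])
    fix s assume "s \<in> {c..d}"
    then have "s > 0" using assms by simp
    from has_field_derivative_at_within[OF bdry_DERIV[OF this, of a x w]]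
    show "(bdry a u x w has_vector_derivative bdry' a u Du x w s) (at s within {c..d})"
      by (simp add: has_real_derivative_iff_has_vector_derivative)
  qed
  then have ib: "integral {c..d} (bdry' a u Du x w) = bdry a u x w d - bdry a u x w c" by (rule integral_unique)
  have "(\<integral>s. indicator {c<..<d} s * (s * (krep a u Du x (s *\<^sub>R w) + krep a u Du x (- (s *\<^sub>R w)))) \<partial>lborel)
     = (\<integral>s. indicator {c<..<d} s * jj a u Du x w s - indicator {c<..<d} s * bdry' a u Du x w s \<partial>lborel)"
    using assms by (intro Bochner_Integration.integral_cong refl) (auto simp: indicator_def krep_line)
  also have "\<dots> = (\<integral>s. indicator {c<..<d} s * jj a u Du x w s \<partial>lborel) - (\<integral>s. indicator {c<..<d} s * bdry' a u Du x w s \<partial>lborel)"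
    using op[OF cj(1)] op[OF cj(2)] by (intro Bochner_Integration.integral_diff) (auto simp: set_integrable_def)
  finally show ?thesis using op[OF cj(2)] ib by simp
qed

lemma C11_measurable: "u \<in> borel_measurable borel" "Du \<in> borel_measurable borel"
  by (intro borel_measurable_continuous_onI C11_continuous[OF C])+

lemma jz_measurable: "jz a u Du x \<in> borel_measurable (lborel \<Otimes>\<^sub>M lborel)"
proof -
  note [measurable] = C11_measurable
  show ?thesis unfolding jz_def[abs_def] jj_def by measurable
qed

lemma jj_bound:
  assumes "0 \<le> a" "a \<le> 1/2" "s > 0" "norm w = 1"
  shows "\<bar>jj a u Du x w s\<bar> \<le> 20 * B\<^sup>2 * mu s"
proof -
  have "\<bar>jj a u Du x w s\<bar> = s powr (- 1 - a) * \<bar>Psi a (Du x \<bullet> w) (qp u x w s) - Psi a (Du x \<bullet> w) (qm u x w s)\<bar>"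
    by (simp add: jj_def abs_mult)
  also have "\<dots> \<le> s powr (- 1 - a) * (20 * B\<^sup>2 * min s (1 / s))"
    by (intro mult_left_mono Psi_qp_qm_bound[OF C] assms) auto
  also have "\<dots> = 20 * B\<^sup>2 * (s powr (- 1 - a) * min s (1 / s))" by simp
  also have "\<dots> \<le> 20 * B\<^sup>2 * mu s" by (intro mult_left_mono powr_min_le_mu assms) auto
  finally show ?thesis .
qed

lemma jz_bound:
  assumes "0 \<le> a" "a \<le> 1/2"
  shows "\<bar>jz a u Du x z\<bar> \<le> 20 * B\<^sup>2 * wgt z"
proof (cases "snd z > 0")
  case True
  have "\<bar>jz a u Du x z\<bar> = 1 / (1 + (fst z)\<^sup>2) * \<bar>jj a u Du x (dir (fst z)) (snd z)\<bar>"
    using True one_plus_sq_pos[of "fst z"] by (simp add: jz_def abs_mult)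
  also have "\<dots> \<le> 1 / (1 + (fst z)\<^sup>2) * (20 * B\<^sup>2 * mu (snd z))"
    using one_plus_sq_pos[of "fst z"] by (intro mult_left_mono jj_bound assms True) auto
  finally show ?thesis by (simp add: wgt_def)
next
  case False
  then show ?thesis using wgt_nonneg by (simp add: jz_def)
qed

lemma jz_integrable:
  assumes "0 \<le> a" "a \<le> 1/2"
  shows "integrable (lborel \<Otimes>\<^sub>M lborel) (jz a u Du x)"
proof (rule Bochner_Integration.integrable_bound)
  show "integrable (lborel \<Otimes>\<^sub>M lborel) (\<lambda>z. 20 * B\<^sup>2 * wgt z)" by (intro integrable_mult_right wgt_integrable)
  show "AE z in lborel \<Otimes>\<^sub>M lborel. norm (jz a u Du x z) \<le> norm (20 * B\<^sup>2 * wgt z)"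
    using jz_bound[OF assms] wgt_nonneg by (intro AE_I2) (simp add: abs_mult)
qed (rule jz_measurable)

lemma bdry_bound:
  assumes "0 \<le> a" "a \<le> 1/2" "s > 0" "norm w = 1"
  shows "\<bar>bdry a u x w s\<bar> \<le> 4 * B * (s * mu s)"
proof -
  have "\<bar>bdry a u x w s\<bar> \<le> s powr (- a) * \<bar>qp u x w s - qm u x w s\<bar>"
    unfolding bdry_def abs_mult using Phi_Lipschitz[OF assms(1)] by (intro mult_mono) auto
  also have "\<dots> \<le> s powr (- a) * (4 * B * min s (1 / s))"
    by (intro mult_left_mono qp_qm_diff[OF C] assms) auto
  also have "s powr (- a) = s * s powr (- 1 - a)"
    using assms by (simp add: powr_diff powr_minus_divide[symmetric])
  also have "s * s powr (- 1 - a) * (4 * B * min s (1 / s)) = 4 * B * (s * (s powr (- 1 - a) * min s (1 / s)))" by simp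
  also have "\<dots> \<le> 4 * B * (s * mu s)"
    using C11_ge_1[OF C] assms by (intro mult_left_mono powr_min_le_mu) auto
  finally show ?thesis .
qed

end

context
  fixes B u Du assumes C: "C11 B u Du"
begin

text \<open>Polar coordinates reduce the annulus to rays, on which the integration by parts is
  exact. Integrability over the annulus is a hypothesis because it is part of
  \<open>pv_integral\<close>; it yields integrability along almost every line, which is
  enough.\<close>

lemma annulus_integral:
  assumes a: "0 \<le> a" "a \<le> 1/2" and e: "0 < e" "e < 1"
    and int: "set_integrable lborel {y. e < norm y \<and> norm y < 1 / e} (krep a u Du x)"
  shows "integrable lborel (\<lambda>\<tau>. 1 / (1 + \<tau>\<^sup>2) * (bdry a u x (dir \<tau>) (1 / e) - bdry a u x (dir \<tau>) e))"
    and "(LINT y:{y. e < norm y \<and> norm y < 1 / e}|lborel. krep a u Du x y) =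
      (\<integral>z. indicator {e<..<1 / e} (snd z) * jz a u Du x z \<partial>(lborel \<Otimes>\<^sub>M lborel))
      - (\<integral>\<tau>. 1 / (1 + \<tau>\<^sup>2) * (bdry a u x (dir \<tau>) (1 / e) - bdry a u x (dir \<tau>) e) \<partial>lborel)"
proof -
  let ?A = "{y::pt. e < norm y \<and> norm y < 1 / e}"
  let ?k = "\<lambda>y. indicator ?A y * krep a u Du x y"
  have e1: "e < 1 / e" using e by (simp add: field_simps) (smt (verit) mult_less_cancel_left2)
  have k: "integrable lborel ?k" using int by (simp add: set_integrable_def)
  define f where "f \<tau> s = \<bar>s\<bar> / (1 + \<tau>\<^sup>2) * ?k (s *\<^sub>R dir \<tau>)" for \<tau> s
  have fi: "integrable (lborel \<Otimes>\<^sub>M lborel) (\<lambda>(\<tau>, s). f \<tau> s)" unfolding f_def by (rule integral_polar(1)[OF k])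
  define g where "g \<tau> = (\<integral>s. indicator {e<..<1 / e} s * jz a u Du x (\<tau>, s) \<partial>lborel)" for \<tau>
  define b where "b \<tau> = 1 / (1 + \<tau>\<^sup>2) * (bdry a u x (dir \<tau>) (1 / e) - bdry a u x (dir \<tau>) e)" for \<tau>
  have inner: "(\<integral>s. f \<tau> s \<partial>lborel) = g \<tau> - b \<tau>" if "integrable lborel (f \<tau>)" for \<tau>
  proof -
    have "(\<integral>s. f \<tau> s \<partial>lborel) = (\<integral>s. indicator {0<..} s * (f \<tau> s + f \<tau> (- s)) \<partial>lborel)"
      by (rule integral_fold_half_line[OF that])
    also have "\<dots> = (\<integral>s. 1 / (1 + \<tau>\<^sup>2) * (indicator {e<..<1 / e} s * (s * (krep a u Du x (s *\<^sub>R dir \<tau>) + krep a u Du x (- (s *\<^sub>R dir \<tau>))))) \<partial>lborel)"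
      using e by (intro Bochner_Integration.integral_cong refl) (auto simp: f_def indicator_def algebra_simps)
    also have "\<dots> = 1 / (1 + \<tau>\<^sup>2) * ((\<integral>s. indicator {e<..<1 / e} s * jj a u Du x (dir \<tau>) s \<partial>lborel) - (bdry a u x (dir \<tau>) (1 / e) - bdry a u x (dir \<tau>) e))"
      using krep_line_integral[OF C e(1) less_imp_le[OF e1] norm_dir, of a x \<tau>] by simp
    also have "\<dots> = 1 / (1 + \<tau>\<^sup>2) * (\<integral>s. indicator {e<..<1 / e} s * jj a u Du x (dir \<tau>) s \<partial>lborel) - b \<tau>"
      by (simp only: right_diff_distrib b_def)
    also have "1 / (1 + \<tau>\<^sup>2) * (\<integral>s. indicator {e<..<1 / e} s * jj a u Du x (dir \<tau>) s \<partial>lborel) =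
       (\<integral>s. 1 / (1 + \<tau>\<^sup>2) * (indicator {e<..<1 / e} s * jj a u Du x (dir \<tau>) s) \<partial>lborel)"
      by (rule integral_mult_right_zero[symmetric])
    also have "\<dots> = g \<tau>" unfolding g_def jz_def using e
      by (intro Bochner_Integration.integral_cong refl) (auto simp: indicator_def)
    finally show ?thesis .
  qed
  have gi: "integrable (lborel \<Otimes>\<^sub>M lborel) (\<lambda>z. indicator {e<..<1 / e} (snd z) * jz a u Du x z)"
  proof (rule Bochner_Integration.integrable_bound[OF jz_integrable[OF C a, of x]])
    note [measurable] = jz_measurable[OF C]
    show "(\<lambda>z. indicator {e<..<1 / e} (snd z) * jz a u Du x z) \<in> borel_measurable (lborel \<Otimes>\<^sub>M lborel)" by measurable
  qed (auto simp: indicator_def)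
  have ae: "AE \<tau> in lborel. (\<integral>s. f \<tau> s \<partial>lborel) = g \<tau> - b \<tau>"
    using lborel_pair.AE_integrable_fst'[OF fi] by eventually_elim (use inner in auto)
  have g_int: "integrable lborel g"
    using lborel_pair.integrable_fst'[OF gi] by (simp add: g_def[abs_def])
  have f_int: "integrable lborel (\<lambda>\<tau>. \<integral>s. f \<tau> s \<partial>lborel)"
    using lborel_pair.integrable_fst'[OF fi] by simp
  have bm [measurable]: "b \<in> borel_measurable borel"
  proof -
    note [measurable] = C11_measurable(1)[OF C]
    have [measurable]: "(\<lambda>\<tau>. Phi a (qp u x (dir \<tau>) s)) \<in> borel_measurable borel" "(\<lambda>\<tau>. Phi a (qm u x (dir \<tau>) s)) \<in> borel_measurable borel" for s
      by (intro measurable_compose[OF _ phi_Phi_GG_measurable(2)]; measurable)+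
    show ?thesis unfolding b_def[abs_def] bdry_def by measurable
  qed
  \<comment> \<open>Integrability of the boundary contribution is read off from the two other terms
    of the identity, with which it agrees almost everywhere.\<close>
  have "integrable lborel (\<lambda>\<tau>. g \<tau> - (\<integral>s. f \<tau> s \<partial>lborel))" using g_int f_int by simp
  then show bi: "integrable lborel b"
    by (rule integrable_cong_AE_imp) (use ae in \<open>auto elim: eventually_mono\<close>)
  have "(LINT y:?A|lborel. krep a u Du x y) = (\<integral>\<tau>. (\<integral>s. f \<tau> s \<partial>lborel) \<partial>lborel)"
    unfolding f_def integral_polar(2)[OF k, symmetric] by (simp add: set_lebesgue_integral_def)
  also have "\<dots> = (\<integral>\<tau>. g \<tau> - b \<tau> \<partial>lborel)"
    using borel_measurable_integrable[OF f_int] borel_measurable_integrable[OF g_int] ae by (intro integral_cong_AE) auto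
  also have "\<dots> = (\<integral>\<tau>. g \<tau> \<partial>lborel) - (\<integral>\<tau>. b \<tau> \<partial>lborel)" using g_int bi by simp
  also have "(\<integral>\<tau>. g \<tau> \<partial>lborel) = (\<integral>z. indicator {e<..<1 / e} (snd z) * jz a u Du x z \<partial>(lborel \<Otimes>\<^sub>M lborel))"
    using lborel_pair.integral_fst'[OF gi] by (simp add: g_def)
  finally show "(LINT y:?A|lborel. krep a u Du x y) =
      (\<integral>z. indicator {e<..<1 / e} (snd z) * jz a u Du x z \<partial>(lborel \<Otimes>\<^sub>M lborel)) - (\<integral>\<tau>. b \<tau> \<partial>lborel)" .
qed

text \<open>The truncated integrals converge to \<open>JJ\<close> by dominated convergence while the
  boundary terms vanish, so uniqueness of limits forces the value of the principal value. It
  suffices to let the radius run through one sequence.\<close>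

lemma pv_krep_eq_JJ:
  assumes a: "0 \<le> a" "a \<le> 1/2" and pv: "pv_integral (krep a u Du x) v"
  shows "v = JJ a u Du x"
proof -
  let ?A = "\<lambda>e. {y::pt. e < norm y \<and> norm y < 1 / e}"
  define X where "X n = 1 / (real n + 2)" for n
  have X: "0 < X n" "X n < 1" for n by (auto simp: X_def)
  have Xl: "X \<longlonglongrightarrow> 0"
    unfolding X_def by real_asymp
  have X0: "filterlim X (at_right 0) sequentially"
  proof -
    have "X n \<noteq> 0" for n using X(1)[of n] by simp
    then show ?thesis using Xl X by (simp add: filterlim_at)
  qed
  have lim: "(\<lambda>n. LINT y:?A (X n)|lborel. krep a u Du x y) \<longlonglongrightarrow> v"
    using filterlim_compose[OF _ X0] pv unfolding pv_integral_def by blast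
  have si: "\<forall>\<^sub>F n in sequentially. set_integrable lborel (?A (X n)) (krep a u Du x)"
    using filterlim_iff[THEN iffD1, OF X0] pv unfolding pv_integral_def by blast
  let ?g = "\<lambda>n. \<integral>z. indicator {X n<..<1 / X n} (snd z) * jz a u Du x z \<partial>(lborel \<Otimes>\<^sub>M lborel)"
  let ?b = "\<lambda>n. \<integral>\<tau>. 1 / (1 + \<tau>\<^sup>2) * (bdry a u x (dir \<tau>) (1 / X n) - bdry a u x (dir \<tau>) (X n)) \<partial>lborel"
  note [measurable] = jz_measurable[OF C]
  have g: "?g \<longlonglongrightarrow> (\<integral>z. jz a u Du x z \<partial>(lborel \<Otimes>\<^sub>M lborel))"
  proof (rule integral_dominated_convergence[where w="\<lambda>z. \<bar>jz a u Du x z\<bar>"])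
    show "integrable (lborel \<Otimes>\<^sub>M lborel) (\<lambda>z. \<bar>jz a u Du x z\<bar>)" using jz_integrable[OF C a] by simp
    show "AE z in lborel \<Otimes>\<^sub>M lborel. (\<lambda>n. indicator {X n<..<1 / X n} (snd z) * jz a u Du x z) \<longlonglongrightarrow> jz a u Du x z"
    proof (intro AE_I2)
      fix z
      show "(\<lambda>n. indicator {X n<..<1 / X n} (snd z) * jz a u Du x z) \<longlonglongrightarrow> jz a u Du x z"
      proof (cases "snd z > 0")
        case True
        have "\<forall>\<^sub>F n in sequentially. X n < snd z" using order_tendstoD(2)[OF Xl True] .
        moreover have "\<forall>\<^sub>F n in sequentially. snd z < 1 / X n"
        proof -
          have "\<forall>\<^sub>F n in sequentially. X n < 1 / snd z" using order_tendstoD(2)[OF Xl, of "1 / snd z"] True by simp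
          then show ?thesis
          proof eventually_elim
            case (elim n)
            then show ?case using X(1)[of n] True by (simp add: field_simps)
          qed
        qed
        ultimately have "\<forall>\<^sub>F n in sequentially. indicator {X n<..<1 / X n} (snd z) * jz a u Du x z = jz a u Du x z"
          by eventually_elim simp
        then show ?thesis by (rule tendsto_eventually)
      qed (simp add: jz_def)
    qed
    show "AE z in lborel \<Otimes>\<^sub>M lborel. norm (indicator {X n<..<1 / X n} (snd z) * jz a u Du x z) \<le> \<bar>jz a u Du x z\<bar>" for n
      by (intro AE_I2) (auto simp: indicator_def)
  qed measurable
  have b: "?b \<longlonglongrightarrow> 0"
  proof (rule Lim_null_comparison)
    let ?W = "\<integral>\<tau>. 1 / (1 + \<tau>\<^sup>2) \<partial>(lborel :: real measure)"
    \<comment> \<open>\<open>bdry_bound\<close> controls the boundary terms by s * mu s, which is of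
      order e at the outer radius 1/e and of order e^(1/2) at the inner radius e.\<close>
    have muX: "1 / X n * mu (1 / X n) = X n" "X n * mu (X n) = X n powr (1/2)" for n
    proof -
      have "1 / X n > 1" using X[of n] by simp
      then show "1 / X n * mu (1 / X n) = X n" using X[of n] by (simp add: mu_def power2_eq_square)
      have "X n * mu (X n) = X n powr 1 * X n powr (- 1/2)" using X[of n] by (simp add: mu_def)
      also have "\<dots> = X n powr (1 + (- 1/2))" by (rule powr_add[symmetric])
      finally show "X n * mu (X n) = X n powr (1/2)" by simp
    qed
    have "norm (?b n) \<le> ?W * (4 * B * (X n + X n powr (1/2)))" if "set_integrable lborel (?A (X n)) (krep a u Du x)" for n
    proof -
      have "norm (?b n) \<le> (\<integral>\<tau>. 1 / (1 + \<tau>\<^sup>2) * (4 * B * (X n + X n powr (1/2))) \<partial>lborel)"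
      proof (rule Bochner_Integration.integral_norm_bound_integral)
        show "integrable lborel (\<lambda>\<tau>. 1 / (1 + \<tau>\<^sup>2) * (bdry a u x (dir \<tau>) (1 / X n) - bdry a u x (dir \<tau>) (X n)))"
          by (rule annulus_integral(1)[OF a X that])
        show "integrable lborel (\<lambda>\<tau>. 1 / (1 + \<tau>\<^sup>2) * (4 * B * (X n + X n powr (1/2))))"
          by (intro integrable_mult_left cauchy_density_integrable)
        fix \<tau> :: real
        have "\<bar>bdry a u x (dir \<tau>) (1 / X n)\<bar> \<le> 4 * B * X n" "\<bar>bdry a u x (dir \<tau>) (X n)\<bar> \<le> 4 * B * X n powr (1/2)"
          using bdry_bound[OF C a _ norm_dir, of "1 / X n" x \<tau>] bdry_bound[OF C a _ norm_dir, of "X n" x \<tau>] X[of n] muX[of n]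
          unfolding muX by auto
        then have "\<bar>bdry a u x (dir \<tau>) (1 / X n) - bdry a u x (dir \<tau>) (X n)\<bar> \<le> 4 * B * (X n + X n powr (1/2))"
          by (simp add: distrib_left)
        then show "norm (1 / (1 + \<tau>\<^sup>2) * (bdry a u x (dir \<tau>) (1 / X n) - bdry a u x (dir \<tau>) (X n))) \<le> 1 / (1 + \<tau>\<^sup>2) * (4 * B * (X n + X n powr (1/2)))"
          using one_plus_sq_pos[of \<tau>] unfolding real_norm_def abs_mult by (intro mult_mono) auto
      qed
      then show ?thesis by (simp only: integral_mult_left_zero)
    qed
    then show "\<forall>\<^sub>F n in sequentially. norm (?b n) \<le> ?W * (4 * B * (X n + X n powr (1/2)))"
      using si by (auto elim: eventually_mono)
    have "(\<lambda>n. ?W * (4 * B * (X n + X n powr (1/2)))) \<longlonglongrightarrow> ?W * (4 * B * (0 + 0 powr (1/2)))"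
      using X by (intro tendsto_intros Xl tendsto_powr') (auto intro!: always_eventually less_imp_le)
    then show "(\<lambda>n. ?W * (4 * B * (X n + X n powr (1/2)))) \<longlonglongrightarrow> 0" by simp
  qed
  have "(\<lambda>n. ?g n - ?b n) \<longlonglongrightarrow> JJ a u Du x - 0" unfolding JJ_def by (rule tendsto_diff[OF g b])
  moreover have "\<forall>\<^sub>F n in sequentially. ?g n - ?b n = (LINT y:?A (X n)|lborel. krep a u Du x y)"
    using si by eventually_elim (simp add: annulus_integral(2)[OF a X])
  ultimately have "(\<lambda>n. LINT y:?A (X n)|lborel. krep a u Du x y) \<longlonglongrightarrow> JJ a u Du x"
    by (simp add: tendsto_cong)
  then show ?thesis using lim LIMSEQ_unique by blast
qed

text \<open>Continuity is what upgrades the equation from almost every x to every x, in particular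
  to a maximum point.\<close>

lemma JJ_continuous:
  assumes a: "0 \<le> a" "a \<le> 1/2"
  shows "continuous_on UNIV (JJ a u Du)"
  unfolding continuous_on_sequentially comp_def
proof (intro allI ballI impI, elim conjE)
  fix X :: "nat \<Rightarrow> pt" and x assume X: "X \<longlonglongrightarrow> x"
  note [measurable] = jz_measurable[OF C]
  have uc: "(\<lambda>n. u (f n)) \<longlonglongrightarrow> u y" "(\<lambda>n. Du (f n)) \<longlonglongrightarrow> Du y" if "f \<longlonglongrightarrow> y" for f :: "nat \<Rightarrow> pt" and y
    using C11_continuous[OF C, of UNIV] that by (auto intro: continuous_on_tendsto_compose)
  show "(\<lambda>n. JJ a u Du (X n)) \<longlonglongrightarrow> JJ a u Du x"
    unfolding JJ_def
  proof (rule integral_dominated_convergence[where w="\<lambda>z. 20 * B\<^sup>2 * wgt z"])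
    show "integrable (lborel \<Otimes>\<^sub>M lborel) (\<lambda>z. 20 * B\<^sup>2 * wgt z)" by (intro integrable_mult_right wgt_integrable)
    show "AE z in lborel \<Otimes>\<^sub>M lborel. norm (jz a u Du (X n) z) \<le> 20 * B\<^sup>2 * wgt z" for n
      using jz_bound[OF C a] by simp
    show "AE z in lborel \<Otimes>\<^sub>M lborel. (\<lambda>n. jz a u Du (X n) z) \<longlonglongrightarrow> jz a u Du x z"
    proof (intro AE_I2)
      fix z :: "real \<times> real"
      show "(\<lambda>n. jz a u Du (X n) z) \<longlonglongrightarrow> jz a u Du x z"
      proof (cases "snd z > 0")
        case True
        let ?w = "dir (fst z)" and ?s = "snd z"
        have q: "(\<lambda>n. qp u (X n) ?w ?s) \<longlonglongrightarrow> qp u x ?w ?s" "(\<lambda>n. qm u (X n) ?w ?s) \<longlonglongrightarrow> qm u x ?w ?s"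
          unfolding qp_def qm_def using True by (intro tendsto_intros uc X; simp)+
        have D: "(\<lambda>n. Du (X n) \<bullet> ?w) \<longlonglongrightarrow> Du x \<bullet> ?w" by (intro tendsto_intros uc X)
        have P: "(\<lambda>n. Psi a (Du (X n) \<bullet> ?w) (r n)) \<longlonglongrightarrow> Psi a (Du x \<bullet> ?w) r0" if "r \<longlonglongrightarrow> r0" for r r0
          using continuous_on_tendsto_compose[OF Psi_continuous[of a] tendsto_Pair[OF D that]] by simp
        show ?thesis unfolding jz_def jj_def by (intro tendsto_mult tendsto_const tendsto_diff P q)
      qed (simp add: jz_def)
    qed
  qed measurable
qed

end

text \<open>For almost every x the functions agree at x itself, and reflection y -> x - y shows that
  they agree at \<open>x - y\<close> for almost every y. The two kernels then differ on a null set
  of y, invisible to every truncated integral.\<close>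

lemma kernel_pv_imp_krep_pv:
  assumes m: "u \<in> borel_measurable borel" "v \<in> borel_measurable borel" "wd 1 0 u \<in> borel_measurable borel" "wd 0 1 u \<in> borel_measurable borel"
      "Dv \<in> borel_measurable borel"
    and ae: "AE x in lborel. u x = v x" "AE x in lborel. grad u x = Dv x"
  shows "AE x in lborel. \<forall>r. pv_integral (kernel a u x) r \<longrightarrow> pv_integral (krep a v Dv x) r"
  using ae
proof eventually_elim
  case (elim x)
  have [measurable]: "grad u \<in> borel_measurable borel" unfolding grad_def[abs_def] using m by measurable
  note [measurable] = m
  have eq: "AE y in lborel. kernel a u x y = krep a v Dv x y"
    using AE_lborel_reflect[OF ae(1), of x] AE_lborel_reflect[OF ae(2), of x]
    by eventually_elim (simp add: kernel_def krep_def elim)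
  have [measurable]: "kernel a u x \<in> borel_measurable borel" "krep a v Dv x \<in> borel_measurable borel"
    unfolding kernel_def[abs_def] krep_def[abs_def] by measurable
  have A [measurable]: "{y::pt. e < norm y \<and> norm y < 1 / e} \<in> sets borel" for e :: real by measurable
  have si: "set_integrable lborel {y. e < norm y \<and> norm y < 1 / e} (kernel a u x) = set_integrable lborel {y. e < norm y \<and> norm y < 1 / e} (krep a v Dv x)" for e
    unfolding set_integrable_def using eq by (intro integrable_cong_AE) (auto elim: eventually_mono)
  have li: "(LINT y:{y. e < norm y \<and> norm y < 1 / e}|lborel. kernel a u x y) = (LINT y:{y. e < norm y \<and> norm y < 1 / e}|lborel. krep a v Dv x y)" for e
    unfolding set_lebesgue_integral_def using eq by (intro integral_cong_AE) (auto elim: eventually_mono)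
  show ?case unfolding pv_integral_def si li by blast
qed

section \<open>Maximum principle and dependence on the exponent\<close>

definition weight_total :: real where "weight_total = (\<integral>z. wgt z \<partial>(lborel \<Otimes>\<^sub>M lborel))"

text \<open>At a maximum point of \<open>u - v\<close> the slopes satisfy \<open>qp u \<ge> qp v\<close> and \<open>qm u \<le> qm v\<close>; since \<open>Psi\<close> is
  decreasing near \<open>Du x \<bullet> w\<close>, small \<open>s\<close> contribute a nonpositive amount, and large \<open>s\<close> at most
  a multiple of \<open>u x - v x\<close>.\<close>

lemma JJ_max_principle:
  assumes u: "C11 B u Du" and v: "C11 B v Dv" and a: "0 \<le> a" "a \<le> 1/2"
    and D: "Du x = Dv x" and mx: "\<And>y. \<bar>u y - v y\<bar> \<le> u x - v x"
  shows "JJ a u Du x - JJ a v Dv x \<le> 20 * B * (4 * B) ^ 3 * weight_total * (u x - v x)"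
proof -
  let ?m = "u x - v x"
  have B1: "1 \<le> B" using C11_ge_1[OF u] .
  have m0: "0 \<le> ?m" using mx[of x] by simp
  have bound: "jz a u Du x z - jz a v Dv x z \<le> 20 * B * (4 * B) ^ 3 * ?m * wgt z" for z
  proof (cases "snd z > 0")
    case False
    then show ?thesis using wgt_nonneg[of z] m0 B1 by (simp add: jz_def)
  next
    case s: True
    let ?s = "snd z" and ?w = "dir (fst z)"
    let ?P = "Psi a (Dv x \<bullet> ?w)"
    define X where "X = (?P (qp u x ?w ?s) - ?P (qp v x ?w ?s)) - (?P (qm u x ?w ?s) - ?P (qm v x ?w ?s))"
    have eq: "jz a u Du x z - jz a v Dv x z = 1 / (1 + (fst z)\<^sup>2) * (?s powr (- 1 - a) * X)"
      using s by (simp add: jz_def jj_def D X_def algebra_simps add_divide_distrib diff_divide_distrib)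
    have qpd: "qp u x ?w ?s - qp v x ?w ?s = (?m - (u (x - ?s *\<^sub>R ?w) - v (x - ?s *\<^sub>R ?w))) / ?s"
      by (simp add: qp_def diff_divide_distrib)
    have qmd: "qm u x ?w ?s - qm v x ?w ?s = - ((?m - (u (x + ?s *\<^sub>R ?w) - v (x + ?s *\<^sub>R ?w))) / ?s)"
      by (simp add: qm_def diff_divide_distrib)
    have g: "0 \<le> ?m - (u y - v y)" "?m - (u y - v y) \<le> 2 * ?m" for y
    proof -
      have "u y - v y \<le> ?m" "- (u y - v y) \<le> ?m" using mx[of y] by (simp_all only: abs_le_iff)
      then show "0 \<le> ?m - (u y - v y)" "?m - (u y - v y) \<le> 2 * ?m" by simp_all
    qed
    have sgn: "qp v x ?w ?s \<le> qp u x ?w ?s" "qm u x ?w ?s \<le> qm v x ?w ?s"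
      using qpd qmd s g(1)[of "x - ?s *\<^sub>R ?w"] g(1)[of "x + ?s *\<^sub>R ?w"]
      by (smt (verit) divide_nonneg_pos)+
    have X_le: "?s powr (- 1 - a) * X \<le> 20 * B * (4 * B) ^ 3 * ?m * mu ?s"
    \<comment> \<open>The threshold makes B * s at most 1/4, so all four quotients lie in the range
      of \<open>Psi_antimono_near\<close> around the common slope.\<close>
    proof (cases "?s \<le> 1 / (4 * B)")
      case True
      have Bs: "B * ?s \<le> 1/4" using True B1 by (simp add: field_simps)
      note bb = qp_bounds(2)[OF u s norm_dir, of x "fst z"] qp_bounds(2)[OF v s norm_dir, of x "fst z"]
        qm_bounds(2)[OF u s norm_dir, of x "fst z"] qm_bounds(2)[OF v s norm_dir, of x "fst z"]
      have "?P (qp u x ?w ?s) \<le> ?P (qp v x ?w ?s)"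
        using bb Bs D by (intro Psi_antimono_near a sgn) auto
      moreover have "?P (qm v x ?w ?s) \<le> ?P (qm u x ?w ?s)"
        using bb Bs D by (intro Psi_antimono_near a sgn) auto
      ultimately have "X \<le> 0" unfolding X_def by linarith
      then have "?s powr (- 1 - a) * X \<le> 0" by (simp add: mult_nonneg_nonpos)
      also have "0 \<le> 20 * B * (4 * B) ^ 3 * ?m * mu ?s" using B1 m0 mu_nonneg by simp
      finally show ?thesis .
    next
      case False
      have "\<bar>?P (qp u x ?w ?s) - ?P (qp v x ?w ?s)\<bar> \<le> 5 * B * \<bar>qp u x ?w ?s - qp v x ?w ?s\<bar>"
        by (intro Psi_Lipschitz a B1 grad_dir_bound[OF v] norm_dir qp_bounds(1)[OF u s] qp_bounds(1)[OF v s])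
      also have "\<dots> \<le> 5 * B * (2 * ?m / ?s)"
        unfolding qpd using g[of "x - ?s *\<^sub>R ?w"] s B1
        by (intro mult_left_mono) (auto simp: divide_right_mono)
      finally have 1: "\<bar>?P (qp u x ?w ?s) - ?P (qp v x ?w ?s)\<bar> \<le> 5 * B * (2 * ?m / ?s)" .
      have "\<bar>?P (qm u x ?w ?s) - ?P (qm v x ?w ?s)\<bar> \<le> 5 * B * \<bar>qm u x ?w ?s - qm v x ?w ?s\<bar>"
        by (intro Psi_Lipschitz a B1 grad_dir_bound[OF v] norm_dir qm_bounds(1)[OF u s] qm_bounds(1)[OF v s])
      also have "\<dots> \<le> 5 * B * (2 * ?m / ?s)"
        unfolding qmd using g[of "x + ?s *\<^sub>R ?w"] s B1
        by (intro mult_left_mono) (auto simp: divide_right_mono)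
      finally have "X \<le> 5 * B * (2 * ?m / ?s) + 5 * B * (2 * ?m / ?s)" using 1 unfolding X_def by linarith
      also have "\<dots> = 20 * B * ?m * (1 / ?s)" by simp
      finally have "X \<le> 20 * B * ?m * (1 / ?s)" .
      then have "?s powr (- 1 - a) * X \<le> ?s powr (- 1 - a) * (20 * B * ?m * (1 / ?s))" by (intro mult_left_mono) auto
      also have "\<dots> = 20 * B * ?m * (?s powr (- 1 - a) * (1 / ?s))" by simp
      also have "\<dots> \<le> 20 * B * ?m * ((1 / (1 / (4 * B))) ^ 3 * mu ?s)"
        using a B1 m0 False by (intro mult_left_mono powr_far_le_mu) auto
      also have "\<dots> = 20 * B * (4 * B) ^ 3 * ?m * mu ?s" using B1 by simp
      finally show ?thesis .
    qed
    have "1 / (1 + (fst z)\<^sup>2) * (?s powr (- 1 - a) * X) \<le> 1 / (1 + (fst z)\<^sup>2) * (20 * B * (4 * B) ^ 3 * ?m * mu ?s)"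
      using one_plus_sq_pos[of "fst z"] by (intro mult_left_mono X_le) auto
    then show ?thesis unfolding eq by (simp add: wgt_def)
  qed
  have "JJ a u Du x - JJ a v Dv x = (\<integral>z. jz a u Du x z - jz a v Dv x z \<partial>(lborel \<Otimes>\<^sub>M lborel))"
    unfolding JJ_def using jz_integrable[OF u a] jz_integrable[OF v a] by simp
  also have "\<dots> \<le> (\<integral>z. 20 * B * (4 * B) ^ 3 * ?m * wgt z \<partial>(lborel \<Otimes>\<^sub>M lborel))"
    using jz_integrable[OF u a] jz_integrable[OF v a] wgt_integrable by (intro integral_mono bound) auto
  finally show ?thesis by (simp add: weight_total_def mult_ac)
qed

text \<open>The minimum of two bounds with different merits: the first is integrable uniformly in a,
  the second tends to 0 with a at each fixed s > 0 but its 1/s part is not integrable. The bound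
  depends on the function through B only.\<close>

definition alpha_gap :: "real \<Rightarrow> real \<Rightarrow> real \<times> real \<Rightarrow> real" where
  "alpha_gap B a z = indicator {0<..} (snd z) * (1 / (1 + (fst z)\<^sup>2) *
     min (40 * B\<^sup>2 * mu (snd z)) (\<bar>snd z powr (- 1 - a) - snd z powr (- 1)\<bar> * (20 * B\<^sup>2) * min (snd z) (1 / snd z) + snd z powr (- 1) * (4 * B ^ 3 * a)))"

definition alpha_err :: "real \<Rightarrow> real \<Rightarrow> real" where
  "alpha_err B a = (\<integral>z. alpha_gap B a z \<partial>(lborel \<Otimes>\<^sub>M lborel))"

lemma alpha_gap_measurable [measurable]: "alpha_gap B a \<in> borel_measurable (lborel \<Otimes>\<^sub>M lborel)"
  unfolding alpha_gap_def[abs_def] by measurable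

lemma alpha_gap_bounds:
  assumes "0 \<le> a" "1 \<le> B"
  shows "0 \<le> alpha_gap B a z" "alpha_gap B a z \<le> 40 * B\<^sup>2 * wgt z"
proof -
  have p: "0 \<le> 1 / (1 + (fst z)\<^sup>2)" using one_plus_sq_pos[of "fst z"] by simp
  show "0 \<le> alpha_gap B a z"
    unfolding alpha_gap_def using assms mu_nonneg[of "snd z"] p by (auto simp: indicator_def)
  have "1 / (1 + (fst z)\<^sup>2) * min (40 * B\<^sup>2 * mu (snd z)) c \<le> 1 / (1 + (fst z)\<^sup>2) * (40 * B\<^sup>2 * mu (snd z))" for c
    by (intro mult_left_mono p) simp
  then show "alpha_gap B a z \<le> 40 * B\<^sup>2 * wgt z"
    unfolding alpha_gap_def wgt_def using mu_nonneg[of "snd z"] p by (auto simp: indicator_def mult_ac)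
qed

lemma alpha_gap_integrable:
  assumes "0 \<le> a" "1 \<le> B"
  shows "integrable (lborel \<Otimes>\<^sub>M lborel) (alpha_gap B a)"
proof (rule Bochner_Integration.integrable_bound)
  show "integrable (lborel \<Otimes>\<^sub>M lborel) (\<lambda>z. 40 * B\<^sup>2 * wgt z)" by (intro integrable_mult_right wgt_integrable)
qed (use alpha_gap_bounds[OF assms] in \<open>auto intro!: AE_I2 simp: wgt_nonneg\<close>)

lemma alpha_err_tendsto:
  assumes "1 \<le> B" "X \<longlonglongrightarrow> 0" "\<And>n. 0 \<le> X n"
  shows "(\<lambda>n. alpha_err B (X n)) \<longlonglongrightarrow> 0"
proof -
  have "(\<lambda>n. alpha_err B (X n)) \<longlonglongrightarrow> (\<integral>z. 0 \<partial>(lborel \<Otimes>\<^sub>M lborel :: (real \<times> real) measure))"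
    unfolding alpha_err_def
  proof (rule integral_dominated_convergence[where w="\<lambda>z. 40 * B\<^sup>2 * wgt z"])
    show "integrable (lborel \<Otimes>\<^sub>M lborel) (\<lambda>z. 40 * B\<^sup>2 * wgt z)" by (intro integrable_mult_right wgt_integrable)
    show "AE z in lborel \<Otimes>\<^sub>M lborel. norm (alpha_gap B (X n) z) \<le> 40 * B\<^sup>2 * wgt z" for n
      using alpha_gap_bounds[OF assms(3,1)] by simp
    show "AE z in lborel \<Otimes>\<^sub>M lborel. (\<lambda>n. alpha_gap B (X n) z) \<longlonglongrightarrow> 0"
    proof (intro AE_I2)
      fix z :: "real \<times> real"
      show "(\<lambda>n. alpha_gap B (X n) z) \<longlonglongrightarrow> 0"
      proof (cases "snd z > 0")
        case True
        have "(\<lambda>n. alpha_gap B (X n) z) \<longlonglongrightarrow> indicator {0<..} (snd z) * (1 / (1 + (fst z)\<^sup>2) *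
          min (40 * B\<^sup>2 * mu (snd z)) (\<bar>snd z powr (- 1 - 0) - snd z powr (- 1)\<bar> * (20 * B\<^sup>2) * min (snd z) (1 / snd z) + snd z powr (- 1) * (4 * B ^ 3 * 0)))"
          unfolding alpha_gap_def using True by (intro tendsto_intros assms(2)) auto
        also have "indicator {0<..} (snd z) * (1 / (1 + (fst z)\<^sup>2) *
          min (40 * B\<^sup>2 * mu (snd z)) (\<bar>snd z powr (- 1 - 0) - snd z powr (- 1)\<bar> * (20 * B\<^sup>2) * min (snd z) (1 / snd z) + snd z powr (- 1) * (4 * B ^ 3 * 0))) = (0::real)"
          using mu_nonneg[of "snd z"] by simp
        finally show ?thesis .
      qed (simp add: alpha_gap_def)
    qed
  qed measurable
  then show ?thesis by simp
qed

lemma JJ_alpha_err: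
  assumes u: "C11 B u Du" and a: "0 \<le> a" "a \<le> 1/2"
  shows "\<bar>JJ a u Du x - JJ 0 u Du x\<bar> \<le> alpha_err B a"
proof -
  have B1: "1 \<le> B" using C11_ge_1[OF u] .
  have a0: "0 \<le> (0::real)" "(0::real) \<le> 1/2" by auto
  have bound: "\<bar>jz a u Du x z - jz 0 u Du x z\<bar> \<le> alpha_gap B a z" for z
  proof (cases "snd z > 0")
    case s: True
    let ?s = "snd z" and ?w = "dir (fst z)"
    let ?d = "\<lambda>a. Psi a (Du x \<bullet> ?w) (qp u x ?w ?s) - Psi a (Du x \<bullet> ?w) (qm u x ?w ?s)"
    have p: "0 \<le> 1 / (1 + (fst z)\<^sup>2)" using one_plus_sq_pos[of "fst z"] by simp
    have eq: "\<bar>jz a u Du x z - jz 0 u Du x z\<bar> = 1 / (1 + (fst z)\<^sup>2) * \<bar>jj a u Du x ?w ?s - jj 0 u Du x ?w ?s\<bar>"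
      using s p by (simp add: jz_def abs_mult diff_divide_distrib[symmetric] abs_divide)
    have 1: "\<bar>jj a u Du x ?w ?s - jj 0 u Du x ?w ?s\<bar> \<le> 40 * B\<^sup>2 * mu ?s"
      using jj_bound[OF u a s norm_dir, of x "fst z"] jj_bound[OF u a0 s norm_dir, of x "fst z"] by linarith
    have d0: "\<bar>?d a\<bar> \<le> 20 * B\<^sup>2 * min ?s (1 / ?s)" by (intro Psi_qp_qm_bound[OF u s norm_dir] a)
    have dd: "\<bar>?d a - ?d 0\<bar> \<le> 4 * B ^ 3 * a"
      using Psi_diff[OF a(1) B1 grad_dir_bound[OF u norm_dir] qp_bounds(1)[OF u s norm_dir], of x "fst z" x "fst z"]
        Psi_diff[OF a(1) B1 grad_dir_bound[OF u norm_dir] qm_bounds(1)[OF u s norm_dir], of x "fst z" x "fst z"]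
      by linarith
    \<comment> \<open>The exponent occurs twice, in the weight and inside \<open>Psi\<close>; the
      two changes are made one after the other.\<close>
    have decomp: "jj a u Du x ?w ?s - jj 0 u Du x ?w ?s = (?s powr (- 1 - a) - ?s powr (- 1)) * ?d a + ?s powr (- 1) * (?d a - ?d 0)"
      by (simp add: jj_def algebra_simps)
    have "\<bar>jj a u Du x ?w ?s - jj 0 u Du x ?w ?s\<bar> \<le> \<bar>?s powr (- 1 - a) - ?s powr (- 1)\<bar> * \<bar>?d a\<bar> + ?s powr (- 1) * \<bar>?d a - ?d 0\<bar>"
      unfolding decomp by (rule order_trans[OF abs_triangle_ineq]) (simp add: abs_mult)
    also have "\<dots> \<le> \<bar>?s powr (- 1 - a) - ?s powr (- 1)\<bar> * (20 * B\<^sup>2 * min ?s (1 / ?s)) + ?s powr (- 1) * (4 * B ^ 3 * a)"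
    proof -
      have *: "p * A + q * A' \<le> p * E + q * E'" if "A \<le> E" "A' \<le> E'" "0 \<le> p" "0 \<le> q" for p q A A' E E' :: real
        using mult_left_mono[OF that(1,3)] mult_left_mono[OF that(2,4)] by (rule add_mono)
      show ?thesis by (rule *) (rule d0 dd abs_ge_zero powr_ge_zero)+
    qed
    finally have 2: "\<bar>jj a u Du x ?w ?s - jj 0 u Du x ?w ?s\<bar> \<le> \<bar>?s powr (- 1 - a) - ?s powr (- 1)\<bar> * (20 * B\<^sup>2) * min ?s (1 / ?s) + ?s powr (- 1) * (4 * B ^ 3 * a)"
      by (simp add: mult.assoc)
    have i: "indicator {0<..} ?s = (1::real)" using s by simp
    show ?thesis
      unfolding eq alpha_gap_def i mult_1 by (rule mult_left_mono[OF min.boundedI[OF 1 2] p])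
  qed (simp add: jz_def alpha_gap_def)
  have "\<bar>JJ a u Du x - JJ 0 u Du x\<bar> = \<bar>\<integral>z. jz a u Du x z - jz 0 u Du x z \<partial>(lborel \<Otimes>\<^sub>M lborel)\<bar>"
    unfolding JJ_def using jz_integrable[OF u a] jz_integrable[OF u a0] by simp
  also have "\<dots> \<le> (\<integral>z. alpha_gap B a z \<partial>(lborel \<Otimes>\<^sub>M lborel))"
    using Bochner_Integration.integral_norm_bound_integral[OF _ alpha_gap_integrable[OF a(1) B1], of "\<lambda>z. jz a u Du x z - jz 0 u Du x z"]
      bound jz_integrable[OF u a] jz_integrable[OF u a0] by simp
  finally show ?thesis by (simp add: alpha_err_def)
qed

text \<open>By translation invariance the integral of P' equals the integral of its average over the
  segment from x to x + w, and this average is P(x + w) - P(x), whose integral is 0. Integrability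
  replaces any decay at infinity.\<close>

lemma integral_directional_derivative_zero:
  fixes P P' :: "pt \<Rightarrow> real"
  assumes P: "integrable lborel P" and P': "integrable lborel P'" "continuous_on UNIV P'"
    and d: "\<And>x r. ((\<lambda>r. P (x + r *\<^sub>R w)) has_real_derivative P' (x + r *\<^sub>R w)) (at r)"
  shows "(\<integral>x. P' x \<partial>lborel) = 0"
proof -
  note [measurable] = borel_measurable_integrable[OF P'(1)]
  have c: "continuous_on {0..1} (\<lambda>r. P' (x + r *\<^sub>R w))" for x
    by (intro continuous_on_compose2[OF P'(2)] continuous_intros) auto
  have ftc: "(\<integral>r. indicator {0..1} r * P' (x + r *\<^sub>R w) \<partial>lborel) = P (x + w) - P x" for x
  proof -
    have "((\<lambda>r. P' (x + r *\<^sub>R w)) has_integral (P (x + 1 *\<^sub>R w) - P (x + 0 *\<^sub>R w))) {0..1}"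
    proof (rule fundamental_theorem_of_calculus)
      fix r
      from has_field_derivative_at_within[OF d, of x r]
      show "((\<lambda>r. P (x + r *\<^sub>R w)) has_vector_derivative P' (x + r *\<^sub>R w)) (at r within {0..1})"
        by (simp add: has_real_derivative_iff_has_vector_derivative)
    qed simp
    with set_borel_integral_eq_integral(2)[OF borel_integrable_atLeastAtMost'[OF c]]
    show ?thesis by (simp add: set_lebesgue_integral_def integral_unique)
  qed
  have si: "integrable lborel (\<lambda>x. P' (x + r *\<^sub>R w))" for r by (rule lborel_integrable_shift[OF P'(1)])
  have i: "integrable (lborel \<Otimes>\<^sub>M lborel) (\<lambda>(r, x). indicator {0..1} r * P' (x + r *\<^sub>R w))"
  proof (rule lborel_pair.Fubini_integrable)
    have "(\<lambda>r. \<integral>x. norm (case (r, x) of (r, x) \<Rightarrow> indicator {0..1} r * P' (x + r *\<^sub>R w)) \<partial>lborel) = (\<lambda>r::real. indicator {0..1} r * (\<integral>x. \<bar>P' x\<bar> \<partial>lborel))"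
      using lborel_integral_shift[of "\<lambda>x. \<bar>P' x\<bar>"] by (auto simp: abs_mult)
    then show "integrable lborel (\<lambda>r. \<integral>x. norm (case (r, x) of (r, x) \<Rightarrow> indicator {0..1} (r::real) * P' (x + r *\<^sub>R w)) \<partial>lborel)"
      by simp
    show "AE r in lborel. integrable lborel (\<lambda>x. case (r, x) of (r, x) \<Rightarrow> indicator {0..1} (r::real) * P' (x + r *\<^sub>R w))"
      using si by simp
  qed measurable
  have "0 = (\<integral>x. P (x + w) - P x \<partial>lborel)"
    using P lborel_integrable_shift[OF P] lborel_integral_shift[of P w] by simp
  also have "\<dots> = (\<integral>x. (\<integral>r. indicator {0..1} r * P' (x + r *\<^sub>R w) \<partial>lborel) \<partial>lborel)" unfolding ftc ..
  also have "\<dots> = (\<integral>r. (\<integral>x. indicator {0..1} r * P' (x + r *\<^sub>R w) \<partial>lborel) \<partial>lborel)"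
    by (rule lborel_pair.Fubini_integral[OF i])
  also have "\<dots> = (\<integral>r. indicator {0..1} (r::real) * (\<integral>x. P' x \<partial>lborel) \<partial>lborel)"
    using lborel_integral_shift[of P'] by simp
  also have "\<dots> = (\<integral>x. P' x \<partial>lborel)" by simp
  finally show ?thesis by simp
qed

section \<open>Energy identity\<close>

text \<open>Chosen so that s^(1-a) * LL(q), differentiated in s along a ray, is the part of the
  energy density that is neither a derivative in x nor a multiple of \<open>dd\<close>.\<close>

definition LL :: "real \<Rightarrow> real \<Rightarrow> real" where "LL a q = q * Phi a q - 2 * GG a q"

lemma LL_DERIV: "(LL a has_real_derivative q * phi a q - Phi a q) (at q)"
proof -
  have "((\<lambda>q. q * Phi a q - 2 * GG a q) has_real_derivative (q * phi a q + 1 * Phi a q) - 2 * Phi a q) (at q)"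
    by (intro DERIV_diff DERIV_mult' DERIV_cmult DERIV_ident Phi_DERIV GG_DERIV)
  then show ?thesis unfolding LL_def[abs_def] by (rule DERIV_cong) simp
qed

lemma LL_bound: assumes "0 \<le> a" shows "\<bar>LL a q\<bar> \<le> 3 * q\<^sup>2"
proof -
  have "\<bar>q * Phi a q\<bar> \<le> \<bar>q\<bar> * \<bar>q\<bar>" unfolding abs_mult by (intro mult_left_mono Phi_bound assms) auto
  then have "\<bar>q * Phi a q\<bar> \<le> q\<^sup>2" by (simp add: power2_eq_square)
  then show ?thesis using GG_bound[OF assms, of q] unfolding LL_def by linarith
qed

lemma slope_bound: assumes "0 \<le> a" shows "\<bar>q * phi a q - Phi a q\<bar> \<le> 2 * \<bar>q\<bar>"
proof -
  have "\<bar>q * phi a q\<bar> \<le> \<bar>q\<bar> * 1" unfolding abs_mult using phi_le_1[OF assms, of q] phi_pos[of a q] by (intro mult_left_mono) auto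
  then show ?thesis using Phi_bound[OF assms, of q] by linarith
qed

lemma LL_continuous: "continuous_on A (LL a)"
  unfolding LL_def[abs_def] by (intro continuous_intros Phi_continuous GG_continuous)

text \<open>U, V are the values and p, v the slopes at x and x - s w; f, F, G stand for
  \<open>phi\<close>, \<open>Phi\<close>, \<open>GG\<close> at q. The first bracket on the right is
  the derivative along w of (s/2) * ((U + V) * F + s * LL(q)). The next term is -2 s^(-a)
  \<open>dd\<close>. The last two form the s-derivative of s^(1-a) * LL(q), since q has s-derivative
  (v - q)/s.\<close>

lemma energy_algebra:
  fixes U V p v q s a F f G :: real
  assumes "s > 0" "q = (U - V) / s"
  shows "s powr (- 1 - a) * (U * ((p - q) * f - a * F) - V * ((v - q) * f - a * F)) =
    s powr (- 1 - a) * (s / 2 * ((p + v) * F + (U + V) * (f * ((p - v) / s)) + s * ((p - v) / s * (q * f - F))))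
    + (- 2 * (s powr (- a) * (q * F - (1 - a) * G)) + ((1 - a) * s powr (- a) * (q * F - 2 * G) + s powr (- a) * ((q * f - F) * (v - q))))"
proof -
  define r where "r = (p - v) / s"
  have p: "p = v + s * r" using assms(1) by (simp add: r_def)
  define t where "t = s powr (- 1 - a)"
  have t: "s powr (- a) = t * s" using assms(1) by (simp add: t_def powr_diff powr_minus_divide)
  have V: "V = U - s * q" using assms by simp
  show ?thesis unfolding t t_def[symmetric] V r_def[symmetric] unfolding p
    by (simp add: field_simps)
qed

context
  fixes B K :: real and u Du
  assumes C: "C11 B u Du" and Lu: "L2 u" and LD: "L2 (\<lambda>x. fst (Du x))" "L2 (\<lambda>x. snd (Du x))"
    and K: "diff_L2_bounds K u"
begin

lemma qp_continuous_x: "continuous_on UNIV (\<lambda>x. qp u x w s)"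
  unfolding qp_def divide_inverse
  by (intro continuous_intros continuous_on_compose2[OF C11_continuous(1)[OF C, of UNIV]]) auto

lemma qp_L2: "L2 (\<lambda>x. qp u x w s)"
proof -
  have "L2 (\<lambda>x. 1 / s * (u x - u (x + (- (s *\<^sub>R w)))))" by (intro L2_cmult L2_diff L2_shift Lu)
  then show ?thesis by (simp add: qp_def)
qed

lemma Dw_L2: "L2 (\<lambda>x. Du (x + c) \<bullet> w)"
proof -
  have "L2 (\<lambda>x. fst w * fst (Du x) + snd w * snd (Du x))" by (intro L2_add L2_cmult LD)
  from L2_shift[OF this, of c] show ?thesis by (simp add: inner_prod_def mult.commute)
qed

text \<open>One constant for both ranges of s: K for small shifts, and four copies of the norm for
  large ones, where a second difference is estimated by the triangle inequality.\<close>

definition K2 :: real where "K2 = K + 4 * l2norm u"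

lemma K2_nonneg: "0 \<le> K2"
  using K l2norm_nonneg[of u] by (simp add: K2_def diff_L2_bounds_def)

lemma qp_l2norm:
  assumes "s > 0" "norm w = 1"
  shows "l2norm (\<lambda>x. qp u x w s) \<le> K2 * min 1 (1 / s)"
proof -
  have e: "l2norm (\<lambda>x. qp u x w s) = 1 / s * l2norm (\<lambda>x. u x - u (x - s *\<^sub>R w))"
    using l2norm_cmult[of "1 / s" "\<lambda>x. u x - u (x - s *\<^sub>R w)"] assms by (simp add: qp_def)
  have "l2norm (\<lambda>x. u x - u (x - s *\<^sub>R w)) \<le> K * s"
    using K assms unfolding diff_L2_bounds_def by (metis abs_of_pos mult.right_neutral norm_scaleR)
  then have "l2norm (\<lambda>x. qp u x w s) \<le> K" unfolding e using assms by (simp add: field_simps)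
  then have 1: "l2norm (\<lambda>x. qp u x w s) \<le> K2 * 1" unfolding K2_def using l2norm_nonneg[of u] by simp
  have "l2norm (\<lambda>x. u x - u (x - s *\<^sub>R w)) \<le> l2norm u + l2norm u"
    using l2norm_triangle_diff[OF Lu L2_shift[OF Lu, of "- (s *\<^sub>R w)"]] l2norm_shift[of u "- (s *\<^sub>R w)"] by simp
  also have "\<dots> \<le> K2" using K l2norm_nonneg[of u] by (simp add: K2_def diff_L2_bounds_def)
  finally have 2: "l2norm (\<lambda>x. qp u x w s) \<le> K2 * (1 / s)"
    unfolding e using assms by (simp add: divide_right_mono)
  show ?thesis using 1 2 K2_nonneg by (simp add: min_def)
qed

lemma qp_square_integral:
  assumes "s > 0" "norm w = 1"
  shows "(\<integral>x. (qp u x w s)\<^sup>2 \<partial>lborel) \<le> K2\<^sup>2 * min 1 (1 / s\<^sup>2)"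
proof -
  have "(\<integral>x. (qp u x w s)\<^sup>2 \<partial>lborel) = (l2norm (\<lambda>x. qp u x w s))\<^sup>2" by (simp add: l2norm_power2)
  also have "\<dots> \<le> (K2 * min 1 (1 / s))\<^sup>2" by (intro power_mono qp_l2norm assms l2norm_nonneg)
  also have "\<dots> = K2\<^sup>2 * min 1 (1 / s\<^sup>2)"
    using assms by (auto simp: min_def power_mult_distrib power_one_over) (smt (verit) one_le_power power_le_one)+
  finally show ?thesis .
qed

text \<open>The difference of the two quotients is a second difference divided by s, so its L2 norm
  gains a factor s near 0. This is the L2 counterpart of \<open>qp_qm_diff\<close>.\<close>

lemma second_difference_integral:
  assumes "s > 0" "norm w = 1"
  shows "integrable lborel (\<lambda>x. u x * (qp u x w s - qm u x w s))"
    and "(\<integral>x. \<bar>u x * (qp u x w s - qm u x w s)\<bar> \<partial>lborel) \<le> l2norm u * (K2 * min s (1 / s))"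
proof -
  let ?S = "\<lambda>x. 2 * u x - u (x - s *\<^sub>R w) - u (x + s *\<^sub>R w)"
  have e: "qp u x w s - qm u x w s = 1 / s * ?S x" for x
    by (simp add: qp_def qm_def diff_divide_distrib add_divide_distrib)
  have LS: "L2 ?S" using L2_diff[OF L2_diff[OF L2_cmult[OF Lu, of 2] L2_shift[OF Lu, of "- (s *\<^sub>R w)"]] L2_shift[OF Lu, of "s *\<^sub>R w"]] by simp
  then have Ld: "L2 (\<lambda>x. qp u x w s - qm u x w s)" unfolding e by (rule L2_cmult)
  then show "integrable lborel (\<lambda>x. u x * (qp u x w s - qm u x w s))" by (intro L2_mult Lu)
  have n: "l2norm (\<lambda>x. qp u x w s - qm u x w s) = 1 / s * l2norm ?S" unfolding e using l2norm_cmult[of "1 / s" ?S] assms by simp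
  have "l2norm ?S \<le> K * (norm (s *\<^sub>R w))\<^sup>2" using K unfolding diff_L2_bounds_def by blast
  then have "l2norm ?S \<le> K * s\<^sup>2" using assms by simp
  also have "\<dots> \<le> K2 * s\<^sup>2" unfolding K2_def using l2norm_nonneg[of u] by (intro mult_right_mono) auto
  finally have 1: "1 / s * l2norm ?S \<le> K2 * s" using assms by (simp add: field_simps power2_eq_square)
  have "l2norm ?S \<le> l2norm (\<lambda>x. 2 * u x - u (x - s *\<^sub>R w)) + l2norm u"
    using l2norm_triangle_diff[OF L2_diff[OF L2_cmult[OF Lu, of 2] L2_shift[OF Lu, of "- (s *\<^sub>R w)"]] L2_shift[OF Lu, of "s *\<^sub>R w"]]
      l2norm_shift[of u "s *\<^sub>R w"] by simp
  also have "l2norm (\<lambda>x. 2 * u x - u (x - s *\<^sub>R w)) \<le> 2 * l2norm u + l2norm u"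
    using l2norm_triangle_diff[OF L2_cmult[OF Lu, of 2] L2_shift[OF Lu, of "- (s *\<^sub>R w)"]]
      l2norm_shift[of u "- (s *\<^sub>R w)"] l2norm_cmult[of 2 u] by simp
  finally have "l2norm ?S \<le> K2" using K by (simp add: K2_def diff_L2_bounds_def)
  then have 2: "1 / s * l2norm ?S \<le> K2 * (1 / s)" using assms by (simp add: divide_right_mono)
  have "l2norm (\<lambda>x. qp u x w s - qm u x w s) \<le> K2 * min s (1 / s)"
    unfolding n using 1 2 by (simp add: min_def)
  then show "(\<integral>x. \<bar>u x * (qp u x w s - qm u x w s)\<bar> \<partial>lborel) \<le> l2norm u * (K2 * min s (1 / s))"
    using L2_Cauchy_Schwarz_abs[OF Lu Ld] mult_left_mono[OF _ l2norm_nonneg[of u]] order_trans by blast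
qed

lemma u_jj_integral:
  assumes "0 \<le> a" "a \<le> 1/2" "s > 0" "norm w = 1"
  shows "integrable lborel (\<lambda>x. u x * jj a u Du x w s)"
    and "(\<integral>x. \<bar>u x * jj a u Du x w s\<bar> \<partial>lborel) \<le> 5 * B * (l2norm u * K2) * mu s"
proof -
  have bd: "\<bar>u x * jj a u Du x w s\<bar> \<le> s powr (- 1 - a) * (5 * B) * \<bar>u x * (qp u x w s - qm u x w s)\<bar>" for x
  proof -
    have "\<bar>u x * jj a u Du x w s\<bar> = s powr (- 1 - a) * \<bar>u x\<bar> * \<bar>Psi a (Du x \<bullet> w) (qp u x w s) - Psi a (Du x \<bullet> w) (qm u x w s)\<bar>"
      by (simp add: jj_def abs_mult)
    also have "\<dots> \<le> s powr (- 1 - a) * \<bar>u x\<bar> * (5 * B * \<bar>qp u x w s - qm u x w s\<bar>)"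
      by (intro mult_left_mono Psi_Lipschitz assms C11_ge_1[OF C] grad_dir_bound[OF C] qp_bounds[OF C] qm_bounds[OF C]) auto
    finally show ?thesis by (simp add: abs_mult mult_ac)
  qed
  have i: "integrable lborel (\<lambda>x. s powr (- 1 - a) * (5 * B) * \<bar>u x * (qp u x w s - qm u x w s)\<bar>)"
    by (intro integrable_mult_right integrable_abs second_difference_integral assms)
  show j: "integrable lborel (\<lambda>x. u x * jj a u Du x w s)"
  proof (rule Bochner_Integration.integrable_bound[OF i])
    note [measurable] = C11_measurable[OF C]
    show "(\<lambda>x. u x * jj a u Du x w s) \<in> borel_measurable lborel" unfolding jj_def by measurable
    show "AE x in lborel. norm (u x * jj a u Du x w s) \<le> norm (s powr (- 1 - a) * (5 * B) * \<bar>u x * (qp u x w s - qm u x w s)\<bar>)"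
      using bd C11_ge_1[OF C] by (intro AE_I2) (simp add: abs_mult)
  qed
  have "(\<integral>x. \<bar>u x * jj a u Du x w s\<bar> \<partial>lborel) \<le> (\<integral>x. s powr (- 1 - a) * (5 * B) * \<bar>u x * (qp u x w s - qm u x w s)\<bar> \<partial>lborel)"
    by (intro integral_mono i integrable_abs j bd)
  also have "\<dots> = s powr (- 1 - a) * (5 * B) * (\<integral>x. \<bar>u x * (qp u x w s - qm u x w s)\<bar> \<partial>lborel)" by (rule integral_mult_right_zero)
  also have "\<dots> \<le> s powr (- 1 - a) * (5 * B) * (l2norm u * (K2 * min s (1 / s)))"
    using C11_ge_1[OF C] by (intro mult_left_mono second_difference_integral assms) auto
  also have "\<dots> = 5 * B * (l2norm u * K2) * (s powr (- 1 - a) * min s (1 / s))" by simp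
  also have "\<dots> \<le> 5 * B * (l2norm u * K2) * mu s"
    using C11_ge_1[OF C] K2_nonneg l2norm_nonneg[of u] by (intro mult_left_mono powr_min_le_mu assms) auto
  finally show "(\<integral>x. \<bar>u x * jj a u Du x w s\<bar> \<partial>lborel) \<le> 5 * B * (l2norm u * K2) * mu s" .
qed

lemma dd_qp_integral:
  assumes "0 \<le> a" "a \<le> 1/2" "s > 0" "norm w = 1"
  shows "integrable lborel (\<lambda>x. dd a (qp u x w s))"
    and "s powr (- a) * (\<integral>x. dd a (qp u x w s) \<partial>lborel) \<le> K2\<^sup>2 * mu s"
proof -
  have i: "integrable lborel (\<lambda>x. (qp u x w s)\<^sup>2)" by (rule L2_square[OF qp_L2])
  have le: "dd a (qp u x w s) \<le> (qp u x w s)\<^sup>2" for x using dd_bound assms by simp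
  show j: "integrable lborel (\<lambda>x. dd a (qp u x w s))"
  proof (rule Bochner_Integration.integrable_bound[OF i])
    note [measurable] = C11_measurable[OF C]
    show "(\<lambda>x. dd a (qp u x w s)) \<in> borel_measurable lborel" by measurable
  qed (use le dd_nonneg[OF assms(1)] in auto)
  have "(\<integral>x. dd a (qp u x w s) \<partial>lborel) \<le> (\<integral>x. (qp u x w s)\<^sup>2 \<partial>lborel)" by (intro integral_mono i j le)
  also have "\<dots> \<le> K2\<^sup>2 * min 1 (1 / s\<^sup>2)" by (intro qp_square_integral assms)
  finally have "s powr (- a) * (\<integral>x. dd a (qp u x w s) \<partial>lborel) \<le> s powr (- a) * (K2\<^sup>2 * min 1 (1 / s\<^sup>2))"
    by (intro mult_left_mono) auto
  also have "s powr (- a) * (K2\<^sup>2 * min 1 (1 / s\<^sup>2)) = K2\<^sup>2 * (s powr (- 1 - a) * (s * min 1 (1 / s\<^sup>2)))"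
    using assms by (simp add: powr_diff powr_minus_divide)
  also have "s * min 1 (1 / s\<^sup>2) = min s (1 / s)" using assms by (simp add: min_mult_distrib_left power2_eq_square)
  also have "K2\<^sup>2 * (s powr (- 1 - a) * min s (1 / s)) \<le> K2\<^sup>2 * mu s" by (intro mult_left_mono powr_min_le_mu assms) auto
  finally show "s powr (- a) * (\<integral>x. dd a (qp u x w s) \<partial>lborel) \<le> K2\<^sup>2 * mu s" .
qed

text \<open>At fixed x this is the s-derivative of
  \<open>s powr (1 - a) * LL a (qp u x w s)\<close>.\<close>

definition RR :: "real \<Rightarrow> pt \<Rightarrow> real \<Rightarrow> pt \<Rightarrow> real" where
  "RR a w s x = (1 - a) * s powr (- a) * LL a (qp u x w s) +
     s powr (- a) * ((qp u x w s * phi a (qp u x w s) - Phi a (qp u x w s)) * (Du (x - s *\<^sub>R w) \<bullet> w - qp u x w s))"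

lemma RR_integral:
  assumes "0 \<le> a" "a \<le> 1/2" "s > 0" "norm w = 1"
  shows "integrable lborel (RR a w s)"
    and "(\<integral>x. \<bar>RR a w s x\<bar> \<partial>lborel) \<le> s powr (- a) * (5 * K2\<^sup>2 + 2 * (K2 * l2norm (\<lambda>x. Du x \<bullet> w)))"
proof -
  let ?q = "\<lambda>x. qp u x w s" and ?v = "\<lambda>x. Du (x - s *\<^sub>R w) \<bullet> w"
  have Lv: "L2 ?v" using Dw_L2[of "- (s *\<^sub>R w)" w] by simp
  have nv: "l2norm ?v = l2norm (\<lambda>x. Du x \<bullet> w)" using l2norm_shift[of "\<lambda>x. Du x \<bullet> w" "- (s *\<^sub>R w)"] by simp
  let ?F = "\<lambda>x. s powr (- a) * (5 * (?q x)\<^sup>2 + 2 * \<bar>?q x * ?v x\<bar>)"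
  have bd: "\<bar>RR a w s x\<bar> \<le> ?F x" for x
  proof -
    have "\<bar>(1 - a) * LL a (?q x)\<bar> \<le> 1 * (3 * (?q x)\<^sup>2)" unfolding abs_mult using assms by (intro mult_mono LL_bound) auto
    moreover have "\<bar>(?q x * phi a (?q x) - Phi a (?q x)) * (?v x - ?q x)\<bar> \<le> 2 * \<bar>?q x\<bar> * (\<bar>?v x\<bar> + \<bar>?q x\<bar>)"
      unfolding abs_mult by (intro mult_mono slope_bound assms) auto
    moreover have "2 * \<bar>?q x\<bar> * (\<bar>?v x\<bar> + \<bar>?q x\<bar>) = 2 * \<bar>?q x * ?v x\<bar> + 2 * (?q x)\<^sup>2"
      by (simp add: abs_mult power2_eq_square algebra_simps)
    ultimately have "\<bar>(1 - a) * LL a (?q x) + (?q x * phi a (?q x) - Phi a (?q x)) * (?v x - ?q x)\<bar> \<le> 5 * (?q x)\<^sup>2 + 2 * \<bar>?q x * ?v x\<bar>"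
      by linarith
    moreover have "RR a w s x = s powr (- a) * ((1 - a) * LL a (?q x) + (?q x * phi a (?q x) - Phi a (?q x)) * (?v x - ?q x))"
      by (simp add: RR_def algebra_simps)
    ultimately show ?thesis by (simp add: abs_mult mult_left_mono)
  qed
  have iF: "integrable lborel ?F"
    by (intro integrable_mult_right Bochner_Integration.integrable_add integrable_abs L2_mult qp_L2 Lv L2_square)
  show j: "integrable lborel (RR a w s)"
  proof (rule Bochner_Integration.integrable_bound[OF iF])
    note [measurable] = C11_measurable[OF C]
    have [measurable]: "LL a \<in> borel_measurable borel" by (intro borel_measurable_continuous_onI LL_continuous)
    show "RR a w s \<in> borel_measurable lborel" unfolding RR_def[abs_def] by measurable
    show "AE x in lborel. norm (RR a w s x) \<le> norm (?F x)" using bd by (intro AE_I2) (simp add: abs_mult)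
  qed
  have "(\<integral>x. \<bar>RR a w s x\<bar> \<partial>lborel) \<le> (\<integral>x. ?F x \<partial>lborel)" by (intro integral_mono iF integrable_abs j bd)
  also have "\<dots> = s powr (- a) * (5 * (\<integral>x. (?q x)\<^sup>2 \<partial>lborel) + 2 * (\<integral>x. \<bar>?q x * ?v x\<bar> \<partial>lborel))"
    using L2_square[OF qp_L2] integrable_abs[OF L2_mult[OF qp_L2 Lv]] by simp
  also have "\<dots> \<le> s powr (- a) * (5 * K2\<^sup>2 + 2 * (K2 * l2norm (\<lambda>x. Du x \<bullet> w)))"
  proof (intro mult_left_mono add_mono)
    have "(\<integral>x. (?q x)\<^sup>2 \<partial>lborel) \<le> K2\<^sup>2 * min 1 (1 / s\<^sup>2)" by (rule qp_square_integral[OF assms(3,4)])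
    also have "\<dots> \<le> K2\<^sup>2 * 1" by (intro mult_left_mono) auto
    finally show "(\<integral>x. (?q x)\<^sup>2 \<partial>lborel) \<le> K2\<^sup>2" by simp
    have "l2norm ?q \<le> K2 * min 1 (1 / s)" by (rule qp_l2norm[OF assms(3,4)])
    also have "\<dots> \<le> K2 * 1" by (intro mult_left_mono K2_nonneg) auto
    finally have "l2norm ?q * l2norm ?v \<le> K2 * l2norm ?v" by (intro mult_right_mono l2norm_nonneg) simp
    then show "(\<integral>x. \<bar>?q x * ?v x\<bar> \<partial>lborel) \<le> K2 * l2norm (\<lambda>x. Du x \<bullet> w)"
      using L2_Cauchy_Schwarz_abs[OF qp_L2 Lv, of w s] unfolding nv by (rule order_trans[rotated])
  qed auto
  finally show "(\<integral>x. \<bar>RR a w s x\<bar> \<partial>lborel) \<le> s powr (- a) * (5 * K2\<^sup>2 + 2 * (K2 * l2norm (\<lambda>x. Du x \<bullet> w)))" .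
qed

lemma L2_dominated:
  assumes "g \<in> borel_measurable borel" "\<And>x. \<bar>g x\<bar> \<le> \<bar>f x\<bar>" "L2 f" shows "L2 g"
proof -
  have "integrable lborel (\<lambda>x. (g x)\<^sup>2)"
    by (rule Bochner_Integration.integrable_bound[OF L2_square[OF assms(3)]])
      (use assms(1,2) in \<open>auto simp: abs_le_square_iff[symmetric]\<close>)
  then show ?thesis using assms(1) by (simp add: L2_def)
qed

lemma Psi_L2:
  assumes "0 \<le> a" "a \<le> 1/2"
  shows "L2 (\<lambda>x. Psi a (Du (x + c) \<bullet> w) (qp u x w s))"
proof (rule L2_dominated)
  let ?p = "\<lambda>x. Du (x + c) \<bullet> w" and ?q = "\<lambda>x. qp u x w s"
  note [measurable] = C11_measurable[OF C]
  show "(\<lambda>x. Psi a (?p x) (?q x)) \<in> borel_measurable borel" by measurable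
  have La: "L2 (\<lambda>x. \<bar>f x\<bar>)" if "L2 f" for f using that L2_measurable[OF that] by (auto simp: L2_def)
  show "L2 (\<lambda>x. \<bar>?p x\<bar> + 2 * \<bar>?q x\<bar>)" by (intro L2_add L2_cmult La Dw_L2 qp_L2)
  fix x
  have "\<bar>(?p x - ?q x) * phi a (?q x)\<bar> \<le> (\<bar>?p x\<bar> + \<bar>?q x\<bar>) * 1"
    unfolding abs_mult using phi_le_1[OF assms(1)] phi_pos[of a] by (intro mult_mono) (auto simp: abs_of_pos less_imp_le)
  moreover have "\<bar>a * Phi a (?q x)\<bar> \<le> 1 * \<bar>?q x\<bar>" unfolding abs_mult using assms by (intro mult_mono Phi_bound) auto
  moreover have "\<bar>Psi a (?p x) (?q x)\<bar> \<le> \<bar>(?p x - ?q x) * phi a (?q x)\<bar> + \<bar>a * Phi a (?q x)\<bar>"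
    unfolding Psi_def by (rule abs_triangle_ineq4)
  ultimately have "\<bar>Psi a (?p x) (?q x)\<bar> \<le> \<bar>?p x\<bar> + 2 * \<bar>?q x\<bar>" by simp
  then show "\<bar>Psi a (?p x) (?q x)\<bar> \<le> \<bar>\<bar>?p x\<bar> + 2 * \<bar>?q x\<bar>\<bar>" by (rule order_trans) (rule abs_ge_self)
qed

text \<open>In the half of \<open>jj\<close> that contains \<open>qm\<close>, the translation x -> x
  - s w turns \<open>qm\<close> into \<open>qp\<close> and moves the factor u and the slope to x - s
  w. \<open>energy_algebra\<close> then applies at each x, and its exact part integrates to
  zero.\<close>

lemma Y_eq:
  assumes a: "0 \<le> a" "a \<le> 1/2" and s: "s > 0" and w: "norm w = 1"
  shows "(\<integral>x. u x * jj a u Du x w s \<partial>lborel) = - 2 * (s powr (- a) * (\<integral>x. dd a (qp u x w s) \<partial>lborel)) + (\<integral>x. RR a w s x \<partial>lborel)"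
proof -
  let ?q = "\<lambda>x. qp u x w s" and ?p = "\<lambda>x. Du x \<bullet> w" and ?v = "\<lambda>x. Du (x - s *\<^sub>R w) \<bullet> w" and ?V = "\<lambda>x. u (x - s *\<^sub>R w)"
  let ?t = "s powr (- 1 - a)"
  have LV: "L2 ?V" using L2_shift[OF Lu, of "- (s *\<^sub>R w)"] by simp
  have Lp: "L2 ?p" "L2 ?v" using Dw_L2[of 0 w] Dw_L2[of "- (s *\<^sub>R w)" w] by auto
  have cu: "continuous_on UNIV u" "continuous_on UNIV Du" by (rule C11_continuous[OF C])+
  have cV: "continuous_on UNIV ?V" "continuous_on UNIV ?v" "continuous_on UNIV ?p"
    by (intro continuous_intros continuous_on_compose2[OF cu(1)] continuous_on_compose2[OF cu(2)]; simp)+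
  have cq: "continuous_on UNIV (\<lambda>x. f (?q x))" if "continuous_on UNIV f" for f :: "real \<Rightarrow> real"
    by (rule continuous_on_compose2[OF that qp_continuous_x]) auto
  have Lfq: "L2 (\<lambda>x. f (?q x))" if "continuous_on UNIV f" "\<And>q. \<bar>f q\<bar> \<le> c * \<bar>q\<bar>" for f :: "real \<Rightarrow> real" and c
  proof (rule L2_dominated)
    show "(\<lambda>x. f (?q x)) \<in> borel_measurable borel" by (intro borel_measurable_continuous_onI cq that)
    show "L2 (\<lambda>x. c * ?q x)" by (intro L2_cmult qp_L2)
    show "\<bar>f (?q x)\<bar> \<le> \<bar>c * ?q x\<bar>" for x
      using that(2)[of "?q x"] mult_right_mono[OF abs_ge_self[of c] abs_ge_zero[of "?q x"]] by (simp add: abs_mult)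
  qed
  define A where "A x = u x * Psi a (?p x) (?q x)" for x
  define A2 where "A2 x = ?V x * Psi a (?v x) (?q x)" for x
  have iA: "integrable lborel A" unfolding A_def using L2_mult[OF Lu Psi_L2[OF a, of 0]] by simp
  have iA2: "integrable lborel A2" unfolding A2_def using L2_mult[OF LV Psi_L2[OF a, of "- (s *\<^sub>R w)"]] by simp
  have jA: "u x * jj a u Du x w s = ?t * (A x - A2 (x + s *\<^sub>R w))" for x
    by (simp add: jj_def A_def A2_def qm_def qp_def algebra_simps)
  have "(\<integral>x. u x * jj a u Du x w s \<partial>lborel) = ?t * ((\<integral>x. A x \<partial>lborel) - (\<integral>x. A2 x \<partial>lborel))"
    unfolding jA using iA lborel_integrable_shift[OF iA2] lborel_integral_shift[of A2] by simp
  also have "\<dots> = (\<integral>x. ?t * (A x - A2 x) \<partial>lborel)" using iA iA2 by simp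
  finally have Y: "(\<integral>x. u x * jj a u Du x w s \<partial>lborel) = (\<integral>x. ?t * (A x - A2 x) \<partial>lborel)" .
  \<comment> \<open>The primitive along w named in \<open>energy_algebra\<close>; P' below is its
    directional derivative.\<close>
  define P where "P x = s / 2 * ((u x + ?V x) * Phi a (?q x) + s * LL a (?q x))" for x
  define P' where "P' x = s / 2 * ((?p x + ?v x) * Phi a (?q x) + (u x + ?V x) * (phi a (?q x) * ((?p x - ?v x) / s))
     + s * ((?p x - ?v x) / s * (?q x * phi a (?q x) - Phi a (?q x))))" for x
  have LPhi: "L2 (\<lambda>x. Phi a (?q x))" by (rule Lfq[of "Phi a" 1]) (auto intro: Phi_continuous simp: Phi_bound[OF a(1)])
  have iP: "integrable lborel P"
  proof -
    have "integrable lborel (\<lambda>x. ?q x * Phi a (?q x))" by (intro L2_mult qp_L2 LPhi)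
    moreover have "integrable lborel (\<lambda>x. GG a (?q x))"
    proof (rule Bochner_Integration.integrable_bound[OF L2_square[OF qp_L2]])
      show "(\<lambda>x. GG a (?q x)) \<in> borel_measurable lborel" using borel_measurable_continuous_onI[OF cq[OF GG_continuous]] by simp
    qed (use GG_bound[OF a(1)] in auto)
    ultimately have "integrable lborel (\<lambda>x. LL a (?q x))" by (simp add: LL_def)
    moreover have "integrable lborel (\<lambda>x. (u x + ?V x) * Phi a (?q x))" by (intro L2_mult L2_add Lu LV LPhi)
    ultimately show ?thesis unfolding P_def by simp
  qed
  have iP': "integrable lborel P'"
  proof -
    have 1: "integrable lborel (\<lambda>x. (?p x + ?v x) * Phi a (?q x))" by (intro L2_mult L2_add Lp LPhi)
    have Ld: "L2 (\<lambda>x. (?p x - ?v x) / s)" using L2_cmult[OF L2_diff[OF Lp], of "1 / s"] by simp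
    have "L2 (\<lambda>x. phi a (?q x) * ((?p x - ?v x) / s))"
    proof (rule L2_dominated[OF _ _ Ld])
      show "(\<lambda>x. phi a (?q x) * ((?p x - ?v x) / s)) \<in> borel_measurable borel"
        using s by (intro borel_measurable_continuous_onI continuous_intros cq phi_continuous cV) auto
      show "\<bar>phi a (?q x) * ((?p x - ?v x) / s)\<bar> \<le> \<bar>(?p x - ?v x) / s\<bar>" for x
        unfolding abs_mult using phi_le_1[OF a(1), of "?q x"] phi_pos[of a "?q x"] by (intro mult_left_le_one_le) auto
    qed
    then have 2: "integrable lborel (\<lambda>x. (u x + ?V x) * (phi a (?q x) * ((?p x - ?v x) / s)))" by (intro L2_mult L2_add Lu LV)
    have "L2 (\<lambda>x. ?q x * phi a (?q x) - Phi a (?q x))"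
      by (rule Lfq[where f="\<lambda>q. q * phi a q - Phi a q" and c=2]) (auto intro!: continuous_intros phi_continuous Phi_continuous slope_bound a)
    then have 3: "integrable lborel (\<lambda>x. (?p x - ?v x) / s * (?q x * phi a (?q x) - Phi a (?q x)))" by (intro L2_mult Ld)
    show ?thesis unfolding P'_def
      by (intro integrable_mult_right Bochner_Integration.integrable_add 1 2 3)
  qed
  have "(\<integral>x. P' x \<partial>lborel) = 0"
  proof (rule integral_directional_derivative_zero[OF iP iP'])
    show "continuous_on UNIV P'" unfolding P'_def
      unfolding divide_inverse
      by (intro continuous_on_mult continuous_on_add continuous_on_diff continuous_on_const
          cq[OF phi_continuous] cq[OF Phi_continuous] cV cu qp_continuous_x)
    fix x r
    let ?y = "x + r *\<^sub>R w"
    have du: "((\<lambda>r. u (x + r *\<^sub>R w)) has_real_derivative ?p ?y) (at r)" using line_DERIV[OF C11_derivative[OF C], of x w r] .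
    have dV: "((\<lambda>r. ?V (x + r *\<^sub>R w)) has_real_derivative ?v ?y) (at r)"
      using line_DERIV[OF C11_derivative[OF C], of "x - s *\<^sub>R w" w r] by (simp add: algebra_simps)
    have dq: "((\<lambda>r. ?q (x + r *\<^sub>R w)) has_real_derivative (?p ?y - ?v ?y) / s) (at r)"
      unfolding qp_def by (intro DERIV_cdivide DERIV_diff du dV)
    have dPhi: "((\<lambda>r. Phi a (?q (x + r *\<^sub>R w))) has_real_derivative phi a (?q ?y) * ((?p ?y - ?v ?y) / s)) (at r)"
      by (rule DERIV_chain2[OF Phi_DERIV dq])
    have dLL: "((\<lambda>r. LL a (?q (x + r *\<^sub>R w))) has_real_derivative (?q ?y * phi a (?q ?y) - Phi a (?q ?y)) * ((?p ?y - ?v ?y) / s)) (at r)"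
      by (rule DERIV_chain2[OF LL_DERIV dq])
    have "((\<lambda>r. P (x + r *\<^sub>R w)) has_real_derivative
      s / 2 * (((u ?y + ?V ?y) * (phi a (?q ?y) * ((?p ?y - ?v ?y) / s)) + (?p ?y + ?v ?y) * Phi a (?q ?y))
        + s * ((?q ?y * phi a (?q ?y) - Phi a (?q ?y)) * ((?p ?y - ?v ?y) / s)))) (at r)"
      unfolding P_def by (intro DERIV_cmult DERIV_add DERIV_mult' du dV dPhi dLL)
    then show "((\<lambda>r. P (x + r *\<^sub>R w)) has_real_derivative P' ?y) (at r)"
      by (rule DERIV_cong) (simp add: P'_def)
  qed
  have "?t * (A x - A2 x) = ?t * P' x + (- 2 * (s powr (- a) * dd a (?q x)) + RR a w s x)" for x
    using energy_algebra[OF s, of "?q x" "u x" "?V x" a "?p x" "phi a (?q x)" "Phi a (?q x)" "?v x" "GG a (?q x)"]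
    unfolding A_def A2_def Psi_def P'_def dd_def RR_def LL_def by (simp add: qp_def)
  then have "(\<integral>x. ?t * (A x - A2 x) \<partial>lborel) = (\<integral>x. ?t * P' x + (- 2 * (s powr (- a) * dd a (?q x)) + RR a w s x) \<partial>lborel)"
    by simp
  also have "\<dots> = ?t * (\<integral>x. P' x \<partial>lborel) + (- 2 * (s powr (- a) * (\<integral>x. dd a (?q x) \<partial>lborel)) + (\<integral>x. RR a w s x \<partial>lborel))"
    using iP' dd_qp_integral(1)[OF a s w] RR_integral(1)[OF a s w] by simp
  finally show ?thesis using Y \<open>(\<integral>x. P' x \<partial>lborel) = 0\<close> by simp
qed

definition Lam :: "real \<Rightarrow> pt \<Rightarrow> real \<Rightarrow> real" where
  "Lam a w s = s powr (1 - a) * (\<integral>x. LL a (qp u x w s) \<partial>lborel)"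

lemma LL_integral:
  assumes "0 \<le> a" "s > 0" "norm w = 1"
  shows "integrable lborel (\<lambda>x. LL a (qp u x w s))" "\<bar>\<integral>x. LL a (qp u x w s) \<partial>lborel\<bar> \<le> 3 * K2\<^sup>2 * min 1 (1 / s\<^sup>2)"
proof -
  have i: "integrable lborel (\<lambda>x. 3 * (qp u x w s)\<^sup>2)" by (intro integrable_mult_right L2_square qp_L2)
  show j: "integrable lborel (\<lambda>x. LL a (qp u x w s))"
  proof (rule Bochner_Integration.integrable_bound[OF i])
    have "continuous_on UNIV (\<lambda>x. LL a (qp u x w s))"
      by (rule continuous_on_compose2[OF LL_continuous qp_continuous_x]) auto
    then show "(\<lambda>x. LL a (qp u x w s)) \<in> borel_measurable lborel" using borel_measurable_continuous_onI by simp
  qed (use LL_bound[OF assms(1)] in auto)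
  have "\<bar>\<integral>x. LL a (qp u x w s) \<partial>lborel\<bar> \<le> (\<integral>x. 3 * (qp u x w s)\<^sup>2 \<partial>lborel)"
    using Bochner_Integration.integral_norm_bound_integral[OF j i] LL_bound[OF assms(1)] by simp
  also have "\<dots> \<le> 3 * (K2\<^sup>2 * min 1 (1 / s\<^sup>2))" using qp_square_integral[OF assms(2,3)] by simp
  finally show "\<bar>\<integral>x. LL a (qp u x w s) \<partial>lborel\<bar> \<le> 3 * K2\<^sup>2 * min 1 (1 / s\<^sup>2)" by simp
qed

text \<open>Integrating in s before x collapses the exact derivative to its end values. The
  interchange is made on a compact interval away from 0, where the x-integral of
  \<open>\<bar>RR\<bar>\<close> is bounded.\<close>

lemma RR_Fubini:
  assumes a: "0 \<le> a" "a \<le> 1/2" and c: "0 < c" "c \<le> d" and w: "norm w = 1"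
  shows "(\<integral>s. indicator {c<..<d} s * (\<integral>x. RR a w s x \<partial>lborel) \<partial>lborel) = Lam a w d - Lam a w c"
    and "integrable lborel (\<lambda>s. indicator {c<..<d} s * (\<integral>x. RR a w s x \<partial>lborel))"
proof -
  note [measurable] = C11_measurable[OF C]
  have [measurable]: "LL a \<in> borel_measurable borel" by (intro borel_measurable_continuous_onI LL_continuous)
  let ?M = "5 * K2\<^sup>2 + 2 * (K2 * l2norm (\<lambda>x. Du x \<bullet> w))"
  have M0: "0 \<le> ?M" using K2_nonneg l2norm_nonneg by simp
  have i: "integrable (lborel \<Otimes>\<^sub>M lborel) (\<lambda>(s, x). indicator {c<..<d} s * RR a w s x)"
  proof (rule lborel_pair.Fubini_integrable)
    show m: "(\<lambda>(s, x). indicator {c<..<d} s * RR a w s x) \<in> borel_measurable (lborel \<Otimes>\<^sub>M lborel)"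
      unfolding RR_def by measurable
    show "integrable lborel (\<lambda>s. \<integral>x. norm (case (s, x) of (s, x) \<Rightarrow> indicator {c<..<d} s * RR a w s x) \<partial>lborel)"
    proof (rule Bochner_Integration.integrable_bound)
      show "integrable lborel (\<lambda>s::real. indicator {c<..<d} s * (c powr (- a) * ?M))" using c by simp
      show "AE s in lborel. norm (\<integral>x. norm (case (s, x) of (s, x) \<Rightarrow> indicator {c<..<d} s * RR a w s x) \<partial>lborel) \<le> norm (indicator {c<..<d} s * (c powr (- a) * ?M))"
      proof (intro AE_I2)
        fix s
        show "norm (\<integral>x. norm (case (s, x) of (s, x) \<Rightarrow> indicator {c<..<d} s * RR a w s x) \<partial>lborel) \<le> norm (indicator {c<..<d} s * (c powr (- a) * ?M))"
        proof (cases "s \<in> {c<..<d}")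
          case True
          then have s: "s > 0" using c by simp
          have "(\<integral>x. \<bar>RR a w s x\<bar> \<partial>lborel) \<le> s powr (- a) * ?M" by (rule RR_integral(2)[OF a s w])
          also have "\<dots> \<le> c powr (- a) * ?M" using True c a M0 by (intro mult_right_mono powr_mono2') auto
          finally show ?thesis using True M0 by (simp add: abs_mult)
        qed simp
      qed
      show "(\<lambda>s. \<integral>x. norm (case (s, x) of (s, x) \<Rightarrow> indicator {c<..<d} s * RR a w s x) \<partial>lborel) \<in> borel_measurable lborel"
        unfolding RR_def by measurable
    qed
    show "AE s in lborel. integrable lborel (\<lambda>x. case (s, x) of (s, x) \<Rightarrow> indicator {c<..<d} s * RR a w s x)"
    proof (intro AE_I2)
      fix s show "integrable lborel (\<lambda>x. case (s, x) of (s, x) \<Rightarrow> indicator {c<..<d} s * RR a w s x)"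
        using RR_integral(1)[OF a _ w, of s] c by (cases "s \<in> {c<..<d}") auto
    qed
  qed
  show "integrable lborel (\<lambda>s. indicator {c<..<d} s * (\<integral>x. RR a w s x \<partial>lborel))"
    using lborel_pair.integrable_fst'[OF i] by simp
  have line: "(\<integral>s. indicator {c<..<d} s * RR a w s x \<partial>lborel) = d powr (1 - a) * LL a (qp u x w d) - c powr (1 - a) * LL a (qp u x w c)" for x
  proof -
    have D: "((\<lambda>s. s powr (1 - a) * LL a (qp u x w s)) has_real_derivative RR a w s x) (at s)" if "s > 0" for s
    proof -
      have "((\<lambda>s. s powr (1 - a)) has_real_derivative (1 - a) * s powr (1 - a - 1)) (at s)"
        by (rule has_real_derivative_powr[OF that])
      then have "((\<lambda>s. s powr (1 - a) * LL a (qp u x w s)) has_real_derivative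
        s powr (1 - a) * ((qp u x w s * phi a (qp u x w s) - Phi a (qp u x w s)) * ((Du (x - s *\<^sub>R w) \<bullet> w - qp u x w s) / s))
        + ((1 - a) * s powr (1 - a - 1)) * LL a (qp u x w s)) (at s)"
        using that by (intro DERIV_mult' DERIV_chain2[OF LL_DERIV] qp_DERIV[OF C]) auto
      moreover have "s powr (1 - a) = s powr (- a) * s" using that by (simp add: powr_diff powr_minus_divide)
      ultimately show ?thesis using that by (simp add: RR_def add.commute)
    qed
    have "((\<lambda>s. RR a w s x) has_integral (d powr (1 - a) * LL a (qp u x w d) - c powr (1 - a) * LL a (qp u x w c))) {c..d}"
    proof (rule fundamental_theorem_of_calculus[OF c(2)])
      fix s assume "s \<in> {c..d}"
      then have "s > 0" using c by simp
      from has_field_derivative_at_within[OF D[OF this]]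
      show "((\<lambda>s. s powr (1 - a) * LL a (qp u x w s)) has_vector_derivative RR a w s x) (at s within {c..d})"
        by (simp add: has_real_derivative_iff_has_vector_derivative)
    qed
    then have hk: "integral {c..d} (\<lambda>s. RR a w s x) = d powr (1 - a) * LL a (qp u x w d) - c powr (1 - a) * LL a (qp u x w c)"
      by (rule integral_unique)
    note q = qp_qm_continuous(1)[OF C c(1), of d x w]
    have "continuous_on {c..d} (\<lambda>s. RR a w s x)"
      unfolding RR_def using c(1)
      by (intro continuous_intros q continuous_on_compose2[OF LL_continuous[of UNIV]] continuous_on_compose2[OF phi_continuous[of UNIV]]
          continuous_on_compose2[OF Phi_continuous[of UNIV]] continuous_on_compose2[OF C11_continuous(2)[OF C, of UNIV]]) auto
    then have si: "set_integrable lborel {c<..<d} (\<lambda>s. RR a w s x)"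
      by (intro set_integrable_subset[OF borel_integrable_atLeastAtMost']) auto
    show ?thesis using set_borel_integral_eq_integral(2)[OF si] hk
      by (simp add: set_lebesgue_integral_def integral_open_interval_real)
  qed
  have "(\<integral>s. indicator {c<..<d} s * (\<integral>x. RR a w s x \<partial>lborel) \<partial>lborel) = (\<integral>s. (\<integral>x. indicator {c<..<d} s * RR a w s x \<partial>lborel) \<partial>lborel)"
    by simp
  also have "\<dots> = (\<integral>x. (\<integral>s. indicator {c<..<d} s * RR a w s x \<partial>lborel) \<partial>lborel)"
    by (rule lborel_pair.Fubini_integral[OF i, symmetric])
  also have "\<dots> = Lam a w d - Lam a w c"
    unfolding line Lam_def using LL_integral(1)[OF a(1) _ w] c by simp
  finally show "(\<integral>s. indicator {c<..<d} s * (\<integral>x. RR a w s x \<partial>lborel) \<partial>lborel) = Lam a w d - Lam a w c" .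
qed

end

section \<open>Exhaustion of the half line by intervals from e to 1/e\<close>

definition trunc :: "nat \<Rightarrow> real" where "trunc n = 1 / (real n + 2)"

lemma trunc: "0 < trunc n" "trunc n < 1" "trunc n < 1 / trunc n" "trunc \<longlonglongrightarrow> 0"
proof -
  show 1: "0 < trunc n" "trunc n < 1" by (auto simp: trunc_def)
  have "1 < 1 / trunc n" using 1 by simp
  then show "trunc n < 1 / trunc n" using 1 by linarith
  show "trunc \<longlonglongrightarrow> 0" unfolding trunc_def by real_asymp
qed

lemma trunc_eventually:
  assumes "s > 0" shows "\<forall>\<^sub>F n in sequentially. s \<in> {trunc n<..<1 / trunc n}"
proof -
  have "\<forall>\<^sub>F n in sequentially. trunc n < s" using order_tendstoD(2)[OF trunc(4) assms] .
  moreover have "\<forall>\<^sub>F n in sequentially. trunc n < 1 / s" using order_tendstoD(2)[OF trunc(4), of "1 / s"] assms by simp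
  ultimately show ?thesis
  proof eventually_elim
    case (elim n)
    then show ?case using trunc(1)[of n] assms by (simp add: field_simps)
  qed
qed

lemma trunc_integral_tendsto:
  fixes f :: "real \<Rightarrow> real"
  assumes f: "integrable lborel (\<lambda>s. indicator {0<..} s * f s)"
  shows "(\<lambda>n. \<integral>s. indicator {trunc n<..<1 / trunc n} s * f s \<partial>lborel) \<longlonglongrightarrow> (\<integral>s. indicator {0<..} s * f s \<partial>lborel)"
    and "integrable lborel (\<lambda>s. indicator {trunc n<..<1 / trunc n} s * f s)"
proof -
  have e: "indicator {trunc n<..<1 / trunc n} s * f s = indicator {trunc n<..<1 / trunc n} s * (indicator {0<..} s * f s)" for n s
    using trunc(1)[of n] by (auto simp: indicator_def)
  note [measurable] = borel_measurable_integrable[OF f]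
  show "integrable lborel (\<lambda>s. indicator {trunc n<..<1 / trunc n} s * f s)"
    unfolding e using integrable_mult_indicator[OF _ f, of "{trunc n<..<1 / trunc n}"] by simp
  show "(\<lambda>n. \<integral>s. indicator {trunc n<..<1 / trunc n} s * f s \<partial>lborel) \<longlonglongrightarrow> (\<integral>s. indicator {0<..} s * f s \<partial>lborel)"
    unfolding e
  proof (rule integral_dominated_convergence[where w="\<lambda>s. \<bar>indicator {0<..} s * f s\<bar>"])
    show "AE s in lborel. (\<lambda>n. indicator {trunc n<..<1 / trunc n} s * (indicator {0<..} s * f s)) \<longlonglongrightarrow> indicator {0<..} s * f s"
    proof (intro AE_I2)
      fix s :: real
      show "(\<lambda>n. indicator {trunc n<..<1 / trunc n} s * (indicator {0<..} s * f s)) \<longlonglongrightarrow> indicator {0<..} s * f s"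
      proof (cases "s > 0")
        case True
        have "\<forall>\<^sub>F n in sequentially. indicator {trunc n<..<1 / trunc n} s * (indicator {0<..} s * f s) = indicator {0<..} s * f s"
          using trunc_eventually[OF True] by eventually_elim simp
        then show ?thesis by (rule tendsto_eventually)
      qed simp
    qed
  qed (use f in \<open>auto simp: indicator_def\<close>)
qed

lemma integrable_of_nonneg_le:
  fixes f g :: "'a \<Rightarrow> real"
  assumes "integrable M g" "f \<in> borel_measurable M" "\<And>x. 0 \<le> f x" "\<And>x. f x \<le> g x"
  shows "integrable M f"
proof (rule Bochner_Integration.integrable_bound[OF assms(1,2)])
  have "norm (f x) \<le> norm (g x)" for x using assms(3,4)[of x] by simp
  then show "AE x in M. norm (f x) \<le> norm (g x)" by (intro AE_I2)
qed

definition dz :: "real \<Rightarrow> (pt \<Rightarrow> real) \<Rightarrow> (real \<times> real) \<times> pt \<Rightarrow> real" where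
  "dz a u p = indicator {0<..} (snd (fst p)) * (1 / (1 + (fst (fst p))\<^sup>2) *
     (snd (fst p) powr (- a) * dd a (qp u (snd p) (dir (fst (fst p))) (snd (fst p)))))"

lemma dz_nonneg: "0 \<le> a \<Longrightarrow> 0 \<le> dz a u p"
  using dd_nonneg one_plus_sq_pos[of "fst (fst p)"] by (auto simp: dz_def indicator_def)

context
  fixes B K :: real and u Du
  assumes C: "C11 B u Du" and Lu: "L2 u" and LD: "L2 (\<lambda>x. fst (Du x))" "L2 (\<lambda>x. snd (Du x))"
    and K: "diff_L2_bounds K u"
begin

text \<open>On truncated intervals the identity holds with the two end values of \<open>Lam\<close>.
  Since the integral of \<open>LL\<close> is at most a constant times min(1, 1/s^2), these are of
  order e at 1/e and e^(1/2) at e and disappear. Truncation is used because the available bound for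
  \<open>RR\<close> is not integrable at infinity.\<close>

lemma energy_direction:
  assumes a: "0 \<le> a" "a \<le> 1/2" and w: "norm w = 1"
  shows "(\<integral>s. indicator {0<..} s * (\<integral>x. u x * jj a u Du x w s \<partial>lborel) \<partial>lborel) =
    - 2 * (\<integral>s. indicator {0<..} s * (s powr (- a) * (\<integral>x. dd a (qp u x w s) \<partial>lborel)) \<partial>lborel)"
proof -
  note [measurable] = C11_measurable[OF C]
  define Y where "Y s = (\<integral>x. u x * jj a u Du x w s \<partial>lborel)" for s
  define E where "E s = s powr (- a) * (\<integral>x. dd a (qp u x w s) \<partial>lborel)" for s
  let ?R = "\<lambda>s. \<integral>x. RR u Du a w s x \<partial>lborel"
  have [measurable]: "Y \<in> borel_measurable borel" unfolding Y_def[abs_def] jj_def by measurable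
  have [measurable]: "E \<in> borel_measurable borel" unfolding E_def[abs_def] by measurable
  have iY: "integrable lborel (\<lambda>s. indicator {0<..} s * Y s)"
  proof (rule Bochner_Integration.integrable_bound)
    show "integrable lborel (\<lambda>s. 5 * B * (l2norm u * K2 K u) * mu s)" by (intro integrable_mult_right mu_integrable)
    have "\<bar>Y s\<bar> \<le> 5 * B * (l2norm u * K2 K u) * mu s" if "s > 0" for s
      unfolding Y_def by (rule order_trans[OF integral_abs_bound u_jj_integral(2)[OF C Lu LD K a that w]])
    then show "AE s in lborel. norm (indicator {0<..} s * Y s) \<le> norm (5 * B * (l2norm u * K2 K u) * mu s)"
      by (intro AE_I2) (force simp: indicator_def)
  qed measurable
  have iE: "integrable lborel (\<lambda>s. indicator {0<..} s * E s)"
  proof (rule Bochner_Integration.integrable_bound)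
    show "integrable lborel (\<lambda>s. (K2 K u)\<^sup>2 * mu s)" by (intro integrable_mult_right mu_integrable)
    have "\<bar>E s\<bar> \<le> (K2 K u)\<^sup>2 * mu s" if "s > 0" for s
    proof -
      have "0 \<le> E s" unfolding E_def using dd_nonneg[OF a(1)] by (intro mult_nonneg_nonneg Bochner_Integration.integral_nonneg) auto
      then show ?thesis using dd_qp_integral(2)[OF C Lu LD K a that w] by (simp add: E_def)
    qed
    then show "AE s in lborel. norm (indicator {0<..} s * E s) \<le> norm ((K2 K u)\<^sup>2 * mu s)"
      by (intro AE_I2) (force simp: indicator_def)
  qed measurable
  let ?i = "\<lambda>n. indicator {trunc n<..<1 / trunc n} :: real \<Rightarrow> real"
  have Yn: "(\<integral>s. ?i n s * Y s \<partial>lborel) = - 2 * (\<integral>s. ?i n s * E s \<partial>lborel) + (Lam u a w (1 / trunc n) - Lam u a w (trunc n))" for n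
  proof -
    have "(\<integral>s. ?i n s * Y s \<partial>lborel) = (\<integral>s. - 2 * (?i n s * E s) + ?i n s * ?R s \<partial>lborel)"
    proof (intro Bochner_Integration.integral_cong refl)
      fix s show "?i n s * Y s = - 2 * (?i n s * E s) + ?i n s * ?R s"
        using Y_eq[OF C Lu LD K a _ w, of s] trunc(1)[of n] by (auto simp: indicator_def Y_def E_def)
    qed
    also have "\<dots> = (\<integral>s. - 2 * (?i n s * E s) \<partial>lborel) + (\<integral>s. ?i n s * ?R s \<partial>lborel)"
      by (intro Bochner_Integration.integral_add integrable_mult_right trunc_integral_tendsto(2)[OF iE]
          RR_Fubini(2)[OF C Lu LD K a trunc(1) less_imp_le[OF trunc(3)] w])
    finally show ?thesis
      using RR_Fubini(1)[OF C Lu LD K a trunc(1) less_imp_le[OF trunc(3)] w, of n] by simp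
  qed
  have Lam0: "(\<lambda>n. Lam u a w (1 / trunc n) - Lam u a w (trunc n)) \<longlonglongrightarrow> 0"
  proof (rule Lim_null_comparison)
    show "\<forall>\<^sub>F n in sequentially. norm (Lam u a w (1 / trunc n) - Lam u a w (trunc n)) \<le> 3 * (K2 K u)\<^sup>2 * (trunc n + trunc n powr (1/2))"
    proof (intro always_eventually allI)
      fix n
      let ?t = "trunc n"
      note t = trunc(1-3)[of n]
      have "\<bar>Lam u a w (1 / ?t)\<bar> \<le> (1 / ?t) powr (1 - a) * (3 * (K2 K u)\<^sup>2 * min 1 (1 / (1 / ?t)\<^sup>2))"
        unfolding Lam_def[OF C Lu LD K] abs_mult using LL_integral(2)[OF C Lu LD K a(1) _ w, of "1 / ?t"] t by (intro mult_mono) auto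
      also have "\<dots> \<le> (1 / ?t) powr 1 * (3 * (K2 K u)\<^sup>2 * ?t\<^sup>2)"
        using a t by (intro mult_mono powr_mono) (auto simp: power_divide)
      also have "\<dots> = 3 * (K2 K u)\<^sup>2 * ?t" using t by (simp add: power2_eq_square)
      finally have 1: "\<bar>Lam u a w (1 / ?t)\<bar> \<le> 3 * (K2 K u)\<^sup>2 * ?t" .
      have "\<bar>Lam u a w ?t\<bar> \<le> ?t powr (1 - a) * (3 * (K2 K u)\<^sup>2 * min 1 (1 / ?t\<^sup>2))"
        unfolding Lam_def[OF C Lu LD K] abs_mult using LL_integral(2)[OF C Lu LD K a(1) _ w, of ?t] t by (intro mult_mono) auto
      also have "\<dots> \<le> ?t powr (1/2) * (3 * (K2 K u)\<^sup>2 * 1)"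
        using a t by (intro mult_mono powr_mono') auto
      finally have 2: "\<bar>Lam u a w ?t\<bar> \<le> 3 * (K2 K u)\<^sup>2 * ?t powr (1/2)" by (simp add: mult.commute)
      show "norm (Lam u a w (1 / ?t) - Lam u a w ?t) \<le> 3 * (K2 K u)\<^sup>2 * (?t + ?t powr (1/2))"
        using 1 2 by (simp add: distrib_left)
    qed
    have "(\<lambda>n. 3 * (K2 K u)\<^sup>2 * (trunc n + trunc n powr (1/2))) \<longlonglongrightarrow> 3 * (K2 K u)\<^sup>2 * (0 + 0 powr (1/2))"
      using trunc(1) by (intro tendsto_intros trunc(4) tendsto_powr') (auto intro!: always_eventually less_imp_le)
    then show "(\<lambda>n. 3 * (K2 K u)\<^sup>2 * (trunc n + trunc n powr (1/2))) \<longlonglongrightarrow> 0" by simp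
  qed
  have "(\<lambda>n. - 2 * (\<integral>s. ?i n s * E s \<partial>lborel) + (Lam u a w (1 / trunc n) - Lam u a w (trunc n))) \<longlonglongrightarrow> - 2 * (\<integral>s. indicator {0<..} s * E s \<partial>lborel) + 0"
    by (intro tendsto_add tendsto_mult tendsto_const trunc_integral_tendsto(1)[OF iE] Lam0)
  moreover have "(\<lambda>n. - 2 * (\<integral>s. ?i n s * E s \<partial>lborel) + (Lam u a w (1 / trunc n) - Lam u a w (trunc n))) \<longlonglongrightarrow> (\<integral>s. indicator {0<..} s * Y s \<partial>lborel)"
    unfolding Yn[symmetric] by (rule trunc_integral_tendsto(1)[OF iY])
  ultimately have "(\<integral>s. indicator {0<..} s * Y s \<partial>lborel) = - 2 * (\<integral>s. indicator {0<..} s * E s \<partial>lborel) + 0"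
    using LIMSEQ_unique by blast
  then show ?thesis by (simp add: Y_def E_def)
qed

lemma dz_measurable: "dz a u \<in> borel_measurable ((lborel \<Otimes>\<^sub>M lborel) \<Otimes>\<^sub>M lborel)"
proof -
  note [measurable] = C11_measurable[OF C]
  show ?thesis unfolding dz_def[abs_def] by measurable
qed

text \<open>The splitting of the integrand is useful only after integration in x, so x is integrated
  first, then s, then the slope. Both interchanges rest on bounds of the x-integrals by a constant
  times \<open>wgt\<close>.\<close>

lemma energy_identity:
  assumes a: "0 \<le> a" "a \<le> 1/2"
  shows "integrable ((lborel \<Otimes>\<^sub>M lborel) \<Otimes>\<^sub>M lborel) (dz a u)"
    and "(\<integral>x. u x * JJ a u Du x \<partial>lborel) = - 2 * (\<integral>p. dz a u p \<partial>((lborel \<Otimes>\<^sub>M lborel) \<Otimes>\<^sub>M lborel))"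
proof -
  note [measurable] = C11_measurable[OF C] dz_measurable
  interpret P: pair_sigma_finite "lborel \<Otimes>\<^sub>M lborel :: (real \<times> real) measure" "lborel :: pt measure"
    unfolding lborel_prod ..
  have p: "0 \<le> 1 / (1 + t\<^sup>2)" for t :: real using one_plus_sq_pos[of t] by simp
  let ?w = "\<lambda>z. dir (fst z)"
  have uj: "integrable lborel (\<lambda>x. u x * jz a u Du x z)" "(\<integral>x. \<bar>u x * jz a u Du x z\<bar> \<partial>lborel) \<le> 5 * B * (l2norm u * K2 K u) * wgt z" for z
  proof -
    have "integrable lborel (\<lambda>x. u x * jz a u Du x z) \<and> (\<integral>x. \<bar>u x * jz a u Du x z\<bar> \<partial>lborel) \<le> 5 * B * (l2norm u * K2 K u) * wgt z"
    proof (cases "snd z > 0")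
      case True
      note j = u_jj_integral[OF C Lu LD K a True norm_dir, of "fst z"]
      have e: "u x * jz a u Du x z = 1 / (1 + (fst z)\<^sup>2) * (u x * jj a u Du x (?w z) (snd z))" for x
        using True by (simp add: jz_def)
      have "(\<integral>x. \<bar>u x * jz a u Du x z\<bar> \<partial>lborel) = 1 / (1 + (fst z)\<^sup>2) * (\<integral>x. \<bar>u x * jj a u Du x (?w z) (snd z)\<bar> \<partial>lborel)"
        unfolding e abs_mult[of "1 / (1 + (fst z)\<^sup>2)"] abs_of_nonneg[OF p] by (rule integral_mult_right_zero)
      also have "\<dots> \<le> 1 / (1 + (fst z)\<^sup>2) * (5 * B * (l2norm u * K2 K u) * mu (snd z))" by (intro mult_left_mono j p)
      finally show ?thesis unfolding e using j(1) by (simp add: wgt_def mult_ac)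
    next
      case False
      then show ?thesis using C11_ge_1[OF C] K2_nonneg[OF C Lu LD K] l2norm_nonneg[of u] wgt_nonneg[of z] by (simp add: jz_def)
    qed
    then show "integrable lborel (\<lambda>x. u x * jz a u Du x z)" "(\<integral>x. \<bar>u x * jz a u Du x z\<bar> \<partial>lborel) \<le> 5 * B * (l2norm u * K2 K u) * wgt z" by auto
  qed
  have ij: "integrable ((lborel \<Otimes>\<^sub>M lborel) \<Otimes>\<^sub>M lborel) (\<lambda>(z, x). u x * jz a u Du x z)"
  proof (rule P.Fubini_integrable)
    show "(\<lambda>(z, x). u x * jz a u Du x z) \<in> borel_measurable ((lborel \<Otimes>\<^sub>M lborel) \<Otimes>\<^sub>M lborel)"
      unfolding jz_def jj_def by measurable
    have "(\<lambda>z. \<integral>x. norm (case (z, x) of (z, x) \<Rightarrow> u x * jz a u Du x z) \<partial>lborel) \<in> borel_measurable (lborel \<Otimes>\<^sub>M lborel)"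
      unfolding jz_def jj_def by (intro sigma_finite_measure.borel_measurable_lebesgue_integral[OF sigma_finite_lborel]) measurable
    then show "integrable (lborel \<Otimes>\<^sub>M lborel) (\<lambda>z. \<integral>x. norm (case (z, x) of (z, x) \<Rightarrow> u x * jz a u Du x z) \<partial>lborel)"
      by (rule integrable_of_nonneg_le[OF integrable_mult_right[OF wgt_integrable, of "5 * B * (l2norm u * K2 K u)"]])
        (use uj(2) in simp_all)
    show "AE z in lborel \<Otimes>\<^sub>M lborel. integrable lborel (\<lambda>x. case (z, x) of (z, x) \<Rightarrow> u x * jz a u Du x z)"
      using uj(1) by simp
  qed
  have dq: "integrable lborel (\<lambda>x. dz a u (z, x))" "(\<integral>x. dz a u (z, x) \<partial>lborel) \<le> (K2 K u)\<^sup>2 * wgt z" for z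
  proof -
    have "integrable lborel (\<lambda>x. dz a u (z, x)) \<and> (\<integral>x. dz a u (z, x) \<partial>lborel) \<le> (K2 K u)\<^sup>2 * wgt z"
    proof (cases "snd z > 0")
      case True
      note j = dd_qp_integral[OF C Lu LD K a True norm_dir, of "fst z"]
      have e: "dz a u (z, x) = 1 / (1 + (fst z)\<^sup>2) * (snd z powr (- a) * dd a (qp u x (?w z) (snd z)))" for x
        using True by (simp add: dz_def)
      have "(\<integral>x. dz a u (z, x) \<partial>lborel) = 1 / (1 + (fst z)\<^sup>2) * (snd z powr (- a) * (\<integral>x. dd a (qp u x (?w z) (snd z)) \<partial>lborel))"
        unfolding e by (simp only: integral_mult_right_zero)
      also have "\<dots> \<le> 1 / (1 + (fst z)\<^sup>2) * ((K2 K u)\<^sup>2 * mu (snd z))" by (intro mult_left_mono j p)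
      finally show ?thesis unfolding e using j(1) by (simp add: wgt_def mult_ac)
    next
      case False
      then show ?thesis using wgt_nonneg[of z] by (simp add: dz_def)
    qed
    then show "integrable lborel (\<lambda>x. dz a u (z, x))" "(\<integral>x. dz a u (z, x) \<partial>lborel) \<le> (K2 K u)\<^sup>2 * wgt z" by auto
  qed
  show id: "integrable ((lborel \<Otimes>\<^sub>M lborel) \<Otimes>\<^sub>M lborel) (dz a u)"
  proof (rule P.Fubini_integrable[OF dz_measurable])
    have "(\<lambda>z. \<integral>x. norm (dz a u (z, x)) \<partial>lborel) \<in> borel_measurable (lborel \<Otimes>\<^sub>M lborel)"
      by (intro sigma_finite_measure.borel_measurable_lebesgue_integral[OF sigma_finite_lborel]) measurable
    then show "integrable (lborel \<Otimes>\<^sub>M lborel) (\<lambda>z. \<integral>x. norm (dz a u (z, x)) \<partial>lborel)"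
      by (rule integrable_of_nonneg_le[OF integrable_mult_right[OF wgt_integrable, of "(K2 K u)\<^sup>2"]])
        (use dq(2) dz_nonneg[OF a(1)] in simp_all)
  qed (use dq(1) in simp)
  have "(\<integral>x. u x * JJ a u Du x \<partial>lborel) = (\<integral>x. (\<integral>z. u x * jz a u Du x z \<partial>(lborel \<Otimes>\<^sub>M lborel)) \<partial>lborel)"
    by (simp add: JJ_def)
  also have "\<dots> = (\<integral>z. (\<integral>x. u x * jz a u Du x z \<partial>lborel) \<partial>(lborel \<Otimes>\<^sub>M lborel))"
    by (rule P.Fubini_integral[OF ij])
  also have "\<dots> = (\<integral>\<tau>. (\<integral>s. (\<integral>x. u x * jz a u Du x (\<tau>, s) \<partial>lborel) \<partial>lborel) \<partial>lborel)"
    using lborel_pair.integral_fst'[OF P.integrable_fst'[OF ij]] by simp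
  also have "\<dots> = (\<integral>\<tau>. - 2 * (\<integral>s. (\<integral>x. dz a u ((\<tau>, s), x) \<partial>lborel) \<partial>lborel) \<partial>lborel)"
  proof (intro Bochner_Integration.integral_cong refl)
    fix \<tau> :: real
    have 1: "(\<integral>x. u x * jz a u Du x (\<tau>, s) \<partial>lborel) = 1 / (1 + \<tau>\<^sup>2) * (indicator {0<..} s * (\<integral>x. u x * jj a u Du x (dir \<tau>) s \<partial>lborel))" for s
    proof -
      have "u x * jz a u Du x (\<tau>, s) = 1 / (1 + \<tau>\<^sup>2) * (indicator {0<..} s * (u x * jj a u Du x (dir \<tau>) s))" for x
        by (simp add: jz_def)
      then show ?thesis by (simp only: integral_mult_right_zero)
    qed
    have 2: "(\<integral>x. dz a u ((\<tau>, s), x) \<partial>lborel) = 1 / (1 + \<tau>\<^sup>2) * (indicator {0<..} s * (s powr (- a) * (\<integral>x. dd a (qp u x (dir \<tau>) s) \<partial>lborel)))" for s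
    proof -
      have "dz a u ((\<tau>, s), x) = 1 / (1 + \<tau>\<^sup>2) * (indicator {0<..} s * (s powr (- a) * dd a (qp u x (dir \<tau>) s)))" for x
        by (simp add: dz_def)
      then show ?thesis by (simp only: integral_mult_right_zero)
    qed
    show "(\<integral>s. (\<integral>x. u x * jz a u Du x (\<tau>, s) \<partial>lborel) \<partial>lborel) = - 2 * (\<integral>s. (\<integral>x. dz a u ((\<tau>, s), x) \<partial>lborel) \<partial>lborel)"
      unfolding 1 2 integral_mult_right_zero energy_direction[OF a norm_dir] by (rule mult.left_commute)
  qed
  also have "\<dots> = - 2 * (\<integral>\<tau>. (\<integral>s. (\<integral>x. dz a u ((\<tau>, s), x) \<partial>lborel) \<partial>lborel) \<partial>lborel)"
    by (rule integral_mult_right_zero)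
  also have "(\<integral>\<tau>. (\<integral>s. (\<integral>x. dz a u ((\<tau>, s), x) \<partial>lborel) \<partial>lborel) \<partial>lborel) = (\<integral>z. (\<integral>x. dz a u (z, x) \<partial>lborel) \<partial>(lborel \<Otimes>\<^sub>M lborel))"
    using lborel_pair.integral_fst'[OF P.integrable_fst'[OF id]] by simp
  also have "\<dots> = (\<integral>p. dz a u p \<partial>((lborel \<Otimes>\<^sub>M lborel) \<Otimes>\<^sub>M lborel))" by (rule P.integral_fst'[OF id])
  finally show "(\<integral>x. u x * JJ a u Du x \<partial>lborel) = - 2 * (\<integral>p. dz a u p \<partial>((lborel \<Otimes>\<^sub>M lborel) \<Otimes>\<^sub>M lborel))" .
qed

end

lemma sobolev_mono: "sobolev k f \<Longrightarrow> l \<le> k \<Longrightarrow> sobolev l f"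
  by (auto simp: sobolev_def)

section \<open>Evolution in time\<close>

definition crep0 :: "(pt \<Rightarrow> real) \<Rightarrow> pt \<Rightarrow> real" where "crep0 = crep 0 0"

lemma crep0_L2: "sobolev 4 f \<Longrightarrow> L2 (crep0 f)"
  unfolding crep0_def by (rule crep_L2) auto

context
  fixes k :: nat and T :: real and u u' :: "real \<Rightarrow> pt \<Rightarrow> real"
  assumes k: "4 \<le> k" and H: "C1_Hk k T u u'"
begin

lemma time_sobolev: "t \<in> {0..T} \<Longrightarrow> sobolev 4 (u t)" "t \<in> {0..T} \<Longrightarrow> sobolev 4 (u' t)"
  using H k sobolev_mono[of k _ 4] by (auto simp: C1_Hk_def)

text \<open>The error of the time difference quotient. It is written as nested linear combinations
  with explicit factors 1 and -1 so that \<open>sobolev_lin\<close> and \<open>crep_lin\<close>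
  match it literally.\<close>

definition quot :: "real \<Rightarrow> real \<Rightarrow> pt \<Rightarrow> real" where
  "quot t s x = 1 * (1 / (s - t) * u s x + (- 1 / (s - t)) * u t x) + (- 1) * u' t x"

lemma quot_sobolev: "t \<in> {0..T} \<Longrightarrow> s \<in> {0..T} \<Longrightarrow> sobolev 4 (quot t s)"
  unfolding quot_def by (intro sobolev_lin time_sobolev)

lemma quot_tendsto:
  assumes t: "t \<in> {0..T}"
  shows "((\<lambda>s. hk_norm 4 (quot t s)) \<longlongrightarrow> 0) (at t within {0..T})"
proof (rule tendstoI)
  fix e :: real assume e: "e > 0"
  have "((\<lambda>h. hk_norm k (\<lambda>x. (u (t + h) x - u t x) / h - u' t x)) \<longlongrightarrow> 0) (at 0 within {h. t + h \<in> {0..T}})"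
    using H t by (auto simp: C1_Hk_def)
  from tendstoD[OF this e] obtain d where d: "d > 0"
    "\<And>h. t + h \<in> {0..T} \<Longrightarrow> h \<noteq> 0 \<Longrightarrow> \<bar>h\<bar> < d \<Longrightarrow> hk_norm k (\<lambda>x. (u (t + h) x - u t x) / h - u' t x) < e"
    using hk_norm_nonneg by (force simp: eventually_at dist_real_def)
  show "\<forall>\<^sub>F s in at t within {0..T}. dist (hk_norm 4 (quot t s)) 0 < e"
    unfolding eventually_at
  proof (intro exI[of _ d] conjI d(1) ballI impI)
    fix s assume s: "s \<in> {0..T}" "s \<noteq> t \<and> dist s t < d"
    have "quot t s = (\<lambda>x. (u (t + (s - t)) x - u t x) / (s - t) - u' t x)"
      by (auto simp: quot_def diff_divide_distrib)
    then have "hk_norm k (quot t s) < e" using d(2)[of "s - t"] s by (simp add: dist_real_def)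
    then show "dist (hk_norm 4 (quot t s)) 0 < e"
      using hk_norm_mono[OF k, of "quot t s"] hk_norm_nonneg[of 4 "quot t s"] by (simp add: dist_real_def)
  qed
qed

lemma quot_crep0:
  assumes "t \<in> {0..T}" "s \<in> {0..T}"
  shows "crep0 (quot t s) x = (crep0 (u s) x - crep0 (u t) x) / (s - t) - crep0 (u' t) x"
proof -
  have 1: "sobolev 4 (\<lambda>x. 1 / (s - t) * u s x + (- 1 / (s - t)) * u t x)" by (intro sobolev_lin time_sobolev assms)
  have "crep0 (quot t s) x = 1 * crep0 (\<lambda>x. 1 / (s - t) * u s x + (- 1 / (s - t)) * u t x) x + (- 1) * crep0 (u' t) x"
    unfolding quot_def crep0_def by (rule crep_lin[OF 1 time_sobolev(2)[OF assms(1)]]) simp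
  also have "crep0 (\<lambda>x. 1 / (s - t) * u s x + (- 1 / (s - t)) * u t x) x = 1 / (s - t) * crep0 (u s) x + (- 1 / (s - t)) * crep0 (u t) x"
    unfolding crep0_def by (rule crep_lin[OF time_sobolev(1)[OF assms(2)] time_sobolev(1)[OF assms(1)]]) simp
  finally show ?thesis by (simp add: diff_divide_distrib)
qed

lemma increment_crep0:
  assumes "t \<in> {0..T}" "s \<in> {0..T}" "s \<noteq> t"
  shows "crep0 (u s) x = crep0 (u t) x + (s - t) * (crep0 (u' t) x + crep0 (quot t s) x)"
  using assms by (simp add: quot_crep0 field_simps)

lemma crep0_time_derivative:
  assumes t: "t \<in> {0..T}"
  shows "((\<lambda>t. crep0 (u t) x) has_real_derivative crep0 (u' t) x) (at t within {0..T})"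
proof -
  have "((\<lambda>s. crep0 (quot t s) x) \<longlongrightarrow> 0) (at t within {0..T})"
  proof (rule Lim_null_comparison)
    show "\<forall>\<^sub>F s in at t within {0..T}. norm (crep0 (quot t s) x) \<le> 4 * hk_norm 4 (quot t s)"
      unfolding crep0_def real_norm_def
      by (auto simp: eventually_at_filter intro!: always_eventually crep_bound quot_sobolev t)
    show "((\<lambda>s. 4 * hk_norm 4 (quot t s)) \<longlongrightarrow> 0) (at t within {0..T})"
      using tendsto_mult_right_zero[OF quot_tendsto[OF t]] .
  qed
  then have "((\<lambda>s. crep0 (quot t s) x + crep0 (u' t) x) \<longlongrightarrow> 0 + crep0 (u' t) x) (at t within {0..T})"
    by (intro tendsto_add tendsto_const)
  moreover have "\<forall>\<^sub>F s in at t within {0..T}. crep0 (quot t s) x + crep0 (u' t) x = (crep0 (u s) x - crep0 (u t) x) / (s - t)"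
    unfolding eventually_at_filter using t by (auto simp: quot_crep0 intro!: always_eventually)
  ultimately show ?thesis unfolding has_field_derivative_iff by (simp add: tendsto_cong)
qed

text \<open>A bound for the change between times t and s that is uniform in space; the 4 is the
  constant of \<open>crep_bound\<close>.\<close>

definition modulus :: "real \<Rightarrow> real \<Rightarrow> real" where
  "modulus t s = 4 * \<bar>s - t\<bar> * (hk_norm 4 (u' t) + hk_norm 4 (quot t s))"

lemma modulus_tendsto: assumes t: "t \<in> {0..T}" shows "((\<lambda>s. modulus t s) \<longlongrightarrow> 0) (at t within {0..T})"
proof -
  have "((\<lambda>s. modulus t s) \<longlongrightarrow> 4 * \<bar>t - t\<bar> * (hk_norm 4 (u' t) + 0)) (at t within {0..T})"
    unfolding modulus_def by (intro tendsto_intros quot_tendsto t)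
  then show ?thesis by simp
qed

lemma crep0_modulus:
  assumes "t \<in> {0..T}" "s \<in> {0..T}"
  shows "\<bar>crep0 (u s) x - crep0 (u t) x\<bar> \<le> modulus t s"
proof (cases "s = t")
  case False
  have "\<bar>crep0 (u s) x - crep0 (u t) x\<bar> = \<bar>s - t\<bar> * \<bar>crep0 (u' t) x + crep0 (quot t s) x\<bar>"
    using increment_crep0[OF assms False, of x] by (simp add: abs_mult)
  also have "\<dots> \<le> \<bar>s - t\<bar> * (4 * hk_norm 4 (u' t) + 4 * hk_norm 4 (quot t s))"
    using crep_bound[OF time_sobolev(2)[OF assms(1)], of 0 0 x] crep_bound[OF quot_sobolev[OF assms], of 0 0 x]
    by (intro mult_left_mono order_trans[OF abs_triangle_ineq] add_mono) (auto simp: crep0_def)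
  finally show ?thesis by (simp add: modulus_def algebra_simps)
qed (simp add: modulus_def)

text \<open>The uniform bound in the theorem speaks of the family; for the limit solution a bound
  comes from continuity of its H^4 norm on the compact time interval.\<close>

lemma time_hk_bounded: "\<exists>M. \<forall>t\<in>{0..T}. hk_norm 4 (u t) \<le> M"
proof -
  have inc: "hk_norm 4 (u s) \<le> hk_norm 4 (u t) + modulus t s" "hk_norm 4 (u t) \<le> hk_norm 4 (u s) + modulus t s"
    if ts: "t \<in> {0..T}" "s \<in> {0..T}" "s \<noteq> t" for t s
  proof -
    have q: "hk_norm 4 (\<lambda>x. 1 * u' t x + 1 * quot t s x) \<le> hk_norm 4 (u' t) + hk_norm 4 (quot t s)"
      using hk_norm_triangle[OF time_sobolev(2)[OF ts(1)] quot_sobolev[OF ts(1,2)], of 1 1] by simp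
    have sq: "sobolev 4 (\<lambda>x. 1 * u' t x + 1 * quot t s x)" by (intro sobolev_lin time_sobolev quot_sobolev ts)
    have "1 * u' t x + 1 * quot t s x = (u s x - u t x) / (s - t)" for x
      by (simp add: quot_def diff_divide_distrib)
    then have dq: "(s - t) * (1 * u' t x + 1 * quot t s x) = u s x - u t x" for x using ts(3) by simp
    \<comment> \<open>Each of the two functions is the other plus a multiple of u' + quot, so one
      triangle inequality serves both directions.\<close>
    have e: "u s = (\<lambda>x. 1 * u t x + (s - t) * (1 * u' t x + 1 * quot t s x))" "u t = (\<lambda>x. 1 * u s x + (- (s - t)) * (1 * u' t x + 1 * quot t s x))"
      unfolding mult_minus_left dq by auto
    have m: "\<bar>s - t\<bar> * hk_norm 4 (\<lambda>x. 1 * u' t x + 1 * quot t s x) \<le> modulus t s"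
    proof -
      have "\<bar>s - t\<bar> * hk_norm 4 (\<lambda>x. 1 * u' t x + 1 * quot t s x) \<le> \<bar>s - t\<bar> * (hk_norm 4 (u' t) + hk_norm 4 (quot t s))"
        by (intro mult_left_mono q) auto
      also have "\<dots> \<le> 4 * (\<bar>s - t\<bar> * (hk_norm 4 (u' t) + hk_norm 4 (quot t s)))"
        using hk_norm_nonneg[of 4 "u' t"] hk_norm_nonneg[of 4 "quot t s"] by simp
      finally show ?thesis by (simp add: modulus_def mult.assoc)
    qed
    show "hk_norm 4 (u s) \<le> hk_norm 4 (u t) + modulus t s"
      by (subst e(1)) (use hk_norm_triangle[OF time_sobolev(1)[OF ts(1)] sq, of 1 "s - t"] m in linarith)
    show "hk_norm 4 (u t) \<le> hk_norm 4 (u s) + modulus t s"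
      by (subst e(2)) (use hk_norm_triangle[OF time_sobolev(1)[OF ts(2)] sq, of 1 "- (s - t)"] m in \<open>simp add: abs_minus_commute\<close>)
  qed
  have "continuous_on {0..T} (\<lambda>t. hk_norm 4 (u t))"
    unfolding continuous_on_def
  proof
    fix t assume t: "t \<in> {0..T}"
    have "((\<lambda>s. hk_norm 4 (u s) - hk_norm 4 (u t)) \<longlongrightarrow> 0) (at t within {0..T})"
    proof (rule Lim_null_comparison[OF _ modulus_tendsto[OF t]])
      show "\<forall>\<^sub>F s in at t within {0..T}. norm (hk_norm 4 (u s) - hk_norm 4 (u t)) \<le> modulus t s"
        unfolding eventually_at_filter using inc[OF t] by (intro always_eventually) (force simp: abs_le_iff)
    qed
    then show "((\<lambda>t. hk_norm 4 (u t)) \<longlongrightarrow> hk_norm 4 (u t)) (at t within {0..T})" by (simp add: Lim_null[symmetric])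
  qed
  then have "compact ((\<lambda>t. hk_norm 4 (u t)) ` {0..T})" by (intro compact_continuous_image) auto
  then obtain M where "\<forall>y\<in>(\<lambda>t. hk_norm 4 (u t)) ` {0..T}. norm y \<le> M"
    using compact_imp_bounded bounded_iff by metis
  then show ?thesis by (intro exI[of _ M]) auto
qed

text \<open>With u(s) = U + (s - t)(V + D) and D the error of the quotient, the square expands
  exactly. The remainder is controlled by Cauchy-Schwarz and the H^4 norm of D.\<close>

lemma energy_derivative:
  assumes t: "t \<in> {0..T}"
  shows "((\<lambda>t. \<integral>x. (crep0 (u t) x)\<^sup>2 \<partial>lborel) has_real_derivative 2 * (\<integral>x. crep0 (u t) x * crep0 (u' t) x \<partial>lborel)) (at t within {0..T})"
proof -
  let ?U = "crep0 (u t)" and ?V = "crep0 (u' t)" and ?D = "\<lambda>s. crep0 (quot t s)"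
  note LU = crep0_L2[OF time_sobolev(1)[OF t]] and LV = crep0_L2[OF time_sobolev(2)[OF t]]
  have nD: "l2norm (?D s) \<le> hk_norm 4 (quot t s)" if "s \<in> {0..T}" for s
    unfolding crep0_def by (rule crep_l2norm_le[OF quot_sobolev[OF t that]])
  have eq: "((\<integral>x. (crep0 (u s) x)\<^sup>2 \<partial>lborel) - (\<integral>x. (?U x)\<^sup>2 \<partial>lborel)) / (s - t) - 2 * (\<integral>x. ?U x * ?V x \<partial>lborel)
     = 2 * (\<integral>x. ?U x * ?D s x \<partial>lborel) + (s - t) * (\<integral>x. (?V x + ?D s x)\<^sup>2 \<partial>lborel)"
    if s: "s \<in> {0..T}" "s \<noteq> t" for s
  proof -
    note LD = crep0_L2[OF quot_sobolev[OF t s(1)]]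
    have "(\<integral>x. (crep0 (u s) x)\<^sup>2 \<partial>lborel) = (\<integral>x. (?U x)\<^sup>2 + 2 * (s - t) * (?U x * ?V x) + 2 * (s - t) * (?U x * ?D s x) + (s - t)\<^sup>2 * (?V x + ?D s x)\<^sup>2 \<partial>lborel)"
      unfolding increment_crep0[OF t s] by (intro Bochner_Integration.integral_cong) (auto simp: power2_eq_square algebra_simps)
    also have "\<dots> = (\<integral>x. (?U x)\<^sup>2 \<partial>lborel) + 2 * (s - t) * (\<integral>x. ?U x * ?V x \<partial>lborel) + 2 * (s - t) * (\<integral>x. ?U x * ?D s x \<partial>lborel) + (s - t)\<^sup>2 * (\<integral>x. (?V x + ?D s x)\<^sup>2 \<partial>lborel)"
      using L2_square[OF LU] L2_mult[OF LU LV] L2_mult[OF LU LD] L2_square[OF L2_add[OF LV LD]] by simp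
    finally show ?thesis using s(2) by (simp add: field_simps power2_eq_square)
  qed
  have b: "norm (2 * (\<integral>x. ?U x * ?D s x \<partial>lborel) + (s - t) * (\<integral>x. (?V x + ?D s x)\<^sup>2 \<partial>lborel))
     \<le> 2 * (l2norm ?U * hk_norm 4 (quot t s)) + \<bar>s - t\<bar> * (l2norm ?V + hk_norm 4 (quot t s))\<^sup>2" if s: "s \<in> {0..T}" for s
  proof -
    note LD = crep0_L2[OF quot_sobolev[OF t s]]
    have 1: "\<bar>\<integral>x. ?U x * ?D s x \<partial>lborel\<bar> \<le> l2norm ?U * hk_norm 4 (quot t s)"
      using L2_Cauchy_Schwarz[OF LU LD] mult_left_mono[OF nD[OF s] l2norm_nonneg[of ?U]] by linarith
    have "(\<integral>x. (?V x + ?D s x)\<^sup>2 \<partial>lborel) = (l2norm (\<lambda>x. ?V x + ?D s x))\<^sup>2" by (simp add: l2norm_power2)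
    also have "\<dots> \<le> (l2norm ?V + hk_norm 4 (quot t s))\<^sup>2"
      using l2norm_triangle[OF LV LD] nD[OF s] by (intro power_mono l2norm_nonneg) linarith
    finally have "\<bar>s - t\<bar> * \<bar>\<integral>x. (?V x + ?D s x)\<^sup>2 \<partial>lborel\<bar> \<le> \<bar>s - t\<bar> * (l2norm ?V + hk_norm 4 (quot t s))\<^sup>2"
      by (intro mult_left_mono) auto
    then have 2: "\<bar>(s - t) * (\<integral>x. (?V x + ?D s x)\<^sup>2 \<partial>lborel)\<bar> \<le> \<bar>s - t\<bar> * (l2norm ?V + hk_norm 4 (quot t s))\<^sup>2"
      by (simp add: abs_mult)
    have "\<bar>2 * A + C\<bar> \<le> 2 * A' + C'" if "\<bar>A\<bar> \<le> A'" "\<bar>C\<bar> \<le> C'" for A A' C C' :: real using that by linarith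
    from this[OF 1 2] show ?thesis by simp
  qed
  have "((\<lambda>s. 2 * (l2norm ?U * hk_norm 4 (quot t s)) + \<bar>s - t\<bar> * (l2norm ?V + hk_norm 4 (quot t s))\<^sup>2)
     \<longlongrightarrow> 2 * (l2norm ?U * 0) + \<bar>t - t\<bar> * (l2norm ?V + 0)\<^sup>2) (at t within {0..T})"
    by (intro tendsto_intros quot_tendsto t)
  then have lim: "((\<lambda>s. 2 * (l2norm ?U * hk_norm 4 (quot t s)) + \<bar>s - t\<bar> * (l2norm ?V + hk_norm 4 (quot t s))\<^sup>2)
     \<longlongrightarrow> 0) (at t within {0..T})" by simp
  have "((\<lambda>s. ((\<integral>x. (crep0 (u s) x)\<^sup>2 \<partial>lborel) - (\<integral>x. (?U x)\<^sup>2 \<partial>lborel)) / (s - t) - 2 * (\<integral>x. ?U x * ?V x \<partial>lborel)) \<longlongrightarrow> 0) (at t within {0..T})"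
  proof (rule Lim_null_comparison[OF _ lim])
    show "\<forall>\<^sub>F s in at t within {0..T}. norm (((\<integral>x. (crep0 (u s) x)\<^sup>2 \<partial>lborel) - (\<integral>x. (?U x)\<^sup>2 \<partial>lborel)) / (s - t) - 2 * (\<integral>x. ?U x * ?V x \<partial>lborel))
       \<le> 2 * (l2norm ?U * hk_norm 4 (quot t s)) + \<bar>s - t\<bar> * (l2norm ?V + hk_norm 4 (quot t s))\<^sup>2"
      unfolding eventually_at_filter
    proof (intro always_eventually allI impI)
      fix s assume "s \<noteq> t" "s \<in> {0..T}"
      then show "norm (((\<integral>x. (crep0 (u s) x)\<^sup>2 \<partial>lborel) - (\<integral>x. (?U x)\<^sup>2 \<partial>lborel)) / (s - t) - 2 * (\<integral>x. ?U x * ?V x \<partial>lborel))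
         \<le> 2 * (l2norm ?U * hk_norm 4 (quot t s)) + \<bar>s - t\<bar> * (l2norm ?V + hk_norm 4 (quot t s))\<^sup>2"
        by (subst eq) (assumption+, rule b)
    qed
  qed
  then show ?thesis unfolding has_field_derivative_iff by (simp add: Lim_null[symmetric])
qed

text \<open>Supplies the measurability in time of the dissipation, which Fatou's lemma needs in the
  time variable. Here the continuity of \<open>u'\<close> in the H^k norm enters.\<close>

lemma pairing_continuous: "continuous_on {0..T} (\<lambda>t. \<integral>x. crep0 (u t) x * crep0 (u' t) x \<partial>lborel)"
  unfolding continuous_on_def
proof
  fix t assume t: "t \<in> {0..T}"
  let ?U = "\<lambda>t. crep0 (u t)" and ?V = "\<lambda>t. crep0 (u' t)"
  let ?du = "\<lambda>s. \<bar>s - t\<bar> * (l2norm (?V t) + hk_norm 4 (quot t s))" and ?dv = "\<lambda>s. hk_norm k (\<lambda>x. u' s x - u' t x)"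
  have dv: "(?dv \<longlongrightarrow> 0) (at t within {0..T})" using H t by (auto simp: C1_Hk_def)
  have nU: "l2norm (\<lambda>x. ?U s x - ?U t x) \<le> ?du s" if s: "s \<in> {0..T}" "s \<noteq> t" for s
  proof -
    note L = crep0_L2[OF time_sobolev(2)[OF t]] crep0_L2[OF quot_sobolev[OF t s(1)]]
    have "l2norm (\<lambda>x. ?U s x - ?U t x) = \<bar>s - t\<bar> * l2norm (\<lambda>x. ?V t x + crep0 (quot t s) x)"
      unfolding increment_crep0[OF t s] using l2norm_cmult[of "s - t" "\<lambda>x. ?V t x + crep0 (quot t s) x"] by simp
    also have "\<dots> \<le> ?du s"
      using l2norm_triangle[OF L] crep_l2norm_le[OF quot_sobolev[OF t s(1)]] by (intro mult_left_mono) (auto simp: crep0_def)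
    finally show ?thesis .
  qed
  have nV: "l2norm (\<lambda>x. ?V s x - ?V t x) \<le> ?dv s" if s: "s \<in> {0..T}" for s
  proof -
    have sb: "sobolev 4 (\<lambda>x. 1 * u' s x + (- 1) * u' t x)" by (intro sobolev_lin time_sobolev s t)
    have "crep0 (\<lambda>x. 1 * u' s x + (- 1) * u' t x) x = 1 * ?V s x + (- 1) * ?V t x" for x
      unfolding crep0_def by (rule crep_lin[OF time_sobolev(2)[OF s] time_sobolev(2)[OF t]]) simp
    then have "(\<lambda>x. ?V s x - ?V t x) = crep0 (\<lambda>x. 1 * u' s x + (- 1) * u' t x)" by auto
    then have "l2norm (\<lambda>x. ?V s x - ?V t x) \<le> hk_norm 4 (\<lambda>x. 1 * u' s x + (- 1) * u' t x)"
      using crep_l2norm_le[OF sb] by (simp add: crep0_def)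
    also have "\<dots> \<le> hk_norm k (\<lambda>x. 1 * u' s x + (- 1) * u' t x)" by (rule hk_norm_mono[OF k])
    finally show ?thesis by simp
  qed
  let ?b = "\<lambda>s. ?du s * (l2norm (?V t) + ?dv s) + l2norm (?U t) * ?dv s"
  have bound: "norm ((\<integral>x. ?U s x * ?V s x \<partial>lborel) - (\<integral>x. ?U t x * ?V t x \<partial>lborel)) \<le> ?b s" if s: "s \<in> {0..T}" "s \<noteq> t" for s
  proof -
    note L = crep0_L2[OF time_sobolev(1)[OF t]] crep0_L2[OF time_sobolev(2)[OF t]] crep0_L2[OF time_sobolev(1)[OF s(1)]] crep0_L2[OF time_sobolev(2)[OF s(1)]]
    have "(\<integral>x. ?U s x * ?V s x \<partial>lborel) - (\<integral>x. ?U t x * ?V t x \<partial>lborel) = (\<integral>x. ?U s x * ?V s x - ?U t x * ?V t x \<partial>lborel)"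
      using L2_mult[OF L(3,4)] L2_mult[OF L(1,2)] by simp
    also have "\<dots> = (\<integral>x. (?U s x - ?U t x) * ?V s x + ?U t x * (?V s x - ?V t x) \<partial>lborel)"
      by (intro Bochner_Integration.integral_cong) (auto simp: algebra_simps)
    also have "\<dots> = (\<integral>x. (?U s x - ?U t x) * ?V s x \<partial>lborel) + (\<integral>x. ?U t x * (?V s x - ?V t x) \<partial>lborel)"
      by (intro Bochner_Integration.integral_add L2_mult L2_diff L)
    finally have e: "(\<integral>x. ?U s x * ?V s x \<partial>lborel) - (\<integral>x. ?U t x * ?V t x \<partial>lborel) = (\<integral>x. (?U s x - ?U t x) * ?V s x \<partial>lborel) + (\<integral>x. ?U t x * (?V s x - ?V t x) \<partial>lborel)" .
    have "l2norm (?V s) \<le> l2norm (?V t) + ?dv s"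
      using l2norm_triangle[OF L(2) L2_diff[OF L(4) L(2)]] nV[OF s(1)] by simp
    then have "l2norm (\<lambda>x. ?U s x - ?U t x) * l2norm (?V s) \<le> ?du s * (l2norm (?V t) + ?dv s)"
      by (intro mult_mono nU[OF s] l2norm_nonneg mult_nonneg_nonneg add_nonneg_nonneg hk_norm_nonneg) auto
    then have 1: "\<bar>\<integral>x. (?U s x - ?U t x) * ?V s x \<partial>lborel\<bar> \<le> ?du s * (l2norm (?V t) + ?dv s)"
      using L2_Cauchy_Schwarz[OF L2_diff[OF L(3) L(1)] L(4)] by linarith
    have 2: "\<bar>\<integral>x. ?U t x * (?V s x - ?V t x) \<partial>lborel\<bar> \<le> l2norm (?U t) * ?dv s"
      using L2_Cauchy_Schwarz[OF L(1) L2_diff[OF L(4) L(2)]] mult_left_mono[OF nV[OF s(1)] l2norm_nonneg[of "?U t"]] by linarith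
    show ?thesis unfolding e real_norm_def using 1 2 by (rule order_trans[OF abs_triangle_ineq add_mono])
  qed
  have "(?b \<longlongrightarrow> \<bar>t - t\<bar> * (l2norm (?V t) + 0) * (l2norm (?V t) + 0) + l2norm (?U t) * 0) (at t within {0..T})"
    by (intro tendsto_intros quot_tendsto t dv)
  then have lim: "(?b \<longlongrightarrow> 0) (at t within {0..T})" by simp
  have "((\<lambda>s. (\<integral>x. ?U s x * ?V s x \<partial>lborel) - (\<integral>x. ?U t x * ?V t x \<partial>lborel)) \<longlongrightarrow> 0) (at t within {0..T})"
  proof (rule Lim_null_comparison[OF _ lim])
    show "\<forall>\<^sub>F s in at t within {0..T}. norm ((\<integral>x. ?U s x * ?V s x \<partial>lborel) - (\<integral>x. ?U t x * ?V t x \<partial>lborel)) \<le> ?b s"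
      unfolding eventually_at_filter by (intro always_eventually allI impI bound)
  qed
  then show "((\<lambda>t. \<integral>x. ?U t x * ?V t x \<partial>lborel) \<longlongrightarrow> (\<integral>x. ?U t x * ?V t x \<partial>lborel)) (at t within {0..T})" by (simp add: Lim_null[symmetric])
qed

section \<open>Solutions of the equation: pointwise form and energy balance\<close>

context
  fixes a :: real
  assumes a: "0 \<le> a" "a \<le> 1/2"
    and eqn: "\<forall>t\<in>{0..T}. AE x in lborel. pv_integral (kernel a (u t) x) (u' t x)"
begin

lemma crep0_C11: assumes "t \<in> {0..T}" "1 \<le> B" "16 * hk_norm 4 (u t) \<le> B" shows "C11 B (crep0 (u t)) (cgrad (u t))"
  unfolding crep0_def by (rule crep_C11[OF time_sobolev(1)[OF assms(1)] assms(2,3)])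

text \<open>For almost every x the principal value of the equation equals \<open>JJ\<close>; both
  sides are continuous in x, so equality holds everywhere.\<close>

lemma evolution_eq:
  assumes t: "t \<in> {0..T}" shows "crep0 (u' t) x = JJ a (crep0 (u t)) (cgrad (u t)) x"
proof -
  let ?B = "max 1 (16 * hk_norm 4 (u t))"
  note S = time_sobolev(1)[OF t] and S' = time_sobolev(2)[OF t]
  have C: "C11 ?B (crep0 (u t)) (cgrad (u t))" by (rule crep0_C11[OF t]) auto
  have "AE x in lborel. \<forall>r. pv_integral (kernel a (u t) x) r \<longrightarrow> pv_integral (krep a (crep0 (u t)) (cgrad (u t)) x) r"
  proof (rule kernel_pv_imp_krep_pv)
    show "u t \<in> borel_measurable borel" using S by (auto simp: sobolev_def L2_def)
    show "wd 1 0 (u t) \<in> borel_measurable borel" "wd 0 1 (u t) \<in> borel_measurable borel"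
      by (intro L2_measurable sobolev_wd[OF S]; simp)+
    show "AE x in lborel. u t x = crep0 (u t) x" unfolding crep0_def by (rule crep_AE_self[OF S])
    show "AE x in lborel. grad (u t) x = cgrad (u t) x"
      using crep_AE[OF S, of 1 0] crep_AE[OF S, of 0 1] by (auto simp: grad_def cgrad_def)
  qed (use C11_measurable[OF C] in auto)
  moreover have "AE x in lborel. pv_integral (kernel a (u t) x) (u' t x)" using eqn t by blast
  moreover have "AE x in lborel. u' t x = crep0 (u' t) x" unfolding crep0_def by (rule crep_AE_self[OF S'])
  ultimately have "AE x in lborel. crep0 (u' t) x - JJ a (crep0 (u t)) (cgrad (u t)) x = 0"
  proof eventually_elim
    case (elim x)
    then have "pv_integral (krep a (crep0 (u t)) (cgrad (u t)) x) (crep0 (u' t) x)" by simp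
    from pv_krep_eq_JJ[OF C a this] show ?case by simp
  qed
  then have "crep0 (u' t) x - JJ a (crep0 (u t)) (cgrad (u t)) x = 0"
    by (rule continuous_AE_zero[rotated]) (auto simp: crep0_def intro!: continuous_intros JJ_continuous[OF C[unfolded crep0_def] a] crep_continuous[OF S'])
  then show ?thesis by simp
qed

definition diss :: "real \<Rightarrow> real" where
  "diss t = (\<integral>p. dz a (crep0 (u t)) p \<partial>((lborel \<Otimes>\<^sub>M lborel) \<Otimes>\<^sub>M lborel))"

lemma diss_facts:
  assumes t: "t \<in> {0..T}"
  shows "(\<integral>x. crep0 (u t) x * crep0 (u' t) x \<partial>lborel) = - 2 * diss t" "0 \<le> diss t"
    "(\<integral>\<^sup>+p. ennreal (dz a (crep0 (u t)) p) \<partial>((lborel \<Otimes>\<^sub>M lborel) \<Otimes>\<^sub>M lborel)) = ennreal (diss t)"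
    "dz a (crep0 (u t)) \<in> borel_measurable ((lborel \<Otimes>\<^sub>M lborel) \<Otimes>\<^sub>M lborel)"
proof -
  let ?B = "max 1 (16 * hk_norm 4 (u t))"
  note S = time_sobolev(1)[OF t]
  have C: "C11 ?B (crep0 (u t)) (cgrad (u t))" by (rule crep0_C11[OF t]) auto
  have L: "L2 (crep0 (u t))" "L2 (\<lambda>x. fst (cgrad (u t) x))" "L2 (\<lambda>x. snd (cgrad (u t) x))"
    using crep_L2[OF S, of 0 0] crep_L2[OF S, of 1 0] crep_L2[OF S, of 0 1] by (simp_all add: crep0_def cgrad_def)
  obtain K where K: "diff_L2_bounds K (crep0 (u t))" using crep_diff_L2_bounds[OF S] by (auto simp: crep0_def)
  note E = energy_identity[OF C L K a]
  show "(\<integral>x. crep0 (u t) x * crep0 (u' t) x \<partial>lborel) = - 2 * diss t"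
    unfolding evolution_eq[OF t] diss_def by (rule E(2))
  show "0 \<le> diss t" unfolding diss_def by (intro Bochner_Integration.integral_nonneg dz_nonneg a)
  show "(\<integral>\<^sup>+p. ennreal (dz a (crep0 (u t)) p) \<partial>((lborel \<Otimes>\<^sub>M lborel) \<Otimes>\<^sub>M lborel)) = ennreal (diss t)"
    unfolding diss_def by (intro nn_integral_eq_integral E(1)) (simp add: dz_nonneg a)
  show "dz a (crep0 (u t)) \<in> borel_measurable ((lborel \<Otimes>\<^sub>M lborel) \<Otimes>\<^sub>M lborel)" using E(1) by (rule borel_measurable_integrable)
qed

text \<open>The 4 is the 2 from differentiating a square times the 2 of the energy identity. The
  gauge integral from the fundamental theorem becomes a nonnegative Lebesgue integral because of the
  sign of the dissipation, in the form that Fatou's lemma accepts.\<close>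

lemma energy_balance:
  assumes t: "t \<in> {0..T}"
  shows "(\<integral>\<^sup>+s. ennreal (indicator {0..t} s * (4 * diss s)) \<partial>lborel)
     = ennreal ((\<integral>x. (crep0 (u 0) x)\<^sup>2 \<partial>lborel) - (\<integral>x. (crep0 (u t) x)\<^sup>2 \<partial>lborel))"
    and "(\<integral>x. (crep0 (u t) x)\<^sup>2 \<partial>lborel) \<le> (\<integral>x. (crep0 (u 0) x)\<^sup>2 \<partial>lborel)"
    and "(\<lambda>s. indicator {0..t} s * (4 * diss s)) \<in> borel_measurable borel"
proof -
  let ?P = "\<lambda>t. \<integral>x. (crep0 (u t) x)\<^sup>2 \<partial>lborel"
  have "((\<lambda>s. 4 * diss s) has_integral ((- ?P t) - (- ?P 0))) {0..t}"
  proof (rule fundamental_theorem_of_calculus)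
    fix s assume "s \<in> {0..t}"
    then have s: "s \<in> {0..T}" using t by auto
    have "((\<lambda>t. - ?P t) has_real_derivative 4 * diss s) (at s within {0..T})"
      using DERIV_minus[OF energy_derivative[OF s]] diss_facts(1)[OF s] by simp
    then have "((\<lambda>t. - ?P t) has_real_derivative 4 * diss s) (at s within {0..t})"
      by (rule DERIV_subset) (use t in auto)
    then show "((\<lambda>t. - ?P t) has_vector_derivative 4 * diss s) (at s within {0..t})"
      by (simp add: has_real_derivative_iff_has_vector_derivative)
  qed (use t in simp)
  then have hi: "((\<lambda>s. 4 * diss s) has_integral (?P 0 - ?P t)) {0..t}" by simp
  have nn: "0 \<le> 4 * diss s" if "s \<in> {0..t}" for s using diss_facts(2)[of s] that t by simp
  show "(\<integral>\<^sup>+s. ennreal (indicator {0..t} s * (4 * diss s)) \<partial>lborel) = ennreal (?P 0 - ?P t)"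
    by (rule nn_integral_has_integral_lebesgue[OF nn hi])
  show "?P t \<le> ?P 0" using has_integral_nonneg[OF hi nn] by simp
  have "continuous_on {0..t} (\<lambda>s. - 2 * (\<integral>x. crep0 (u s) x * crep0 (u' s) x \<partial>lborel))"
    using t by (intro continuous_intros continuous_on_subset[OF pairing_continuous]) auto
  then have "continuous_on {0..t} (\<lambda>s. 4 * diss s)"
    by (rule continuous_on_eq) (use diss_facts(1) t in auto)
  then have "(\<lambda>s. indicator {0..t} s *\<^sub>R (4 * diss s)) \<in> borel_measurable borel"
    by (intro borel_measurable_continuous_on_indicator) auto
  then show "(\<lambda>s. indicator {0..t} s * (4 * diss s)) \<in> borel_measurable borel" by simp
qed

end

end

section \<open>Uniform and strong convergence\<close>

text \<open>If h is nonzero somewhere, its values outside a large ball are smaller than that one, so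
  the maximum over the ball is global.\<close>

lemma vanishing_attains_max:
  fixes h :: "pt \<Rightarrow> real"
  assumes c: "continuous_on UNIV h" and v: "(h \<longlongrightarrow> 0) at_infinity"
  shows "\<exists>x. \<forall>y. \<bar>h y\<bar> \<le> \<bar>h x\<bar>"
proof (cases "\<forall>y. h y = 0")
  case False
  then obtain z where z: "\<bar>h z\<bar> > 0" by auto
  from tendstoD[OF v z] obtain R where R: "\<And>y. norm y \<ge> R \<Longrightarrow> \<bar>h y\<bar> < \<bar>h z\<bar>"
    by (auto simp: eventually_at_infinity)
  have "continuous_on (cball 0 (max R (norm z))) (\<lambda>y. \<bar>h y\<bar>)"
    by (intro continuous_intros continuous_on_subset[OF c]) auto
  moreover have ne: "z \<in> cball 0 (max R (norm z))" by simp
  ultimately obtain x where x: "\<And>y. y \<in> cball 0 (max R (norm z)) \<Longrightarrow> \<bar>h y\<bar> \<le> \<bar>h x\<bar>"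
    using continuous_attains_sup[of "cball 0 (max R (norm z))" "\<lambda>y. \<bar>h y\<bar>"] compact_cball by blast
  have "\<bar>h y\<bar> \<le> \<bar>h x\<bar>" for y
  proof (cases "norm y \<ge> R")
    case True
    then show ?thesis using R[OF True] x[OF ne] by linarith
  next
    case False
    then show ?thesis by (intro x) simp
  qed
  then show ?thesis by blast
qed auto

lemma alpha_err_nonneg: "0 \<le> a \<Longrightarrow> 1 \<le> B \<Longrightarrow> 0 \<le> alpha_err B a"
  unfolding alpha_err_def by (intro Bochner_Integration.integral_nonneg alpha_gap_bounds)

lemma weight_total_nonneg: "0 \<le> weight_total"
  unfolding weight_total_def by (intro Bochner_Integration.integral_nonneg wgt_nonneg)

text \<open>At the space-time maximum of \<open>exp (- l * t) * \<bar>F - f\<bar>\<close> the time derivative dominates \<open>l\<close> times the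
  difference, while the maximum principle bounds it by \<open>C\<close> times the difference plus the error of
  changing the exponent; \<open>l = C + 1\<close> closes the estimate.\<close>

lemma sup_norm_estimate:
  fixes F F' f f' :: "real \<Rightarrow> pt \<Rightarrow> real"
  assumes k: "4 \<le> k" and T: "0 < T" and a: "0 \<le> a" "a \<le> 1/2"
    and HF: "C1_Hk k T F F'" and eqF: "\<forall>t\<in>{0..T}. AE x in lborel. pv_integral (kernel a (F t) x) (F' t x)"
    and Hf: "C1_Hk k T f f'" and eqf: "\<forall>t\<in>{0..T}. AE x in lborel. pv_integral (kernel 0 (f t) x) (f' t x)"
    and init: "AE x in lborel. F 0 x = f 0 x"
    and B: "1 \<le> B" "\<And>t. t \<in> {0..T} \<Longrightarrow> 16 * hk_norm 4 (F t) \<le> B" "\<And>t. t \<in> {0..T} \<Longrightarrow> 16 * hk_norm 4 (f t) \<le> B"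
    and t: "t \<in> {0..T}"
  shows "\<bar>crep0 (F t) x - crep0 (f t) x\<bar> \<le> exp ((20 * B * (4 * B) ^ 3 * weight_total + 1) * T) * alpha_err B a"
proof -
  define C where "C = 20 * B * (4 * B) ^ 3 * weight_total"
  define l where "l = C + 1"
  have C0: "0 \<le> C" unfolding C_def using B(1) weight_total_nonneg by simp
  have l0: "0 \<le> l" using C0 by (simp add: l_def)
  define e where "e = alpha_err B a"
  have e0: "0 \<le> e" unfolding e_def by (intro alpha_err_nonneg a B)
  define g where "g t x = crep0 (F t) x - crep0 (f t) x" for t x
  have a0: "0 \<le> (0::real)" "(0::real) \<le> 1/2" by auto
  note SF = time_sobolev(1)[OF k HF] and Sf = time_sobolev(1)[OF k Hf]
  have CF: "C11 B (crep0 (F t)) (cgrad (F t))" and Cf: "C11 B (crep0 (f t)) (cgrad (f t))" if "t \<in> {0..T}" for t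
    using crep0_C11[OF k HF a eqF that B(1) B(2)[OF that]] crep0_C11[OF k Hf a0 eqf that B(1) B(3)[OF that]] .
  have gc: "continuous_on UNIV (g t)" if "t \<in> {0..T}" for t
    unfolding g_def by (intro continuous_intros C11_continuous[OF CF[OF that]] C11_continuous[OF Cf[OF that]])
  have gv: "(g t \<longlongrightarrow> 0) at_infinity" if "t \<in> {0..T}" for t
    using tendsto_diff[OF crep_vanish[OF SF[OF that], of 0 0] crep_vanish[OF Sf[OF that], of 0 0]]
    by (simp add: g_def[abs_def] crep0_def)
  have "\<forall>t\<in>{0..T}. \<exists>x. \<forall>y. \<bar>g t y\<bar> \<le> \<bar>g t x\<bar>" using vanishing_attains_max gc gv by blast
  then obtain X where X: "\<And>t y. t \<in> {0..T} \<Longrightarrow> \<bar>g t y\<bar> \<le> \<bar>g t (X t)\<bar>" by metis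
  define m where "m t = \<bar>g t (X t)\<bar>" for t
  have m0: "0 \<le> m t" for t by (simp add: m_def)
  have gm: "\<bar>g t y\<bar> \<le> m t" if "t \<in> {0..T}" for t y using X[OF that] by (simp add: m_def)
  define rho where "rho t s = modulus F F' t s + modulus f f' t s" for t s
  have gr: "\<bar>g s y - g t y\<bar> \<le> rho t s" if "t \<in> {0..T}" "s \<in> {0..T}" for t s y
    using crep0_modulus[OF k HF that, of y] crep0_modulus[OF k Hf that, of y] unfolding g_def rho_def by linarith
  \<comment> \<open>The maximisers \<open>X\<close> are mere choices and may jump in time. Their
    maximal values do not: each is compared with the other function at the same point.\<close>
  have mr: "\<bar>m s - m t\<bar> \<le> rho t s" if "t \<in> {0..T}" "s \<in> {0..T}" for t s
    using gm[OF that(1), of "X s"] gm[OF that(2), of "X t"] gr[OF that, of "X s"] gr[OF that, of "X t"]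
    unfolding m_def by linarith
  have mc: "continuous_on {0..T} m"
    unfolding continuous_on_def
  proof
    fix t assume t: "t \<in> {0..T}"
    have "((\<lambda>s. m s - m t) \<longlongrightarrow> 0) (at t within {0..T})"
    proof (rule Lim_null_comparison)
      show "\<forall>\<^sub>F s in at t within {0..T}. norm (m s - m t) \<le> rho t s"
        unfolding eventually_at_filter using mr[OF t] by (intro always_eventually) simp
      show "((\<lambda>s. rho t s) \<longlongrightarrow> 0) (at t within {0..T})"
        unfolding rho_def using tendsto_add[OF modulus_tendsto[OF k HF t] modulus_tendsto[OF k Hf t]] by simp
    qed
    then show "(m \<longlongrightarrow> m t) (at t within {0..T})" by (simp add: Lim_null[symmetric])
  qed
  have "continuous_on {0..T} (\<lambda>t. exp (- l * t) * m t)" by (intro continuous_intros mc)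
  then obtain r where r: "r \<in> {0..T}" "\<And>t. t \<in> {0..T} \<Longrightarrow> exp (- l * t) * m t \<le> exp (- l * r) * m r"
    using continuous_attains_sup[of "{0..T}" "\<lambda>t. exp (- l * t) * m t"] T by auto
  have main: "m r \<le> e"
  proof (cases "m r = 0 \<or> r = 0")
    case True
    have "g 0 y = 0" for y
    proof -
      have t0: "0 \<in> {0..T}" using T by simp
      have "AE x in lborel. g 0 x = 0"
        using init crep_AE_self[OF SF[OF t0]] crep_AE_self[OF Sf[OF t0]] by (auto simp: g_def crep0_def)
      from continuous_AE_zero[OF gc[OF t0] this] show ?thesis .
    qed
    then have "m 0 = 0" by (simp add: m_def)
    then show ?thesis using True e0 by auto
  next
    case False
    then have mpos: "m r > 0" and rpos: "r > 0" using m0[of r] r(1) by auto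
    define sg where "sg = sgn (g r (X r))"
    \<comment> \<open>Multiplication by the sign replaces the absolute value by a smooth function
      which at the chosen point has the same maximum.\<close>
    have sg: "sg = 1 \<or> sg = -1" "sg * g r (X r) = m r"
      using mpos by (auto simp: sg_def m_def sgn_if)
    have sg_le: "sg * g t y \<le> m t" if "t \<in> {0..T}" for t y using gm[OF that, of y] sg(1) by auto
    have D: "cgrad (F r) (X r) = cgrad (f r) (X r)"
    proof -
      let ?d = "cgrad (F r) (X r) - cgrad (f r) (X r)"
      have "((\<lambda>x. sg * g r x) has_derivative (\<lambda>h. sg * (cgrad (F r) (X r) \<bullet> h - cgrad (f r) (X r) \<bullet> h))) (at (X r))"
        unfolding g_def by (intro has_derivative_mult_right has_derivative_diff C11_derivative[OF CF[OF r(1)]] C11_derivative[OF Cf[OF r(1)]])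
      moreover have "\<forall>y\<in>UNIV. sg * g r y \<le> sg * g r (X r)" using sg_le[OF r(1)] sg(2) by simp
      ultimately have "(\<lambda>h. sg * (cgrad (F r) (X r) \<bullet> h - cgrad (f r) (X r) \<bullet> h)) = (\<lambda>h. 0)"
        using differential_zero_maxmin[OF UNIV_I open_UNIV] by blast
      then have "sg * (cgrad (F r) (X r) \<bullet> ?d - cgrad (f r) (X r) \<bullet> ?d) = 0" by metis
      then have "?d \<bullet> ?d = 0" using sg(1) by (auto simp: inner_diff_left)
      then show ?thesis by simp
    qed
    define gt where "gt = JJ a (crep0 (F r)) (cgrad (F r)) (X r) - JJ 0 (crep0 (f r)) (cgrad (f r)) (X r)"
    have dg: "((\<lambda>t. g t (X r)) has_real_derivative gt) (at r within {0..T})"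
      unfolding g_def gt_def evolution_eq[OF k HF a eqF r(1), symmetric] evolution_eq[OF k Hf a0 eqf r(1), symmetric]
      by (intro DERIV_diff crep0_time_derivative[OF k HF r(1)] crep0_time_derivative[OF k Hf r(1)])
    have "((\<lambda>t. exp (- l * t)) has_real_derivative exp (- l * r) * (- l)) (at r within {0..T})"
      by (auto intro!: derivative_eq_intros)
    from DERIV_mult'[OF this DERIV_cmult[OF dg, of sg]]
    have dpsi: "((\<lambda>t. exp (- l * t) * (sg * g t (X r))) has_real_derivative
        exp (- l * r) * (sg * gt) + exp (- l * r) * (- l) * (sg * g r (X r))) (at r within {0..T})" .
    \<comment> \<open>A negative derivative would make the function larger just before r, against
      maximality. Only times to the left of r are compared, so r = T is allowed.\<close>
    have "0 \<le> exp (- l * r) * (sg * gt) + exp (- l * r) * (- l) * (sg * g r (X r))"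
    proof (rule ccontr)
      assume "\<not> 0 \<le> exp (- l * r) * (sg * gt) + exp (- l * r) * (- l) * (sg * g r (X r))"
      then obtain d where d: "d > 0" "\<And>h. h > 0 \<Longrightarrow> r - h \<in> {0..T} \<Longrightarrow> h < d \<Longrightarrow>
          exp (- l * r) * (sg * g r (X r)) < exp (- l * (r - h)) * (sg * g (r - h) (X r))"
        using has_real_derivative_neg_dec_left[OF dpsi] by (auto simp: not_le)
      define h where "h = min (d / 2) r"
      have h: "h > 0" "h < d" "r - h \<in> {0..T}" using d(1) rpos r(1) by (auto simp: h_def)
      have "exp (- l * (r - h)) * (sg * g (r - h) (X r)) \<le> exp (- l * (r - h)) * m (r - h)"
        by (intro mult_left_mono sg_le h) auto
      also have "\<dots> \<le> exp (- l * r) * m r" by (rule r(2)[OF h(3)])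
      finally show False using d(2)[OF h(1,3,2)] sg(2) by simp
    qed
    then have "0 \<le> exp (- l * r) * (sg * gt - l * m r)" using sg(2) by (simp add: algebra_simps)
    then have lower: "l * m r \<le> sg * gt" by (simp add: zero_le_mult_iff)
    have errF: "\<bar>JJ a (crep0 (f r)) (cgrad (f r)) (X r) - JJ 0 (crep0 (f r)) (cgrad (f r)) (X r)\<bar> \<le> e"
      unfolding e_def by (rule JJ_alpha_err[OF Cf[OF r(1)] a])
    \<comment> \<open>The exponent is changed for the limit solution, so that both arguments of the
      maximum principle carry the exponent a; for sign -1 the two solutions exchange roles.\<close>
    have "sg * gt \<le> C * m r + e"
    proof (cases "sg = 1")
      case True
      have "JJ a (crep0 (F r)) (cgrad (F r)) (X r) - JJ a (crep0 (f r)) (cgrad (f r)) (X r) \<le> C * (crep0 (F r) (X r) - crep0 (f r) (X r))"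
        unfolding C_def
      proof (rule JJ_max_principle[OF CF[OF r(1)] Cf[OF r(1)] a D])
        show "\<bar>crep0 (F r) y - crep0 (f r) y\<bar> \<le> crep0 (F r) (X r) - crep0 (f r) (X r)" for y
          using gm[OF r(1), of y] sg(2) True by (simp add: g_def)
      qed
      also have "crep0 (F r) (X r) - crep0 (f r) (X r) = m r" using sg(2) True by (simp add: g_def)
      finally show ?thesis using True errF unfolding gt_def by (simp add: abs_le_iff)
    next
      case False
      then have sm: "sg = -1" using sg by auto
      have "JJ a (crep0 (f r)) (cgrad (f r)) (X r) - JJ a (crep0 (F r)) (cgrad (F r)) (X r) \<le> C * (crep0 (f r) (X r) - crep0 (F r) (X r))"
        unfolding C_def
      proof (rule JJ_max_principle[OF Cf[OF r(1)] CF[OF r(1)] a D[symmetric]])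
        show "\<bar>crep0 (f r) y - crep0 (F r) y\<bar> \<le> crep0 (f r) (X r) - crep0 (F r) (X r)" for y
          using gm[OF r(1), of y] sg(2) sm by (simp add: g_def abs_minus_commute)
      qed
      also have "crep0 (f r) (X r) - crep0 (F r) (X r) = m r" using sg(2) sm by (simp add: g_def)
      finally show ?thesis using sm errF unfolding gt_def by (simp add: abs_le_iff)
    qed
    then show ?thesis using lower by (simp add: l_def algebra_simps)
  qed
  have "exp (- l * t) * m t \<le> exp (- l * r) * m r" by (rule r(2)[OF t])
  also have "\<dots> \<le> 1 * e" using l0 r(1) m0 by (intro mult_mono main) auto
  finally have "m t \<le> exp (l * t) * e" by (simp add: exp_minus field_simps)
  also have "\<dots> \<le> exp (l * T) * e" using l0 t e0 by (intro mult_right_mono) (auto intro: mult_left_mono)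
  finally have "\<bar>g t x\<bar> \<le> exp (l * T) * e" using gm[OF t, of x] by linarith
  then show ?thesis by (simp add: g_def l_def C_def e_def)
qed

text \<open>Translates the lower limits that Fatou's lemma produces in the extended reals into real
  inequalities with an error. Negative \<open>c - e\<close> is separate since \<open>ennreal\<close>
  sends it to 0.\<close>

lemma le_liminf_eventually:
  fixes x :: "nat \<Rightarrow> real"
  assumes "ennreal c \<le> liminf (\<lambda>n. ennreal (x n))" "\<And>n. 0 \<le> x n" "e > 0"
  shows "\<forall>\<^sub>F n in sequentially. c - e < x n"
proof (cases "c - e < 0")
  case True
  then have "c - e < x n" for n using assms(2)[of n] by linarith
  then show ?thesis by simp
next
  case False
  then have "ennreal (c - e) < ennreal c" using assms(3) by (intro ennreal_lessI) auto
  then have "\<forall>\<^sub>F n in sequentially. ennreal (c - e) < ennreal (x n)" using assms(1) by (simp add: le_Liminf_iff)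
  then show ?thesis by eventually_elim (use False in \<open>simp add: ennreal_less_iff\<close>)
qed

theorem theorem5p1:
  fixes k :: nat and f0 :: "pt \<Rightarrow> real" and T M :: real
    and fa :: "real \<Rightarrow> real \<Rightarrow> pt \<Rightarrow> real" and f :: "real \<Rightarrow> pt \<Rightarrow> real"
  assumes "k \<ge> 4" and "sobolev k f0" and "T > 0" and "M > 0"
    and "\<forall>\<alpha>\<in>{0..<1/2}. solves k T \<alpha> f0 (fa \<alpha>)"
    and "solves k T 0 f0 f"
    and "\<forall>\<alpha>\<in>{0..<1/2}. \<forall>t\<in>{0..T}. hk_norm 4 (fa \<alpha> t) \<le> M"
  shows "\<forall>t\<in>{0..T}. ((\<lambda>\<alpha>. l2norm (\<lambda>x. fa \<alpha> t x - f t x)) \<longlongrightarrow> 0) (at_right 0)"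
proof (intro ballI)
  fix t assume t: "t \<in> {0..T}"
  note k = assms(1) and T = assms(3)
  obtain f' where f': "C1_Hk k T f f'" "\<forall>t\<in>{0..T}. AE x in lborel. pv_integral (kernel 0 (f t) x) (f' t x)"
    "AE x in lborel. f 0 x = f0 x" using assms(6) unfolding solves_def by blast
  obtain Mf where Mf: "\<And>t. t \<in> {0..T} \<Longrightarrow> hk_norm 4 (f t) \<le> Mf" using time_hk_bounded[OF k f'(1)] by blast
  define B where "B = max 1 (16 * max M Mf)"
  have B: "1 \<le> B" "16 * M \<le> B" "16 * Mf \<le> B" by (auto simp: B_def)
  have a0: "0 \<le> (0::real)" "(0::real) \<le> 1/2" by auto
  have t0: "0 \<in> {0..T}" using T by simp
  show "((\<lambda>\<alpha>. l2norm (\<lambda>x. fa \<alpha> t x - f t x)) \<longlongrightarrow> 0) (at_right 0)"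
  proof (rule tendsto_at_right_sequentially[of 0 "1/2"])
    \<comment> \<open>Fatou's lemma and dominated convergence work along sequences, so the limit is
      tested on arbitrary sequences of exponents.\<close>
    fix S :: "nat \<Rightarrow> real" assume S: "\<And>n. 0 < S n" "\<And>n. S n < 1/2" "S \<longlonglongrightarrow> 0"
    have a: "0 \<le> S n" "S n \<le> 1/2" "S n \<in> {0..<1/2}" for n using S(1,2)[of n] by auto
    have "\<forall>n. \<exists>F'. C1_Hk k T (fa (S n)) F' \<and> (\<forall>t\<in>{0..T}. AE x in lborel. pv_integral (kernel (S n) (fa (S n) t) x) (F' t x)) \<and>
        (AE x in lborel. fa (S n) 0 x = f0 x)"
      using assms(5) a(3) unfolding solves_def by blast
    then obtain F' where F': "\<And>n. C1_Hk k T (fa (S n)) (F' n)"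
      "\<And>n. \<forall>t\<in>{0..T}. AE x in lborel. pv_integral (kernel (S n) (fa (S n) t) x) (F' n t x)"
      "\<And>n. AE x in lborel. fa (S n) 0 x = f0 x" by metis
    define U where "U s = crep0 (f s)" for s
    define V where "V n s = crep0 (fa (S n) s)" for n s
    note Sf = time_sobolev(1)[OF k f'(1)] and SF = time_sobolev(1)[OF k F'(1)]
    have init: "AE x in lborel. fa (S n) 0 x = f 0 x" for n using F'(3)[of n] f'(3) by eventually_elim simp
    have Bn: "16 * hk_norm 4 (fa (S n) s) \<le> B" "16 * hk_norm 4 (f s) \<le> B" if "s \<in> {0..T}" for n s
    proof -
      have "hk_norm 4 (fa (S n) s) \<le> M" using assms(7) a(3) that by blast
      then show "16 * hk_norm 4 (fa (S n) s) \<le> B" using B by linarith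
      show "16 * hk_norm 4 (f s) \<le> B" using Mf[OF that] B by linarith
    qed
    have conv: "(\<lambda>n. V n s x) \<longlonglongrightarrow> U s x" if s: "s \<in> {0..T}" for s x
    proof -
      have "(\<lambda>n. V n s x - U s x) \<longlonglongrightarrow> 0"
      proof (rule Lim_null_comparison)
        show "\<forall>\<^sub>F n in sequentially. norm (V n s x - U s x) \<le> exp ((20 * B * (4 * B) ^ 3 * weight_total + 1) * T) * alpha_err B (S n)"
          unfolding V_def U_def real_norm_def
          by (intro always_eventually allI sup_norm_estimate[OF k T a(1,2) F'(1,2) f'(1,2) init B(1) Bn s])
        show "(\<lambda>n. exp ((20 * B * (4 * B) ^ 3 * weight_total + 1) * T) * alpha_err B (S n)) \<longlonglongrightarrow> 0"
          using tendsto_mult_right_zero[OF alpha_err_tendsto[OF B(1) S(3) a(1)]] .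
      qed
      then show ?thesis by (simp add: Lim_null[symmetric])
    qed
    let ?D = "diss f 0" and ?Dn = "\<lambda>n. diss (fa (S n)) (S n)"
    note df = diss_facts[OF k f'(1) a0 f'(2)] and dF = diss_facts[OF k F'(1) a(1,2) F'(2)]
    let ?P = "\<lambda>s. \<integral>x. (U s x)\<^sup>2 \<partial>lborel" and ?Pn = "\<lambda>n s. \<integral>x. (V n s x)\<^sup>2 \<partial>lborel"
    \<comment> \<open>Equal initial energies allow the dissipation inequality to be read as one for
      the energies at time t.\<close>
    have P0: "?Pn n 0 = ?P 0" for n
    proof -
      have "V n 0 x - U 0 x = 0" for x
      proof (rule continuous_AE_zero[where w = "\<lambda>x. V n 0 x - U 0 x"])
        show "continuous_on UNIV (\<lambda>x. V n 0 x - U 0 x)"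
          unfolding V_def U_def crep0_def by (intro continuous_intros crep_continuous SF Sf t0) auto
        show "AE x in lborel. V n 0 x - U 0 x = 0"
          using init[of n] crep_AE_self[OF SF[OF t0, of n]] crep_AE_self[OF Sf[OF t0]]
          unfolding V_def U_def crep0_def by eventually_elim simp
      qed
      then show ?thesis by simp
    qed
    \<comment> \<open>First use of Fatou: at a fixed time, over slope, radius and position.
      Pointwise convergence of the solutions is enough, since \<open>dz\<close> contains difference
      quotients and no gradients.\<close>
    have D_liminf: "ennreal (?D s) \<le> liminf (\<lambda>n. ennreal (?Dn n s))" if s: "s \<in> {0..T}" for s
    proof -
      let ?M = "(lborel \<Otimes>\<^sub>M lborel) \<Otimes>\<^sub>M lborel :: ((real \<times> real) \<times> pt) measure"
      have lim: "(\<lambda>n. dz (S n) (V n s) p) \<longlonglongrightarrow> dz 0 (U s) p" for p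
      proof (cases "snd (fst p) > 0")
        case True
        have q: "(\<lambda>n. qp (V n s) (snd p) (dir (fst (fst p))) (snd (fst p))) \<longlonglongrightarrow> qp (U s) (snd p) (dir (fst (fst p))) (snd (fst p))"
          unfolding qp_def using True by (intro tendsto_intros conv s) auto
        have pw: "(\<lambda>n. snd (fst p) powr (- S n)) \<longlonglongrightarrow> snd (fst p) powr (- 0)"
          using True by (intro tendsto_intros S(3)) auto
        show ?thesis unfolding dz_def by (intro tendsto_mult tendsto_const pw dd_tendsto[OF S(3) a(1) q])
      qed (simp add: dz_def)
      have "ennreal (?D s) = (\<integral>\<^sup>+p. ennreal (dz 0 (U s) p) \<partial>?M)" unfolding U_def by (rule df(3)[OF s, symmetric])
      also have "\<dots> = (\<integral>\<^sup>+p. liminf (\<lambda>n. ennreal (dz (S n) (V n s) p)) \<partial>?M)"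
        using lim_imp_Liminf[OF _ tendsto_ennrealI[OF lim]] by simp
      also have "\<dots> \<le> liminf (\<lambda>n. \<integral>\<^sup>+p. ennreal (dz (S n) (V n s) p) \<partial>?M)"
        using dF(4)[OF s] unfolding V_def by (intro nn_integral_liminf) simp
      also have "\<dots> = liminf (\<lambda>n. ennreal (?Dn n s))" unfolding V_def dF(3)[OF s] ..
      finally show ?thesis .
    qed
    note ef = energy_balance[OF k f'(1) a0 f'(2) t, folded U_def] and eF = energy_balance[OF k F'(1) a(1,2) F'(2) t, folded V_def]
    \<comment> \<open>Second use of Fatou, now over time: the energy lost by the limit is at most
      the lower limit of the energies lost by the approximations, so their norms at time t cannot
      exceed that of the limit asymptotically.\<close>
    have "ennreal (?P 0 - ?P t) = (\<integral>\<^sup>+s. ennreal (indicator {0..t} s * (4 * ?D s)) \<partial>lborel)" by (rule ef(1)[symmetric])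
    also have "\<dots> \<le> (\<integral>\<^sup>+s. liminf (\<lambda>n. ennreal (indicator {0..t} s * (4 * ?Dn n s))) \<partial>lborel)"
    proof (rule nn_integral_mono)
      fix s
      show "ennreal (indicator {0..t} s * (4 * ?D s)) \<le> liminf (\<lambda>n. ennreal (indicator {0..t} s * (4 * ?Dn n s)))"
      proof (cases "s \<in> {0..t}")
        case True
        then have s: "s \<in> {0..T}" using t by auto
        show ?thesis
        proof (rule iffD2[OF le_Liminf_iff], intro allI impI)
          \<comment> \<open>The factor 4 is taken through the lower limit by testing against every
            smaller number; the slack (4 D - z) / 4 turns the eventual bound into z < 4 Dn.\<close>
          fix y assume y: "y < ennreal (indicator {0..t} s * (4 * ?D s))"
          then obtain z where z: "y = ennreal z" "0 \<le> z" by (cases y) auto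
          then have "z < 4 * ?D s" using y True by (simp add: ennreal_less_iff)
          from le_liminf_eventually[OF D_liminf[OF s] dF(2)[OF s], of "(4 * ?D s - z) / 4"] this
          have "\<forall>\<^sub>F n in sequentially. ?D s - (4 * ?D s - z) / 4 < ?Dn n s" by simp
          then show "\<forall>\<^sub>F n in sequentially. y < ennreal (indicator {0..t} s * (4 * ?Dn n s))"
          proof eventually_elim
            case (elim n)
            then have "z < 4 * ?Dn n s" by (simp add: field_simps)
            then show ?case using True z by (simp add: ennreal_less_iff)
          qed
        qed
      qed simp
    qed
    also have "\<dots> \<le> liminf (\<lambda>n. \<integral>\<^sup>+s. ennreal (indicator {0..t} s * (4 * ?Dn n s)) \<partial>lborel)"
      using eF(3) by (intro nn_integral_liminf) simp
    also have "\<dots> = liminf (\<lambda>n. ennreal (?P 0 - ?Pn n t))" unfolding eF(1) P0 ..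
    finally have lim1: "ennreal (?P 0 - ?P t) \<le> liminf (\<lambda>n. ennreal (?P 0 - ?Pn n t))" .
    have Pn_le: "0 \<le> ?P 0 - ?Pn n t" for n using eF(2)[of n] P0[of n] by simp
    have LU: "L2 (U t)" "L2 (V n t)" for n unfolding U_def V_def by (rule crep0_L2[OF Sf[OF t]] crep0_L2[OF SF[OF t]])+
    \<comment> \<open>Third use of Fatou, over position: the sums tend pointwise to twice the limit,
      which gives the lower bound in the parallelogram identity.\<close>
    have "ennreal (4 * ?P t) = (\<integral>\<^sup>+x. ennreal ((2 * U t x)\<^sup>2) \<partial>lborel)"
      using L2_square[OF L2_cmult[OF LU(1), of 2]] by (subst nn_integral_eq_integral) (auto simp: power_mult_distrib)
    also have "\<dots> = (\<integral>\<^sup>+x. liminf (\<lambda>n. ennreal ((V n t x + U t x)\<^sup>2)) \<partial>lborel)"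
    proof (rule nn_integral_cong)
      fix x
      have "(\<lambda>n. (V n t x + U t x)\<^sup>2) \<longlonglongrightarrow> (U t x + U t x)\<^sup>2" by (intro tendsto_intros conv t)
      then have "(\<lambda>n. ennreal ((V n t x + U t x)\<^sup>2)) \<longlonglongrightarrow> ennreal ((2 * U t x)\<^sup>2)" by (intro tendsto_ennrealI) simp
      from lim_imp_Liminf[OF _ this] show "ennreal ((2 * U t x)\<^sup>2) = liminf (\<lambda>n. ennreal ((V n t x + U t x)\<^sup>2))" by simp
    qed
    also have "\<dots> \<le> liminf (\<lambda>n. \<integral>\<^sup>+x. ennreal ((V n t x + U t x)\<^sup>2) \<partial>lborel)"
      using L2_measurable[OF LU(1)] L2_measurable[OF LU(2)] by (intro nn_integral_liminf) simp
    also have "\<dots> = liminf (\<lambda>n. ennreal (\<integral>x. (V n t x + U t x)\<^sup>2 \<partial>lborel))"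
      using L2_square[OF L2_add[OF LU(2) LU(1)]] by (simp add: nn_integral_eq_integral)
    finally have lim2: "ennreal (4 * ?P t) \<le> liminf (\<lambda>n. ennreal (\<integral>x. (V n t x + U t x)\<^sup>2 \<partial>lborel))" .
    have par: "(l2norm (\<lambda>x. fa (S n) t x - f t x))\<^sup>2 = 2 * ?Pn n t + 2 * ?P t - (\<integral>x. (V n t x + U t x)\<^sup>2 \<partial>lborel)" for n
    proof -
      have m: "fa (S n) t \<in> borel_measurable borel" "f t \<in> borel_measurable borel"
        using SF[OF t, of n] Sf[OF t] by (auto simp: sobolev_def L2_def)
      have "AE x in lborel. fa (S n) t x - f t x = V n t x - U t x"
        using crep_AE_self[OF SF[OF t, of n]] crep_AE_self[OF Sf[OF t]] unfolding V_def U_def crep0_def by eventually_elim simp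
      then have "l2norm (\<lambda>x. fa (S n) t x - f t x) = l2norm (\<lambda>x. V n t x - U t x)"
        using m L2_measurable[OF LU(1)] L2_measurable[OF LU(2)] by (intro l2norm_AE_cong) auto
      then have "(l2norm (\<lambda>x. fa (S n) t x - f t x))\<^sup>2 = (\<integral>x. (V n t x - U t x)\<^sup>2 \<partial>lborel)" by (simp add: l2norm_power2)
      also have "\<dots> = (\<integral>x. 2 * (V n t x)\<^sup>2 + 2 * (U t x)\<^sup>2 - (V n t x + U t x)\<^sup>2 \<partial>lborel)"
        by (intro Bochner_Integration.integral_cong) (auto simp: power2_eq_square algebra_simps)
      also have "\<dots> = 2 * ?Pn n t + 2 * ?P t - (\<integral>x. (V n t x + U t x)\<^sup>2 \<partial>lborel)"
        using L2_square[OF LU(1)] L2_square[OF LU(2)] L2_square[OF L2_add[OF LU(2) LU(1)]] by simp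
      finally show ?thesis .
    qed
    have "(\<lambda>n. (l2norm (\<lambda>x. fa (S n) t x - f t x))\<^sup>2) \<longlonglongrightarrow> 0"
    proof (rule tendstoI)
      fix e :: real assume e: "e > 0"
      \<comment> \<open>In the parallelogram identity the first error counts twice and the second
        once, so e/4 in each leaves 3 e / 4 < e.\<close>
      have "\<forall>\<^sub>F n in sequentially. ?P 0 - ?P t - e / 4 < ?P 0 - ?Pn n t"
        using e by (intro le_liminf_eventually[OF lim1 Pn_le]) simp
      moreover have "\<forall>\<^sub>F n in sequentially. 4 * ?P t - e / 4 < (\<integral>x. (V n t x + U t x)\<^sup>2 \<partial>lborel)"
        using e by (intro le_liminf_eventually[OF lim2]) auto
      ultimately show "\<forall>\<^sub>F n in sequentially. dist ((l2norm (\<lambda>x. fa (S n) t x - f t x))\<^sup>2) 0 < e"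
      proof eventually_elim
        case (elim n)
        then have "(l2norm (\<lambda>x. fa (S n) t x - f t x))\<^sup>2 < e" unfolding par using e by linarith
        then show ?case by simp
      qed
    qed
    then have "(\<lambda>n. sqrt ((l2norm (\<lambda>x. fa (S n) t x - f t x))\<^sup>2)) \<longlonglongrightarrow> sqrt 0" by (rule tendsto_real_sqrt)
    then show "(\<lambda>n. l2norm (\<lambda>x. fa (S n) t x - f t x)) \<longlonglongrightarrow> 0" by (simp add: l2norm_nonneg)
  qed simp
qed

end
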